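(* Let $r\geq 2$ be an integer. Then the set $\mathcal{F}_r$ of tuples $\vec{g}=(g_1,\dots,g_r)\in A^r$ with $g_r\neq 0$ for which the $T$-adic Galois representation $\hat{\rho}_{\phi^{\vec{g}},T}:\operatorname{Gal}(F^{\mathrm{sep}}/F)\to \operatorname{GL}_r(\mathbb{F}_q[\![T]\!])$ is surjective has density $1$, i.e. \[\lim_{X\to\infty}\frac{\#\{\vec{g}\in \mathcal{F}_r : \deg_T g_i<X \text{ for all } i\}}{\#\{\vec{g}\in A^r: g_r\neq 0,\ \deg_T g_i<X \text{ for all } i\}}=1.\]
   Context: Standing assumptions: $p$ is an odd prime, $q=p^n$ with $q\geq 5$, $A=\mathbb{F}_q[T]$, $F=\mathbb{F}_q(T)$. For $\vec{g}=(g_1,\dots,g_r)\in A^r$ with $g_r\neq 0$, $\phi^{\vec{g}}$ is the Drinfeld module of rank $r$ over $F$ (with structure map $A\hookrightarrow F$) determined by $\phi^{\vec{g}}_T=T+g_1\tau+\dots+g_r\tau^r$ in the twisted polynomial ring $F\{\tau\}$ (where $\tau c=c^q\tau$). For $n\geq1$, $\phi[T^n]\subset F^{\mathrm{sep}}$ is the set of roots of the polynomial $\phi_{T^n}(x)$, an $A$-module isomorphic to $(A/T^n)^r$ with Galois action; the $T$-adic Tate module is $\varprojlim_n \phi[T^n]$ (transition maps multiplication by $T$), a free $\mathbb{F}_q[\![T]\!]$-module of rank $r$, and $\hat{\rho}_{\phi,T}$ is the Galois action on it after a choice of basis. *)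

theory Defs
  imports
    Complex_Main
    "HOL-Library.FuncSet"
    "HOL-Library.Cardinality"
    "HOL-Computational_Algebra.Computational_Algebra"
    "HOL-Algebra.Algebraic_Closure_Type"
    "Jordan_Normal_Form.Matrix"
begin

no_notation vec_index (infixl \<open>$\<close> 100)

section \<open>The function field and its separable closure\<close>

text \<open>
  The finite field with \<open>q\<close> elements is a type \<open>'a :: finite_field\<close> with \<open>q = CARD('a)\<close>;
  then \<open>A\<close> is \<open>'a poly\<close> and \<open>F\<close> is its fraction field.
\<close>

type_synonym 'a ratfun = "'a poly fract"

type_synonym 'a ratfun_ac = "'a ratfun alg_closure"

text \<open>
  The separable closure of \<open>'k\<close> inside the fixed algebraic closure; an irreducible polynomial
  vanishing at \<open>x\<close> is the minimal polynomial of \<open>x\<close> up to a unit.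
\<close>

definition sep_closure :: "'k :: field alg_closure set" where
  "sep_closure =
     {x. \<exists>f :: 'k poly. irreducible f \<and> coprime f (pderiv f) \<and> poly (map_poly to_ac f) x = 0}"

text \<open>
  \<open>Gal(K\<^sup>s\<^sup>e\<^sup>p/K)\<close>; extensionality makes its elements correspond bijectively to automorphisms
  of the separable closure.
\<close>

definition galois_group :: "('k :: field alg_closure \<Rightarrow> 'k alg_closure) set" where
  "galois_group =
     {\<sigma> \<in> extensional sep_closure.
        bij_betw \<sigma> sep_closure sep_closure \<and>
        (\<forall>x\<in>sep_closure. \<forall>y\<in>sep_closure. \<sigma> (x + y) = \<sigma> x + \<sigma> y \<and> \<sigma> (x * y) = \<sigma> x * \<sigma> y) \<and>
        (\<forall>c. \<sigma> (to_ac c) = to_ac c)}"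


section \<open>Twisted polynomials\<close>

lemma of_nat_card_choose_eq_0:
  assumes "0 < k" "k < CARD('a)"
  shows   "of_nat (CARD('a) choose k) = (0 :: 'a :: finite_field)"
proof -
  define q where "q = CARD('a)"
  define P :: "'a poly" where "P = (\<Sum>k\<in>{1..<q}. monom (of_nat (q choose k)) k)"
  have q: "q > 0" by (simp add: q_def)
  have root: "poly P c = 0" for c
  proof -
    have split: "{..q} = insert 0 (insert q {1..<q})" using q by auto
    have "(c + 1) ^ q = (\<Sum>k\<le>q. of_nat (q choose k) * c ^ k)"
      by (simp add: binomial_ring)
    also have "\<dots> = 1 + c ^ q + poly P c"
      unfolding split using q by (simp add: P_def poly_sum poly_monom)
    finally show ?thesis
      by (simp add: q_def finite_field_power_card_eq_same)
  qed
  have "P = 0"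
  proof (rule ccontr)
    assume "P \<noteq> 0"
    have "degree P \<le> q - 1"
      unfolding P_def by (rule degree_sum_le) (auto intro: order.trans[OF degree_monom_le])
    moreover have "card {x. poly P x = 0} \<le> degree P"
      using \<open>P \<noteq> 0\<close> by (rule card_poly_roots_bound)
    moreover have "card {x. poly P x = 0} = q" using root by (simp add: q_def)
    ultimately show False using q by linarith
  qed
  moreover have "coeff P k = of_nat (q choose k)"
    using assms by (simp add: P_def coeff_sum q_def)
  ultimately show ?thesis by (simp add: q_def)
qed

lemma to_fract_of_nat: "to_fract (of_nat n) = of_nat n"
  by (induction n) auto

lemma ratfun_frobenius_add:
  fixes x y :: "'a :: finite_field ratfun"
  shows "(x + y) ^ CARD('a) = x ^ CARD('a) + y ^ CARD('a)"
proof -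
  let ?q = "CARD('a)"
  have q: "?q > 0" by simp
  have z: "of_nat (?q choose k) = (0 :: 'a ratfun)" if "0 < k" "k < ?q" for k
  proof -
    have "of_nat (?q choose k) = (0 :: 'a poly)"
      using of_nat_card_choose_eq_0[OF that] by (simp add: of_nat_poly)
    thus ?thesis by (metis to_fract_of_nat to_fract_0)
  qed
  have "(x + y) ^ ?q = (\<Sum>k\<le>?q. of_nat (?q choose k) * x ^ k * y ^ (?q - k))"
    by (rule binomial_ring)
  also have "\<dots> = (\<Sum>k\<in>{0, ?q}. of_nat (?q choose k) * x ^ k * y ^ (?q - k))"
    by (rule sum.mono_neutral_right) (use z in auto)
  also have "\<dots> = x ^ ?q + y ^ ?q" using q by (simp del: zero_less_card_finite)
  finally show ?thesis .
qed

lemma ratfun_frobenius_add_pow: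
  fixes x y :: "'a :: finite_field ratfun"
  shows "(x + y) ^ (CARD('a) ^ i) = x ^ (CARD('a) ^ i) + y ^ (CARD('a) ^ i)"
proof (induction i)
  case (Suc i)
  have "z ^ (CARD('a) ^ Suc i) = (z ^ (CARD('a) ^ i)) ^ CARD('a)" for z :: "'a ratfun"
    unfolding power_Suc2 by (rule power_mult)
  thus ?case using Suc by (simp only: ratfun_frobenius_add)
qed simp

lemma ratfun_frobenius_sum_pow:
  fixes f :: "'b \<Rightarrow> 'a :: finite_field ratfun"
  shows "(sum f S) ^ (CARD('a) ^ i) = (\<Sum>s\<in>S. f s ^ (CARD('a) ^ i))"
  by (induction S rule: infinite_finite_induct)
     (simp_all add: ratfun_frobenius_add_pow zero_power)

text \<open>The ring \<open>F{\<tau>}\<close>; an element is given by its coefficients, written to the left of the powers of \<open>\<tau>\<close>.\<close>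

typedef (overloaded) 'a twisted_poly = "{f :: nat \<Rightarrow> 'a :: finite_field ratfun. finite {i. f i \<noteq> 0}}"
  morphisms tcoeff Abs_twisted_poly
  by (rule exI[of _ "\<lambda>_. 0"]) simp

setup_lifting type_definition_twisted_poly

lemma twisted_poly_eqI: "(\<And>i. tcoeff f i = tcoeff g i) \<Longrightarrow> f = g"
  by transfer auto

lemma finite_tcoeff: "finite {i. tcoeff f i \<noteq> 0}"
  by transfer auto

instantiation twisted_poly :: (finite_field) ring_1
begin

lift_definition zero_twisted_poly :: "'a twisted_poly" is "\<lambda>_. 0" by simp

lift_definition one_twisted_poly :: "'a twisted_poly" is "\<lambda>i. if i = 0 then 1 else 0"
  by simp

lift_definition plus_twisted_poly :: "'a twisted_poly \<Rightarrow> 'a twisted_poly \<Rightarrow> 'a twisted_poly"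
  is "\<lambda>f g i. f i + g i"
proof -
  fix f g :: "nat \<Rightarrow> 'a ratfun"
  assume "finite {i. f i \<noteq> 0}" "finite {i. g i \<noteq> 0}"
  moreover have "{i. f i + g i \<noteq> 0} \<subseteq> {i. f i \<noteq> 0} \<union> {i. g i \<noteq> 0}" by auto
  ultimately show "finite {i. f i + g i \<noteq> 0}" by (meson finite_UnI finite_subset)
qed

lift_definition minus_twisted_poly :: "'a twisted_poly \<Rightarrow> 'a twisted_poly \<Rightarrow> 'a twisted_poly"
  is "\<lambda>f g i. f i - g i"
proof -
  fix f g :: "nat \<Rightarrow> 'a ratfun"
  assume "finite {i. f i \<noteq> 0}" "finite {i. g i \<noteq> 0}"
  moreover have "{i. f i - g i \<noteq> 0} \<subseteq> {i. f i \<noteq> 0} \<union> {i. g i \<noteq> 0}" by auto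
  ultimately show "finite {i. f i - g i \<noteq> 0}" by (meson finite_UnI finite_subset)
qed

lift_definition uminus_twisted_poly :: "'a twisted_poly \<Rightarrow> 'a twisted_poly"
  is "\<lambda>f i. - f i"
  by simp

text \<open>\<open>(a \<tau>\<^sup>i) (b \<tau>\<^sup>j) = a b\<^bsup>q^i\<^esup> \<tau>\<^bsup>i+j\<^esup>\<close>\<close>

lift_definition times_twisted_poly :: "'a twisted_poly \<Rightarrow> 'a twisted_poly \<Rightarrow> 'a twisted_poly"
  is "\<lambda>f g n. \<Sum>i=0..n. f i * g (n - i) ^ (CARD('a) ^ i)"
proof -
  fix f g :: "nat \<Rightarrow> 'a ratfun"
  assume fin: "finite {i. f i \<noteq> 0}" "finite {i. g i \<noteq> 0}"
  have "{n. (\<Sum>i=0..n. f i * g (n - i) ^ (CARD('a) ^ i)) \<noteq> 0} \<subseteq>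
          (\<lambda>(i,j). i + j) ` ({i. f i \<noteq> 0} \<times> {i. g i \<noteq> 0})"
  proof
    fix n assume "n \<in> {n. (\<Sum>i=0..n. f i * g (n - i) ^ (CARD('a) ^ i)) \<noteq> 0}"
    then obtain i where "i \<in> {0..n}" "f i * g (n - i) ^ (CARD('a) ^ i) \<noteq> 0"
      by (metis (mono_tags, lifting) mem_Collect_eq sum.neutral)
    hence "f i \<noteq> 0" "g (n - i) \<noteq> 0" "n = i + (n - i)" by (auto simp: zero_power)
    thus "n \<in> (\<lambda>(i,j). i + j) ` ({i. f i \<noteq> 0} \<times> {i. g i \<noteq> 0})"
      by (intro image_eqI[of _ _ "(i, n - i)"]) auto
  qed
  thus "finite {n. (\<Sum>i=0..n. f i * g (n - i) ^ (CARD('a) ^ i)) \<noteq> 0}"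
    by (rule finite_subset) (use fin in auto)
qed

instance
proof
  fix f g h :: "'a twisted_poly"
  show "f + g + h = f + (g + h)" "f + g = g + f" "0 + f = f" "- f + f = 0" "f - g = f + - g"
    by (transfer; simp add: algebra_simps)+
  show "(0 :: 'a twisted_poly) \<noteq> 1"
    by transfer (auto simp: fun_eq_iff)
  show "1 * f = f"
  proof (rule twisted_poly_eqI)
    fix n
    have "tcoeff (1 * f) n = (\<Sum>i=0..n. if i = 0 then tcoeff f n else 0)"
      unfolding times_twisted_poly.rep_eq by (rule sum.cong) (auto simp: one_twisted_poly.rep_eq)
    thus "tcoeff (1 * f) n = tcoeff f n" by simp
  qed
  show "f * 1 = f"
  proof (rule twisted_poly_eqI)
    fix n
    have "tcoeff (f * 1) n = (\<Sum>i=0..n. if i = n then tcoeff f n else 0)"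
      unfolding times_twisted_poly.rep_eq
      by (rule sum.cong) (auto simp: one_twisted_poly.rep_eq zero_power)
    thus "tcoeff (f * 1) n = tcoeff f n" by simp
  qed
  show "(f + g) * h = f * h + g * h"
    by transfer (simp add: algebra_simps sum.distrib)
  show "f * (g + h) = f * g + f * h"
    by transfer (simp add: algebra_simps sum.distrib ratfun_frobenius_add_pow)
  show "f * g * h = f * (g * h)"
  proof (rule twisted_poly_eqI)
    fix n
    let ?F = "tcoeff f" and ?G = "tcoeff g" and ?H = "tcoeff h" and ?q = "CARD('a)"
    have pow: "x ^ (?q ^ (j + i)) = (x ^ (?q ^ i)) ^ (?q ^ j)" for x :: "'a ratfun" and i j
      by (metis add.commute power_add power_mult)
    have "tcoeff (f * g * h) n =
        (\<Sum>j=0..n. \<Sum>i=0..j. ?F i * ?G (j - i) ^ (?q ^ i) * ?H (n - j) ^ (?q ^ (i + (j - i))))"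
      by (simp add: times_twisted_poly.rep_eq sum_distrib_right)
    also have "\<dots> = (\<Sum>j=0..n. \<Sum>i=0..n - j. ?F j * ?G i ^ (?q ^ j) * ?H (n - j - i) ^ (?q ^ (j + i)))"
      by (rule fps_mult_assoc_lemma[of "\<lambda>i j k. ?F i * ?G j ^ (?q ^ i) * ?H k ^ (?q ^ (i + j))"])
    also have "\<dots> = tcoeff (f * (g * h)) n"
      by (simp only: times_twisted_poly.rep_eq ratfun_frobenius_sum_pow sum_distrib_left
            power_mult_distrib pow mult.assoc)
    finally show "tcoeff (f * g * h) n = tcoeff (f * (g * h)) n" .
  qed
qed

end

definition tconst :: "'a :: finite_field ratfun \<Rightarrow> 'a twisted_poly" where
  "tconst c = Abs_twisted_poly (\<lambda>i. if i = 0 then c else 0)"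

definition tau :: "'a :: finite_field twisted_poly" where
  "tau = Abs_twisted_poly (\<lambda>i. if i = 1 then 1 else 0)"

lemma tcoeff_tconst: "tcoeff (tconst c) = (\<lambda>i. if i = 0 then c else 0)"
  unfolding tconst_def by (rule Abs_twisted_poly_inverse) simp

lemma tcoeff_tau: "tcoeff tau = (\<lambda>i. if i = 1 then 1 else 0)"
  unfolding tau_def by (rule Abs_twisted_poly_inverse) simp

lemma tcoeff_tconst_mult: "tcoeff (tconst c * f) n = c * tcoeff f n"
proof -
  have "tcoeff (tconst c * f) n = (\<Sum>i=0..n. if i = 0 then c * tcoeff f n else 0)"
    unfolding times_twisted_poly.rep_eq by (rule sum.cong) (auto simp: tcoeff_tconst)
  thus ?thesis by simp
qed

lemma tcoeff_mult_tconst: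
  "tcoeff (f * tconst c) n = tcoeff f n * c ^ (CARD('a) ^ n)"
  for f :: "'a :: finite_field twisted_poly"
proof -
  have "tcoeff (f * tconst c) n =
      (\<Sum>i=0..n. if i = n then tcoeff f n * c ^ (CARD('a) ^ n) else 0)"
    unfolding times_twisted_poly.rep_eq
    by (rule sum.cong) (auto simp: tcoeff_tconst zero_power)
  thus ?thesis by simp
qed

lemma tau_mult_tconst: "tau * tconst c = tconst (c ^ CARD('a)) * tau"
  for c :: "'a :: finite_field ratfun"
  by (rule twisted_poly_eqI) (auto simp: tcoeff_tconst_mult tcoeff_mult_tconst tcoeff_tau)

lemma tcoeff_tau_power: "tcoeff (tau ^ k) n = (if n = k then 1 else 0)"
proof (induction k arbitrary: n)
  case 0
  thus ?case by (simp add: one_twisted_poly.rep_eq)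
next
  case (Suc k)
  have "tcoeff (tau ^ Suc k :: 'a twisted_poly) n =
      (\<Sum>i=0..n. if i = 1 then (if n = Suc k then 1 else 0) else 0)"
    unfolding power_Suc times_twisted_poly.rep_eq
    by (rule sum.cong) (auto simp: tcoeff_tau Suc zero_power)
  thus ?case by auto
qed

text \<open>The additive polynomial \<open>f(x) = \<Sum> c\<^sub>i x\<^bsup>q^i\<^esup>\<close> attached to \<open>f = \<Sum> c\<^sub>i \<tau>\<^sup>i\<close>.\<close>

definition additive_poly :: "'a :: finite_field twisted_poly \<Rightarrow> 'a ratfun poly" where
  "additive_poly f = (\<Sum>i | tcoeff f i \<noteq> 0. monom (tcoeff f i) (CARD('a) ^ i))"


section \<open>Drinfeld modules\<close>

text \<open>
  Drinfeld modules of rank \<open>r \<ge> 1\<close> over \<open>F\<close> with structure map the inclusion of \<open>A\<close>: homomorphisms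
  of \<open>\<bbbF>\<^sub>q\<close>-algebras from \<open>A\<close> to \<open>F{\<tau>}\<close> with the constant terms prescribed by the structure map
  and with \<open>\<phi>\<^sub>T\<close> of degree \<open>r\<close> in \<open>\<tau>\<close>.
\<close>

definition drinfeld_module :: "nat \<Rightarrow> ('a :: finite_field poly \<Rightarrow> 'a twisted_poly) \<Rightarrow> bool" where
  "drinfeld_module r \<phi> \<longleftrightarrow>
     (\<forall>a b. \<phi> (a + b) = \<phi> a + \<phi> b) \<and>
     (\<forall>a b. \<phi> (a * b) = \<phi> a * \<phi> b) \<and>
     (\<forall>c. \<phi> [:c:] = tconst (to_fract [:c:])) \<and>
     (\<forall>a. tcoeff (\<phi> a) 0 = to_fract a) \<and>
     r \<ge> 1 \<and> tcoeff (\<phi> [:0, 1:]) r \<noteq> 0 \<and> (\<forall>i>r. tcoeff (\<phi> [:0, 1:]) i = 0)"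

definition drinfeld_T :: "nat \<Rightarrow> (nat \<Rightarrow> 'a :: finite_field poly) \<Rightarrow> 'a twisted_poly" where
  "drinfeld_T r g = tconst (to_fract [:0, 1:]) + (\<Sum>i=1..r. tconst (to_fract (g i)) * tau ^ i)"

definition drinfeld :: "nat \<Rightarrow> (nat \<Rightarrow> 'a :: finite_field poly) \<Rightarrow> 'a poly \<Rightarrow> 'a twisted_poly" where
  "drinfeld r g a = (\<Sum>i\<le>degree a. tconst (to_fract [:coeff a i:]) * drinfeld_T r g ^ i)"

lemma tcoeff_sum: "tcoeff (sum f S) n = (\<Sum>s\<in>S. tcoeff (f s) n)"
  by (induction S rule: infinite_finite_induct)
     (simp_all add: zero_twisted_poly.rep_eq plus_twisted_poly.rep_eq)

lemma tcoeff_drinfeld_T: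
  "tcoeff (drinfeld_T r g) n =
     (if n = 0 then to_fract [:0, 1:] else if n \<le> r then to_fract (g n) else 0)"
  by (auto simp: drinfeld_T_def plus_twisted_poly.rep_eq tcoeff_sum tcoeff_tconst_mult
        tcoeff_tau_power tcoeff_tconst if_distrib sum.delta cong: if_cong)

lemma tconst_add: "tconst (c + d) = tconst c + tconst d"
  by (rule twisted_poly_eqI) (simp add: tcoeff_tconst plus_twisted_poly.rep_eq)

lemma tconst_mult: "tconst (c * d) = tconst c * tconst d"
  by (rule twisted_poly_eqI) (simp add: tcoeff_tconst_mult tcoeff_tconst)

lemma tconst_0: "tconst 0 = 0"
  by (rule twisted_poly_eqI) (simp add: tcoeff_tconst zero_twisted_poly.rep_eq)

lemma tconst_1: "tconst 1 = 1"
  by (rule twisted_poly_eqI) (simp add: tcoeff_tconst one_twisted_poly.rep_eq)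

lemma to_fract_power: "to_fract (x ^ n) = to_fract x ^ n"
  by (induction n) auto

lemma const_poly_power: "[:c:] ^ n = [:c ^ n:]" for c :: "'b :: comm_semiring_1"
  by (induction n) (auto simp: one_pCons mult.commute)

lemma tconst_scalar_commute: "tconst (to_fract [:c:]) * f = f * tconst (to_fract [:c:])"
proof -
  have "to_fract [:c:] ^ (CARD('a) ^ n) = to_fract [:c:]" for n
    by (simp add: const_poly_power finite_field_power_card_power_eq_same flip: to_fract_power)
  thus ?thesis
    by (intro twisted_poly_eqI) (simp add: tcoeff_tconst_mult tcoeff_mult_tconst mult.commute)
qed

lemma drinfeld_bound:
  assumes "degree a \<le> n"
  shows "drinfeld r g a = (\<Sum>i\<le>n. tconst (to_fract [:coeff a i:]) * drinfeld_T r g ^ i)"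
  unfolding drinfeld_def
  by (rule sum.mono_neutral_left) (use assms in \<open>auto simp: coeff_eq_0 tconst_0\<close>)

lemma drinfeld_add: "drinfeld r g (a + b) = drinfeld r g a + drinfeld r g b"
proof -
  let ?n = "max (degree a) (degree b)"
  have *: "to_fract [:x + y:] = to_fract [:x:] + to_fract [:y:]" for x y :: 'a
    by (simp flip: to_fract_add)
  have bounds: "degree (a + b) \<le> ?n" "degree a \<le> ?n" "degree b \<le> ?n"
    by (auto intro: degree_add_le_max)
  have "drinfeld r g (a + b) =
      (\<Sum>i\<le>?n. tconst (to_fract [:coeff a i:]) * drinfeld_T r g ^ i +
              tconst (to_fract [:coeff b i:]) * drinfeld_T r g ^ i)"
    unfolding drinfeld_bound[OF bounds(1)] coeff_add * tconst_add distrib_right ..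
  also have "\<dots> = drinfeld r g a + drinfeld r g b"
    unfolding drinfeld_bound[OF bounds(2)] drinfeld_bound[OF bounds(3)] by (rule sum.distrib)
  finally show ?thesis .
qed

lemma drinfeld_pCons:
  "drinfeld r g (pCons c a) = tconst (to_fract [:c:]) + drinfeld r g a * drinfeld_T r g"
proof -
  have "degree (pCons c a) \<le> Suc (degree a)" by (simp add: degree_pCons_le)
  thus ?thesis
    unfolding drinfeld_bound[OF \<open>degree (pCons c a) \<le> Suc (degree a)\<close>]
    by (subst sum.atMost_Suc_shift)
       (simp add: drinfeld_def sum_distrib_right mult.assoc power_commutes)
qed

lemma drinfeld_0: "drinfeld r g 0 = 0"
  by (simp add: drinfeld_def tconst_0)

lemma drinfeld_const: "drinfeld r g [:c:] = tconst (to_fract [:c:])"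
  by (simp add: drinfeld_def)

lemma drinfeld_smult: "drinfeld r g (smult c a) = tconst (to_fract [:c:]) * drinfeld r g a"
proof -
  have *: "to_fract [:x * y:] = to_fract [:x:] * to_fract [:y:]" for x y :: 'a
    by (simp flip: to_fract_mult)
  have "degree (smult c a) \<le> degree a" by simp
  from drinfeld_bound[OF this, of r g] show ?thesis
    by (simp add: * tconst_mult drinfeld_def sum_distrib_left mult.assoc)
qed

lemma drinfeld_T_commute: "drinfeld r g a * drinfeld_T r g = drinfeld_T r g * drinfeld r g a"
  by (induction a)
     (simp_all add: drinfeld_0 drinfeld_pCons distrib_left distrib_right
        tconst_scalar_commute mult.assoc)

lemma drinfeld_mult: "drinfeld r g (a * b) = drinfeld r g a * drinfeld r g b"
proof (induction a)
  case 0
  show ?case by (simp add: drinfeld_0)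
next
  case (pCons c a)
  have "drinfeld r g (pCons c a * b) =
      tconst (to_fract [:c:]) * drinfeld r g b + drinfeld r g (a * b) * drinfeld_T r g"
    by (simp add: drinfeld_add drinfeld_smult drinfeld_pCons tconst_0)
  also have "\<dots> = drinfeld r g (pCons c a) * drinfeld r g b"
    using drinfeld_T_commute[of r g b]
    by (simp add: pCons.IH drinfeld_pCons distrib_right mult.assoc)
  finally show ?case .
qed

lemma drinfeld_X: "drinfeld r g [:0, 1:] = drinfeld_T r g"
proof -
  have "drinfeld r g [:1:] = 1"
    unfolding drinfeld_const by (simp add: tconst_1 flip: one_pCons)
  thus ?thesis
    unfolding drinfeld_pCons[of r g 0 "[:1:]"] by (simp add: tconst_0)
qed

lemma tcoeff_0_mult: "tcoeff (f * g) 0 = tcoeff f 0 * tcoeff g 0"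
  by (simp add: times_twisted_poly.rep_eq)

lemma tcoeff_0_drinfeld: "tcoeff (drinfeld r g a) 0 = to_fract a"
proof (induction a)
  case 0
  show ?case by (simp add: drinfeld_0 zero_twisted_poly.rep_eq)
next
  case (pCons c a)
  have "tcoeff (drinfeld r g (pCons c a)) 0 = to_fract ([:c:] + a * [:0, 1:])"
    by (simp add: drinfeld_pCons plus_twisted_poly.rep_eq tcoeff_0_mult pCons.IH
          tcoeff_drinfeld_T tcoeff_tconst del: mult_pCons_right)
  thus ?case by simp
qed

theorem drinfeld_module_drinfeld:
  assumes "r \<ge> 1" "g r \<noteq> 0"
  shows "drinfeld_module r (drinfeld r g)"
  using assms unfolding drinfeld_module_def
  by (simp add: drinfeld_add drinfeld_mult drinfeld_const tcoeff_0_drinfeld drinfeld_X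
        tcoeff_drinfeld_T)

theorem drinfeld_module_unique:
  assumes "drinfeld_module r \<phi>" "\<phi> [:0, 1:] = drinfeld_T r g"
  shows "\<phi> = drinfeld r g"
proof
  fix a
  show "\<phi> a = drinfeld r g a"
  proof (induction a)
    case 0
    have "\<phi> [:0:] = tconst (to_fract [:0:])"
      using assms unfolding drinfeld_module_def by blast
    thus ?case by (simp add: drinfeld_0 tconst_0)
  next
    case (pCons c a)
    have "pCons c a = [:c:] + a * [:0, 1:]" by simp
    hence "\<phi> (pCons c a) = \<phi> [:c:] + \<phi> a * \<phi> [:0, 1:]"
      using assms(1) unfolding drinfeld_module_def by metis
    also have "\<dots> = drinfeld r g (pCons c a)"
      using assms unfolding drinfeld_module_def by (simp add: pCons.IH drinfeld_pCons)
    finally show ?case .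
  qed
qed


section \<open>Torsion, Tate module and Galois representation\<close>

text \<open>The action of \<open>a \<in> A\<close> on \<open>x\<close>, i.e. \<open>\<phi>\<^sub>a(x)\<close>.\<close>

definition drinfeld_action ::
  "('a :: finite_field poly \<Rightarrow> 'a twisted_poly) \<Rightarrow> 'a poly \<Rightarrow> 'a ratfun_ac \<Rightarrow> 'a ratfun_ac" where
  "drinfeld_action \<phi> a x = poly (map_poly to_ac (additive_poly (\<phi> a))) x"

definition T_torsion ::
  "('a :: finite_field poly \<Rightarrow> 'a twisted_poly) \<Rightarrow> nat \<Rightarrow> 'a ratfun_ac set" where
  "T_torsion \<phi> n = {x \<in> sep_closure. drinfeld_action \<phi> (monom 1 n) x = 0}"

text \<open>
  The limit is indexed from \<open>n = 0\<close> instead of \<open>n = 1\<close>, which changes nothing because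
  \<open>\<phi>[T\<^sup>0] = {0}\<close>.
\<close>

definition tate_module ::
  "('a :: finite_field poly \<Rightarrow> 'a twisted_poly) \<Rightarrow> (nat \<Rightarrow> 'a ratfun_ac) set" where
  "tate_module \<phi> =
     {x. \<forall>n. x n \<in> T_torsion \<phi> n \<and> drinfeld_action \<phi> [:0, 1:] (x (Suc n)) = x n}"

text \<open>On \<open>\<phi>[T\<^sup>n]\<close> a power series acts through its class modulo \<open>T\<^sup>n\<close>.\<close>

definition tate_smult ::
  "('a :: finite_field poly \<Rightarrow> 'a twisted_poly) \<Rightarrow> 'a fps \<Rightarrow> (nat \<Rightarrow> 'a ratfun_ac) \<Rightarrow> nat \<Rightarrow> 'a ratfun_ac" where
  "tate_smult \<phi> f x = (\<lambda>n. drinfeld_action \<phi> (truncate_fps n f) (x n))"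

definition tate_lincomb ::
  "('a :: finite_field poly \<Rightarrow> 'a twisted_poly) \<Rightarrow> nat \<Rightarrow> (nat \<Rightarrow> nat \<Rightarrow> 'a ratfun_ac) \<Rightarrow>
     'a fps vec \<Rightarrow> nat \<Rightarrow> 'a ratfun_ac" where
  "tate_lincomb \<phi> r b c = (\<lambda>n. \<Sum>i<r. tate_smult \<phi> (vec_index c i) (b i) n)"

definition tate_basis ::
  "('a :: finite_field poly \<Rightarrow> 'a twisted_poly) \<Rightarrow> nat \<Rightarrow> (nat \<Rightarrow> nat \<Rightarrow> 'a ratfun_ac) \<Rightarrow> bool" where
  "tate_basis \<phi> r b \<longleftrightarrow>
     (\<forall>i<r. b i \<in> tate_module \<phi>) \<and>
     (\<forall>x\<in>tate_module \<phi>. \<exists>!c. c \<in> carrier_vec r \<and> x = tate_lincomb \<phi> r b c)"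

definition tate_coords ::
  "('a :: finite_field poly \<Rightarrow> 'a twisted_poly) \<Rightarrow> nat \<Rightarrow> (nat \<Rightarrow> nat \<Rightarrow> 'a ratfun_ac) \<Rightarrow>
     (nat \<Rightarrow> 'a ratfun_ac) \<Rightarrow> 'a fps vec" where
  "tate_coords \<phi> r b x = (THE c. c \<in> carrier_vec r \<and> x = tate_lincomb \<phi> r b c)"

text \<open>
  The matrix of the (componentwise) action of \<open>\<sigma>\<close> with respect to the basis \<open>b\<close>: column \<open>j\<close>
  consists of the coordinates of \<open>\<sigma>(b\<^sub>j)\<close>.
\<close>

definition tate_rep ::
  "('a :: finite_field poly \<Rightarrow> 'a twisted_poly) \<Rightarrow> nat \<Rightarrow> (nat \<Rightarrow> nat \<Rightarrow> 'a ratfun_ac) \<Rightarrow>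
     ('a ratfun_ac \<Rightarrow> 'a ratfun_ac) \<Rightarrow> 'a fps mat" where
  "tate_rep \<phi> r b \<sigma> = mat r r (\<lambda>(i, j). vec_index (tate_coords \<phi> r b (\<sigma> \<circ> b j)) i)"

definition GL :: "nat \<Rightarrow> 'b :: comm_ring_1 mat set" where
  "GL r = {M \<in> carrier_mat r r. invertible_mat M}"

text \<open>
  A change of basis conjugates the representation by an element of \<open>GL\<^sub>r\<close>, so surjectivity does
  not depend on the basis chosen.
\<close>

definition tate_rep_surjective ::
  "('a :: finite_field poly \<Rightarrow> 'a twisted_poly) \<Rightarrow> nat \<Rightarrow> bool" where
  "tate_rep_surjective \<phi> r \<longleftrightarrow> (\<exists>b. tate_basis \<phi> r b \<and> tate_rep \<phi> r b ` galois_group = GL r)"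


section \<open>Counting tuples\<close>

text \<open>Tuples \<open>(g\<^sub>1, \<dots>, g\<^sub>r)\<close> with \<open>g\<^sub>r \<noteq> 0\<close>, as extensional functions on \<open>{1..r}\<close>.\<close>

definition drinfeld_tuples :: "nat \<Rightarrow> (nat \<Rightarrow> 'a :: finite_field poly) set" where
  "drinfeld_tuples r = {g \<in> {1..r} \<rightarrow>\<^sub>E UNIV. g r \<noteq> 0}"

definition surjective_tuples :: "nat \<Rightarrow> (nat \<Rightarrow> 'a :: finite_field poly) set" where
  "surjective_tuples r = {g \<in> drinfeld_tuples r. tate_rep_surjective (drinfeld r g) r}"

text \<open>\<open>deg f < d\<close> with the convention \<open>deg 0 = -\<infinity>\<close>.\<close>

definition deg_less :: "'b :: zero poly \<Rightarrow> nat \<Rightarrow> bool" where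
  "deg_less f d \<longleftrightarrow> f = 0 \<or> degree f < d"

end

(*
  A generic condition forces surjectivity. Let alpha be a nonzero simple root of g_r, in an algebraic
  closure of F_q, at which g_(r-1) does not vanish. Over the completed maximal unramified extension at
  T = alpha, the torsion points that reduce to torsion of the rank r-1 reduction are rational, while the
  remaining direction is totally ramified, as explicit Eisenstein polynomials show. So the local Galois
  group already yields every matrix that fixes the first r-1 vectors of a suitable basis and has a
  constant in the last diagonal entry. If moreover phi[T] has no proper nonzero Galois submodule, the
  conjugates of the resulting transvections generate SL_r modulo every power of T. The determinant is,
  up to a constant twist, given by the torsion of the Carlitz module, which is again described by
  Eisenstein polynomials, so it is onto.

  Both exceptional conditions are rare. A submodule of phi[T] yields a factorisation of phi_T(x) over A,
  in which the factor and few coefficients determine g. If there is no suitable alpha, then up to a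
  common factor with g_(r-1) the polynomial g_r is nearly a square.
*)

theory Submission
  imports Defs "Jordan_Normal_Form.Char_Poly" "HOL-Real_Asymp.Real_Asymp"
begin

no_notation vec_index (infixl \<open>$\<close> 100)

text \<open>The conditions at alpha have separate tasks. As alpha is nonzero, the linear coefficient
  T stays a unit, so the reduction is separable and its torsion lifts to power series. As g_(r-1)
  does not vanish, the reduction has rank exactly r-1. As the zero of g_r is simple, the leading
  coefficient is a uniformiser, which makes the polynomials Eisenstein. The local group is found at
  every level T^n directly, so nothing has to be lifted from phi[T]. Irreducibility serves only to
  move a given vector of phi[T] off the hyperplane of points rational over the completion. No
  valuation is extended to an algebraic closure: the closure of F is embedded into that of the
  completed field, and local conjugations are restricted back. Partial isomorphisms are kept as
  graphs and extended by Zorn's lemma. The determinant is reached only up to a constant because the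
  twist involves a root of order q-1; the constants in the last diagonal entry repair this. The
  density rests on one saving: there are at most N q^(N+1) pairs of nonzero polynomials with degree
  sum below N. A factorisation therefore costs hardly more than its product, and a nearly square
  factor costs only about q^(2d/3) instead of q^d.\<close>

lemma degree_diff_less_if_lead_coeff_eq:
  fixes p q :: "'a :: ab_group_add poly"
  assumes "degree q = degree p" "lead_coeff q = lead_coeff p"
  shows "p - q = 0 \<or> degree (p - q) < degree p"
proof (cases "degree (p - q) = degree p")
  case True
  have "coeff (p - q) (degree p) = 0" using assms by simp
  hence "lead_coeff (p - q) = 0" by (simp only: True)
  thus ?thesis unfolding leading_coeff_0_iff ..
next
  case False
  moreover have "degree (p - q) \<le> degree p" using degree_diff_le_max[of p q] assms by simp
  ultimately show ?thesis by linarith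
qed

section \<open>Extending homomorphisms to algebraic extensions\<close>

text \<open>Graphs of isomorphisms between subrings of two fields.\<close>

definition ring_graph :: "('b :: field \<times> 'c :: field) set \<Rightarrow> bool" where
  "ring_graph R \<longleftrightarrow> (1, 1) \<in> R \<and>
     (\<forall>x y x' y'. (x, y) \<in> R \<longrightarrow> (x', y') \<in> R \<longrightarrow> (x - x', y - y') \<in> R \<and> (x * x', y * y') \<in> R) \<and>
     (\<forall>x y. (x, y) \<in> R \<longrightarrow> (x = 0 \<longleftrightarrow> y = 0))"

lemma ring_graphI:
  assumes "(1, 1) \<in> R"
    and "\<And>x y x' y'. (x, y) \<in> R \<Longrightarrow> (x', y') \<in> R \<Longrightarrow> (x - x', y - y') \<in> R"
    and "\<And>x y x' y'. (x, y) \<in> R \<Longrightarrow> (x', y') \<in> R \<Longrightarrow> (x * x', y * y') \<in> R"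
    and "\<And>x y. (x, y) \<in> R \<Longrightarrow> x = 0 \<longleftrightarrow> y = 0"
  shows "ring_graph R"
  using assms unfolding ring_graph_def by blast

definition poly_graph :: "('b :: field \<times> 'c :: field) set \<Rightarrow> 'b poly \<Rightarrow> 'c poly \<Rightarrow> bool" where
  "poly_graph R p p' \<longleftrightarrow> (\<forall>i. (coeff p i, coeff p' i) \<in> R)"

context
  fixes R :: "('b :: field \<times> 'c :: field) set"
  assumes R: "ring_graph R"
begin

lemma ring_graph_1: "(1, 1) \<in> R"
  using R by (auto simp: ring_graph_def)

lemma ring_graph_diff: "(x, y) \<in> R \<Longrightarrow> (x', y') \<in> R \<Longrightarrow> (x - x', y - y') \<in> R"
  using R by (auto simp: ring_graph_def)

lemma ring_graph_mult: "(x, y) \<in> R \<Longrightarrow> (x', y') \<in> R \<Longrightarrow> (x * x', y * y') \<in> R"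
  using R by (auto simp: ring_graph_def)

lemma ring_graph_zero_iff: "(x, y) \<in> R \<Longrightarrow> x = 0 \<longleftrightarrow> y = 0"
  using R by (auto simp: ring_graph_def)

lemma ring_graph_0: "(0, 0) \<in> R"
  using ring_graph_diff[OF ring_graph_1 ring_graph_1] by simp

lemma ring_graph_add:
  assumes "(x, y) \<in> R" "(x', y') \<in> R"
  shows   "(x + x', y + y') \<in> R"
  using ring_graph_diff[OF assms(1) ring_graph_diff[OF ring_graph_0 assms(2)]] by simp

lemma ring_graph_power: "(x, y) \<in> R \<Longrightarrow> (x ^ n, y ^ n) \<in> R"
  by (induction n) (auto intro: ring_graph_1 ring_graph_mult)

lemma ring_graph_sum: "(\<And>i. i \<in> A \<Longrightarrow> (f i, g i) \<in> R) \<Longrightarrow> (sum f A, sum g A) \<in> R"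
  by (induction A rule: infinite_finite_induct) (auto intro: ring_graph_0 ring_graph_add)

lemma ring_graph_unique: "(x, y) \<in> R \<Longrightarrow> (x, y') \<in> R \<Longrightarrow> y = y'"
  using ring_graph_diff[of x y x y'] ring_graph_zero_iff by fastforce

lemma ring_graph_localization:
  "ring_graph {(u / x ^ k, v / y ^ k) | u v k. (u, v) \<in> R}" (is "ring_graph ?L")
  if xy: "(x, y) \<in> R" and "x \<noteq> 0"
proof (rule ring_graphI)
  have "y \<noteq> 0" using ring_graph_zero_iff[OF xy] \<open>x \<noteq> 0\<close> by simp
  show "(1, 1) \<in> ?L" using ring_graph_1 by force
  fix a b a' b' assume "(a, b) \<in> ?L" "(a', b') \<in> ?L"
  then obtain u v k u' v' k' where *: "(u, v) \<in> R" "(u', v') \<in> R"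
    "a = u / x ^ k" "b = v / y ^ k" "a' = u' / x ^ k'" "b' = v' / y ^ k'" by blast
  have "(u * x ^ k' - u' * x ^ k, v * y ^ k' - v' * y ^ k) \<in> R"
    by (intro ring_graph_diff ring_graph_mult ring_graph_power * xy)
  moreover have "a - a' = (u * x ^ k' - u' * x ^ k) / x ^ (k + k')"
    "b - b' = (v * y ^ k' - v' * y ^ k) / y ^ (k + k')"
    using \<open>x \<noteq> 0\<close> \<open>y \<noteq> 0\<close> by (simp_all add: * field_simps power_add)
  ultimately show "(a - a', b - b') \<in> ?L" by blast
  have "(u * u', v * v') \<in> R" by (intro ring_graph_mult *)
  moreover have "a * a' = u * u' / x ^ (k + k')" "b * b' = v * v' / y ^ (k + k')"
    by (simp_all add: * power_add)
  ultimately show "(a * a', b * b') \<in> ?L" by blast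
next
  have "y \<noteq> 0" using ring_graph_zero_iff[OF xy] \<open>x \<noteq> 0\<close> by simp
  fix a b assume "(a, b) \<in> ?L"
  then show "a = 0 \<longleftrightarrow> b = 0"
    using \<open>x \<noteq> 0\<close> \<open>y \<noteq> 0\<close> ring_graph_zero_iff by fastforce
qed

lemma poly_graph_diff: "poly_graph R p p' \<Longrightarrow> poly_graph R s s' \<Longrightarrow> poly_graph R (p - s) (p' - s')"
  by (auto simp: poly_graph_def intro: ring_graph_diff)

lemma poly_graph_mult: "poly_graph R p p' \<Longrightarrow> poly_graph R s s' \<Longrightarrow> poly_graph R (p * s) (p' * s')"
  by (auto simp: poly_graph_def coeff_mult intro!: ring_graph_sum ring_graph_mult)

lemma poly_graph_monom: "(c, d) \<in> R \<Longrightarrow> poly_graph R (monom c k) (monom d k)"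
  by (auto simp: poly_graph_def intro: ring_graph_0)

lemma poly_graph_exists:
  assumes "\<And>i. coeff p i \<in> fst ` R"
  shows   "\<exists>p'. poly_graph R p p'"
proof -
  define f where "f x = (if x = 0 then 0 else SOME y. (x, y) \<in> R)" for x
  have f: "(x, f x) \<in> R" if "x \<in> fst ` R" for x
    using that ring_graph_0 by (auto simp: f_def intro: someI)
  have "f 0 = 0" by (simp add: f_def)
  hence "poly_graph R p (map_poly f p)"
    using assms f by (auto simp: poly_graph_def coeff_map_poly)
  thus ?thesis by blast
qed

lemma poly_graph_degree:
  assumes "poly_graph R p p'"
  shows   "degree p' = degree p"
proof -
  have "coeff p i = 0 \<longleftrightarrow> coeff p' i = 0" for i
    using assms by (intro ring_graph_zero_iff) (auto simp: poly_graph_def)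
  hence "(\<forall>i>n. coeff p i = 0) \<longleftrightarrow> (\<forall>i>n. coeff p' i = 0)" for n by blast
  thus ?thesis by (simp add: degree_def)
qed

end

text \<open>The localisation at \<open>x\<close> is again a graph, and maximality leaves it no room.
  So the domain of a maximal graph is a field, as Euclidean division over it requires.\<close>

lemma ring_graph_inverse_closed:
  assumes "ring_graph R" and max: "\<And>S. ring_graph S \<Longrightarrow> R \<subseteq> S \<Longrightarrow> S = R"
    and "(x, y) \<in> R" "x \<noteq> 0"
  shows "(1 / x, 1 / y) \<in> R"
proof -
  let ?S = "{(u / x ^ k, v / y ^ k) | u v k. (u, v) \<in> R}"
  have "R \<subseteq> ?S"
  proof
    fix z assume "z \<in> R"
    then obtain u v where "z = (u, v)" "(u, v) \<in> R" by (cases z) auto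
    then have "z = (u / x ^ 0, v / y ^ 0)" by simp
    then show "z \<in> ?S" using \<open>(u, v) \<in> R\<close> by blast
  qed
  hence "?S = R"
    using max ring_graph_localization[OF assms(1,3,4)] by blast
  moreover have "(1 / x ^ 1, 1 / y ^ 1) \<in> ?S"
    using ring_graph_1[OF assms(1)] by blast
  ultimately show ?thesis by simp
qed

text \<open>A relation \<open>m\<close> of least degree for \<open>b\<close> over the domain is
  carried to \<open>m'\<close>. For any root \<open>y\<close> of \<open>m'\<close> the pairs
  \<open>(p(b), p'(y))\<close> form a larger graph, so \<open>(b, y)\<close> was already in
  \<open>R\<close>.\<close>

lemma ring_graph_maximal_total:
  fixes R :: "('b :: field \<times> 'c :: alg_closed_field) set"
  assumes R: "ring_graph R" and max: "\<And>S. ring_graph S \<Longrightarrow> R \<subseteq> S \<Longrightarrow> S = R"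
    and alg: "\<And>x. \<exists>p. p \<noteq> 0 \<and> poly p x = 0 \<and> (\<forall>i. coeff p i \<in> fst ` R)"
  shows "b \<in> fst ` R"
proof -
  note [intro] = ring_graph_diff[OF R] ring_graph_mult[OF R] ring_graph_0[OF R]
  note zero = ring_graph_zero_iff[OF R]
  let ?pg = "poly_graph R"
  define Q where "Q p \<longleftrightarrow> p \<noteq> 0 \<and> poly p b = 0 \<and> (\<forall>i. coeff p i \<in> fst ` R)" for p
  obtain m where "Q m" and min: "\<And>p. Q p \<Longrightarrow> degree m \<le> degree p"
    using alg[of b] ex_has_least_nat[of Q _ degree] unfolding Q_def by blast
  have m: "m \<noteq> 0" "poly m b = 0" "\<And>i. coeff m i \<in> fst ` R"
    using \<open>Q m\<close> by (auto simp: Q_def)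
  obtain m' where m': "?pg m m'" using poly_graph_exists[OF R m(3)] by blast
  have "degree m > 0"
  proof (rule ccontr)
    assume "\<not> degree m > 0"
    then obtain c where "m = [:c:]" by (auto elim: degree_eq_zeroE)
    thus False using m by auto
  qed
  hence "degree m' > 0" using poly_graph_degree[OF R m'] by simp
  then obtain y where y: "poly m' y = 0" using alg_closed_imp_poly_has_root by blast
  \<comment> \<open>This makes \<open>p(b) -> p'(y)\<close> well defined. Division by
    \<open>m\<close> is carried out in parallel on both sides; the quotients of leading coefficients
    lie in the graph by \<open>ring_graph_inverse_closed\<close>.\<close>
  have lift: "poly p' y = 0" if "?pg p p'" "poly p b = 0" for p p'
    using that
  proof (induction "degree p" arbitrary: p p' rule: less_induct)
    case less
    show ?case
    proof (cases "p = 0")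
      case True
      hence "\<And>i. coeff p' i = 0"
        using less.prems zero by (metis coeff_0 poly_graph_def)
      hence "p' = 0" by (simp add: poly_eq_iff)
      thus ?thesis by simp
    next
      case False
      have "Q p" using False less.prems
        unfolding Q_def poly_graph_def by force
      hence le: "degree m \<le> degree p" by (rule min)
      define k where "k = degree p - degree m"
      define c d where "c = lead_coeff p * (1 / lead_coeff m)"
        and "d = coeff p' (degree p) * (1 / coeff m' (degree m))"
      have "lead_coeff m \<noteq> 0" using m by simp
      have pc: "(lead_coeff p, coeff p' (degree p)) \<in> R" "(lead_coeff m, coeff m' (degree m)) \<in> R"
        using less.prems m' by (auto simp: poly_graph_def)
      have cd: "(c, d) \<in> R" unfolding c_def d_def
        using ring_graph_mult[OF R pc(1) ring_graph_inverse_closed[OF R max pc(2)]] \<open>lead_coeff m \<noteq> 0\<close> by blast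
      define p1 p1' where "p1 = p - monom c k * m" and "p1' = p' - monom d k * m'"
      have pg1: "?pg p1 p1'" unfolding p1_def p1'_def
        by (intro poly_graph_diff[OF R] poly_graph_mult[OF R] poly_graph_monom[OF R] less.prems m' cd)
      have root: "poly p1 b = 0" using less.prems m by (simp add: p1_def)
      have "c \<noteq> 0" using False m by (simp add: c_def)
      have "degree (monom c k * m) = degree p"
        using \<open>c \<noteq> 0\<close> m le by (simp add: degree_mult_eq degree_monom_eq k_def)
      moreover have "lead_coeff (monom c k * m) = lead_coeff p"
        using m False by (simp add: lead_coeff_mult c_def degree_monom_eq)
      ultimately have "p1 = 0 \<or> degree p1 < degree p"
        unfolding p1_def by (intro degree_diff_less_if_lead_coeff_eq) auto
      moreover have "poly p1' y = 0" if "p1 = 0"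
      proof -
        have "coeff p1' i = 0" for i
          using pg1 zero that by (metis coeff_0 poly_graph_def)
        hence "p1' = 0" by (simp add: poly_eq_iff)
        thus ?thesis by simp
      qed
      ultimately have "poly p1' y = 0" using less.hyps[OF _ pg1 root] by blast
      thus ?thesis using y by (simp add: p1'_def)
    qed
  qed
  define S where "S = {(poly p b, poly p' y) | p p'. ?pg p p'}"
  have S: "(poly p b, poly p' y) \<in> S" if "?pg p p'" for p p'
    using that by (auto simp: S_def)
  have RS: "(u, v) \<in> S" if "(u, v) \<in> R" for u v
    using S[OF poly_graph_monom[OF R that, of 0]] by (simp add: poly_monom)
  have S_diff: "(u - u', v - v') \<in> S" if "(u, v) \<in> S" "(u', v') \<in> S" for u v u' v'
    using that unfolding S_def by (force simp flip: poly_diff intro: poly_graph_diff[OF R])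
  have S_mult: "(u * u', v * v') \<in> S" if "(u, v) \<in> S" "(u', v') \<in> S" for u v u' v'
    using that unfolding S_def by (force simp flip: poly_mult intro: poly_graph_mult[OF R])
  have S_0: "(0, 0) \<in> S" using RS ring_graph_0[OF R] by simp
  have S_add: "(u + u', v + v') \<in> S" if "(u, v) \<in> S" "(u', v') \<in> S" for u v u' v'
    using S_diff[OF that(1) S_diff[OF S_0 that(2)]] by simp
  have S_lift: "v = 0" if "(0, v) \<in> S" for v
    using that lift unfolding S_def by auto
  have "ring_graph S"
  proof (rule ring_graphI)
    fix u v assume uv: "(u, v) \<in> S"
    \<comment> \<open>Injectivity. If \<open>u\<close> were nonzero, a relation of least degree for
      \<open>u\<close> would have a nonzero constant term, as otherwise the variable could be
      divided out. Its transport has the root \<open>v\<close>, and \<open>v = 0\<close> would kill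
      that constant term.\<close>
    have "u = 0" if "v = 0"
    proof (rule ccontr)
      assume "u \<noteq> 0"
      define Q' where "Q' p \<longleftrightarrow> p \<noteq> 0 \<and> poly p u = 0 \<and> (\<forall>i. coeff p i \<in> fst ` R)" for p
      obtain s where "Q' s" and min': "\<And>p. Q' p \<Longrightarrow> degree s \<le> degree p"
        using alg[of u] ex_has_least_nat[of Q' _ degree] unfolding Q'_def by blast
      obtain a s1 where s: "s = pCons a s1" by (cases s)
      have "a \<noteq> 0"
      proof
        assume "a = 0"
        hence "Q' s1" using \<open>Q' s\<close> \<open>u \<noteq> 0\<close> unfolding Q'_def s
          by (metis \<open>a = 0\<close> coeff_pCons_Suc mult_eq_0_iff pCons_eq_0_iff poly_pCons add_0)
        thus False using min' s \<open>a = 0\<close> unfolding Q'_def by fastforce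
      qed
      have "\<forall>i. coeff s i \<in> fst ` R" using \<open>Q' s\<close> by (simp add: Q'_def)
      then obtain s' where s': "?pg s s'" using poly_graph_exists[OF R] by blast
      have ev: "(poly t u, poly t' v) \<in> S" if "?pg t t'" for t t'
        using that
      proof (induction t arbitrary: t')
        case 0
        hence "\<And>i. coeff t' i = 0" using zero by (metis coeff_0 poly_graph_def)
        hence "t' = 0" by (simp add: poly_eq_iff)
        thus ?case using S_0 by simp
      next
        case (pCons c t)
        obtain d t1 where t': "t' = pCons d t1" by (cases t')
        have "(c, d) \<in> R" using pCons.prems unfolding t' poly_graph_def
          by (metis coeff_pCons_0)
        moreover have "?pg t t1" using pCons.prems unfolding t' poly_graph_def
          by (metis coeff_pCons_Suc)
        ultimately show ?case using pCons.IH RS S_add S_mult uv by (simp add: t')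
      qed
      have "poly s' v = 0" using S_lift ev[OF s'] \<open>Q' s\<close> by (simp add: Q'_def)
      hence "coeff s' 0 = 0" using \<open>v = 0\<close> by (simp add: poly_0_coeff_0)
      hence "a = 0" using s' zero unfolding s poly_graph_def by (metis coeff_pCons_0)
      thus False using \<open>a \<noteq> 0\<close> by simp
    qed
    thus "u = 0 \<longleftrightarrow> v = 0" using S_lift uv by auto
  qed (use RS ring_graph_1[OF R] S_diff S_mult in auto)
  moreover have "R \<subseteq> S" using RS by auto
  ultimately have "S = R" by (rule max)
  moreover have "(b, y) \<in> S"
    using S[OF poly_graph_monom[OF R ring_graph_1[OF R], of 1]] by (simp add: poly_monom)
  ultimately show ?thesis by force
qed

text \<open>The extension theorem for isomorphisms into an algebraically closed field. It is applied
  both inside one algebraic closure and between two different ones, and for this reason the two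
  fields are unrelated.\<close>

theorem ring_graph_extend:
  fixes R :: "('b :: field \<times> 'c :: alg_closed_field) set"
  assumes R: "ring_graph R"
    and alg: "\<And>x. \<exists>p. p \<noteq> 0 \<and> poly p x = 0 \<and> (\<forall>i. coeff p i \<in> fst ` R)"
  obtains h where "comm_ring_hom h" "\<And>x y. (x, y) \<in> R \<Longrightarrow> h x = y"
proof -
  let ?A = "{S. R \<subseteq> S \<and> ring_graph S}"
  have "\<exists>M\<in>?A. \<forall>S\<in>?A. M \<subseteq> S \<longrightarrow> S = M"
  proof (rule subset_Zorn_nonempty)
    show "?A \<noteq> {}" using R by blast
  next
    fix C assume C: "C \<noteq> {}" "subset.chain ?A C"
    have gr: "ring_graph S" "R \<subseteq> S" if "S \<in> C" for S
      using C that by (auto simp: subset.chain_def)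
    have two: "\<exists>S\<in>C. z \<in> S \<and> z' \<in> S" if "z \<in> \<Union>C" "z' \<in> \<Union>C" for z z'
    proof -
      from that obtain S S' where S: "S \<in> C" "z \<in> S" "S' \<in> C" "z' \<in> S'" by blast
      hence "S \<subseteq> S' \<or> S' \<subseteq> S" using C(2) by (auto simp: subset_chain_def)
      thus ?thesis using S by blast
    qed
    have "ring_graph (\<Union>C)"
    proof (rule ring_graphI)
      obtain S where "S \<in> C" using C by blast
      thus "(1, 1) \<in> \<Union>C" using ring_graph_1[OF gr(1)] by blast
    next
      fix x y x' y' assume "(x, y) \<in> \<Union>C" "(x', y') \<in> \<Union>C"
      from two[OF this] obtain S where "S \<in> C" "(x, y) \<in> S" "(x', y') \<in> S" by blast
      thus "(x - x', y - y') \<in> \<Union>C" "(x * x', y * y') \<in> \<Union>C"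
        using ring_graph_diff[OF gr(1)] ring_graph_mult[OF gr(1)] by (meson UnionI)+
    next
      fix x y assume "(x, y) \<in> \<Union>C"
      then obtain S where "S \<in> C" "(x, y) \<in> S" by blast
      thus "x = 0 \<longleftrightarrow> y = 0" using ring_graph_zero_iff[OF gr(1)] by blast
    qed
    moreover have "R \<subseteq> \<Union>C" using C(1) gr(2) by blast
    ultimately show "\<Union>C \<in> ?A" by blast
  qed
  then obtain M where "M \<in> ?A" and "\<forall>S\<in>?A. M \<subseteq> S \<longrightarrow> S = M" by (elim bexE)
  hence M: "R \<subseteq> M" "ring_graph M" and max: "\<And>S. ring_graph S \<Longrightarrow> M \<subseteq> S \<Longrightarrow> S = M"
    by auto
  have "x \<in> fst ` M" for x
  proof (rule ring_graph_maximal_total[OF M(2) max])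
    show "\<exists>p. p \<noteq> 0 \<and> poly p x = 0 \<and> (\<forall>i. coeff p i \<in> fst ` M)" for x
      using alg[of x] image_mono[OF M(1), of fst] by blast
  qed auto
  hence ex: "\<exists>y. (x, y) \<in> M" for x by force
  define h where "h x = (THE y. (x, y) \<in> M)" for x
  have hM: "(x, h x) \<in> M" for x
    unfolding h_def using ex[of x] ring_graph_unique[OF M(2)] by (metis the_equality)
  have h_eq: "h x = y" if "(x, y) \<in> M" for x y
    using ring_graph_unique[OF M(2) hM that] .
  show ?thesis
  proof (rule that[of h])
    show "comm_ring_hom h"
      by unfold_locales
         (auto intro!: h_eq ring_graph_add[OF M(2)] ring_graph_mult[OF M(2)] hM
            ring_graph_1[OF M(2)] ring_graph_0[OF M(2)])
    show "h x = y" if "(x, y) \<in> R" for x y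
      using that M(1) by (intro h_eq) auto
  qed
qed

section \<open>Conjugation in the algebraic closure\<close>

interpretation to_ac: field_hom to_ac
  by unfold_locales auto

interpretation to_ac_poly: map_poly_comm_ring_hom to_ac ..

lemma comm_ring_hom_zero_iff:
  fixes h :: "'b :: field \<Rightarrow> 'c :: field"
  assumes "comm_ring_hom h"
  shows "h x = 0 \<longleftrightarrow> x = 0"
proof -
  interpret comm_ring_hom h by fact
  have "h x \<noteq> 0" if "x \<noteq> 0"
  proof
    assume "h x = 0"
    moreover have "h x * h (inverse x) = 1" using that by (simp flip: hom_mult)
    ultimately show False by simp
  qed
  thus ?thesis by auto
qed

lemma comm_ring_hom_inj:
  fixes h :: "'b :: field \<Rightarrow> 'c :: field"
  assumes "comm_ring_hom h"
  shows "inj h"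
proof (rule injI)
  interpret comm_ring_hom h by fact
  fix x y assume "h x = h y"
  hence "h (x - y) = 0" by (simp add: hom_minus)
  thus "x = y" using comm_ring_hom_zero_iff[OF assms] by simp
qed

lemma card_roots_eq_degree:
  fixes p :: "'b :: alg_closed_field poly"
  assumes "p \<noteq> 0" and sep: "\<And>x. poly p x = 0 \<Longrightarrow> poly (pderiv p) x \<noteq> 0"
  shows "card {x. poly p x = 0} = degree p"
  using assms
proof (induction "degree p" arbitrary: p)
  case 0
  then obtain c where "p = [:c:]" by (metis degree_eq_zeroE)
  thus ?case using 0 by simp
next
  case (Suc n)
  then obtain x where x: "poly p x = 0" using alg_closed_imp_poly_has_root by (metis zero_less_Suc)
  then obtain s where p: "p = [:-x, 1:] * s" by (metis dvdE poly_eq_0_iff_dvd)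
  hence "s \<noteq> 0" using Suc.prems by auto
  hence deg: "degree p = Suc (degree s)" unfolding p by (subst degree_mult_eq) auto
  have pd: "poly (pderiv p) y = poly s y + (y - x) * poly (pderiv s) y" for y
    unfolding p pderiv_mult by (simp add: pderiv_pCons algebra_simps del: mult_pCons_left)
  have sx: "poly s x \<noteq> 0" using Suc.prems(2)[OF x] pd[of x] by simp
  have "card {y. poly s y = 0} = degree s"
  proof (rule Suc.hyps)
    show "n = degree s" using deg Suc.hyps(2) by simp
    show "poly (pderiv s) y \<noteq> 0" if "poly s y = 0" for y
    proof -
      have "poly p y = 0" using that by (simp add: p)
      thus ?thesis using Suc.prems(2)[of y] pd[of y] that by auto
    qed
  qed fact
  moreover have "{y. poly p y = 0} = insert x {y. poly s y = 0}" by (auto simp: p)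
  ultimately show ?case using sx deg \<open>s \<noteq> 0\<close> by (simp add: poly_roots_finite)
qed

lemma irreducible_root_dvd_iff:
  fixes f :: "'k :: field poly"
  assumes "irreducible f" "poly (map_poly to_ac f) x = 0"
  shows "poly (map_poly to_ac p) x = 0 \<longleftrightarrow> f dvd p"
proof
  assume "f dvd p"
  then obtain u where "p = f * u" by blast
  thus "poly (map_poly to_ac p) x = 0" using assms by (simp add: to_ac_poly.hom_mult)
next
  define Q where "Q s \<longleftrightarrow> s \<noteq> 0 \<and> poly (map_poly to_ac s) x = 0" for s
  have "Q f" using assms by (auto simp: Q_def irreducible_def)
  then obtain m where "Q m" and min: "\<And>s. Q s \<Longrightarrow> degree m \<le> degree s"
    using ex_has_least_nat[of Q f degree] by blast
  have m: "m \<noteq> 0" "poly (map_poly to_ac m) x = 0" using \<open>Q m\<close> by (auto simp: Q_def)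
  have dvd: "m dvd s" if "poly (map_poly to_ac s) x = 0" for s
  proof -
    have "poly (map_poly to_ac (m * (s div m) + s mod m)) x = 0" using that by simp
    hence "poly (map_poly to_ac (s mod m)) x = 0"
      using m unfolding to_ac_poly.hom_add to_ac_poly.hom_mult by simp
    hence "s mod m = 0" using min[of "s mod m"] degree_mod_less'[of m s] m(1)
      unfolding Q_def by fastforce
    thus ?thesis by (simp add: dvd_eq_mod_eq_0)
  qed
  have "\<not> m dvd 1"
  proof
    assume "m dvd 1"
    then obtain c where "m = [:c:]" "c \<noteq> 0" using is_unit_poly_iff[of m] m(1) by auto
    thus False using m by simp
  qed
  obtain u where u: "f = m * u" using dvd[OF assms(2)] by blast
  hence "u dvd 1" using irreducibleD[OF assms(1) u] \<open>\<not> m dvd 1\<close> by blast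
  hence "f dvd m" unfolding u by (simp add: mult_unit_dvd_iff)
  moreover assume "poly (map_poly to_ac p) x = 0"
  ultimately show "f dvd p" using dvd dvd_trans by blast
qed

lemma irreducible_root_exists:
  fixes x :: "'k :: field alg_closure"
  obtains f :: "'k poly" where "irreducible f" "poly (map_poly to_ac f) x = 0"
proof -
  define Q where "Q s \<longleftrightarrow> s \<noteq> 0 \<and> poly (map_poly to_ac s) x = 0" for s :: "'k poly"
  obtain f where "Q f" and min: "\<And>s. Q s \<Longrightarrow> degree f \<le> degree s"
    using alg_closure_algebraic[of x] ex_has_least_nat[of Q _ degree] unfolding Q_def by metis
  have f: "f \<noteq> 0" "poly (map_poly to_ac f) x = 0" using \<open>Q f\<close> by (auto simp: Q_def)
  have unit: "v dvd 1" if "f = u * v" "poly (map_poly to_ac u) x = 0" for u v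
  proof -
    have nz: "u \<noteq> 0" "v \<noteq> 0" using that f by auto
    hence "degree f \<le> degree u" using that by (intro min) (auto simp: Q_def)
    hence "degree v = 0" using nz by (simp add: that degree_mult_eq)
    thus ?thesis using nz by (metis is_unit_iff_degree)
  qed
  have "irreducible f"
  proof (rule irreducibleI)
    show "\<not> f dvd 1"
    proof
      assume "f dvd 1"
      then obtain c where "f = [:c:]" "c \<noteq> 0" using is_unit_poly_iff[of f] f(1) by auto
      thus False using f by simp
    qed
    fix u v assume uv: "f = u * v"
    hence "poly (map_poly to_ac u) x = 0 \<or> poly (map_poly to_ac v) x = 0"
      using f by (simp add: to_ac_poly.hom_mult)
    thus "u dvd 1 \<or> v dvd 1" using unit[of u v] unit[of v u] uv by (auto simp: mult.commute)
  qed fact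
  thus ?thesis using that f by blast
qed

text \<open>Galois elements are represented on the whole algebraic closure, where extension and
  conjugation are available. Bijectivity is automatic by algebraicity, and
  \<open>galois_group_restrict\<close> and \<open>galois_group_extend\<close> pass to
  \<open>galois_group\<close> and back.\<close>

definition ac_hom :: "('k :: field alg_closure \<Rightarrow> 'k alg_closure) \<Rightarrow> bool" where
  "ac_hom \<sigma> \<longleftrightarrow> comm_ring_hom \<sigma> \<and> (\<forall>c. \<sigma> (to_ac c) = to_ac c)"

lemma ac_hom_comm_ring_hom: "ac_hom \<sigma> \<Longrightarrow> comm_ring_hom \<sigma>"
  by (simp add: ac_hom_def)

lemma ac_hom_to_ac: "ac_hom \<sigma> \<Longrightarrow> \<sigma> (to_ac c) = to_ac c"
  by (simp add: ac_hom_def)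

lemma ac_hom_poly:
  assumes "ac_hom \<sigma>"
  shows "\<sigma> (poly (map_poly to_ac p) x) = poly (map_poly to_ac p) (\<sigma> x)"
proof -
  interpret comm_ring_hom \<sigma> using assms by (rule ac_hom_comm_ring_hom)
  have "map_poly \<sigma> (map_poly to_ac p) = map_poly to_ac p"
    using ac_hom_to_ac[OF assms] by (simp add: map_poly_map_poly o_def)
  thus ?thesis by (metis poly_map_poly)
qed

lemma ac_hom_id: "ac_hom id"
proof -
  have "comm_ring_hom (id :: 'k :: field alg_closure \<Rightarrow> _)" by unfold_locales auto
  thus ?thesis by (simp add: ac_hom_def)
qed

lemma ac_hom_comp: "ac_hom \<sigma> \<Longrightarrow> ac_hom \<tau> \<Longrightarrow> ac_hom (\<sigma> \<circ> \<tau>)"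
proof -
  assume *: "ac_hom \<sigma>" "ac_hom \<tau>"
  interpret \<sigma>: comm_ring_hom \<sigma> using * by (simp add: ac_hom_def)
  interpret \<tau>: comm_ring_hom \<tau> using * by (simp add: ac_hom_def)
  have "comm_ring_hom (\<sigma> \<circ> \<tau>)"
    by unfold_locales (simp_all add: \<sigma>.hom_add \<tau>.hom_add \<sigma>.hom_mult \<tau>.hom_mult)
  thus ?thesis using * by (simp add: ac_hom_def)
qed

text \<open>Every element lies in the finite root set of some polynomial over the base, which the
  injective map sends into itself.\<close>

lemma ac_hom_bij:
  fixes \<sigma> :: "'k :: field alg_closure \<Rightarrow> 'k alg_closure"
  assumes "ac_hom \<sigma>"
  shows "bij \<sigma>"
proof -
  have inj: "inj \<sigma>" using assms by (intro comm_ring_hom_inj) (simp add: ac_hom_def)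
  have "y \<in> range \<sigma>" for y
  proof -
    obtain p :: "'k poly" where p: "p \<noteq> 0" "poly (map_poly to_ac p) y = 0"
      using alg_closure_algebraic .
    define Z where "Z = {x. poly (map_poly to_ac p) x = 0}"
    have "map_poly to_ac p \<noteq> 0" using p(1) by simp
    hence "finite Z" unfolding Z_def by (rule poly_roots_finite)
    moreover have "\<sigma> ` Z \<subseteq> Z"
      by (auto simp: Z_def simp flip: ac_hom_poly[OF assms])
         (simp add: comm_ring_hom_zero_iff[OF ac_hom_comm_ring_hom[OF assms]])
    moreover have "inj_on \<sigma> Z" using inj by (simp add: inj_on_def)
    ultimately have "\<sigma> ` Z = Z" by (rule endo_inj_surj)
    thus ?thesis using p by (auto simp: Z_def)
  qed
  thus ?thesis using inj by (auto simp: bij_def)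
qed

lemma ac_hom_inv:
  assumes "ac_hom \<sigma>"
  shows "ac_hom (inv_into UNIV \<sigma>)"
proof -
  interpret comm_ring_hom \<sigma> using assms by (rule ac_hom_comm_ring_hom)
  have bij: "bij \<sigma>" using assms by (rule ac_hom_bij)
  hence [simp]: "\<sigma> (inv_into UNIV \<sigma> x) = x" "inv_into UNIV \<sigma> (\<sigma> x) = x" for x
    by (auto simp: bij_def surj_f_inv_f)
  have eq: "inv_into UNIV \<sigma> x = y" if "\<sigma> y = x" for x y using that by auto
  have "comm_ring_hom (inv_into UNIV \<sigma>)"
    by unfold_locales (auto intro!: eq simp: hom_add hom_mult)
  thus ?thesis using assms by (auto simp: ac_hom_def intro!: eq)
qed

lemma ac_hom_extend:
  fixes R :: "('k :: field alg_closure \<times> 'k alg_closure) set"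
  assumes "ring_graph R" "\<And>c. (to_ac c, to_ac c) \<in> R"
  obtains \<sigma> where "ac_hom \<sigma>" "\<And>x y. (x, y) \<in> R \<Longrightarrow> \<sigma> x = y"
proof -
  have "\<exists>p. p \<noteq> 0 \<and> poly p x = 0 \<and> (\<forall>i. coeff p i \<in> fst ` R)" for x
  proof -
    obtain p :: "'k poly" where "p \<noteq> 0" "poly (map_poly to_ac p) x = 0"
      using alg_closure_algebraic .
    thus ?thesis using assms(2) by (intro exI[of _ "map_poly to_ac p"]) force
  qed
  from ring_graph_extend[OF assms(1) this] obtain h
    where h: "comm_ring_hom h" "\<And>x y. (x, y) \<in> R \<Longrightarrow> h x = y" by blast
  hence "ac_hom h" using assms(2) by (auto simp: ac_hom_def)
  thus ?thesis using that h by blast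
qed

text \<open>The assignment \<open>p(x) -> p(y)\<close> is a ring graph because divisibility by
  \<open>f\<close> decides vanishing at \<open>x\<close> and at \<open>y\<close> alike.\<close>

theorem ac_hom_conjugate:
  fixes f :: "'k :: field poly"
  assumes "irreducible f" "poly (map_poly to_ac f) x = 0" "poly (map_poly to_ac f) y = 0"
  obtains \<sigma> where "ac_hom \<sigma>" "\<sigma> x = y"
proof -
  define R where "R = {(poly (map_poly to_ac p) x, poly (map_poly to_ac p) y) | p. True}"
  have R: "(poly (map_poly to_ac p) x, poly (map_poly to_ac p) y) \<in> R" for p
    by (auto simp: R_def)
  have "ring_graph R"
  proof (rule ring_graphI)
    show "(1, 1) \<in> R" using R[of 1] by simp
  next
    fix a b a' b' assume "(a, b) \<in> R" "(a', b') \<in> R"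
    then obtain p p' where "a = poly (map_poly to_ac p) x" "b = poly (map_poly to_ac p) y"
      "a' = poly (map_poly to_ac p') x" "b' = poly (map_poly to_ac p') y" by (auto simp: R_def)
    thus "(a - a', b - b') \<in> R" "(a * a', b * b') \<in> R"
      using R[of "p - p'"] R[of "p * p'"] by (simp_all add: to_ac_poly.hom_minus to_ac_poly.hom_mult)
  next
    fix a b assume "(a, b) \<in> R"
    thus "a = 0 \<longleftrightarrow> b = 0"
      by (auto simp: R_def irreducible_root_dvd_iff[OF assms(1,2)] irreducible_root_dvd_iff[OF assms(1,3)])
  qed
  moreover have "(to_ac c, to_ac c) \<in> R" for c
  proof -
    have "map_poly to_ac [:c:] = [:to_ac c:]" by (rule poly_eqI) (simp add: coeff_map_poly coeff_pCons split: nat.split)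
    thus ?thesis using R[of "[:c:]"] by simp
  qed
  ultimately obtain \<sigma> where \<sigma>: "ac_hom \<sigma>" "\<And>a b. (a, b) \<in> R \<Longrightarrow> \<sigma> a = b"
    using ac_hom_extend by blast
  have "\<sigma> x = y" using \<sigma>(2) R[of "[:0, 1:]"] by (simp add: map_poly_pCons)
  thus ?thesis using that \<sigma>(1) by blast
qed

section \<open>The separable closure\<close>

text \<open>The witness need not be irreducible: a simple root of a polynomial is also a simple root
  of its irreducible factor that vanishes there.\<close>

lemma sep_closure_iff:
  fixes x :: "'k :: field alg_closure"
  shows "x \<in> sep_closure \<longleftrightarrow>
    (\<exists>f :: 'k poly. poly (map_poly to_ac f) x = 0 \<and> poly (map_poly to_ac (pderiv f)) x \<noteq> 0)"
proof
  assume "x \<in> sep_closure"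
  then obtain f :: "'k poly" where f: "irreducible f" "coprime f (pderiv f)" "poly (map_poly to_ac f) x = 0"
    by (auto simp: sep_closure_def)
  have "\<not> f dvd pderiv f" using f(1,2) by (meson coprime_absorb_left irreducible_not_unit)
  thus "\<exists>f :: 'k poly. poly (map_poly to_ac f) x = 0 \<and> poly (map_poly to_ac (pderiv f)) x \<noteq> 0"
    using irreducible_root_dvd_iff[OF f(1,3)] f(3) by blast
next
  assume "\<exists>f :: 'k poly. poly (map_poly to_ac f) x = 0 \<and> poly (map_poly to_ac (pderiv f)) x \<noteq> 0"
  then obtain s :: "'k poly" where s: "poly (map_poly to_ac s) x = 0" "poly (map_poly to_ac (pderiv s)) x \<noteq> 0"
    by blast
  obtain f :: "'k poly" where f: "irreducible f" "poly (map_poly to_ac f) x = 0"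
    by (rule irreducible_root_exists)
  obtain u where u: "s = f * u" using s irreducible_root_dvd_iff[OF f] by blast
  have "poly (map_poly to_ac (pderiv f)) x \<noteq> 0"
    using s(2) f(2) unfolding u pderiv_mult to_ac_poly.hom_add to_ac_poly.hom_mult by auto
  hence ndvd: "\<not> f dvd pderiv f" using irreducible_root_dvd_iff[OF f] by simp
  have "coprime f (pderiv f)"
  proof (rule coprimeI)
    fix c assume c: "c dvd f" "c dvd pderiv f"
    then obtain v where v: "f = c * v" by blast
    hence "c dvd 1 \<or> v dvd 1" by (rule irreducibleD[OF f(1)])
    thus "c dvd 1"
    proof
      assume "v dvd 1"
      hence "f dvd c" unfolding v by (simp add: mult_unit_dvd_iff)
      thus ?thesis using c ndvd dvd_trans by blast
    qed
  qed
  thus "x \<in> sep_closure" using f by (auto simp: sep_closure_def)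
qed

lemma to_ac_in_sep_closure: "to_ac c \<in> sep_closure"
  unfolding sep_closure_iff by (rule exI[of _ "[:-c, 1:]"]) (simp add: pderiv_pCons)

lemma sep_closure_ac_hom:
  assumes "ac_hom \<sigma>"
  shows "\<sigma> x \<in> sep_closure \<longleftrightarrow> x \<in> sep_closure"
  unfolding sep_closure_iff
  by (simp add: comm_ring_hom_zero_iff[OF ac_hom_comm_ring_hom[OF assms]] flip: ac_hom_poly[OF assms])

text \<open>A separable irreducible polynomial has as many roots as its degree, and all of them are
  conjugate. A fixed root is therefore the only one, and the degree is 1.\<close>

lemma sep_closure_fixed:
  fixes x :: "'k :: field alg_closure"
  assumes "x \<in> sep_closure" and fixed: "\<And>\<sigma>. ac_hom \<sigma> \<Longrightarrow> \<sigma> x = x"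
  shows "x \<in> range to_ac"
proof -
  obtain f :: "'k poly" where f: "irreducible f" "coprime f (pderiv f)" "poly (map_poly to_ac f) x = 0"
    using assms(1) by (auto simp: sep_closure_def)
  have "\<not> f dvd pderiv f" using f(1,2) by (meson coprime_absorb_left irreducible_not_unit)
  hence sep: "poly (pderiv (map_poly to_ac f)) y \<noteq> 0" if "poly (map_poly to_ac f) y = 0" for y
    using irreducible_root_dvd_iff[OF f(1) that] by (simp flip: to_ac.map_poly_pderiv)
  have "f \<noteq> 0" using f(1) by auto
  hence "card {y. poly (map_poly to_ac f) y = 0} = degree (map_poly to_ac f)"
    by (intro card_roots_eq_degree sep) auto
  moreover have "{y. poly (map_poly to_ac f) y = 0} = {x}"
    using f fixed ac_hom_conjugate[OF f(1,3)] by (metis (mono_tags, lifting) Collect_cong singleton_conv)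
  ultimately have "degree f = 1" by simp
  then obtain a b where "f = [:a, b:]" "b \<noteq> 0" by (metis degree1_coeffs)
  hence "x = to_ac (- a / b)" using f(3)
    by (simp add: field_simps) (metis add.commute add_eq_0_iff)
  thus ?thesis by blast
qed

lemma poly_eq_sum_atMost:
  fixes p :: "'b :: comm_semiring_1 poly"
  assumes "degree p \<le> n"
  shows "poly p x = (\<Sum>i\<le>n. coeff p i * x ^ i)"
proof -
  have "(\<Sum>i\<le>degree p. coeff p i * x ^ i) = (\<Sum>i\<le>n. coeff p i * x ^ i)"
    by (rule sum.mono_neutral_left) (use assms in \<open>auto simp: coeff_eq_0\<close>)
  thus ?thesis by (simp add: poly_altdef)
qed

section \<open>Sums and products of separable elements\<close>

interpretation ac_space: vector_space "\<lambda>(c :: 'k :: field) (x :: 'k alg_closure). to_ac c * x"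
  by unfold_locales (simp_all add: algebra_simps)

context
  fixes w :: "'k :: field alg_closure"
begin

lemma poly_in_span_powers:
  assumes "degree h \<le> e"
  shows "poly (map_poly to_ac h) w \<in> ac_space.span ((\<lambda>i. w ^ i) ` {..e})"
proof -
  have "poly (map_poly to_ac h) w = (\<Sum>i\<le>e. to_ac (coeff h i) * w ^ i)"
    using assms by (simp add: poly_eq_sum_atMost[of _ e])
  also have "\<dots> \<in> ac_space.span ((\<lambda>i. w ^ i) ` {..e})"
    by (intro ac_space.span_sum ac_space.span_scale ac_space.span_base) auto
  finally show ?thesis .
qed

lemma powers_independent_iff:
  "inj_on (\<lambda>i. w ^ i) {..e} \<and> ac_space.independent ((\<lambda>i. w ^ i) ` {..e}) \<longleftrightarrow>
   (\<forall>h. h \<noteq> 0 \<longrightarrow> degree h \<le> e \<longrightarrow> poly (map_poly to_ac h) w \<noteq> 0)"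
proof (intro iffI conjI allI impI notI; (elim conjE)?)
  assume *: "\<forall>h. h \<noteq> 0 \<longrightarrow> degree h \<le> e \<longrightarrow> poly (map_poly to_ac h) w \<noteq> 0"
  show inj: "inj_on (\<lambda>i. w ^ i) {..e}"
  proof (rule inj_onI, rule ccontr)
    fix i j assume ij: "i \<in> {..e}" "j \<in> {..e}" "w ^ i = w ^ j" "i \<noteq> j"
    define h :: "'k poly" where "h = monom 1 i - monom 1 j"
    have "coeff h i = 1" using ij by (simp add: h_def)
    hence "h \<noteq> 0" by auto
    moreover have "degree h \<le> e" unfolding h_def using ij
      by (intro degree_diff_le) (auto intro: order.trans[OF degree_monom_le])
    moreover have "poly (map_poly to_ac h) w = 0"
      using ij by (simp add: h_def to_ac_poly.hom_minus map_poly_monom poly_monom)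
    ultimately show False using * by blast
  qed
  assume "ac_space.dependent ((\<lambda>i. w ^ i) ` {..e})"
  then obtain u where u: "\<exists>v\<in>(\<lambda>i. w ^ i) ` {..e}. u v \<noteq> 0"
    "(\<Sum>v\<in>(\<lambda>i. w ^ i) ` {..e}. to_ac (u v) * v) = 0"
    by (subst (asm) ac_space.dependent_finite) auto
  define h where "h = (\<Sum>i\<le>e. monom (u (w ^ i)) i)"
  have coeff: "coeff h i = (if i \<le> e then u (w ^ i) else 0)" for i
    by (auto simp: h_def coeff_sum)
  have "h \<noteq> 0" using u(1) coeff by (metis (no_types, lifting) atMost_iff coeff_0 imageE)
  moreover have "degree h \<le> e" by (rule degree_le) (simp add: coeff)
  moreover have "poly (map_poly to_ac h) w = 0"
    using u(2) inj by (simp add: h_def to_ac_poly.hom_sum map_poly_monom poly_sum poly_monom sum.reindex)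
  ultimately show False using * by blast
next
  fix h :: "'k poly"
  assume inj: "inj_on (\<lambda>i. w ^ i) {..e}" and ind: "ac_space.independent ((\<lambda>i. w ^ i) ` {..e})"
    and h: "h \<noteq> 0" "degree h \<le> e" "poly (map_poly to_ac h) w = 0"
  define u where "u v = coeff h (the_inv_into {..e} (\<lambda>i. w ^ i) v)" for v
  have u: "u (w ^ i) = coeff h i" if "i \<le> e" for i
    using that inj by (simp add: u_def the_inv_into_f_f)
  have "poly (map_poly to_ac h) w = (\<Sum>i\<le>e. to_ac (coeff h i) * w ^ i)"
    using h(2) by (simp add: poly_eq_sum_atMost[of _ e])
  also have "\<dots> = (\<Sum>v\<in>(\<lambda>i. w ^ i) ` {..e}. to_ac (u v) * v)"
    using inj by (simp add: sum.reindex u)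
  finally have "(\<Sum>v\<in>(\<lambda>i. w ^ i) ` {..e}. to_ac (u v) * v) = 0" using h by simp
  moreover have "\<exists>v\<in>(\<lambda>i. w ^ i) ` {..e}. u v \<noteq> 0"
    using h(1,2) u by (intro bexI[of _ "w ^ degree h"]) auto
  ultimately have "ac_space.dependent ((\<lambda>i. w ^ i) ` {..e})"
    by (subst ac_space.dependent_finite) auto
  thus False using ind by simp
qed

end

lemma span_mult:
  fixes a b :: "'k :: field alg_closure"
  assumes "a \<in> ac_space.span A" "b \<in> ac_space.span B"
  shows "a * b \<in> ac_space.span {u * v | u v. u \<in> A \<and> v \<in> B}"
  using assms(1)
proof (induction rule: ac_space.span_induct_alt)
  case base
  show ?case by (simp add: ac_space.span_zero)
next
  case (step c x y)
  from assms(2) have "x * b \<in> ac_space.span {u * v | u v. u \<in> A \<and> v \<in> B}"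
  proof (induction rule: ac_space.span_induct_alt)
    case base
    show ?case by (simp add: ac_space.span_zero)
  next
    case (step d x' y')
    have "x * x' \<in> ac_space.span {u * v | u v. u \<in> A \<and> v \<in> B}"
      using step \<open>x \<in> A\<close> by (intro ac_space.span_base) blast
    from ac_space.span_add[OF ac_space.span_scale[OF this, of d] step(2)]
    show ?case by (simp add: algebra_simps)
  qed
  from ac_space.span_add[OF ac_space.span_scale[OF this, of c] step(2)]
  show ?case by (simp add: algebra_simps)
qed

context
  fixes p :: nat
  defines "p \<equiv> CHAR('k :: field)"
  assumes prime: "prime p"
begin

lemma ac_frobenius_add: "(x + y :: 'k alg_closure) ^ p = x ^ p + y ^ p"
  using prime unfolding p_def by (intro freshmans_dream) simp_all

lemma ac_frobenius_inj:
  assumes "(x :: 'k alg_closure) ^ p = y ^ p"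
  shows "x = y"
proof -
  have "(x - y) ^ p + y ^ p = x ^ p" using ac_frobenius_add[of "x - y" y] by simp
  thus ?thesis using assms by simp
qed

lemma ac_frobenius_span:
  assumes "(x :: 'k alg_closure) \<in> ac_space.span A"
  shows "x ^ p \<in> ac_space.span ((\<lambda>a. a ^ p) ` A)"
  using assms
proof (induction rule: ac_space.span_induct_alt)
  case base
  show ?case using prime by (simp add: ac_space.span_zero prime_gt_0_nat power_0_left)
next
  case (step c x y)
  have "x ^ p \<in> ac_space.span ((\<lambda>a. a ^ p) ` A)"
    using step by (intro ac_space.span_base) blast
  from ac_space.span_add[OF ac_space.span_scale[OF this, of "c ^ p"] step(2)]
  show ?case by (simp add: ac_frobenius_add power_mult_distrib)
qed

text \<open>Dimension count: if the \<open>p\<close>-th powers were dependent, fewer than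
  \<open>card B\<close> of them would span the independent set \<open>B\<close>.\<close>

lemma ac_frobenius_independent:
  fixes B :: "'k alg_closure set"
  assumes "finite B" "ac_space.independent B" "B \<subseteq> ac_space.span ((\<lambda>b. b ^ p) ` B)"
  shows "ac_space.independent ((\<lambda>b. b ^ p) ` B)"
proof
  let ?C = "(\<lambda>b. b ^ p) ` B"
  assume "ac_space.dependent ?C"
  then obtain a where a: "a \<in> ?C" "a \<in> ac_space.span (?C - {a})"
    unfolding ac_space.dependent_def by blast
  hence "ac_space.span ?C = ac_space.span (?C - {a})"
    by (metis ac_space.span_redundant insert_Diff)
  hence "card B \<le> card (?C - {a})"
    using assms ac_space.independent_span_bound[of "?C - {a}" B] by auto
  also have "\<dots> < card ?C" using a assms(1) by (intro psubset_card_mono) auto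
  also have "card ?C \<le> card B" using assms(1) by (rule card_image_le)
  finally show False by simp
qed

text \<open>In field terms k(x) = k(x^p). Frobenius is injective, so \<open>x ^ p\<close> has as
  many conjugates as \<open>x\<close>; hence as many of its powers are independent, and they fill
  the same finite-dimensional space.\<close>

lemma separable_power_in_span:
  fixes x :: "'k alg_closure"
  assumes "x \<in> sep_closure"
  shows "\<exists>e. (\<forall>k. x ^ k \<in> ac_space.span ((\<lambda>i. x ^ i) ` {..e})) \<and>
             (\<forall>k. x ^ k \<in> ac_space.span ((\<lambda>i. (x ^ i) ^ p) ` {..e}))"
proof -
  obtain f :: "'k poly" where f: "irreducible f" "coprime f (pderiv f)" "poly (map_poly to_ac f) x = 0"
    using assms(1) by (auto simp: sep_closure_def)
  define d where "d = degree f"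
  have "f \<noteq> 0" "\<not> f dvd 1" using f(1) by (auto simp: irreducible_def)
  hence "d > 0" by (simp add: d_def is_unit_iff_degree)
  have "\<not> f dvd pderiv f" using f(1,2) by (meson coprime_absorb_left irreducible_not_unit)
  hence sep: "poly (pderiv (map_poly to_ac f)) y \<noteq> 0" if "poly (map_poly to_ac f) y = 0" for y
    using irreducible_root_dvd_iff[OF f(1) that] by (simp flip: to_ac.map_poly_pderiv)
  have roots: "card {y. poly (map_poly to_ac f) y = 0} = d"
    unfolding d_def using card_roots_eq_degree[of "map_poly to_ac f", OF _ sep] \<open>f \<noteq> 0\<close> by simp
  have nz1: "poly (map_poly to_ac h) x \<noteq> 0" if "h \<noteq> 0" "degree h \<le> d - 1" for h
    using that \<open>d > 0\<close> unfolding irreducible_root_dvd_iff[OF f(1,3)] d_def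
    by (metis Suc_pred' divides_degree le_imp_less_Suc linorder_not_less)
  have nz2: "poly (map_poly to_ac h) (x ^ p) \<noteq> 0" if "h \<noteq> 0" "degree h \<le> d - 1" for h
  proof
    assume h: "poly (map_poly to_ac h) (x ^ p) = 0"
    have "poly (map_poly to_ac h) (y ^ p) = 0" if y: "poly (map_poly to_ac f) y = 0" for y
    proof -
      obtain \<sigma> where \<sigma>: "ac_hom \<sigma>" "\<sigma> x = y" using ac_hom_conjugate[OF f(1,3) y] .
      interpret \<sigma>: comm_ring_hom \<sigma> using \<sigma>(1) by (rule ac_hom_comm_ring_hom)
      have "\<sigma> (poly (map_poly to_ac h) (x ^ p)) = poly (map_poly to_ac h) (y ^ p)"
        using \<sigma> by (simp add: ac_hom_poly \<sigma>.hom_power)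
      thus ?thesis using h by simp
    qed
    hence "(\<lambda>y. y ^ p) ` {y. poly (map_poly to_ac f) y = 0} \<subseteq> {z. poly (map_poly to_ac h) z = 0}"
      by auto
    hence "card ((\<lambda>y. y ^ p) ` {y. poly (map_poly to_ac f) y = 0}) \<le> card {z. poly (map_poly to_ac h) z = 0}"
      using that by (intro card_mono poly_roots_finite) auto
    also have "\<dots> \<le> degree h" using that card_poly_roots_bound[of "map_poly to_ac h"] by simp
    finally show False
      using roots that \<open>d > 0\<close> by (subst (asm) card_image) (auto intro: inj_onI ac_frobenius_inj)
  qed
  define S T where "S = (\<lambda>i. x ^ i) ` {..d - 1}" and "T = (\<lambda>i. (x ^ p) ^ i) ` {..d - 1}"
  have S: "inj_on (\<lambda>i. x ^ i) {..d - 1}" "ac_space.independent S"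
    using powers_independent_iff[of x "d - 1"] nz1 unfolding S_def by blast+
  have T: "inj_on (\<lambda>i. (x ^ p) ^ i) {..d - 1}" "ac_space.independent T"
    using powers_independent_iff[of "x ^ p" "d - 1"] nz2 unfolding T_def by blast+
  have x_S: "x ^ k \<in> ac_space.span S" for k
  proof -
    have "poly (map_poly to_ac (f * (monom 1 k div f) + monom 1 k mod f)) x = x ^ k"
      by (simp add: map_poly_monom poly_monom)
    hence "x ^ k = poly (map_poly to_ac (monom 1 k mod f)) x"
      using f(3) unfolding to_ac_poly.hom_add to_ac_poly.hom_mult by simp
    moreover have "degree (monom 1 k mod f) \<le> d - 1"
      using degree_mod_less'[of f "monom 1 k"] \<open>f \<noteq> 0\<close> unfolding d_def by fastforce
    ultimately show ?thesis unfolding S_def using poly_in_span_powers by metis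
  qed
  have TS: "T \<subseteq> ac_space.span S" using x_S by (auto simp: T_def simp flip: power_mult)
  obtain B where B: "T \<subseteq> B" "B \<subseteq> ac_space.span S" "ac_space.independent B" "ac_space.span S \<subseteq> ac_space.span B"
    using ac_space.maximal_independent_subset_extend[OF TS T(2)] by blast
  have "finite S" "finite T" "card S = d" "card T = d"
    using S T \<open>d > 0\<close> by (auto simp: S_def T_def card_image)
  moreover from this have "finite B" "card B \<le> card S"
    using ac_space.independent_span_bound[of S B] B by auto
  ultimately have "T = B" using B(1) by (intro card_subset_eq) (auto simp: card_mono dest: card_mono)
  hence "x ^ k \<in> ac_space.span T" for k using x_S B by blast
  moreover have "T = (\<lambda>i. (x ^ i) ^ p) ` {..d - 1}"
    by (auto simp: T_def mult.commute simp flip: power_mult)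
  ultimately show ?thesis using x_S unfolding S_def by blast
qed

text \<open>The algebra k[x,y] is finite-dimensional and spanned by \<open>p\<close>-th powers of
  its monomials, so Frobenius keeps independent families in it independent. An inseparable
  \<open>z\<close> would contradict this: \<open>z ^ p\<close> satisfies a relation of a degree for
  which the powers of \<open>z\<close> satisfy none.\<close>

lemma separable_in_span:
  fixes x y z :: "'k alg_closure"
  assumes "x \<in> sep_closure" "y \<in> sep_closure"
    and z: "z \<in> ac_space.span {x ^ i * y ^ j | i j. True}"
  shows "z \<in> sep_closure"
proof (rule ccontr)
  assume insep: "z \<notin> sep_closure"
  define M where "M = {x ^ i * y ^ j | i j. True}"
  obtain d where d: "\<And>k. x ^ k \<in> ac_space.span ((\<lambda>i. x ^ i) ` {..d})"
    "\<And>k. x ^ k \<in> ac_space.span ((\<lambda>i. (x ^ i) ^ p) ` {..d})"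
    using separable_power_in_span[OF assms(1)] by blast
  obtain e where e: "\<And>k. y ^ k \<in> ac_space.span ((\<lambda>i. y ^ i) ` {..e})"
    "\<And>k. y ^ k \<in> ac_space.span ((\<lambda>i. (y ^ i) ^ p) ` {..e})"
    using separable_power_in_span[OF assms(2)] by blast
  define M0 where "M0 = (\<lambda>(i, j). x ^ i * y ^ j) ` ({..d} \<times> {..e})"
  have "m \<in> ac_space.span M0" if m: "m \<in> M" for m
  proof -
    obtain k l where "m = x ^ k * y ^ l" using m by (auto simp: M_def)
    hence "m \<in> ac_space.span {u * v | u v. u \<in> (\<lambda>i. x ^ i) ` {..d} \<and> v \<in> (\<lambda>i. y ^ i) ` {..e}}"
      using span_mult[OF d(1) e(1)] by simp
    also have "{u * v | u v. u \<in> (\<lambda>i. x ^ i) ` {..d} \<and> v \<in> (\<lambda>i. y ^ i) ` {..e}} = M0"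
      by (force simp: M0_def)
    finally show ?thesis .
  qed
  hence M_M0: "ac_space.span M \<subseteq> ac_space.span M0"
    by (intro ac_space.span_minimal) auto
  have M_Mp: "M \<subseteq> ac_space.span ((\<lambda>m. m ^ p) ` M)"
  proof
    fix m assume "m \<in> M"
    then obtain k l where "m = x ^ k * y ^ l" by (auto simp: M_def)
    hence "m \<in> ac_space.span {u * v | u v. u \<in> (\<lambda>i. (x ^ i) ^ p) ` {..d} \<and> v \<in> (\<lambda>i. (y ^ i) ^ p) ` {..e}}"
      using span_mult[OF d(2) e(2)] by simp
    also have "\<dots> \<subseteq> ac_space.span ((\<lambda>m. m ^ p) ` M)"
    proof (rule ac_space.span_mono, safe)
      fix i j
      have "(x ^ i * y ^ j) ^ p \<in> (\<lambda>m. m ^ p) ` M" by (auto simp: M_def)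
      thus "(x ^ i) ^ p * (y ^ j) ^ p \<in> (\<lambda>m. m ^ p) ` M" by (simp add: power_mult_distrib)
    qed
    finally show "m \<in> ac_space.span ((\<lambda>m. m ^ p) ` M)" .
  qed
  have z_pow: "z ^ k \<in> ac_space.span M" for k
  proof (induction k)
    case 0
    have "x ^ 0 * y ^ 0 \<in> M" unfolding M_def by blast
    thus ?case by (simp add: ac_space.span_base)
  next
    case (Suc k)
    have "{u * v | u v. u \<in> M \<and> v \<in> M} \<subseteq> M"
    proof safe
      fix u v assume "u \<in> M" "v \<in> M"
      then obtain i j i' j' where "u = x ^ i * y ^ j" "v = x ^ i' * y ^ j'" by (auto simp: M_def)
      hence "u * v = x ^ (i + i') * y ^ (j + j')" by (simp add: power_add)
      thus "u * v \<in> M" by (auto simp: M_def)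
    qed
    hence "ac_space.span {u * v | u v. u \<in> M \<and> v \<in> M} \<subseteq> ac_space.span M" by (rule ac_space.span_mono)
    thus ?case using span_mult[OF z[folded M_def] Suc] by auto
  qed
  obtain f :: "'k poly" where f: "irreducible f" "poly (map_poly to_ac f) z = 0"
    by (rule irreducible_root_exists)
  have "f \<noteq> 0" "\<not> f dvd 1" using f(1) by (auto simp: irreducible_def)
  hence deg: "degree f > 0" by (simp add: is_unit_iff_degree)
  have "f dvd pderiv f"
    using insep f irreducible_root_dvd_iff[OF f] unfolding sep_closure_iff by blast
  moreover have "degree (pderiv f) < degree f"
    using degree_pderiv_le[of f] deg by linarith
  ultimately have "pderiv f = 0" by (meson divides_degree linorder_not_less)
  have p_dvd: "p dvd i" if "coeff f i \<noteq> 0" for i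
  proof (cases i)
    case (Suc j)
    have "coeff (pderiv f) j = 0" using \<open>pderiv f = 0\<close> by simp
    hence "(of_nat (Suc j) :: 'k) = 0" using that Suc by (simp add: coeff_pderiv del: of_nat_Suc)
    thus ?thesis unfolding p_def Suc by (simp add: of_nat_eq_0_iff_char_dvd del: of_nat_Suc)
  qed simp
  define n where "n = degree f div p"
  have n: "degree f = p * n" using p_dvd[of "degree f"] \<open>f \<noteq> 0\<close> by (simp add: n_def)
  have "p > 1" using prime by (rule prime_gt_1_nat)
  hence "n < degree f" using n deg by simp
  \<comment> \<open>Only multiples of \<open>p\<close> occur as exponents in \<open>f\<close>, so
    f(X) = h(X^p). Thus \<open>z ^ p\<close> is a root of \<open>h\<close>, whose degree is at most
    \<open>n < degree f\<close>.\<close>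
  define h where "h = (\<Sum>i\<le>n. monom (coeff f (p * i)) i)"
  have coeff_h: "coeff h i = (if i \<le> n then coeff f (p * i) else 0)" for i
    by (auto simp: h_def coeff_sum)
  have "coeff h n \<noteq> 0" using n \<open>f \<noteq> 0\<close> by (simp add: coeff_h flip: n)
  hence "h \<noteq> 0" by auto
  have "degree h \<le> n" by (rule degree_le) (simp add: coeff_h)
  have "poly (map_poly to_ac h) (z ^ p) = (\<Sum>i\<le>n. to_ac (coeff f (p * i)) * z ^ (p * i))"
    by (simp add: h_def to_ac_poly.hom_sum map_poly_monom poly_sum poly_monom power_mult)
  also have "\<dots> = (\<Sum>i\<in>(\<lambda>i. p * i) ` {..n}. to_ac (coeff f i) * z ^ i)"
    using \<open>p > 1\<close> by (subst sum.reindex) (auto intro: inj_onI)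
  also have "\<dots> = (\<Sum>i\<le>degree f. to_ac (coeff f i) * z ^ i)"
  proof (rule sum.mono_neutral_left)
    show "\<forall>i\<in>{..degree f} - (\<lambda>i. p * i) ` {..n}. to_ac (coeff f i) * z ^ i = 0"
    proof
      fix i assume i: "i \<in> {..degree f} - (\<lambda>i. p * i) ` {..n}"
      have "\<not> p dvd i"
      proof
        assume "p dvd i"
        then obtain j where "i = p * j" by blast
        thus False using i n \<open>p > 1\<close> by auto
      qed
      thus "to_ac (coeff f i) * z ^ i = 0" using p_dvd by auto
    qed
  qed (auto simp: n)
  also have "\<dots> = poly (map_poly to_ac f) z" by (simp add: poly_altdef)
  finally have h: "poly (map_poly to_ac h) (z ^ p) = 0" using f by simp
  have "\<forall>h. h \<noteq> 0 \<longrightarrow> degree h \<le> n \<longrightarrow> poly (map_poly to_ac h) z \<noteq> 0"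
    unfolding irreducible_root_dvd_iff[OF f] using \<open>n < degree f\<close>
    by (metis divides_degree le_less_trans linorder_not_less)
  hence inj: "inj_on (\<lambda>i. z ^ i) {..n}" and ind: "ac_space.independent ((\<lambda>i. z ^ i) ` {..n})"
    unfolding powers_independent_iff[symmetric] by auto
  have "(\<lambda>i. z ^ i) ` {..n} \<subseteq> ac_space.span M" using z_pow by blast
  from ac_space.maximal_independent_subset_extend[OF this ind] obtain B
    where B: "(\<lambda>i. z ^ i) ` {..n} \<subseteq> B" "B \<subseteq> ac_space.span M" "ac_space.independent B" "ac_space.span M \<subseteq> ac_space.span B"
    by blast
  have "finite M0" by (simp add: M0_def)
  moreover have "B \<subseteq> ac_space.span M0" using B(2) M_M0 by blast
  ultimately have "finite B" using ac_space.independent_span_bound B(3) by blast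
  have "m ^ p \<in> ac_space.span ((\<lambda>b. b ^ p) ` B)" if "m \<in> M" for m
    using ac_frobenius_span[of m B] B(4) that ac_space.span_base by blast
  hence "ac_space.span ((\<lambda>m. m ^ p) ` M) \<subseteq> ac_space.span ((\<lambda>b. b ^ p) ` B)"
    by (intro ac_space.span_minimal) auto
  hence "ac_space.span M \<subseteq> ac_space.span ((\<lambda>b. b ^ p) ` B)"
    using M_Mp by (intro ac_space.span_minimal) auto
  hence ind': "ac_space.independent ((\<lambda>b. b ^ p) ` B)"
    using \<open>finite B\<close> B by (intro ac_frobenius_independent) auto
  have eq: "(\<lambda>i. (z ^ p) ^ i) ` {..n} = (\<lambda>b. b ^ p) ` (\<lambda>i. z ^ i) ` {..n}"
    by (simp add: image_image mult.commute flip: power_mult)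
  have "ac_space.independent ((\<lambda>i. (z ^ p) ^ i) ` {..n})"
    unfolding eq using B(1) by (intro ac_space.independent_mono[OF ind']) auto
  moreover have "inj_on (\<lambda>i. (z ^ p) ^ i) {..n}"
  proof (rule inj_onI)
    fix i j assume ij: "i \<in> {..n}" "j \<in> {..n}" "(z ^ p) ^ i = (z ^ p) ^ j"
    hence "(z ^ i) ^ p = (z ^ j) ^ p" by (metis mult.commute power_mult)
    thus "i = j" using ij inj by (auto dest: ac_frobenius_inj simp: inj_on_def)
  qed
  ultimately show False
    using powers_independent_iff[of "z ^ p" n] \<open>h \<noteq> 0\<close> \<open>degree h \<le> n\<close> h by blast
qed

lemma sep_closure_diff:
  fixes x y :: "'k alg_closure"
  assumes "x \<in> sep_closure" "y \<in> sep_closure"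
  shows "x - y \<in> sep_closure"
proof (rule separable_in_span[OF assms])
  have "x ^ 1 * y ^ 0 \<in> {x ^ i * y ^ j | i j. True}" "x ^ 0 * y ^ 1 \<in> {x ^ i * y ^ j | i j. True}"
    by blast+
  thus "x - y \<in> ac_space.span {x ^ i * y ^ j | i j. True}"
    by (intro ac_space.span_diff ac_space.span_base) auto
qed

lemma sep_closure_mult:
  fixes x y :: "'k alg_closure"
  assumes "x \<in> sep_closure" "y \<in> sep_closure"
  shows "x * y \<in> sep_closure"
proof (rule separable_in_span[OF assms])
  have "x ^ 1 * y ^ 1 \<in> {x ^ i * y ^ j | i j. True}" by blast
  thus "x * y \<in> ac_space.span {x ^ i * y ^ j | i j. True}"
    by (intro ac_space.span_base) auto
qed

lemma sep_closure_0: "(0 :: 'k alg_closure) \<in> sep_closure"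
  using to_ac_in_sep_closure[of 0] by simp

lemma sep_closure_1: "(1 :: 'k alg_closure) \<in> sep_closure"
  using to_ac_in_sep_closure[of 1] by simp

lemma sep_closure_uminus: "(x :: 'k alg_closure) \<in> sep_closure \<Longrightarrow> - x \<in> sep_closure"
  using sep_closure_diff[OF sep_closure_0] by force

lemma sep_closure_add:
  "(x :: 'k alg_closure) \<in> sep_closure \<Longrightarrow> y \<in> sep_closure \<Longrightarrow> x + y \<in> sep_closure"
  using sep_closure_diff[OF _ sep_closure_uminus] by fastforce

lemma galois_group_restrict:
  fixes \<sigma> :: "'k alg_closure \<Rightarrow> 'k alg_closure"
  assumes "ac_hom \<sigma>"
  shows "restrict \<sigma> sep_closure \<in> galois_group"
proof -
  interpret comm_ring_hom \<sigma> using assms by (rule ac_hom_comm_ring_hom)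
  have "bij \<sigma>" by (rule ac_hom_bij) fact
  hence "bij_betw \<sigma> sep_closure sep_closure"
    using sep_closure_ac_hom[OF assms]
    by (intro bij_betwI') (auto simp: bij_def inj_eq, metis surj_def)
  hence "bij_betw (restrict \<sigma> sep_closure) sep_closure sep_closure" by simp
  thus ?thesis unfolding galois_group_def
    by (auto simp: sep_closure_add sep_closure_mult hom_add hom_mult to_ac_in_sep_closure
        ac_hom_to_ac[OF assms])
qed

lemma galois_group_extend:
  fixes \<sigma> :: "'k alg_closure \<Rightarrow> 'k alg_closure"
  assumes "\<sigma> \<in> galois_group"
  obtains \<tau> where "ac_hom \<tau>" "\<And>x. x \<in> sep_closure \<Longrightarrow> \<tau> x = \<sigma> x"
proof -
  define R where "R = {(x, \<sigma> x) | x. x \<in> sep_closure}"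
  have inj: "inj_on \<sigma> sep_closure"
    using assms by (auto simp: galois_group_def bij_betw_def)
  have add: "\<sigma> (x + y) = \<sigma> x + \<sigma> y" and mult: "\<sigma> (x * y) = \<sigma> x * \<sigma> y"
    if "x \<in> sep_closure" "y \<in> sep_closure" for x y
    using assms that by (auto simp: galois_group_def)
  have const: "\<sigma> (to_ac c) = to_ac c" for c using assms by (simp add: galois_group_def)
  have diff: "\<sigma> (x - y) = \<sigma> x - \<sigma> y" if "x \<in> sep_closure" "y \<in> sep_closure" for x y
    using add[of "x - y" y] that sep_closure_diff by auto
  have "ring_graph R"
  proof (rule ring_graphI)
    show "(1, 1) \<in> R" using const[of 1] sep_closure_1 by (force simp: R_def)
  next
    fix a b a' b' assume "(a, b) \<in> R" "(a', b') \<in> R"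
    thus "(a - a', b - b') \<in> R" "(a * a', b * b') \<in> R"
      using diff mult sep_closure_diff sep_closure_mult by (force simp: R_def)+
  next
    fix a b assume "(a, b) \<in> R"
    thus "a = 0 \<longleftrightarrow> b = 0"
      using const[of 0] inj_on_eq_iff[OF inj, of a 0] sep_closure_0 by (auto simp: R_def)
  qed
  moreover have "(to_ac c, to_ac c) \<in> R" for c
    using const[of c] to_ac_in_sep_closure[of c] by (force simp: R_def)
  ultimately obtain \<tau> where "ac_hom \<tau>" "\<And>x y. (x, y) \<in> R \<Longrightarrow> \<tau> x = y"
    using ac_hom_extend by blast
  thus ?thesis using that by (auto simp: R_def)
qed

end

section \<open>Polynomials over integral domains\<close>

lemma fract_poly_clear_denominators:
  fixes G :: "'a :: idom fract poly"
  obtains c g where "c \<noteq> 0" "smult (to_fract c) G = fract_poly g"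
proof -
  have "\<exists>c g. c \<noteq> 0 \<and> smult (to_fract c) G = fract_poly g"
  proof (induction G)
    case (pCons x G)
    then obtain c g where cg: "c \<noteq> 0" "smult (to_fract c) G = fract_poly g" by blast
    obtain a b where x: "x = Fract a b" "b \<noteq> 0" by (cases x)
    have "smult (to_fract (b * c)) (pCons x G) = fract_poly (pCons (c * a) (smult b g))"
    proof (rule poly_eqI)
      fix n
      have "to_fract c * coeff G i = to_fract (coeff g i)" for i
        using arg_cong[OF cg(2), of "\<lambda>p. coeff p i"] by (simp add: coeff_map_poly)
      thus "coeff (smult (to_fract (b * c)) (pCons x G)) n =
          coeff (fract_poly (pCons (c * a) (smult b g))) n"
        using x(2) by (cases n) (simp_all add: x(1) Fract_conv_to_fract coeff_map_poly mult.assoc)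
    qed
    thus ?case using cg x by (metis mult_eq_0_iff)
  qed (auto intro: exI[of _ 1] exI[of _ 0])
  thus ?thesis using that by blast
qed

lemma factor_cancel_prime_power:
  fixes f g h :: "'a :: idom poly"
  assumes "prime_elem \<pi>" "smult (\<pi> ^ k * c) f = g * h" "f \<noteq> 0" "c \<noteq> 0"
  obtains g' h' where "smult c f = g' * h'" "degree g' = degree g" "degree h' = degree h"
proof -
  have "\<pi> \<noteq> 0" using assms(1) by auto
  have "\<exists>g' h'. smult c f = g' * h' \<and> degree g' = degree g \<and> degree h' = degree h"
    using assms(2)
  proof (induction k arbitrary: g h)
    case (Suc k)
    have "g * h = [:\<pi>:] * smult (\<pi> ^ k * c) f" by (simp flip: Suc.prems add: mult_ac)
    hence "[:\<pi>:] dvd g * h" by (metis dvd_triv_left)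
    moreover have "prime_elem [:\<pi>:]" using assms(1) by (simp add: prime_elem_const_poly_iff)
    ultimately consider "[:\<pi>:] dvd g" | "[:\<pi>:] dvd h" using prime_elem_dvd_multD by blast
    then show ?case
    proof cases
      case 1
      then obtain u where u: "g = smult \<pi> u" by (auto elim!: dvdE)
      hence "smult \<pi> (smult (\<pi> ^ k * c) f) = smult \<pi> (u * h)"
        using Suc.prems by (simp add: mult.assoc)
      hence "smult (\<pi> ^ k * c) f = u * h" using \<open>\<pi> \<noteq> 0\<close> by (metis smult_cancel)
      from Suc.IH[OF this] show ?thesis using u \<open>\<pi> \<noteq> 0\<close> by simp
    next
      case 2
      then obtain u where u: "h = smult \<pi> u" by (auto elim!: dvdE)
      hence "smult \<pi> (smult (\<pi> ^ k * c) f) = smult \<pi> (g * u)"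
        using Suc.prems by (simp add: mult.assoc)
      hence "smult (\<pi> ^ k * c) f = g * u" using \<open>\<pi> \<noteq> 0\<close> by (metis smult_cancel)
      from Suc.IH[OF this] show ?thesis using u \<open>\<pi> \<noteq> 0\<close> by simp
    qed
  qed auto
  thus ?thesis using that by blast
qed

text \<open>
  No unique factorization is required: denominators prime to \<open>\<pi>\<close> are harmless, and powers
  of \<open>\<pi>\<close> cancel since \<open>\<pi>\<close> remains prime in the polynomial ring.
\<close>

theorem eisenstein_irreducible:
  fixes f :: "'a :: idom poly"
  assumes \<pi>: "prime_elem \<pi>" and fin: "\<And>c. c \<noteq> 0 \<Longrightarrow> \<exists>k c'. c = \<pi> ^ k * c' \<and> \<not> \<pi> dvd c'"
    and deg: "degree f > 0" and lead: "\<not> \<pi> dvd lead_coeff f"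
    and coeffs: "\<And>i. i < degree f \<Longrightarrow> \<pi> dvd coeff f i" and const: "\<not> \<pi> ^ 2 dvd coeff f 0"
  shows "irreducible (fract_poly f)"
proof (rule irreducibleI)
  note prime_dvd = prime_elem_dvd_mult_iff[OF \<pi>]
  have "f \<noteq> 0" using deg by auto
  thus "fract_poly f \<noteq> 0" by simp
  show "\<not> fract_poly f dvd 1" using deg \<open>f \<noteq> 0\<close> by (simp add: is_unit_iff_degree degree_map_poly)
  have no_factor: False
    if gh: "smult c f = g * h" "\<not> \<pi> dvd c" "degree h > 0" "\<pi> dvd coeff g 0" for c g h
  proof -
    have "c \<noteq> 0" using gh by auto
    have "lead_coeff g * lead_coeff h = c * lead_coeff f"
      using arg_cong[OF gh(1), of lead_coeff] \<open>c \<noteq> 0\<close> by (simp add: lead_coeff_mult)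
    hence "\<not> \<pi> dvd lead_coeff g" using gh(2) lead prime_dvd by (metis dvd_mult2)
    hence ex: "\<not> \<pi> dvd coeff g (LEAST j. \<not> \<pi> dvd coeff g j)" by (rule LeastI)
    define j where "j = (LEAST j. \<not> \<pi> dvd coeff g j)"
    have j: "\<not> \<pi> dvd coeff g j" "\<And>i. i < j \<Longrightarrow> \<pi> dvd coeff g i"
      using ex not_less_Least unfolding j_def by blast+
    have "degree f = degree g + degree h"
    proof -
      have "g * h \<noteq> 0" using gh(1) \<open>c \<noteq> 0\<close> \<open>f \<noteq> 0\<close> by (metis smult_eq_0_iff)
      thus ?thesis using arg_cong[OF gh(1), of degree] \<open>c \<noteq> 0\<close>
        by (simp add: degree_mult_eq mult_eq_0_iff)
    qed
    moreover have "j \<le> degree g" using j(1) by (intro le_degree) auto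
    ultimately have "j < degree f" using gh(3) by simp
    hence "\<pi> dvd c * coeff f j" using coeffs by simp
    also have "c * coeff f j = (\<Sum>i\<le>j. coeff g i * coeff h (j - i))"
      using arg_cong[OF gh(1), of "\<lambda>p. coeff p j"] by (simp add: coeff_mult)
    also have "\<dots> = coeff g j * coeff h 0 + (\<Sum>i<j. coeff g i * coeff h (j - i))"
      by (simp add: lessThan_Suc_atMost[symmetric])
    finally have "\<pi> dvd coeff g j * coeff h 0"
      using j(2) by (subst (asm) dvd_add_left_iff) (auto intro: dvd_sum)
    hence "\<pi> dvd coeff h 0" using j(1) prime_dvd by blast
    hence "\<pi> ^ 2 dvd coeff g 0 * coeff h 0" unfolding power2_eq_square using gh(4) by (rule mult_dvd_mono[rotated])
    also have "coeff g 0 * coeff h 0 = c * coeff f 0"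
      using arg_cong[OF gh(1), of "\<lambda>p. coeff p 0"] by (simp add: coeff_mult)
    finally have *: "\<pi> ^ 2 dvd c * coeff f 0" .
    obtain m where m: "coeff f 0 = \<pi> * m" using coeffs[OF deg] by blast
    have "\<pi> * \<pi> dvd \<pi> * (c * m)" using * by (simp add: m power2_eq_square algebra_simps)
    hence "\<pi> dvd c * m" using \<pi> by (subst (asm) dvd_mult_cancel_left) auto
    hence "\<pi> dvd m" using gh(2) prime_dvd by blast
    hence "\<pi> ^ 2 dvd coeff f 0" by (auto simp: m power2_eq_square)
    thus False using const by blast
  qed
  fix G H assume GH: "fract_poly f = G * H"
  show "G dvd 1 \<or> H dvd 1"
  proof (rule ccontr)
    assume "\<not> ?thesis"
    moreover have "G \<noteq> 0" "H \<noteq> 0" using GH \<open>f \<noteq> 0\<close> by auto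
    ultimately have GH_deg: "degree G > 0" "degree H > 0" by (auto simp: is_unit_iff_degree)
    obtain a g where g: "a \<noteq> 0" "smult (to_fract a) G = fract_poly g"
      by (rule fract_poly_clear_denominators)
    obtain b h where h: "b \<noteq> 0" "smult (to_fract b) H = fract_poly h"
      by (rule fract_poly_clear_denominators)
    have "degree (fract_poly g) = degree G" "degree (fract_poly h) = degree H"
      using g h by (simp_all flip: g(2) h(2))
    hence dg: "degree g = degree G" "degree h = degree H" by (simp_all add: degree_map_poly)
    have "fract_poly (smult (a * b) f) = smult (to_fract a) G * smult (to_fract b) H"
      by (simp add: GH mult.commute)
    also have "\<dots> = fract_poly (g * h)" by (simp add: g h)
    finally have gh: "smult (a * b) f = g * h" by (simp only: fract_poly_eq_iff)
    obtain k c where c: "a * b = \<pi> ^ k * c" "\<not> \<pi> dvd c" using fin[of "a * b"] g h by auto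
    hence "c \<noteq> 0" by auto
    obtain g' h' where gh': "smult c f = g' * h'" "degree g' = degree g" "degree h' = degree h"
      by (rule factor_cancel_prime_power[OF \<pi> gh[unfolded c(1)] \<open>f \<noteq> 0\<close> \<open>c \<noteq> 0\<close>])
    have "coeff g' 0 * coeff h' 0 = c * coeff f 0"
      using arg_cong[OF gh'(1), of "\<lambda>p. coeff p 0"] by (simp add: coeff_mult)
    hence "\<pi> dvd coeff g' 0 * coeff h' 0" using coeffs[OF deg] by simp
    hence "\<pi> dvd coeff g' 0 \<or> \<pi> dvd coeff h' 0" using prime_dvd by blast
    thus False
      using no_factor[of c g' h'] no_factor[of c h' g'] gh' c(2) dg GH_deg by (auto simp: mult.commute)
  qed
qed

section \<open>Algebras over a finite field\<close>

lemma card_finite_field_ge_2: "CARD('a :: finite_field) \<ge> 2"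
proof -
  have "card {0, 1 :: 'a} \<le> CARD('a)" by (rule card_mono) auto
  thus ?thesis by simp
qed

locale fq_algebra = comm_ring_hom \<epsilon> for \<epsilon> :: "'a :: finite_field \<Rightarrow> 'b :: idom" +
  fixes q :: nat
  assumes q_eq: "q = CARD('a)"
begin

lemma q_ge_2: "q \<ge> 2" by (simp add: q_eq card_finite_field_ge_2)

lemma eps_eq_0_iff [simp]: "\<epsilon> c = 0 \<longleftrightarrow> c = 0"
proof -
  have "\<epsilon> c \<noteq> 0" if "c \<noteq> 0"
  proof
    assume "\<epsilon> c = 0"
    moreover have "\<epsilon> c * \<epsilon> (inverse c) = 1" using that by (simp flip: hom_mult)
    ultimately show False by simp
  qed
  thus ?thesis by auto
qed

lemma eps_eq_iff [simp]: "\<epsilon> c = \<epsilon> d \<longleftrightarrow> c = d"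
  using eps_eq_0_iff[of "c - d"] by (simp add: hom_minus del: eps_eq_0_iff)

lemma eps_power [simp]: "\<epsilon> c ^ (q ^ i) = \<epsilon> c"
  by (simp add: finite_field_power_card_power_eq_same q_eq flip: hom_power)

lemma eps_power1 [simp]: "\<epsilon> c ^ q = \<epsilon> c"
  using eps_power[of c 1] by simp

lemma frob_add1: "(x + y :: 'b) ^ q = x ^ q + y ^ q"
proof -
  have z: "of_nat (q choose k) = (0 :: 'b)" if "0 < k" "k < q" for k
    using arg_cong[OF of_nat_card_choose_eq_0[OF that[unfolded q_eq]], of \<epsilon>] by (simp add: hom_of_nat q_eq)
  have "(x + y) ^ q = (\<Sum>k\<le>q. of_nat (q choose k) * x ^ k * y ^ (q - k))"
    by (rule binomial_ring)
  also have "\<dots> = (\<Sum>k\<in>{0, q}. of_nat (q choose k) * x ^ k * y ^ (q - k))"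
    by (rule sum.mono_neutral_right) (use z in auto)
  also have "\<dots> = x ^ q + y ^ q" using q_ge_2 by simp
  finally show ?thesis .
qed

lemma frob_add: "(x + y :: 'b) ^ (q ^ i) = x ^ (q ^ i) + y ^ (q ^ i)"
proof (induction i)
  case (Suc i)
  have "z ^ (q ^ Suc i) = (z ^ (q ^ i)) ^ q" for z :: 'b
    unfolding power_Suc2 by (rule power_mult)
  thus ?case using Suc by (simp only: frob_add1)
qed simp

lemma frob_diff: "(x - y :: 'b) ^ (q ^ i) = x ^ (q ^ i) - y ^ (q ^ i)"
  using frob_add[of "x - y" y i] by (simp add: algebra_simps)

lemma frob_sum: "(sum f A :: 'b) ^ (q ^ i) = (\<Sum>a\<in>A. f a ^ (q ^ i))"
  using q_ge_2 by (induction A rule: infinite_finite_induct) (auto simp: frob_add power_0_left)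

lemma frob_inj: "(x :: 'b) ^ (q ^ i) = y ^ (q ^ i) \<longleftrightarrow> x = y"
  using frob_diff[of x y i] by (metis eq_iff_diff_eq_0 power_eq_0_iff)

text \<open>The homogeneous form of the factorisation of X^q - X. For \<open>y\<close> nonzero both
  sides are monic of degree \<open>q\<close> in \<open>x\<close> and agree at the \<open>q\<close>
  points \<open>\<epsilon> c * y\<close>.\<close>

lemma prod_shift: "(\<Prod>c\<in>UNIV. x - \<epsilon> c * y) = x ^ q - y ^ (q - 1) * x"
proof -
  define P where "P = (\<Prod>c\<in>UNIV. [:- (\<epsilon> c * y), 1:])"
  define Q where "Q = monom 1 q - monom (y ^ (q - 1)) 1"
  have "P - Q = 0"
  proof (cases "y = 0")
    case True
    have "P = [:0, 1:] ^ q" using True by (simp add: P_def q_eq)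
    also have "\<dots> = monom 1 q" by (simp add: monom_altdef)
    finally show ?thesis using True q_ge_2 by (simp add: Q_def power_0_left)
  next
    case False
    have degP: "degree P = q" unfolding P_def by (subst degree_prod_eq_sum_degree) (auto simp: q_eq)
    have lcP: "lead_coeff P = 1" unfolding P_def by (subst lead_coeff_prod) auto
    have "coeff Q q = 1" using q_ge_2 by (simp add: Q_def)
    moreover have "degree Q \<le> q" using q_ge_2 unfolding Q_def
      by (intro degree_diff_le) (auto intro: order.trans[OF degree_monom_le])
    ultimately have degQ: "degree Q = q" by (intro antisym le_degree) auto
    have small: "P - Q = 0 \<or> degree (P - Q) < q"
      using degree_diff_less_if_lead_coeff_eq[of Q P] degP degQ lcP \<open>coeff Q q = 1\<close> by simp
    have "poly P (\<epsilon> c * y) = 0" for c by (auto simp: P_def poly_prod prod_zero_iff)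
    moreover have "poly Q (\<epsilon> c * y) = 0" for c
    proof -
      have "y ^ (q - 1) * y = y ^ q" using q_ge_2 by (intro power_minus_mult) simp
      thus ?thesis by (simp add: Q_def poly_monom power_mult_distrib mult.left_commute)
    qed
    ultimately have "(\<lambda>c. \<epsilon> c * y) ` UNIV \<subseteq> {z. poly (P - Q) z = 0}" by auto
    moreover have "card ((\<lambda>c. \<epsilon> c * y) ` UNIV) = q"
      using False by (subst card_image) (auto intro: injI simp: q_eq)
    ultimately have "q \<le> degree (P - Q)" if "P - Q \<noteq> 0"
      using card_poly_roots_bound[OF that] card_mono[OF poly_roots_finite[OF that]]
      by (metis order.trans)
    thus ?thesis using small by fastforce
  qed
  hence "poly P x = poly Q x" by simp
  thus ?thesis by (simp add: P_def Q_def poly_prod poly_monom)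
qed

lemma fq_algebra_poly: "fq_algebra (\<lambda>c. [:\<epsilon> c:]) q"
  by unfold_locales (simp_all add: hom_add hom_mult one_pCons q_eq)

end

lemma pcompose_const_poly: "pcompose p [:a:] = [:poly p a:]"
  by (induction p) (simp_all add: pcompose_pCons mult.commute)

subsection \<open>Polynomials with exponents in the powers of \<open>q\<close>\<close>

text \<open>These are the F_q-linear polynomials. Keeping them as ordinary polynomials, with
  \<open>pcompose\<close> as their product, gives direct access to degrees, roots and
  divisibility.\<close>

definition q_poly :: "nat \<Rightarrow> 'b :: comm_ring_1 poly \<Rightarrow> bool" where
  "q_poly q p \<longleftrightarrow> (\<forall>i. coeff p i \<noteq> 0 \<longrightarrow> (\<exists>j. i = q ^ j))"

lemma q_poly_monom: "q_poly q (monom c (q ^ j))"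
  by (auto simp: q_poly_def)

lemma q_poly_X: "q_poly q [:0, 1:]"
  using q_poly_monom[of q 1 0] by (simp add: monom_altdef)

lemma q_poly_add: "q_poly q p \<Longrightarrow> q_poly q s \<Longrightarrow> q_poly q (p + s)"
  unfolding q_poly_def coeff_add by (metis add.right_neutral)

lemma q_poly_diff: "q_poly q p \<Longrightarrow> q_poly q s \<Longrightarrow> q_poly q (p - s)"
  unfolding q_poly_def coeff_diff by (metis diff_zero)

lemma q_poly_smult: "q_poly q p \<Longrightarrow> q_poly q (smult c p)"
  unfolding q_poly_def coeff_smult by (metis mult_zero_right)

lemma q_poly_0: "q_poly q 0"
  by (simp add: q_poly_def)

lemma q_poly_sum: "(\<And>i. i \<in> A \<Longrightarrow> q_poly q (f i)) \<Longrightarrow> q_poly q (sum f A)"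
  by (induction A rule: infinite_finite_induct) (auto intro: q_poly_add q_poly_0)

lemma q_poly_map_poly: "q_poly q p \<Longrightarrow> h 0 = 0 \<Longrightarrow> q_poly q (map_poly h p)"
  unfolding q_poly_def by (metis coeff_map_poly)

lemma q_poly_coeff_0: "q \<ge> 2 \<Longrightarrow> q_poly q p \<Longrightarrow> coeff p 0 = 0"
  by (auto simp: q_poly_def)

lemma q_poly_decompose:
  assumes "q \<ge> 2" "q_poly q p"
  shows "p = (\<Sum>j\<le>degree p. monom (coeff p (q ^ j)) (q ^ j))"
proof (rule poly_eqI)
  fix i
  have inj: "q ^ j = q ^ k \<longleftrightarrow> j = k" for j k using assms(1) by simp
  show "coeff p i = coeff (\<Sum>j\<le>degree p. monom (coeff p (q ^ j)) (q ^ j)) i"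
  proof (cases "\<exists>j. i = q ^ j")
    case True
    then obtain j where j: "i = q ^ j" by blast
    have "j < q ^ j" using assms(1) by (intro less_exp[THEN less_le_trans] power_mono) auto
    hence "coeff p i = 0" if "\<not> j \<le> degree p" using that j by (intro coeff_eq_0) simp
    thus ?thesis by (auto simp: coeff_sum j inj)
  next
    case False
    hence "coeff p i = 0" using assms(2) by (auto simp: q_poly_def)
    moreover have "coeff (\<Sum>j\<le>degree p. monom (coeff p (q ^ j)) (q ^ j)) i = 0"
      using False by (auto simp: coeff_sum intro!: sum.neutral)
    ultimately show ?thesis by simp
  qed
qed

lemma q_poly_poly:
  assumes "q \<ge> 2" "q_poly q p"
  shows "poly p x = (\<Sum>j\<le>degree p. coeff p (q ^ j) * x ^ (q ^ j))"
  by (subst q_poly_decompose[OF assms]) (simp add: poly_sum poly_monom)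

lemma q_poly_pcompose_eq:
  assumes "q \<ge> 2" "q_poly q p"
  shows "pcompose p u = (\<Sum>j\<le>degree p. smult (coeff p (q ^ j)) (u ^ (q ^ j)))"
proof -
  have "pcompose (monom c k) u = smult c (u ^ k)" for c k
    by (simp add: monom_altdef pcompose_smult pcompose_hom.hom_power pcompose_pCons)
  thus ?thesis
    by (subst q_poly_decompose[OF assms]) (simp add: pcompose_hom.hom_sum)
qed

lemma q_poly_degree_less:
  assumes "q \<ge> 2" "q_poly q p" "degree p < q ^ Suc m"
  shows "degree p \<le> q ^ m"
proof (cases "p = 0")
  case False
  then obtain j where j: "degree p = q ^ j"
    using assms(2) leading_coeff_0_iff unfolding q_poly_def by blast
  hence "j < Suc m" using assms by (simp del: power_Suc)
  thus ?thesis unfolding j using assms(1) by (intro power_increasing) auto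
qed auto

context fq_algebra
begin

lemma q_poly_power:
  fixes p :: "'b poly"
  assumes "q_poly q p"
  shows "q_poly q (p ^ (q ^ k))"
proof -
  interpret P: fq_algebra "\<lambda>c. [:\<epsilon> c:]" q by (rule fq_algebra_poly)
  have "p ^ (q ^ k) = (\<Sum>j\<le>degree p. monom (coeff p (q ^ j)) (q ^ j) ^ (q ^ k))"
    by (subst q_poly_decompose[OF q_ge_2 assms]) (rule P.frob_sum)
  thus ?thesis by (simp only: monom_power power_add[symmetric]) (intro q_poly_sum q_poly_monom)
qed

lemma q_poly_power1: "q_poly q (p :: 'b poly) \<Longrightarrow> q_poly q (p ^ q)"
  using q_poly_power[of p 1] by simp

lemma q_poly_pcompose: "q_poly q (p :: 'b poly) \<Longrightarrow> q_poly q u \<Longrightarrow> q_poly q (pcompose p u)"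
  unfolding q_poly_pcompose_eq[OF q_ge_2] by (intro q_poly_sum q_poly_smult q_poly_power)

lemma q_poly_poly_add: "q_poly q (p :: 'b poly) \<Longrightarrow> poly p (x + y) = poly p x + poly p y"
  by (simp add: q_poly_poly[OF q_ge_2] frob_add algebra_simps sum.distrib)

lemma q_poly_poly_diff: "q_poly q (p :: 'b poly) \<Longrightarrow> poly p (x - y) = poly p x - poly p y"
  using q_poly_poly_add[of p "x - y" y] by (simp add: algebra_simps)

lemma q_poly_poly_0: "q_poly q (p :: 'b poly) \<Longrightarrow> poly p 0 = 0"
  using q_poly_poly_diff[of p 0 0] by simp

lemma q_poly_poly_scale: "q_poly q (p :: 'b poly) \<Longrightarrow> poly p (\<epsilon> c * x) = \<epsilon> c * poly p x"
  by (simp add: q_poly_poly[OF q_ge_2] power_mult_distrib sum_distrib_left mult.left_commute)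

lemma q_poly_poly_sum: "q_poly q (p :: 'b poly) \<Longrightarrow> poly p (sum f A) = (\<Sum>a\<in>A. poly p (f a))"
  by (induction A rule: infinite_finite_induct) (auto simp: q_poly_poly_add q_poly_poly_0)

lemma q_poly_pcompose_diff: "q_poly q (p :: 'b poly) \<Longrightarrow> pcompose p (u - v) = pcompose p u - pcompose p v"
proof -
  interpret P: fq_algebra "\<lambda>c. [:\<epsilon> c:]" q by (rule fq_algebra_poly)
  show "q_poly q p \<Longrightarrow> ?thesis"
    by (simp add: q_poly_pcompose_eq[OF q_ge_2] P.frob_diff smult_diff_right sum_subtractf)
qed

subsection \<open>Finite subspaces\<close>

definition fq_subspace :: "'b set \<Rightarrow> bool" where
  "fq_subspace W \<longleftrightarrow> 0 \<in> W \<and> (\<forall>x\<in>W. \<forall>y\<in>W. x + y \<in> W) \<and> (\<forall>c. \<forall>x\<in>W. \<epsilon> c * x \<in> W)"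

definition fq_lincomb :: "nat \<Rightarrow> (nat \<Rightarrow> 'b) \<Rightarrow> (nat \<Rightarrow> 'a) \<Rightarrow> 'b" where
  "fq_lincomb s b c = (\<Sum>i<s. \<epsilon> (c i) * b i)"

definition fq_indep :: "nat \<Rightarrow> (nat \<Rightarrow> 'b) \<Rightarrow> bool" where
  "fq_indep s b \<longleftrightarrow> (\<forall>c. fq_lincomb s b c = 0 \<longrightarrow> (\<forall>i<s. c i = 0))"

definition fq_span :: "nat \<Rightarrow> (nat \<Rightarrow> 'b) \<Rightarrow> 'b set" where
  "fq_span s b = range (fq_lincomb s b)"

lemma fq_lincomb_add: "fq_lincomb s b (\<lambda>i. c i + d i) = fq_lincomb s b c + fq_lincomb s b d"
  by (simp add: fq_lincomb_def hom_add algebra_simps sum.distrib)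

lemma fq_lincomb_scale: "fq_lincomb s b (\<lambda>i. a * c i) = \<epsilon> a * fq_lincomb s b c"
  by (simp add: fq_lincomb_def hom_mult sum_distrib_left mult.assoc)

lemma fq_lincomb_Suc: "fq_lincomb (Suc s) b c = fq_lincomb s b c + \<epsilon> (c s) * b s"
  by (simp add: fq_lincomb_def)

lemma fq_subspace_span: "fq_subspace (fq_span s b)"
  unfolding fq_subspace_def fq_span_def
proof (intro conjI ballI allI)
  show "0 \<in> range (fq_lincomb s b)"
    by (rule range_eqI[of _ _ "\<lambda>_. 0"]) (simp add: fq_lincomb_def)
qed (auto simp flip: fq_lincomb_add fq_lincomb_scale)

lemma fq_subspace_diff: "fq_subspace W \<Longrightarrow> x \<in> W \<Longrightarrow> y \<in> W \<Longrightarrow> x - y \<in> W"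
  unfolding fq_subspace_def
  by (metis hom_one hom_uminus mult_minus_left mult_1 add_uminus_conv_diff)

lemma fq_subspace_sum: "fq_subspace W \<Longrightarrow> (\<And>i. i \<in> A \<Longrightarrow> f i \<in> W) \<Longrightarrow> sum f A \<in> W"
  by (induction A rule: infinite_finite_induct) (auto simp: fq_subspace_def)

lemma fq_subspace_lincomb: "fq_subspace W \<Longrightarrow> (\<And>i. i < s \<Longrightarrow> b i \<in> W) \<Longrightarrow> fq_lincomb s b c \<in> W"
  unfolding fq_lincomb_def by (rule fq_subspace_sum) (auto simp: fq_subspace_def)

lemma fq_span_Suc: "fq_span (Suc s) b = (\<Union>c. (\<lambda>w. w + \<epsilon> c * b s) ` fq_span s b)"
proof (intro equalityI subsetI)
  fix x assume "x \<in> fq_span (Suc s) b"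
  thus "x \<in> (\<Union>c. (\<lambda>w. w + \<epsilon> c * b s) ` fq_span s b)"
    by (auto simp: fq_span_def fq_lincomb_Suc)
next
  fix x assume "x \<in> (\<Union>c. (\<lambda>w. w + \<epsilon> c * b s) ` fq_span s b)"
  then obtain c d where "x = fq_lincomb s b d + \<epsilon> c * b s" by (auto simp: fq_span_def)
  also have "\<dots> = fq_lincomb (Suc s) b (d(s := c))"
    by (simp add: fq_lincomb_Suc fq_lincomb_def)
  finally show "x \<in> fq_span (Suc s) b" by (simp add: fq_span_def)
qed

lemma fq_indep_less: "fq_indep (Suc s) b \<Longrightarrow> fq_indep s b"
  unfolding fq_indep_def
proof (intro allI impI)
  fix c i assume *: "\<forall>c. fq_lincomb (Suc s) b c = 0 \<longrightarrow> (\<forall>i<Suc s. c i = 0)" "fq_lincomb s b c = 0" "i < s"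
  have "fq_lincomb (Suc s) b (c(s := 0)) = 0"
    using *(2) by (simp add: fq_lincomb_Suc fq_lincomb_def)
  thus "c i = 0" using *(1,3) by (metis fun_upd_other less_SucI less_irrefl_nat)
qed

lemma fq_indep_notin_span:
  assumes "fq_indep (Suc s) b" "c \<noteq> 0"
  shows "\<epsilon> c * b s \<notin> fq_span s b"
proof
  assume "\<epsilon> c * b s \<in> fq_span s b"
  then obtain d where "\<epsilon> c * b s = fq_lincomb s b d" by (auto simp: fq_span_def)
  hence "fq_lincomb (Suc s) b (d(s := - c)) = 0"
    by (simp add: fq_lincomb_Suc fq_lincomb_def hom_uminus)
  hence "(d(s := - c)) s = 0" using assms(1) unfolding fq_indep_def by (metis lessI)
  thus False using assms(2) by simp
qed

lemma fq_indep_SucI: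
  assumes "fq_indep s b" "b s \<notin> fq_span s b"
  shows "fq_indep (Suc s) b"
  unfolding fq_indep_def
proof (intro allI impI)
  fix c i assume c: "fq_lincomb (Suc s) b c = 0" and "i < Suc s"
  have "c s = 0"
  proof (rule ccontr)
    assume cs: "c s \<noteq> 0"
    have "\<epsilon> (c s) * b s = - fq_lincomb s b c" using c by (simp add: fq_lincomb_Suc add_eq_0_iff)
    hence "\<epsilon> (- inverse (c s)) * (\<epsilon> (c s) * b s) = \<epsilon> (inverse (c s)) * fq_lincomb s b c"
      by (simp add: hom_uminus)
    hence "- b s = \<epsilon> (inverse (c s)) * fq_lincomb s b c"
      using cs by (simp flip: mult.assoc hom_mult add: hom_uminus)
    hence "b s = fq_lincomb s b (\<lambda>i. - inverse (c s) * c i)"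
      unfolding fq_lincomb_scale by (metis hom_uminus minus_mult_left minus_minus)
    thus False using assms(2) by (simp add: fq_span_def)
  qed
  moreover from this have "fq_lincomb s b c = 0" using c by (simp add: fq_lincomb_Suc)
  ultimately show "c i = 0" using assms(1) \<open>i < Suc s\<close> unfolding fq_indep_def
    by (metis less_SucE)
qed

lemma fq_span_Suc_bij:
  assumes "fq_indep (Suc s) b"
  shows "bij_betw (\<lambda>(c, w). w + \<epsilon> c * b s) (UNIV \<times> fq_span s b) (fq_span (Suc s) b)"
  unfolding bij_betw_def
proof
  show "inj_on (\<lambda>(c, w). w + \<epsilon> c * b s) (UNIV \<times> fq_span s b)"
  proof (rule inj_onI, clarify)
    fix c w d v assume *: "w \<in> fq_span s b" "v \<in> fq_span s b" "w + \<epsilon> c * b s = v + \<epsilon> d * b s"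
    have "\<epsilon> (c - d) * b s = v - w" using *(3) by (simp add: hom_minus algebra_simps)
    also have "\<dots> \<in> fq_span s b" using * fq_subspace_span fq_subspace_diff by blast
    finally have "c - d = 0" using fq_indep_notin_span[OF assms] by blast
    thus "c = d \<and> w = v" using *(3) by simp
  qed
  show "(\<lambda>(c, w). w + \<epsilon> c * b s) ` (UNIV \<times> fq_span s b) = fq_span (Suc s) b"
    by (auto simp: fq_span_Suc)
qed

lemma card_fq_span: "fq_indep s b \<Longrightarrow> card (fq_span s b) = q ^ s"
proof (induction s)
  case 0
  show ?case by (simp add: fq_span_def fq_lincomb_def)
next
  case (Suc s)
  have "card (fq_span (Suc s) b) = card ((UNIV :: 'a set) \<times> fq_span s b)"
    using bij_betw_same_card[OF fq_span_Suc_bij[OF Suc.prems]] by simp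
  thus ?case using Suc.IH fq_indep_less[OF Suc.prems] by (simp add: card_cartesian_product q_eq)
qed

lemma fq_basis_extend:
  assumes "finite W" "fq_subspace W" "fq_indep s b" "\<And>i. i < s \<Longrightarrow> b i \<in> W"
  obtains s' b' where "s \<le> s'" "fq_indep s' b'" "fq_span s' b' = W" "\<And>i. i < s \<Longrightarrow> b' i = b i"
proof -
  have "\<exists>s' b'. s \<le> s' \<and> fq_indep s' b' \<and> fq_span s' b' = W \<and> (\<forall>i<s. b' i = b i)"
    using assms(3,4)
  proof (induction "card W - card (fq_span s b)" arbitrary: s b rule: less_induct)
    case less
    have sub: "fq_span s b \<subseteq> W"
      using fq_subspace_lincomb[OF assms(2)] less.prems by (auto simp: fq_span_def)
    show ?case
    proof (cases "fq_span s b = W")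
      case True
      thus ?thesis using less.prems by blast
    next
      case False
      then obtain w where w: "w \<in> W" "w \<notin> fq_span s b" using sub by blast
      define b' where "b' = b(s := w)"
      have span: "fq_span s b' = fq_span s b"
        by (auto simp: fq_span_def b'_def fq_lincomb_def)
      have "fq_indep s b'" using less.prems by (simp add: fq_indep_def b'_def fq_lincomb_def)
      hence ind: "fq_indep (Suc s) b'" using w span by (intro fq_indep_SucI) (auto simp: b'_def)
      have mem: "b' i \<in> W" if "i < Suc s" for i using that less.prems w by (auto simp: b'_def less_Suc_eq)
      have "fq_span (Suc s) b' \<subseteq> W"
        using fq_subspace_lincomb[OF assms(2), of "Suc s" b'] mem by (auto simp: fq_span_def)
      hence "card (fq_span (Suc s) b') \<le> card W" using assms(1) by (intro card_mono)
      moreover have "card (fq_span s b) < card (fq_span (Suc s) b')"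
        unfolding card_fq_span[OF ind] card_fq_span[OF less.prems(1)] using q_ge_2 by simp
      ultimately have "card W - card (fq_span (Suc s) b') < card W - card (fq_span s b)" by simp
      from less.hyps[OF this ind mem] obtain s' b'' where
        "Suc s \<le> s'" "fq_indep s' b''" "fq_span s' b'' = W" "\<forall>i<Suc s. b'' i = b' i" by blast
      thus ?thesis by (intro exI[of _ s'] exI[of _ b'']) (auto simp: b'_def)
    qed
  qed
  thus ?thesis using that by blast
qed

lemma fq_basis_exists:
  assumes "finite W" "fq_subspace W"
  obtains s b where "fq_indep s b" "fq_span s b = W" "card W = q ^ s"
proof -
  have "fq_indep 0 undefined" by (simp add: fq_indep_def)
  from fq_basis_extend[OF assms this] obtain s b where "fq_indep s b" "fq_span s b = W" by auto
  thus ?thesis using that card_fq_span by metis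
qed

lemma fq_span_base: "i < s \<Longrightarrow> b i \<in> fq_span s b"
  unfolding fq_span_def by (rule range_eqI[of _ _ "\<lambda>j. if j = i then 1 else 0"])
    (simp add: fq_lincomb_def if_distrib if_distribR sum.delta cong: if_cong)

subsection \<open>The polynomial vanishing on a finite subspace\<close>

definition vanishing_poly :: "'b set \<Rightarrow> 'b poly" where
  "vanishing_poly W = (\<Prod>w\<in>W. [:- w, 1:])"

text \<open>Adding a basis vector b turns the vanishing polynomial P into the product of the P - c
  P(b), which \<open>prod_shift\<close> evaluates to P^q - P(b)^(q-1) P.\<close>

lemma q_poly_vanishing_poly_span: "fq_indep s b \<Longrightarrow> q_poly q (vanishing_poly (fq_span s b))"
proof (induction s)
  case 0
  show ?case by (simp add: fq_span_def fq_lincomb_def vanishing_poly_def q_poly_X)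
next
  case (Suc s)
  interpret P: fq_algebra "\<lambda>c. [:\<epsilon> c:]" q by (rule fq_algebra_poly)
  let ?P = "vanishing_poly (fq_span s b)"
  have P: "q_poly q ?P" using Suc fq_indep_less by blast
  have shift: "(\<Prod>w\<in>fq_span s b. [:- (w + \<epsilon> c * b s), 1:]) = ?P - [:\<epsilon> c:] * [:poly ?P (b s):]" for c
  proof -
    have "(\<Prod>w\<in>fq_span s b. [:- (w + \<epsilon> c * b s), 1:]) = pcompose ?P ([:0, 1:] - [:\<epsilon> c * b s:])"
      by (simp add: vanishing_poly_def pcompose_hom.hom_prod pcompose_pCons algebra_simps)
    also have "\<dots> = ?P - [:poly ?P (\<epsilon> c * b s):]"
      unfolding q_poly_pcompose_diff[OF P] by (simp add: pcompose_const_poly)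
    finally show ?thesis using q_poly_poly_scale[OF P] by simp
  qed
  have "vanishing_poly (fq_span (Suc s) b) =
      (\<Prod>(c, w)\<in>UNIV \<times> fq_span s b. [:- (w + \<epsilon> c * b s), 1:])"
    unfolding vanishing_poly_def
    by (subst prod.reindex_bij_betw[OF fq_span_Suc_bij[OF Suc.prems], symmetric])
       (simp add: case_prod_beta)
  also have "\<dots> = (\<Prod>c\<in>UNIV. ?P - [:\<epsilon> c:] * [:poly ?P (b s):])"
    by (subst prod.cartesian_product[symmetric]) (simp only: shift)
  also have "\<dots> = ?P ^ q - [:poly ?P (b s) ^ (q - 1):] * ?P"
    by (simp only: P.prod_shift const_poly_power)
  finally show ?case using q_poly_diff[OF q_poly_power1[OF P] q_poly_smult[OF P]] by simp
qed

lemma q_poly_vanishing_poly: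
  assumes "finite W" "fq_subspace W"
  shows "q_poly q (vanishing_poly W)"
  using fq_basis_exists[OF assms] q_poly_vanishing_poly_span by metis

end

lemma (in fq_algebra) degree_vanishing_poly: "degree (vanishing_poly W) = card W"
  unfolding vanishing_poly_def by (subst degree_prod_eq_sum_degree) auto

lemma (in fq_algebra) lead_coeff_vanishing_poly: "lead_coeff (vanishing_poly W) = 1"
  unfolding vanishing_poly_def by (subst lead_coeff_prod) auto

lemma (in fq_algebra) poly_vanishing_poly: "poly (vanishing_poly W) x = (\<Prod>w\<in>W. x - w)"
  by (simp add: vanishing_poly_def poly_prod)

section \<open>Local analysis over a power series ring\<close>

lemma fps_X_power_dvd_iff: "fps_X ^ n dvd f \<longleftrightarrow> (\<forall>i<n. f $ i = 0)"
  for f :: "'k :: field fps"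
proof
  assume "fps_X ^ n dvd f"
  thus "\<forall>i<n. f $ i = 0" by (auto elim!: dvdE simp: fps_X_power_mult_nth)
next
  assume "\<forall>i<n. f $ i = 0"
  hence "f = fps_X ^ n * fps_shift n f"
    by (intro fps_ext) (simp add: fps_X_power_mult_nth)
  thus "fps_X ^ n dvd f" by (metis dvd_triv_left)
qed

lemma fps_X_dvd_iff: "fps_X dvd f \<longleftrightarrow> f $ 0 = 0" for f :: "'k :: field fps"
  using fps_X_power_dvd_iff[of 1 f] by simp

lemma fps_X_dvdE:
  fixes f :: "'k :: field fps"
  assumes "f $ 0 = 0" obtains g where "f = fps_X * g"
  using assms fps_X_dvd_iff by (metis dvdE)

lemma prime_elem_fps_X: "prime_elem (fps_X :: 'k :: field fps)"
  by (rule prime_elemI) (auto simp: fps_X_dvd_iff)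

lemma fps_X_multiplicity:
  fixes c :: "'k :: field fps"
  assumes "c \<noteq> 0"
  shows "\<exists>k c'. c = fps_X ^ k * c' \<and> \<not> fps_X dvd c'"
proof (intro exI conjI)
  show "c = fps_X ^ subdegree c * unit_factor c"
    using fps_unit_factor_decompose'[of c] by (simp add: mult.commute)
  show "\<not> fps_X dvd unit_factor c" using assms by (simp add: fps_X_dvd_iff)
qed

lemma poly_diff_dvd: "x - y dvd poly p x - poly p y" for p :: "'a :: comm_ring_1 poly"
proof -
  have "[:- y, 1:] dvd p - [:poly p y:]" by (simp flip: poly_eq_0_iff_dvd)
  then obtain s where "p - [:poly p y:] = [:- y, 1:] * s" by blast
  from arg_cong[OF this, of "\<lambda>p. poly p x"] have "poly p x - poly p y = (x - y) * poly s x"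
    by (simp add: algebra_simps)
  thus ?thesis by simp
qed

lemma fps_prod_nth_0: "prod f A $ 0 = (\<Prod>a\<in>A. f a $ 0)" for f :: "'b \<Rightarrow> 'k :: comm_ring_1 fps"
  by (induction A rule: infinite_finite_induct) auto

text \<open>The map sending z to u^(-1) (y + X \<Psi>(z)) is an X-adic contraction: each application
  gains one power of X. This takes the place of Hensel's lemma.\<close>

lemma fps_fixpoint:
  fixes u y :: "'k :: field fps"
  assumes "u $ 0 \<noteq> 0"
  obtains z where "u * z = y + fps_X * poly \<Psi> z"
proof -
  define f where "f z = inverse u * (y + fps_X * poly \<Psi> z)" for z
  define s where "s n = (f ^^ n) 0" for n
  have uf: "u * f z = y + fps_X * poly \<Psi> z" for z
    using assms by (simp add: f_def inverse_mult_eq_1' flip: mult.assoc)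
  have contract: "fps_X ^ Suc n dvd f z - f z'" if "fps_X ^ n dvd z - z'" for n z z'
  proof -
    have "f z - f z' = inverse u * (fps_X * (poly \<Psi> z - poly \<Psi> z'))"
      by (simp add: f_def algebra_simps)
    moreover have "fps_X ^ n dvd poly \<Psi> z - poly \<Psi> z'"
      using that poly_diff_dvd dvd_trans by blast
    ultimately show ?thesis by (simp add: mult_dvd_mono)
  qed
  have step: "fps_X ^ n dvd s (Suc n) - s n" for n
    by (induction n) (use contract in \<open>auto simp: s_def\<close>)
  have stable: "fps_X ^ n dvd s (n + m) - s n" for n m
  proof (induction m)
    case (Suc m)
    have "fps_X ^ n dvd s (Suc (n + m)) - s (n + m)"
      using step[of "n + m"] by (meson dvd_trans le_imp_power_dvd le_add1)
    from dvd_add[OF this Suc] show ?case by simp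
  qed simp
  \<comment> \<open>Coefficient \<open>n\<close> no longer changes from iterate \<open>n + 1\<close>
    on.\<close>
  define z where "z = Abs_fps (\<lambda>n. s (Suc n) $ n)"
  have z: "fps_X ^ n dvd z - s n" for n
  proof -
    have "(s (Suc i)) $ i = s n $ i" if "i < n" for i
      using stable[of "Suc i" "n - Suc i"] that unfolding fps_X_power_dvd_iff by simp
    thus ?thesis by (simp add: fps_X_power_dvd_iff z_def)
  qed
  have "fps_X ^ n dvd f z - z" for n
  proof -
    have "fps_X ^ n dvd f z - f (s n)"
      using contract[OF z[of n]] by (meson dvd_trans le_imp_power_dvd lessI less_imp_le)
    moreover have "fps_X ^ n dvd s (Suc n) - z"
      using z[of "Suc n"] by (metis dvd_minus_iff dvd_trans le_imp_power_dvd lessI less_imp_le minus_diff_eq)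
    ultimately have "fps_X ^ n dvd (f z - f (s n)) + (s (Suc n) - z)" by (rule dvd_add)
    thus ?thesis by (simp add: s_def)
  qed
  hence "f z $ i = z $ i" for i
    unfolding fps_X_power_dvd_iff by (metis eq_iff_diff_eq_0 fps_sub_nth lessI)
  hence "f z = z" by (simp add: fps_eq_iff)
  thus ?thesis using that uf by metis
qed

lemma poly_split_linear:
  fixes p :: "'b :: comm_ring_1 poly"
  assumes "coeff p 0 = 0"
  obtains s where "\<And>x. poly p x = x * (coeff p 1 + x * poly s x)"
proof -
  obtain a p1 where p: "p = pCons a p1" by (cases p)
  obtain b s where p1: "p1 = pCons b s" by (cases p1)
  have "poly p x = x * (coeff p 1 + x * poly s x)" for x
    using assms by (simp add: p p1 algebra_simps)
  thus ?thesis using that by blast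
qed

text \<open>
  \<open>\<Phi>\<close> is \<open>\<phi>\<^sub>T(x)\<close> over the completion at a zero of \<open>g\<^sub>r\<close> of order one; \<open>r = Suc m\<close>.
\<close>

locale local_module = base: fq_algebra \<epsilon> q
  for \<epsilon> :: "'a :: finite_field \<Rightarrow> 'k :: alg_closed_field" and q +
  fixes \<Phi> :: "'k fps poly" and m :: nat
  assumes q_poly_\<Phi>: "q_poly q \<Phi>" and degree_\<Phi>: "degree \<Phi> = q ^ Suc m" and m_pos: "m > 0"
    and unit_1: "coeff \<Phi> 1 $ 0 \<noteq> 0" and unit_m: "coeff \<Phi> (q ^ m) $ 0 \<noteq> 0"
    and lead_0: "lead_coeff \<Phi> $ 0 = 0" and lead_1: "lead_coeff \<Phi> $ 1 \<noteq> 0"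
begin

sublocale fq_algebra "\<lambda>c. fps_const (\<epsilon> c)" q
  by unfold_locales (simp_all add: base.hom_add base.hom_mult base.q_eq)

text \<open>The T^n-torsion that is rational over the power series ring. Reduction modulo X is
  injective on it by \<open>H_unit\<close>, and \<open>card_H\<close> finds q^(nm) elements, the
  size belonging to rank \<open>m\<close>.\<close>

definition H :: "nat \<Rightarrow> 'k fps set" where
  "H n = {x. (poly \<Phi> ^^ n) x = 0}"

lemma \<Phi>_0 [simp]: "poly \<Phi> 0 = 0"
  using q_poly_poly_0[OF q_poly_\<Phi>] .

lemma coeff_\<Phi>_0: "coeff \<Phi> 0 = 0"
  using q_poly_coeff_0[OF q_ge_2 q_poly_\<Phi>] .

lemma iterate_\<Phi>_add: "(poly \<Phi> ^^ n) (x + y) = (poly \<Phi> ^^ n) x + (poly \<Phi> ^^ n) y"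
  by (induction n) (simp_all add: q_poly_poly_add[OF q_poly_\<Phi>])

lemma iterate_\<Phi>_scale: "(poly \<Phi> ^^ n) (fps_const (\<epsilon> c) * x) = fps_const (\<epsilon> c) * (poly \<Phi> ^^ n) x"
  by (induction n) (simp_all add: q_poly_poly_scale[OF q_poly_\<Phi>])

lemma fq_subspace_H: "fq_subspace (H n)"
proof -
  have "(poly \<Phi> ^^ n) 0 = 0" by (induction n) simp_all
  thus ?thesis by (simp add: fq_subspace_def H_def iterate_\<Phi>_add iterate_\<Phi>_scale)
qed

lemma H_0: "H 0 = {0}"
  by (simp add: H_def)

lemma H_Suc_iff: "x \<in> H (Suc n) \<longleftrightarrow> poly \<Phi> x \<in> H n"
  unfolding H_def mem_Collect_eq funpow_Suc_right o_def ..

text \<open>On series without constant term \<Phi> multiplies by a unit, so a nonzero one stays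
  nonzero without constant term under all iterates and is never torsion.\<close>

lemma H_unit:
  assumes "x \<in> H n" "x \<noteq> 0"
  shows "x $ 0 \<noteq> 0"
proof
  assume x0: "x $ 0 = 0"
  obtain s where s: "\<And>x. poly \<Phi> x = x * (coeff \<Phi> 1 + x * poly s x)"
    using poly_split_linear[OF coeff_\<Phi>_0] by blast
  have step: "poly \<Phi> x \<noteq> 0 \<and> poly \<Phi> x $ 0 = 0" if "x \<noteq> 0" "x $ 0 = 0" for x
  proof -
    have "(coeff \<Phi> 1 + x * poly s x) $ 0 \<noteq> 0" using that unit_1 by simp
    hence "coeff \<Phi> 1 + x * poly s x \<noteq> 0" by (metis fps_zero_nth)
    thus ?thesis using that by (simp add: s)
  qed
  have "(poly \<Phi> ^^ n) x \<noteq> 0 \<and> (poly \<Phi> ^^ n) x $ 0 = 0"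
    by (induction n) (use assms x0 step in auto)
  thus False using assms by (simp add: H_def)
qed

definition \<Phi>0 :: "'k poly" where "\<Phi>0 = map_poly (\<lambda>f. f $ 0) \<Phi>"

lemma coeff_\<Phi>0: "coeff \<Phi>0 i = coeff \<Phi> i $ 0"
  by (simp add: \<Phi>0_def coeff_map_poly)

lemma q_poly_\<Phi>0: "q_poly q \<Phi>0"
  unfolding \<Phi>0_def by (intro q_poly_map_poly q_poly_\<Phi>) simp

lemma poly_\<Phi>_nth_0: "poly \<Phi> x $ 0 = poly \<Phi>0 (x $ 0)"
proof -
  have "degree \<Phi>0 \<le> degree \<Phi>" by (rule degree_le) (simp add: coeff_\<Phi>0 coeff_eq_0)
  from poly_eq_sum_atMost[OF this] show ?thesis
    by (simp add: poly_altdef fps_sum_nth fps_power_zeroth coeff_\<Phi>0)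
qed

lemma degree_\<Phi>0: "degree \<Phi>0 = q ^ m"
proof (rule antisym)
  have "degree \<Phi>0 \<le> q ^ Suc m"
    by (rule degree_le) (simp add: coeff_\<Phi>0 coeff_eq_0 degree_\<Phi>)
  moreover have "coeff \<Phi>0 (q ^ Suc m) = 0" using lead_0 degree_\<Phi> by (simp add: coeff_\<Phi>0)
  moreover have "\<Phi>0 \<noteq> 0" using unit_1 coeff_\<Phi>0 by (metis coeff_0)
  ultimately have "degree \<Phi>0 < q ^ Suc m" by (metis le_neq_implies_less leading_coeff_0_iff)
  thus "degree \<Phi>0 \<le> q ^ m" by (rule q_poly_degree_less[OF q_ge_2 q_poly_\<Phi>0])
  show "q ^ m \<le> degree \<Phi>0" using unit_m by (intro le_degree) (simp add: coeff_\<Phi>0)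
qed

lemma \<Phi>_lift:
  assumes "poly \<Phi>0 a = y $ 0"
  obtains x where "poly \<Phi> x = y" "x $ 0 = a"
proof -
  have "(y - poly \<Phi> (fps_const a)) $ 0 = 0" using assms by (simp add: poly_\<Phi>_nth_0)
  then obtain y1 where y1: "y - poly \<Phi> (fps_const a) = fps_X * y1" by (rule fps_X_dvdE)
  obtain s where s: "\<And>x. poly \<Phi> x = x * (coeff \<Phi> 1 + x * poly s x)"
    using poly_split_linear[OF coeff_\<Phi>_0] by blast
  \<comment> \<open>The equation \<Phi>(X z) = X y1 divided by X. With \<Phi>(x) = x (c + x s(x)) it
    reads c z + X z^2 s(X z) = y1, and the polynomial passed to \<open>fps_fixpoint\<close> is -z^2
    s(X z).\<close>
  obtain z where z: "coeff \<Phi> 1 * z = y1 + fps_X * poly (- ([:0, 0, 1:] * pcompose s [:0, fps_X:])) z"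
    using fps_fixpoint[OF unit_1] by blast
  hence "coeff \<Phi> 1 * z = y1 - fps_X * (z * z * poly s (fps_X * z))"
    by (simp add: poly_pcompose algebra_simps)
  hence "fps_X * (coeff \<Phi> 1 * z) = fps_X * y1 - fps_X * (fps_X * (z * z * poly s (fps_X * z)))"
    by (simp only: right_diff_distrib)
  hence "poly \<Phi> (fps_X * z) = fps_X * y1"
    unfolding s by (simp add: algebra_simps)
  hence "poly \<Phi> (fps_const a + fps_X * z) = y"
    using y1 by (simp add: q_poly_poly_add[OF q_poly_\<Phi>] algebra_simps)
  thus ?thesis by (rule that) simp
qed

lemma \<Phi>_surj: obtains x where "poly \<Phi> x = y"
proof -
  have "degree (\<Phi>0 + [:- (y $ 0):]) = q ^ m"
    using q_ge_2 by (subst degree_add_eq_left) (simp_all add: degree_\<Phi>0)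
  hence "degree (\<Phi>0 + [:- (y $ 0):]) > 0" using q_ge_2 by simp
  then obtain a where "poly (\<Phi>0 + [:- (y $ 0):]) a = 0" using alg_closed_imp_poly_has_root by blast
  hence "poly \<Phi>0 a = y $ 0" by simp
  thus ?thesis using \<Phi>_lift that by blast
qed

lemma of_nat_q_power: "j > 0 \<Longrightarrow> (of_nat (q ^ j) :: 'k) = 0"
proof -
  assume "j > 0"
  have "(of_nat q :: 'k) = 0"
    using arg_cong[OF of_nat_card_choose_eq_0[where 'a = 'a, of 1], of \<epsilon>] base.q_ge_2
    by (simp add: base.hom_of_nat base.q_eq)
  thus ?thesis using \<open>j > 0\<close> by simp
qed

lemma card_H1: "card (H 1) = q ^ m" and finite_H1: "finite (H 1)"
proof -
  have pd: "pderiv \<Phi>0 = [:coeff \<Phi>0 1:]"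
  proof (rule poly_eqI)
    fix i
    show "coeff (pderiv \<Phi>0) i = coeff [:coeff \<Phi>0 1:] i"
    proof (cases "i = 0 \<or> coeff \<Phi>0 (Suc i) = 0")
      case True
      thus ?thesis by (auto simp: coeff_pderiv coeff_pCons split: nat.split)
    next
      case False
      then obtain j where j: "Suc i = q ^ j" using q_poly_\<Phi>0 by (auto simp: q_poly_def)
      hence "j > 0" using False by (cases j) auto
      hence "(of_nat (Suc i) :: 'k) = 0" unfolding j by (rule of_nat_q_power)
      thus ?thesis using False by (simp add: coeff_pderiv coeff_pCons split: nat.split del: of_nat_Suc)
    qed
  qed
  have "\<Phi>0 \<noteq> 0" using unit_1 coeff_\<Phi>0 by (metis coeff_0)
  moreover have "poly (pderiv \<Phi>0) x \<noteq> 0" for x using unit_1 by (simp add: pd coeff_\<Phi>0)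
  ultimately have roots: "card {x. poly \<Phi>0 x = 0} = q ^ m" "finite {x. poly \<Phi>0 x = 0}"
    using card_roots_eq_degree[of \<Phi>0] degree_\<Phi>0 by (auto simp: poly_roots_finite)
  have "bij_betw (\<lambda>x. x $ 0) (H 1) {x. poly \<Phi>0 x = 0}"
    unfolding bij_betw_def
  proof
    show "inj_on (\<lambda>x. x $ 0) (H 1)"
    proof (rule inj_onI)
      fix x y assume "x \<in> H 1" "y \<in> H 1" "x $ 0 = y $ 0"
      thus "x = y" using H_unit[of "x - y" 1] fq_subspace_diff[OF fq_subspace_H, of x 1 y] by auto
    qed
    show "(\<lambda>x. x $ 0) ` H 1 = {x. poly \<Phi>0 x = 0}"
    proof (intro equalityI subsetI)
      fix a assume "a \<in> {x. poly \<Phi>0 x = 0}"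
      then obtain x where "poly \<Phi> x = 0" "x $ 0 = a" using \<Phi>_lift[of a 0] by auto
      thus "a \<in> (\<lambda>x. x $ 0) ` H 1" by (auto simp: H_def)
    qed (auto simp: H_def simp flip: poly_\<Phi>_nth_0)
  qed
  thus "card (H 1) = q ^ m" "finite (H 1)"
    using roots by (auto simp: bij_betw_same_card bij_betw_finite)
qed

text \<open>The fibres of \<Phi> from \<open>H (Suc n)\<close> to \<open>H n\<close> are cosets of
  \<open>H 1\<close>, and none is empty since \<Phi> is surjective.\<close>

lemma card_H: "finite (H n) \<and> card (H n) = q ^ (n * m)"
proof (induction n)
  case (Suc n)
  define t where "t y = (SOME x. poly \<Phi> x = y)" for y
  have t: "poly \<Phi> (t y) = y" for y unfolding t_def by (rule someI_ex) (metis \<Phi>_surj)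
  have "bij_betw (\<lambda>(y, h). t y + h) (H n \<times> H 1) (H (Suc n))"
    unfolding bij_betw_def
  proof
    show "inj_on (\<lambda>(y, h). t y + h) (H n \<times> H 1)"
    proof (rule inj_onI, clarify)
      fix y h y' h' assume *: "h \<in> H 1" "h' \<in> H 1" "t y + h = t y' + h'"
      have "poly \<Phi> (t z + h) = z" if "h \<in> H 1" for z h
        using that by (simp add: q_poly_poly_add[OF q_poly_\<Phi>] t H_def)
      hence "y = y'" using * by metis
      thus "y = y' \<and> h = h'" using * by simp
    qed
    show "(\<lambda>(y, h). t y + h) ` (H n \<times> H 1) = H (Suc n)"
    proof (intro equalityI subsetI)
      fix x assume "x \<in> (\<lambda>(y, h). t y + h) ` (H n \<times> H 1)"
      thus "x \<in> H (Suc n)"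
        by (auto simp: H_Suc_iff q_poly_poly_add[OF q_poly_\<Phi>] t) (simp add: H_def)
    next
      fix x assume "x \<in> H (Suc n)"
      hence "poly \<Phi> x \<in> H n" "x - t (poly \<Phi> x) \<in> H 1"
        by (simp_all add: H_Suc_iff) (simp add: H_def q_poly_poly_diff[OF q_poly_\<Phi>] t)
      thus "x \<in> (\<lambda>(y, h). t y + h) ` (H n \<times> H 1)"
        by (intro image_eqI[of _ _ "(poly \<Phi> x, x - t (poly \<Phi> x))"]) auto
    qed
  qed
  from bij_betw_same_card[OF this] bij_betw_finite[OF this] show ?case
    using Suc card_H1 finite_H1 by (simp add: card_cartesian_product power_add mult.commute)
qed (simp add: H_0)

text \<open>The isogeny that divides out the rational torsion. Its value at a torsion point retains
  only the ramified direction.\<close>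

definition P :: "nat \<Rightarrow> 'k fps poly" where "P n = vanishing_poly (H n)"

lemma q_poly_P: "q_poly q (P n)"
  unfolding P_def using card_H fq_subspace_H by (intro q_poly_vanishing_poly) auto

lemma degree_P: "degree (P n) = q ^ (n * m)"
  using card_H by (simp add: P_def degree_vanishing_poly)

lemma lead_coeff_P: "lead_coeff (P n) = 1"
  by (simp only: P_def lead_coeff_vanishing_poly)

lemma poly_P_eq_0_iff: "poly (P n) x = 0 \<longleftrightarrow> x \<in> H n"
  using card_H by (auto simp: P_def poly_vanishing_poly prod_zero_iff)

text \<open>Up to sign this coefficient is the product of the nonzero elements of
  \<open>H n\<close>, which are units by \<open>H_unit\<close>.\<close>

lemma coeff_P_1: "coeff (P n) 1 $ 0 \<noteq> 0"
proof -
  have "0 \<in> H n" using fq_subspace_H by (simp add: fq_subspace_def)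
  hence "P n = [:0, 1:] * (\<Prod>h\<in>H n - {0}. [:- h, 1:])"
    using card_H by (simp add: P_def vanishing_poly_def prod.remove[of _ 0])
  hence "coeff (P n) 1 = poly (\<Prod>h\<in>H n - {0}. [:- h, 1:]) 0"
    by (simp add: poly_0_coeff_0)
  also have "\<dots> = (\<Prod>h\<in>H n - {0}. - h)" by (simp add: poly_prod)
  also have "\<dots> $ 0 = (\<Prod>h\<in>H n - {0}. (- h) $ 0)"
    by (rule fps_prod_nth_0)
  also have "\<dots> \<noteq> 0" using card_H H_unit by (auto simp: prod_zero_iff)
  finally show ?thesis .
qed

text \<open>
  The isogeny with kernel \<open>H n\<close>, applied to \<open>\<Phi>\<close>, has the kernel \<open>H (Suc n)\<close> inside the power
  series, so it factors through \<open>P (Suc n)\<close> with a quotient of \<open>\<tau>\<close>-degree one.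
\<close>

lemma P_pcompose_\<Phi>:
  obtains a where "a $ 0 \<noteq> 0"
    "pcompose (P n) \<Phi> = smult (lead_coeff \<Phi> ^ (q ^ (n * m))) (P (Suc n) ^ q) + smult a (P (Suc n))"
proof -
  define N where "N = pcompose (P n) \<Phi>"
  define b where "b = lead_coeff \<Phi> ^ (q ^ (n * m))"
  define d where "d = Suc n * m"
  define Q where "Q = P (Suc n)"
  define D where "D = N - smult b (Q ^ q)"
  define a where "a = coeff D (q ^ d)"
  define E where "E = D - smult a Q"
  have Q: "degree Q = q ^ d" "lead_coeff Q = 1" "q_poly q Q"
    unfolding Q_def d_def by (rule degree_P lead_coeff_P q_poly_P)+
  have "q_poly q N" unfolding N_def by (intro q_poly_pcompose q_poly_P q_poly_\<Phi>)
  hence qD: "q_poly q D" unfolding D_def by (intro q_poly_diff q_poly_smult q_poly_power1 Q)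
  have "lead_coeff \<Phi> \<noteq> 0" using lead_1 by auto
  hence "b \<noteq> 0" by (simp add: b_def)
  have "degree \<Phi> > 0" using degree_\<Phi> q_ge_2 by simp
  have degN: "degree N = q ^ Suc d"
    by (simp add: N_def degree_pcompose degree_P degree_\<Phi> d_def power_add algebra_simps)
  have lcN: "lead_coeff N = b"
    unfolding N_def lead_coeff_comp[OF \<open>degree \<Phi> > 0\<close>] lead_coeff_P by (simp add: degree_P b_def)
  have "Q \<noteq> 0" using Q(2) by auto
  hence "degree (smult b (Q ^ q)) = degree N"
    using Q \<open>b \<noteq> 0\<close> by (simp add: degN degree_power_eq)
  moreover have "lead_coeff (smult b (Q ^ q)) = lead_coeff N"
    by (metis lead_coeff_smult lead_coeff_power Q(2) lcN power_one mult_1_right)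
  ultimately have "D = 0 \<or> degree D < q ^ Suc d"
    unfolding D_def degN[symmetric] by (rule degree_diff_less_if_lead_coeff_eq)
  hence "degree D < q ^ Suc d" using q_ge_2 by auto
  \<comment> \<open>Degrees of F_q-linear polynomials are powers of \<open>q\<close>, so losing the
    top term costs a whole factor \<open>q\<close>. After one more subtraction \<open>E\<close> has
    degree below \<open>q ^ d\<close> unless it is zero, yet it vanishes on the \<open>q ^ d\<close>
    points of \<open>H (Suc n)\<close>.\<close>
  hence "degree D \<le> q ^ d" by (rule q_poly_degree_less[OF q_ge_2 qD])
  hence "degree E \<le> q ^ d" unfolding E_def using Q
    by (intro degree_diff_le) (auto intro: order.trans[OF degree_smult_le])
  moreover have "coeff E (q ^ d) = 0" using Q by (simp add: E_def a_def)
  ultimately have degE: "E = 0 \<or> degree E < q ^ d" by (metis le_neq_implies_less leading_coeff_0_iff)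
  have "poly E h = 0" if "h \<in> H (Suc n)" for h
  proof -
    have "poly Q h = 0" using that by (simp add: Q_def poly_P_eq_0_iff)
    moreover have "poly N h = 0"
      using that by (simp add: N_def poly_pcompose poly_P_eq_0_iff H_Suc_iff)
    ultimately show ?thesis using q_ge_2 by (simp add: E_def D_def power_0_left)
  qed
  hence "H (Suc n) \<subseteq> {x. poly E x = 0}" by blast
  hence "q ^ d \<le> card {x. poly E x = 0}" if "E \<noteq> 0"
    using card_mono[OF poly_roots_finite[OF that] \<open>H (Suc n) \<subseteq> _\<close>] card_H[of "Suc n"] by (simp add: d_def)
  hence "E = 0" using degE card_poly_roots_bound[of E] by force
  hence eq: "N = smult b (Q ^ q) + smult a Q" by (simp add: E_def D_def algebra_simps)
  \<comment> \<open>Comparison of linear terms, read off as derivatives at 0. The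
    \<open>q\<close>-th power contributes nothing, so \<open>a\<close> is a quotient of
    units.\<close>
  have "(of_nat q :: 'k fps) = 0"
    using of_nat_q_power[of 1] by (simp flip: fps_of_nat)
  hence "poly (pderiv N) 0 = a * coeff Q 1"
    by (simp add: eq pderiv_add pderiv_smult pderiv_power poly_0_coeff_0 coeff_pderiv)
  moreover have "poly (pderiv N) 0 = coeff (P n) 1 * coeff \<Phi> 1"
    by (simp add: N_def pderiv_pcompose poly_pcompose) (simp add: poly_0_coeff_0 coeff_pderiv)
  ultimately have "a $ 0 * coeff Q 1 $ 0 = coeff (P n) 1 $ 0 * coeff \<Phi> 1 $ 0"
    by (metis fps_mult_nth_0)
  hence "a $ 0 \<noteq> 0" using coeff_P_1[of n] unit_1 by auto
  thus ?thesis using that eq unfolding N_def Q_def b_def by blast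
qed

end

text \<open>Used for two domains: A inside the algebraic closure of F, and the power series ring
  inside the algebraic closure of its fraction field.\<close>

definition frac_ac :: "'b :: idom \<Rightarrow> 'b fract alg_closure" where
  "frac_ac x = to_ac (to_fract x)"

interpretation frac_ac: inj_idom_hom frac_ac
  by unfold_locales (auto simp: frac_ac_def)

interpretation frac_ac_poly: map_poly_inj_idom_hom frac_ac ..

lemma frac_ac_eq_iff [simp]: "frac_ac x = frac_ac y \<longleftrightarrow> x = y"
  by (simp add: frac_ac_def)

lemma map_poly_const: "h 0 = 0 \<Longrightarrow> map_poly h [:c:] = [:h c:]"
  by (rule poly_eqI) (simp add: coeff_map_poly coeff_pCons split: nat.split)

lemma map_poly_frac_ac: "map_poly frac_ac p = map_poly to_ac (fract_poly p)"
  by (simp add: map_poly_map_poly o_def frac_ac_def[abs_def])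

lemma ac_hom_frac_ac: "ac_hom \<sigma> \<Longrightarrow> \<sigma> (frac_ac x) = frac_ac x"
  by (simp add: frac_ac_def ac_hom_to_ac)

lemma ac_hom_poly_frac_ac:
  "ac_hom \<sigma> \<Longrightarrow> \<sigma> (poly (map_poly frac_ac p) x) = poly (map_poly frac_ac p) (\<sigma> x)"
  unfolding map_poly_frac_ac by (rule ac_hom_poly)

theorem eisenstein_conjugate:
  fixes f :: "'b :: idom poly"
  assumes "prime_elem \<pi>" "\<And>c. c \<noteq> 0 \<Longrightarrow> \<exists>k c'. c = \<pi> ^ k * c' \<and> \<not> \<pi> dvd c'"
    "degree f > 0" "\<not> \<pi> dvd lead_coeff f" "\<And>i. i < degree f \<Longrightarrow> \<pi> dvd coeff f i"
    "\<not> \<pi> ^ 2 dvd coeff f 0"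
    and "poly (map_poly frac_ac f) x = 0" "poly (map_poly frac_ac f) y = 0"
  obtains \<sigma> where "ac_hom \<sigma>" "\<sigma> x = y"
proof -
  have "irreducible (fract_poly f)" by (rule eisenstein_irreducible) (fact assms)+
  thus ?thesis using ac_hom_conjugate that assms(7,8) unfolding map_poly_frac_ac by blast
qed

text \<open>The version for roots of negative valuation: the reciprocal polynomial is Eisenstein,
  and a map conjugating the inverses conjugates the roots.\<close>

theorem eisenstein_conjugate_reverse:
  fixes f :: "'b :: idom poly"
  assumes "prime_elem \<pi>" "\<And>c. c \<noteq> 0 \<Longrightarrow> \<exists>k c'. c = \<pi> ^ k * c' \<and> \<not> \<pi> dvd c'"
    "degree f > 0" "\<not> \<pi> dvd coeff f 0" "\<And>i. 0 < i \<Longrightarrow> \<pi> dvd coeff f i"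
    "\<not> \<pi> ^ 2 dvd lead_coeff f"
    and xy: "poly (map_poly frac_ac f) x = 0" "poly (map_poly frac_ac f) y = 0"
  obtains \<sigma> where "ac_hom \<sigma>" "\<sigma> x = y"
proof -
  have f0: "coeff f 0 \<noteq> 0" using assms(4) by auto
  have nz: "z \<noteq> 0" if "poly (map_poly frac_ac f) z = 0" for z
    using f0 that by (auto simp: poly_0_coeff_0)
  have refl: "map_poly frac_ac (reflect_poly f) = reflect_poly (map_poly frac_ac f)"
    by (rule poly_eqI) (simp add: coeff_reflect_poly)
  have root: "poly (map_poly frac_ac (reflect_poly f)) (inverse z) = 0"
    if "poly (map_poly frac_ac f) z = 0" for z
    using that nz[OF that] by (simp add: refl poly_reflect_poly_nz)
  obtain \<sigma> where \<sigma>: "ac_hom \<sigma>" "\<sigma> (inverse x) = inverse y"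
  proof (rule eisenstein_conjugate)
    show "\<pi> dvd coeff (reflect_poly f) i" if "i < degree (reflect_poly f)" for i
      using that f0 assms(5) by (simp add: coeff_reflect_poly)
    show "\<not> \<pi> dvd lead_coeff (reflect_poly f)"
      using f0 assms(4) by (simp add: coeff_reflect_poly)
    show "poly (map_poly frac_ac (reflect_poly f)) (inverse x) = 0"
      "poly (map_poly frac_ac (reflect_poly f)) (inverse y) = 0"
      using root xy by blast+
  qed (use assms f0 root in auto)
  interpret \<sigma>: comm_ring_hom \<sigma> using \<sigma>(1) by (rule ac_hom_comm_ring_hom)
  have "\<sigma> x * \<sigma> (inverse x) = 1" using nz[OF xy(1)] by (simp flip: \<sigma>.hom_mult)
  hence "\<sigma> x * inverse y = 1" by (simp only: \<sigma>(2))
  hence "\<sigma> x = y" using nz[OF xy(2)] by (simp add: field_simps)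
  thus ?thesis using that \<sigma>(1) by blast
qed

section \<open>Ramified torsion points and their conjugates over the completed field\<close>

context local_module
begin

sublocale K: fq_algebra "\<lambda>c. frac_ac (fps_const (\<epsilon> c))" q
  by unfold_locales (simp_all add: base.hom_add base.hom_mult base.q_eq frac_ac.hom_add frac_ac.hom_mult
      flip: fps_const_add fps_const_mult)

abbreviation \<Phi>K where "\<Phi>K \<equiv> poly (map_poly frac_ac \<Phi>)"

abbreviation PK where "PK n \<equiv> poly (map_poly frac_ac (P n))"

lemma q_poly_\<Phi>K: "q_poly q (map_poly frac_ac \<Phi>)"
  by (intro q_poly_map_poly q_poly_\<Phi>) simp

lemma q_poly_PK: "q_poly q (map_poly frac_ac (P n))"
  by (intro q_poly_map_poly q_poly_P) simp

lemma PK_frac_ac: "PK n (frac_ac x) = frac_ac (poly (P n) x)"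
  by simp

lemma PK_eq_0_imp:
  assumes "PK n x = 0"
  shows "x \<in> frac_ac ` H n"
proof -
  have "PK n x = (\<Prod>h\<in>H n. x - frac_ac h)"
    by (simp add: P_def vanishing_poly_def frac_ac_poly.hom_prod poly_prod map_poly_pCons frac_ac.hom_uminus)
  thus ?thesis using assms card_H by (auto simp: prod_zero_iff)
qed

lemma lead_coeff_\<Phi>_power:
  assumes "k > 1" obtains c where "lead_coeff \<Phi> ^ k = lead_coeff \<Phi> * (fps_X * c)"
proof -
  obtain c where c: "lead_coeff \<Phi> = fps_X * c" using lead_0 by (rule fps_X_dvdE)
  have "k = Suc (Suc (k - 2))" using assms by simp
  hence "lead_coeff \<Phi> ^ k = lead_coeff \<Phi> * (lead_coeff \<Phi> * lead_coeff \<Phi> ^ (k - 2))"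
    by (metis power_Suc)
  thus ?thesis using that[of "c * lead_coeff \<Phi> ^ (k - 2)"] c by (simp add: mult.assoc)
qed

lemma PK_relation:
  obtains a where "a $ 0 \<noteq> 0"
    "\<And>x. PK n (\<Phi>K x) = frac_ac (lead_coeff \<Phi>) ^ (q ^ (n * m)) * PK (Suc n) x ^ q + frac_ac a * PK (Suc n) x"
proof -
  obtain a where a: "a $ 0 \<noteq> 0"
    "pcompose (P n) \<Phi> = smult (lead_coeff \<Phi> ^ (q ^ (n * m))) (P (Suc n) ^ q) + smult a (P (Suc n))"
    by (rule P_pcompose_\<Phi>)
  have "PK n (\<Phi>K x) = poly (map_poly frac_ac (pcompose (P n) \<Phi>)) x" for x
    by (simp add: frac_ac.map_poly_pcompose poly_pcompose)
  thus ?thesis using a(1)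
    by (intro that[of a]) (simp_all add: a(2) frac_ac.hom_power frac_ac_poly.hom_add
        frac_ac_poly.hom_power frac_ac.map_poly_hom_smult)
qed

text \<open>
  The points \<open>\<xi> n\<close> lie over the element \<open>y1\<close> of valuation \<open>-1/(q-1)\<close>, up to units: all
  \<open>P n (\<xi> n) / y1\<close> are units of the power series ring.
\<close>

lemma torsion_tower:
  obtains a1 y1 \<xi> where "a1 $ 0 \<noteq> 0" "frac_ac (lead_coeff \<Phi>) * y1 ^ (q - 1) = - frac_ac a1"
    "\<xi> 0 = 0" "\<And>n. \<Phi>K (\<xi> (Suc n)) = \<xi> n"
    "\<And>n. \<exists>w. w $ 0 \<noteq> 0 \<and> PK (Suc n) (\<xi> (Suc n)) = y1 * frac_ac w"
proof -
  define b where "b = lead_coeff \<Phi>"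
  have "b \<noteq> 0" using lead_1 by (auto simp: b_def)
  have P0: "PK 0 x = x" for x
    by (simp add: P_def H_0 vanishing_poly_def)
  obtain a1 where a1: "a1 $ 0 \<noteq> 0" "\<And>x. \<Phi>K x = frac_ac b * PK 1 x ^ q + frac_ac a1 * PK 1 x"
    using PK_relation[of 0] by (auto simp: P0 b_def)
  \<comment> \<open>Chosen so that \<open>frac_ac b * y1 ^ q + frac_ac a1 * y1 = 0\<close>: any
    point with \<open>PK 1\<close> equal to \<open>y1\<close> is then T-torsion, and is not
    rational.\<close>
  obtain y1 where "y1 ^ (q - 1) = - frac_ac a1 / frac_ac b"
    using nth_root_exists[of "q - 1"] q_ge_2 by auto
  hence y1: "frac_ac b * y1 ^ (q - 1) = - frac_ac a1" using \<open>b \<noteq> 0\<close> by simp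
  define Q where "Q n x \<longleftrightarrow> (\<exists>w. w $ 0 \<noteq> 0 \<and> PK (Suc n) x = y1 * frac_ac w) \<and> (n = 0 \<longrightarrow> \<Phi>K x = 0)" for n x
  have y1q: "y1 ^ q = y1 * y1 ^ (q - 1)" using q_ge_2 by (simp flip: power_Suc)
  have "degree (map_poly frac_ac (P n)) > 0" for n
    using q_ge_2 by (simp add: degree_P)
  hence root: "\<exists>x. PK n x = y" for n y
  proof -
    have "degree (map_poly frac_ac (P n) + [:- y:]) > 0"
      using \<open>\<And>n. degree (map_poly frac_ac (P n)) > 0\<close>[of n] by (subst degree_add_eq_left) auto
    then obtain x where "poly (map_poly frac_ac (P n) + [:- y:]) x = 0"
      using alg_closed_imp_poly_has_root by blast
    thus ?thesis by (intro exI[of _ x]) simp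
  qed
  have "\<exists>x. Q 0 x"
  proof -
    obtain x where x: "PK 1 x = y1" using root by blast
    have "\<Phi>K x = y1 * (frac_ac b * y1 ^ (q - 1) + frac_ac a1)"
      unfolding a1(2) x by (simp add: y1q algebra_simps)
    hence "\<Phi>K x = 0" using y1 by simp
    moreover have "PK (Suc 0) x = y1 * frac_ac 1" using x by simp
    ultimately have "Q 0 x" unfolding Q_def by (intro conjI exI[of _ 1]) simp_all
    thus ?thesis ..
  qed
  moreover have "\<exists>x'. Q (Suc n) x' \<and> \<Phi>K x' = x" if Qx: "Q n x" for n x
  proof -
    obtain w where w: "w $ 0 \<noteq> 0" "PK (Suc n) x = y1 * frac_ac w" using Qx unfolding Q_def by blast
    obtain a where a: "a $ 0 \<noteq> 0"
      "\<And>x. PK (Suc n) (\<Phi>K x) = frac_ac b ^ (q ^ (Suc n * m)) * PK (Suc (Suc n)) x ^ q + frac_ac a * PK (Suc (Suc n)) x"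
      using PK_relation[of "Suc n"] unfolding b_def by blast
    have "q ^ (Suc n * m) > 1" using q_ge_2 m_pos by (intro one_less_power) auto
    then obtain c where c: "b ^ (q ^ (Suc n * m)) = b * (fps_X * c)"
      unfolding b_def by (rule lead_coeff_\<Phi>_power)
    \<comment> \<open>With \<open>y1 * frac_ac v\<close> as the value of \<open>PK\<close> the
      required equation becomes divisible by \<open>y1\<close>. One factor \<open>b\<close> of the
      large power of the leading coefficient combines with \<open>y1 ^ (q - 1)\<close> to
      \<open>- frac_ac a1\<close>; the rest is a multiple of X, so the equation for \<open>v\<close>
      is a contraction.\<close>
    obtain v where v: "a * v = w + fps_X * poly (monom (c * a1) q) v"
      using fps_fixpoint[OF a(1)] by blast
    have "a $ 0 * v $ 0 = w $ 0" using arg_cong[OF v, of "\<lambda>f. f $ 0"] by simp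
    hence v0: "v $ 0 \<noteq> 0" using w by auto
    obtain x0 where x0: "PK (Suc (Suc n)) x0 = y1 * frac_ac v" using root by blast
    have "frac_ac b ^ (q ^ (Suc n * m)) = frac_ac b * frac_ac (fps_X * c)"
      by (simp only: c flip: frac_ac.hom_power frac_ac.hom_mult)
    hence "PK (Suc n) (\<Phi>K x0) =
        y1 * (frac_ac a * frac_ac v + (frac_ac b * y1 ^ (q - 1)) * frac_ac (fps_X * c) * frac_ac v ^ q)"
      by (simp only: a(2) x0 power_mult_distrib y1q) (simp add: algebra_simps)
    also have "\<dots> = y1 * frac_ac (a * v - fps_X * (c * a1 * v ^ q))"
      unfolding y1 by (simp add: frac_ac.hom_mult frac_ac.hom_minus frac_ac.hom_power algebra_simps)
    also have "a * v - fps_X * (c * a1 * v ^ q) = w" by (simp add: v poly_monom)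
    finally have "PK (Suc n) (\<Phi>K x0 - x) = 0"
      by (simp add: w K.q_poly_poly_diff[OF q_poly_PK])
    then obtain h where h: "h \<in> H (Suc n)" "\<Phi>K x0 - x = frac_ac h" using PK_eq_0_imp by blast
    \<comment> \<open>\<open>x0\<close> lies above \<open>x\<close> only up to a rational torsion
      point \<open>h\<close>. Subtracting a rational preimage of \<open>h\<close> corrects this and
      does not change the value of the next isogeny.\<close>
    obtain h' where h': "poly \<Phi> h' = h" by (rule \<Phi>_surj)
    hence "h' \<in> H (Suc (Suc n))" using h by (simp add: H_Suc_iff[of _ "Suc n"])
    hence "PK (Suc (Suc n)) (frac_ac h') = 0" by (simp add: poly_P_eq_0_iff)
    hence "PK (Suc (Suc n)) (x0 - frac_ac h') = y1 * frac_ac v"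
      by (simp add: K.q_poly_poly_diff[OF q_poly_PK] x0)
    moreover have "\<Phi>K (x0 - frac_ac h') = x"
      using h(2) by (simp add: K.q_poly_poly_diff[OF q_poly_\<Phi>K] h' algebra_simps)
    ultimately show ?thesis using v0 unfolding Q_def by blast
  qed
  ultimately obtain x where x: "\<And>n. Q n (x n)" "\<And>n. \<Phi>K (x (Suc n)) = x n"
    using dependent_nat_choice[of Q "\<lambda>n x y. \<Phi>K y = x"] by metis
  show ?thesis
  proof (rule that[of a1 y1 "case_nat 0 x"])
    show "\<Phi>K (case_nat 0 x (Suc n)) = case_nat 0 x n" for n
      using x by (cases n) (auto simp: Q_def)
    show "\<exists>w. w $ 0 \<noteq> 0 \<and> PK (Suc n) (case_nat 0 x (Suc n)) = y1 * frac_ac w" for n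
      using x(1)[of n] by (simp add: Q_def)
  qed (use a1 y1 in \<open>auto simp: b_def\<close>)
qed

text \<open>\<open>P n\<close> kills \<open>h\<close>, commutes with the scalar \<open>c\<close>,
  and c^(q-1) = 1. So both points are roots of one polynomial, a multiple of
  \<open>P n ^ (q - 1)\<close> plus a unit constant. Its leading coefficient has valuation one, so
  it is Eisenstein when reversed.\<close>

theorem local_galois_action:
  obtains \<xi> where "\<xi> 0 = 0" "\<And>n. \<Phi>K (\<xi> (Suc n)) = \<xi> n" "\<xi> 1 \<notin> range frac_ac"
    "\<And>n h c. (poly \<Phi> ^^ n) h = 0 \<Longrightarrow> c \<noteq> 0 \<Longrightarrow>
       \<exists>\<tau>. ac_hom \<tau> \<and> \<tau> (\<xi> n) = frac_ac (fps_const (\<epsilon> c)) * \<xi> n + frac_ac h"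
proof -
  obtain a1 y1 \<xi> where a1: "a1 $ 0 \<noteq> 0" "frac_ac (lead_coeff \<Phi>) * y1 ^ (q - 1) = - frac_ac a1"
    and \<xi>: "\<xi> 0 = 0" "\<And>n. \<Phi>K (\<xi> (Suc n)) = \<xi> n"
    and w: "\<And>n. \<exists>w. w $ 0 \<noteq> 0 \<and> PK (Suc n) (\<xi> (Suc n)) = y1 * frac_ac w"
    by (rule torsion_tower) blast
  have "y1 \<noteq> 0" using a1 q_ge_2 by (auto simp: power_0_left)
  have "\<xi> 1 \<notin> range frac_ac"
  proof
    assume "\<xi> 1 \<in> range frac_ac"
    then obtain x where x: "\<xi> 1 = frac_ac x" by blast
    have "frac_ac (poly \<Phi> x) = 0" using \<xi>(2)[of 0] \<xi>(1) x by simp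
    hence "poly (P 1) x = 0" by (simp add: poly_P_eq_0_iff H_def)
    hence "PK 1 (\<xi> 1) = 0" by (simp only: x PK_frac_ac frac_ac.hom_zero)
    moreover obtain w where "w $ 0 \<noteq> 0" "PK 1 (\<xi> 1) = y1 * frac_ac w" using w[of 0] by auto
    ultimately show False using \<open>y1 \<noteq> 0\<close> by auto
  qed
  moreover have "\<exists>\<tau>. ac_hom \<tau> \<and> \<tau> (\<xi> n) = frac_ac (fps_const (\<epsilon> c)) * \<xi> n + frac_ac h"
    if h: "(poly \<Phi> ^^ n) h = 0" and c: "c \<noteq> 0" for n h c
  proof (cases n)
    case 0
    thus ?thesis using h \<xi> by (intro exI[of _ id]) (auto simp: ac_hom_id)
  next
    case (Suc k)
    obtain v where v: "v $ 0 \<noteq> 0" "PK n (\<xi> n) = y1 * frac_ac v" using w[of k] Suc by auto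
    define f where "f = smult (lead_coeff \<Phi>) (P n ^ (q - 1)) + [:a1 * v ^ (q - 1):]"
    have b: "lead_coeff \<Phi> \<noteq> 0" using lead_1 by auto
    have "degree (P n ^ (q - 1)) > 0"
      using q_ge_2 degree_P[of n] by (subst degree_power_eq) auto
    hence deg: "degree f = degree (P n ^ (q - 1))" unfolding f_def
      using b by (subst degree_add_eq_left) auto
    have coeff_f: "coeff f i = lead_coeff \<Phi> * coeff (P n ^ (q - 1)) i" if "i > 0" for i
      using that by (simp add: f_def coeff_pCons split: nat.split)
    have lead: "lead_coeff f = lead_coeff \<Phi>"
      using coeff_f[of "degree f"] deg \<open>degree (P n ^ (q - 1)) > 0\<close>
        lead_coeff_power[of "P n" "q - 1"] lead_coeff_P[of n] by simp
    have eval: "poly (map_poly frac_ac f) x =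
        frac_ac (lead_coeff \<Phi>) * PK n x ^ (q - 1) + frac_ac a1 * frac_ac v ^ (q - 1)" for x
      by (simp add: f_def frac_ac_poly.hom_add frac_ac_poly.hom_power frac_ac.map_poly_hom_smult
          frac_ac.hom_mult frac_ac.hom_power map_poly_const)
    have root: "poly (map_poly frac_ac f) x = 0" if "PK n x = frac_ac (fps_const (\<epsilon> d)) * (y1 * frac_ac v)" "d \<noteq> 0" for x d
    proof -
      have "d ^ (q - 1) * d = d" using q_ge_2 base.q_eq
        by (metis finite_field_power_card_eq_same power_minus_mult zero_less_card_finite)
      hence "d ^ (q - 1) = 1" using \<open>d \<noteq> 0\<close> by simp
      hence "frac_ac (fps_const (\<epsilon> d)) ^ (q - 1) = 1" by (metis K.hom_one K.hom_power)
      hence "PK n x ^ (q - 1) = y1 ^ (q - 1) * frac_ac v ^ (q - 1)"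
        by (simp add: that power_mult_distrib)
      hence "poly (map_poly frac_ac f) x =
          (frac_ac (lead_coeff \<Phi>) * y1 ^ (q - 1) + frac_ac a1) * frac_ac v ^ (q - 1)"
        by (simp add: eval algebra_simps)
      thus ?thesis unfolding a1(2) by simp
    qed
    have "PK n (frac_ac h) = 0" using h by (simp add: poly_P_eq_0_iff H_def)
    hence PK_h: "PK n (frac_ac (fps_const (\<epsilon> c)) * \<xi> n + frac_ac h) = frac_ac (fps_const (\<epsilon> c)) * (y1 * frac_ac v)"
      by (simp add: K.q_poly_poly_add[OF q_poly_PK] K.q_poly_poly_scale[OF q_poly_PK] v)
    have "0 \<in> H n" using fq_subspace_H by (simp add: fq_subspace_def)
    hence "poly (P n) 0 = 0" by (simp add: poly_P_eq_0_iff)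
    hence f0: "coeff f 0 = a1 * v ^ (q - 1)"
      using q_ge_2 by (simp add: f_def power_0_left flip: poly_0_coeff_0)
    obtain \<tau> where "ac_hom \<tau>" "\<tau> (\<xi> n) = frac_ac (fps_const (\<epsilon> c)) * \<xi> n + frac_ac h"
    proof (rule eisenstein_conjugate_reverse[OF prime_elem_fps_X fps_X_multiplicity])
      show "degree f > 0" using deg \<open>degree (P n ^ (q - 1)) > 0\<close> by simp
      show "\<not> fps_X dvd coeff f 0" using a1 v by (simp add: f0 fps_X_dvd_iff fps_power_zeroth)
      show "fps_X dvd coeff f i" if "0 < i" for i
        using lead_0 by (simp add: coeff_f[OF that] fps_X_dvd_iff)
      show "\<not> fps_X ^ 2 dvd lead_coeff f"
        unfolding lead fps_X_power_dvd_iff using lead_1 by (auto intro: exI[of _ 1])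
      show "poly (map_poly frac_ac f) (\<xi> n) = 0" using v by (intro root[of _ 1]) auto
      show "poly (map_poly frac_ac f) (frac_ac (fps_const (\<epsilon> c)) * \<xi> n + frac_ac h) = 0"
        using PK_h c by (rule root)
    qed auto
    thus ?thesis by blast
  qed
  ultimately show ?thesis using that \<xi> by blast
qed

end

section \<open>The polynomial of a Drinfeld module\<close>

text \<open>The coefficients stay in A so that the same polynomial can be read over F and, through
  \<open>expand\<close>, over the completion.\<close>

definition phi_poly :: "nat \<Rightarrow> (nat \<Rightarrow> 'a :: finite_field poly) \<Rightarrow> 'a poly poly" where
  "phi_poly r g = monom [:0, 1:] 1 + (\<Sum>i=1..r. monom (g i) (CARD('a) ^ i))"

lemma q_power_eq_iff [simp]: "CARD('a :: finite_field) ^ i = CARD('a) ^ j \<longleftrightarrow> i = j"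
  using card_finite_field_ge_2[where 'a = 'a] by simp

lemma q_neq_Suc_0 [simp]: "CARD('a :: finite_field) \<noteq> Suc 0"
  using card_finite_field_ge_2[where 'a = 'a] by simp

lemma q_power_eq_Suc_0_iff [simp]: "CARD('a :: finite_field) ^ i = Suc 0 \<longleftrightarrow> i = 0"
  using q_power_eq_iff[where 'a = 'a, of i 0] by (simp del: q_power_eq_iff)

lemma coeff_phi_poly_1: "coeff (phi_poly r g) 1 = [:0, 1:]"
  by (auto simp: phi_poly_def coeff_sum)

lemma coeff_phi_poly_power:
  fixes g :: "nat \<Rightarrow> 'a :: finite_field poly"
  assumes "1 \<le> i"
  shows "coeff (phi_poly r g) (CARD('a) ^ i) = (if i \<le> r then g i else 0)"
proof -
  have "CARD('a) ^ i \<noteq> Suc 0" using assms by (simp only: q_power_eq_Suc_0_iff)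
  thus ?thesis using assms by (simp add: phi_poly_def coeff_sum coeff_monom eq_commute[of "Suc 0"])
qed

lemma q_poly_phi_poly: "q_poly CARD('a) (phi_poly r g)" for g :: "nat \<Rightarrow> 'a :: finite_field poly"
  unfolding phi_poly_def
  by (intro q_poly_add q_poly_sum q_poly_monom) (use q_poly_monom[of "CARD('a)" _ 0] in simp)

lemma degree_phi_poly_le: "degree (phi_poly r g) \<le> CARD('a) ^ r" for g :: "nat \<Rightarrow> 'a :: finite_field poly"
  unfolding phi_poly_def
  by (intro degree_add_le degree_sum_le order.trans[OF degree_monom_le] power_increasing)
     (auto simp: Suc_le_eq)

lemma degree_phi_poly:
  fixes g :: "nat \<Rightarrow> 'a :: finite_field poly"
  assumes "r \<ge> 1" "g r \<noteq> 0"
  shows "degree (phi_poly r g) = CARD('a) ^ r"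
  using assms by (intro antisym degree_phi_poly_le le_degree) (simp add: coeff_phi_poly_power)

lemma lead_coeff_phi_poly:
  fixes g :: "nat \<Rightarrow> 'a :: finite_field poly"
  assumes "r \<ge> 1" "g r \<noteq> 0"
  shows "lead_coeff (phi_poly r g) = g r"
  using assms by (simp add: degree_phi_poly coeff_phi_poly_power)

definition eps :: "'a :: finite_field \<Rightarrow> 'a ratfun_ac" where
  "eps c = frac_ac [:c:]"

interpretation eps: fq_algebra "eps :: 'a :: finite_field \<Rightarrow> 'a ratfun_ac" "CARD('a)"
  by unfold_locales (simp_all add: eps_def one_pCons flip: frac_ac.hom_add frac_ac.hom_mult)

lemma ac_hom_eps: "ac_hom \<sigma> \<Longrightarrow> \<sigma> (eps c) = eps c"
  by (simp add: eps_def ac_hom_frac_ac)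

definition phi :: "nat \<Rightarrow> (nat \<Rightarrow> 'a :: finite_field poly) \<Rightarrow> 'a ratfun_ac \<Rightarrow> 'a ratfun_ac" where
  "phi r g = poly (map_poly frac_ac (phi_poly r g))"

lemma q_poly_phi: "q_poly CARD('a) (map_poly frac_ac (phi_poly r g))" for g :: "nat \<Rightarrow> 'a :: finite_field poly"
  by (intro q_poly_map_poly q_poly_phi_poly) simp

lemmas phi_add = eps.q_poly_poly_add[OF q_poly_phi, folded phi_def]
lemmas phi_diff = eps.q_poly_poly_diff[OF q_poly_phi, folded phi_def]
lemmas phi_scale = eps.q_poly_poly_scale[OF q_poly_phi, folded phi_def]
lemmas phi_0 [simp] = eps.q_poly_poly_0[OF q_poly_phi, folded phi_def]
lemmas phi_sum = eps.q_poly_poly_sum[OF q_poly_phi, folded phi_def]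

lemma ac_hom_phi: "ac_hom \<sigma> \<Longrightarrow> \<sigma> (phi r g x) = phi r g (\<sigma> x)"
  unfolding phi_def by (rule ac_hom_poly_frac_ac)

section \<open>Transport from the completion\<close>

lemma algebraic_over_domain:
  fixes x :: "'b :: idom fract alg_closure"
  obtains p :: "'b poly" where "p \<noteq> 0" "poly (map_poly frac_ac p) x = 0"
proof -
  obtain P :: "'b fract poly" where P: "P \<noteq> 0" "poly (map_poly to_ac P) x = 0"
    by (rule alg_closure_algebraic)
  obtain c p where cp: "c \<noteq> 0" "smult (to_fract c) P = fract_poly p"
    by (rule fract_poly_clear_denominators)
  have "p \<noteq> 0" using cp P by auto
  moreover have "poly (map_poly frac_ac p) x = 0"
    unfolding map_poly_frac_ac using P by (simp add: to_ac.map_poly_hom_smult flip: cp(2))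
  ultimately show ?thesis by (rule that)
qed

text \<open>The polynomial splits before it is mapped, so its image has no roots other than the
  images of these.\<close>

lemma root_in_range:
  fixes \<iota> :: "'b :: alg_closed_field \<Rightarrow> 'c :: field"
  assumes "comm_ring_hom \<iota>" "f \<noteq> 0" "poly (map_poly \<iota> f) z = 0"
  shows "z \<in> range \<iota>"
proof -
  interpret comm_ring_hom \<iota> by fact
  interpret I: map_poly_comm_ring_hom \<iota> ..
  show ?thesis using assms(2,3)
  proof (induction "degree f" arbitrary: f)
    case 0
    then obtain c where "f = [:c:]" "c \<noteq> 0" by (metis degree_eq_zeroE pCons_0_0)
    thus ?case using 0 comm_ring_hom_zero_iff[OF assms(1)] by (simp add: map_poly_const)
  next
    case (Suc n)
    then obtain a where "poly f a = 0" using alg_closed_imp_poly_has_root by (metis zero_less_Suc)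
    then obtain s where s: "f = [:- a, 1:] * s" using poly_eq_0_iff_dvd by blast
    hence "s \<noteq> 0" using Suc by auto
    hence "degree f = Suc (degree s)" unfolding s by (subst degree_mult_eq) auto
    moreover have "map_poly \<iota> f = [:- \<iota> a, 1:] * map_poly \<iota> s"
      unfolding s I.hom_mult by (simp add: map_poly_pCons hom_uminus)
    from arg_cong[OF this, of "\<lambda>p. poly p z"]
    have "poly (map_poly \<iota> f) z = (z - \<iota> a) * poly (map_poly \<iota> s) z"
      by (simp add: algebra_simps)
    hence "z = \<iota> a \<or> poly (map_poly \<iota> s) z = 0" using Suc.prems by simp
    ultimately show ?case using Suc \<open>s \<noteq> 0\<close> by auto
  qed
qed

text \<open>Expansion at the point \<open>\<alpha>\<close>: the element \<open>T\<close> is sent to \<open>\<alpha> + X\<close>.\<close>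

definition expand :: "'a :: field alg_closure \<Rightarrow> 'a poly \<Rightarrow> 'a alg_closure fps" where
  "expand \<alpha> f = fps_of_poly (pcompose (map_poly to_ac f) [:\<alpha>, 1:])"

lemma expand_nth_0: "expand \<alpha> f $ 0 = poly (map_poly to_ac f) \<alpha>"
  by (simp add: expand_def poly_pcompose flip: poly_0_coeff_0)

lemma expand_nth_1: "expand \<alpha> f $ 1 = poly (map_poly to_ac (pderiv f)) \<alpha>"
proof -
  have "expand \<alpha> f $ 1 = poly (pderiv (pcompose (map_poly to_ac f) [:\<alpha>, 1:])) 0"
    by (simp add: expand_def poly_0_coeff_0 coeff_pderiv)
  thus ?thesis by (simp add: pderiv_pcompose poly_pcompose pderiv_pCons to_ac.map_poly_pderiv)
qed

interpretation expand: inj_idom_hom "expand \<alpha>"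
proof unfold_locales
  show "expand \<alpha> (f + g) = expand \<alpha> f + expand \<alpha> g" for f g
    by (simp add: expand_def to_ac_poly.hom_add pcompose_add fps_of_poly_add)
  show "expand \<alpha> (f * g) = expand \<alpha> f * expand \<alpha> g" for f g
    by (simp add: expand_def to_ac_poly.hom_mult pcompose_mult fps_of_poly_mult)
  show "f = 0" if "expand \<alpha> f = 0" for f
  proof -
    have "pcompose (map_poly to_ac f) [:\<alpha>, 1:] = 0"
      using that by (simp add: expand_def)
    hence "map_poly to_ac f = 0" by (rule pcompose_eq_0) simp
    thus ?thesis by simp
  qed
qed (simp_all add: expand_def)

lemma expand_const: "expand \<alpha> [:c:] = fps_const (to_ac c)"
  by (simp add: expand_def map_poly_const fps_of_poly_const)

text \<open>The closure of F is embedded by \<iota> into that of the completed field, with T sent to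
  \<alpha> + X, and \<open>U\<close> is the preimage of the power series ring. Later arguments use
  the completion only through the properties of \<open>U\<close> and \<xi> listed here.\<close>

theorem drinfeld_local_structure:
  fixes g :: "nat \<Rightarrow> 'a :: finite_field poly" and \<alpha> :: "'a alg_closure"
  assumes r: "r \<ge> 2" and "\<alpha> \<noteq> 0"
    and \<alpha>: "poly (map_poly to_ac (g r)) \<alpha> = 0" "poly (map_poly to_ac (pderiv (g r))) \<alpha> \<noteq> 0"
      "poly (map_poly to_ac (g (r - 1))) \<alpha> \<noteq> 0"
  obtains U :: "'a ratfun_ac set" and \<xi> where
    "eps.fq_subspace U"
    "\<And>y. y \<in> U \<Longrightarrow> \<exists>x\<in>U. phi r g x = y"
    "finite {x \<in> U. phi r g x = 0}" "card {x \<in> U. phi r g x = 0} = CARD('a) ^ (r - 1)"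
    "\<xi> 0 = 0" "\<And>n. phi r g (\<xi> (Suc n)) = \<xi> n" "\<xi> 1 \<notin> U"
    "\<And>n h c. h \<in> U \<Longrightarrow> (phi r g ^^ n) h = 0 \<Longrightarrow> c \<noteq> 0 \<Longrightarrow>
       \<exists>\<sigma>. ac_hom \<sigma> \<and> (\<forall>x\<in>U. \<sigma> x = x) \<and> \<sigma> (\<xi> n) = eps c * \<xi> n + h"
proof -
  define m where "m = r - 1"
  have r_m: "r = Suc m" and "m > 0" using r by (simp_all add: m_def)
  define \<Phi> where "\<Phi> = map_poly (expand \<alpha>) (phi_poly r g)"
  have "g r \<noteq> 0" using \<alpha>(2) by auto
  have deg: "degree (phi_poly r g) = CARD('a) ^ Suc m"
    using degree_phi_poly[of r g] \<open>g r \<noteq> 0\<close> r by (simp add: r_m)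
  have lead: "lead_coeff \<Phi> = expand \<alpha> (g r)"
    using lead_coeff_phi_poly[of r g] \<open>g r \<noteq> 0\<close> r by (simp add: \<Phi>_def)
  interpret L: local_module to_ac "CARD('a)" \<Phi> m
  proof unfold_locales
    show "q_poly CARD('a) \<Phi>" unfolding \<Phi>_def by (intro q_poly_map_poly q_poly_phi_poly) simp
    show "degree \<Phi> = CARD('a) ^ Suc m" using deg by (simp add: \<Phi>_def)
    have "coeff \<Phi> 1 = expand \<alpha> [:0, 1:]" unfolding \<Phi>_def expand.coeff_map_poly_hom coeff_phi_poly_1 ..
    thus "coeff \<Phi> 1 $ 0 \<noteq> 0" using \<open>\<alpha> \<noteq> 0\<close> by (simp add: expand_nth_0 map_poly_pCons)
    have "coeff \<Phi> (CARD('a) ^ m) = expand \<alpha> (g m)"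
      using \<open>m > 0\<close> by (simp add: \<Phi>_def coeff_phi_poly_power r_m)
    thus "coeff \<Phi> (CARD('a) ^ m) $ 0 \<noteq> 0" using \<alpha>(3) by (simp add: expand_nth_0 m_def)
    show "lead_coeff \<Phi> $ 0 = 0" "lead_coeff \<Phi> $ 1 \<noteq> 0"
      unfolding lead expand_nth_0 expand_nth_1 using \<alpha> by auto
  qed (use \<open>m > 0\<close> in auto)
  define R where "R = {(frac_ac a, frac_ac (expand \<alpha> a)) | a. True}"
  have R: "(frac_ac a, frac_ac (expand \<alpha> a)) \<in> R" for a by (auto simp: R_def)
  have "ring_graph R"
  proof (rule ring_graphI)
    show "(1, 1) \<in> R" using R[of 1] by simp
    fix x y x' y' assume "(x, y) \<in> R" "(x', y') \<in> R"
    then obtain a a' where "x = frac_ac a" "y = frac_ac (expand \<alpha> a)"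
      "x' = frac_ac a'" "y' = frac_ac (expand \<alpha> a')" by (auto simp: R_def)
    thus "(x - x', y - y') \<in> R" "(x * x', y * y') \<in> R"
      using R[of "a - a'"] R[of "a * a'"]
      by (simp_all add: frac_ac.hom_minus frac_ac.hom_mult expand.hom_minus expand.hom_mult)
  qed (auto simp: R_def)
  moreover have "\<exists>p. p \<noteq> 0 \<and> poly p x = 0 \<and> (\<forall>i. coeff p i \<in> fst ` R)" for x
  proof -
    obtain p :: "'a poly poly" where "p \<noteq> 0" "poly (map_poly frac_ac p) x = 0"
      by (rule algebraic_over_domain)
    thus ?thesis using R by (intro exI[of _ "map_poly frac_ac p"]) force
  qed
  ultimately obtain \<iota> where \<iota>: "comm_ring_hom \<iota>" "\<And>x y. (x, y) \<in> R \<Longrightarrow> \<iota> x = y"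
    by (rule ring_graph_extend) blast
  interpret \<iota>: comm_ring_hom \<iota> by fact
  have inj: "\<iota> x = \<iota> y \<longleftrightarrow> x = y" for x y
    using comm_ring_hom_inj[OF \<iota>(1)] by (auto simp: inj_def)
  have \<iota>_frac: "\<iota> (frac_ac a) = frac_ac (expand \<alpha> a)" for a
    using \<iota>(2) R by blast
  have \<iota>_eps: "\<iota> (eps c) = frac_ac (fps_const (to_ac c))" for c
    by (simp add: eps_def \<iota>_frac expand_const)
  have \<iota>_map: "map_poly \<iota> (map_poly frac_ac p) = map_poly frac_ac (map_poly (expand \<alpha>) p)" for p
    by (simp add: map_poly_map_poly o_def \<iota>_frac)
  have \<iota>_phi: "\<iota> (phi r g x) = L.\<Phi>K (\<iota> x)" for x
    unfolding phi_def \<Phi>_def \<iota>_map[symmetric] by simp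
  have "phi_poly r g \<noteq> 0" using deg card_finite_field_ge_2[where 'a = 'a] by (metis degree_0 power_eq_0_iff not_numeral_le_zero)
  \<comment> \<open>Division points are algebraic over the image of \<iota>, which is algebraically
    closed. So power series and torsion points built over the completion come from the closure of
    F.\<close>
  have phi_preimage: "z \<in> range \<iota>" if z: "L.\<Phi>K z = \<iota> y" for z y
  proof (rule root_in_range[OF \<iota>(1)])
    have "degree (map_poly frac_ac (phi_poly r g)) > 0" using deg by simp
    hence "degree (map_poly frac_ac (phi_poly r g) + [:- y:]) > 0"
      by (subst degree_add_eq_left) auto
    thus "map_poly frac_ac (phi_poly r g) + [:- y:] \<noteq> 0" by auto
    have "map_poly \<iota> (map_poly frac_ac (phi_poly r g) + [:- y:]) = map_poly frac_ac \<Phi> + [:- \<iota> y:]"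
      unfolding \<Phi>_def \<iota>_map[symmetric] by (rule poly_eqI)
        (simp add: coeff_map_poly \<iota>.hom_add \<iota>.hom_uminus coeff_pCons split: nat.split)
    thus "poly (map_poly \<iota> (map_poly frac_ac (phi_poly r g) + [:- y:])) z = 0"
      using z by simp
  qed
  obtain \<xi>K where \<xi>K: "\<xi>K 0 = 0" "\<And>n. L.\<Phi>K (\<xi>K (Suc n)) = \<xi>K n" "\<xi>K 1 \<notin> range frac_ac"
    "\<And>n h c. (poly \<Phi> ^^ n) h = 0 \<Longrightarrow> c \<noteq> 0 \<Longrightarrow>
       \<exists>\<tau>. ac_hom \<tau> \<and> \<tau> (\<xi>K n) = frac_ac (fps_const (to_ac c)) * \<xi>K n + frac_ac h"
    by (rule L.local_galois_action) blast
  have "\<xi>K n \<in> range \<iota>" for n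
  proof (induction n)
    case 0
    show ?case using \<xi>K(1) by (metis \<iota>.hom_zero rangeI)
  next
    case (Suc n)
    then obtain y where "\<xi>K n = \<iota> y" by blast
    thus ?case using phi_preimage[of "\<xi>K (Suc n)" y] \<xi>K(2)[of n] by simp
  qed
  hence "\<forall>n. \<exists>x. \<iota> x = \<xi>K n" by (metis imageE)
  then obtain \<xi> where \<xi>: "\<And>n. \<iota> (\<xi> n) = \<xi>K n" by metis
  define U where "U = {x. \<iota> x \<in> range frac_ac}"
  show ?thesis
  proof (rule that[of U \<xi>])
    show "eps.fq_subspace U"
      unfolding eps.fq_subspace_def U_def
      by (auto simp: \<iota>.hom_add \<iota>.hom_mult \<iota>_eps simp flip: frac_ac.hom_add frac_ac.hom_mult)
    show "\<exists>x\<in>U. phi r g x = y" if y: "y \<in> U" for y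
    proof -
      obtain y' where y': "\<iota> y = frac_ac y'" using y by (auto simp: U_def)
      obtain x' where x': "poly \<Phi> x' = y'" by (rule L.\<Phi>_surj)
      hence "L.\<Phi>K (frac_ac x') = \<iota> y" by (simp add: y')
      moreover from phi_preimage[OF this] obtain x where x: "frac_ac x' = \<iota> x" by blast
      ultimately have "phi r g x = y" by (simp flip: inj add: \<iota>_phi)
      thus ?thesis using x by (auto simp: U_def) (metis rangeI)
    qed
    have "bij_betw (\<lambda>x. THE y. \<iota> y = frac_ac x) (L.H 1) {x \<in> U. phi r g x = 0}"
    proof -
      have *: "\<exists>!y. \<iota> y = frac_ac x" if "x \<in> L.H 1" for x
      proof -
        have "L.\<Phi>K (frac_ac x) = \<iota> 0" using that by (simp add: L.H_def)
        thus ?thesis using phi_preimage inj by (metis imageE)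
      qed
      have **: "\<iota> (THE y. \<iota> y = frac_ac x) = frac_ac x" if "x \<in> L.H 1" for x
        using theI'[OF *[OF that]] .
      show ?thesis unfolding bij_betw_def
      proof
        show "inj_on (\<lambda>x. THE y. \<iota> y = frac_ac x) (L.H 1)"
          by (rule inj_onI) (metis ** frac_ac_eq_iff)
        show "(\<lambda>x. THE y. \<iota> y = frac_ac x) ` L.H 1 = {x \<in> U. phi r g x = 0}"
        proof (intro equalityI subsetI)
          fix y assume "y \<in> (\<lambda>x. THE y. \<iota> y = frac_ac x) ` L.H 1"
          then obtain x where x: "x \<in> L.H 1" "\<iota> y = frac_ac x" using ** by blast
          hence "\<iota> (phi r g y) = \<iota> 0" by (simp add: \<iota>_phi L.H_def)
          thus "y \<in> {x \<in> U. phi r g x = 0}" using x unfolding inj by (auto simp: U_def)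
        next
          fix y assume y: "y \<in> {x \<in> U. phi r g x = 0}"
          then obtain x where x: "\<iota> y = frac_ac x" by (auto simp: U_def)
          have "L.\<Phi>K (frac_ac x) = 0" using y by (simp flip: x \<iota>_phi)
          hence "x \<in> L.H 1" by (simp add: L.H_def)
          moreover from this have "(THE y. \<iota> y = frac_ac x) = y" using ** x inj by metis
          ultimately show "y \<in> (\<lambda>x. THE y. \<iota> y = frac_ac x) ` L.H 1" by blast
        qed
      qed
    qed
    from bij_betw_same_card[OF this] bij_betw_finite[OF this]
    show "card {x \<in> U. phi r g x = 0} = CARD('a) ^ (r - 1)" "finite {x \<in> U. phi r g x = 0}"
      using L.card_H1 L.finite_H1 by (simp_all add: r_m)
    show "\<xi> 0 = 0" by (simp flip: inj add: \<xi> \<xi>K)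
    show "phi r g (\<xi> (Suc n)) = \<xi> n" for n by (simp flip: inj add: \<iota>_phi \<xi> \<xi>K)
    show "\<xi> 1 \<notin> U" using \<xi>K(3) unfolding U_def mem_Collect_eq \<xi> .
    fix n h c assume h: "h \<in> U" "(phi r g ^^ n) h = 0" and c: "(c :: 'a) \<noteq> 0"
    obtain h' where h': "\<iota> h = frac_ac h'" using h by (auto simp: U_def)
    have iter: "\<iota> ((phi r g ^^ k) h) = frac_ac ((poly \<Phi> ^^ k) h')" for k
      by (induction k) (simp_all add: h' \<iota>_phi)
    have "(poly \<Phi> ^^ n) h' = 0" using iter[of n] h by simp
    from \<xi>K(4)[OF this c] obtain \<tau> where \<tau>: "ac_hom \<tau>"
      "\<tau> (\<xi>K n) = frac_ac (fps_const (to_ac c)) * \<xi>K n + frac_ac h'" by blast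
    interpret \<tau>: comm_ring_hom \<tau> using \<tau>(1) by (rule ac_hom_comm_ring_hom)
    \<comment> \<open>\<tau> preserves the image of \<iota>, since a conjugate is a root of the same
      polynomial over A. Hence \<tau> restricts to the closure of F.\<close>
    have "\<exists>y. \<iota> y = \<tau> (\<iota> x)" for x
    proof -
      obtain p :: "'a poly poly" where p: "p \<noteq> 0" "poly (map_poly frac_ac p) x = 0"
        by (rule algebraic_over_domain)
      have "poly (map_poly \<iota> (map_poly frac_ac p)) (\<iota> x) = 0" using p by simp
      hence "poly (map_poly \<iota> (map_poly frac_ac p)) (\<tau> (\<iota> x)) = 0"
        unfolding \<iota>_map by (metis ac_hom_poly_frac_ac[OF \<tau>(1)] \<tau>.hom_zero)
      thus ?thesis using root_in_range[OF \<iota>(1)] p(1)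
        by (metis frac_ac_poly.hom_0_iff imageE)
    qed
    then obtain \<sigma> where \<sigma>: "\<And>x. \<iota> (\<sigma> x) = \<tau> (\<iota> x)" by metis
    have "\<sigma> (frac_ac a) = frac_ac a" for a
      by (simp flip: inj add: \<sigma> \<iota>_frac ac_hom_frac_ac[OF \<tau>(1)])
    moreover have hom: "comm_ring_hom \<sigma>"
      by unfold_locales (simp_all flip: inj add: \<sigma> \<iota>.hom_add \<iota>.hom_mult \<tau>.hom_add \<tau>.hom_mult)
    moreover have "\<sigma> (to_ac x) = to_ac x" if "\<And>a. \<sigma> (frac_ac a) = frac_ac a" for x
    proof -
      interpret \<sigma>: comm_ring_hom \<sigma> by fact
      obtain a b where x: "x = Fract a b" "b \<noteq> 0" by (cases x)
      have "to_ac x * frac_ac b = frac_ac a"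
        using x(2) by (simp add: x(1) Fract_conv_to_fract frac_ac_def)
      hence "\<sigma> (to_ac x) * frac_ac b = to_ac x * frac_ac b" using that \<sigma>.hom_mult by metis
      thus ?thesis using x(2) by simp
    qed
    ultimately have "ac_hom \<sigma>" by (simp add: ac_hom_def)
    moreover have "\<sigma> x = x" if "x \<in> U" for x
      using that by (auto simp flip: inj simp: \<sigma> U_def ac_hom_frac_ac[OF \<tau>(1)])
    moreover have "\<sigma> (\<xi> n) = eps c * \<xi> n + h"
      by (simp flip: inj add: \<sigma> \<xi> \<tau> \<iota>.hom_add \<iota>.hom_mult \<iota>_eps h')
    ultimately show "\<exists>\<sigma>. ac_hom \<sigma> \<and> (\<forall>x\<in>U. \<sigma> x = x) \<and> \<sigma> (\<xi> n) = eps c * \<xi> n + h" by blast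
  qed
qed

section \<open>Matrices over a power series ring\<close>

lemma GL_iff_det: "M \<in> GL r \<longleftrightarrow> M \<in> carrier_mat r r \<and> det M dvd 1" for M :: "'b :: comm_ring_1 mat"
proof
  assume "M \<in> GL r"
  hence M: "M \<in> carrier_mat r r" "invertible_mat M" by (auto simp: GL_def)
  then obtain B where B: "M * B = 1\<^sub>m r" "B * M = 1\<^sub>m (dim_row B)"
    by (auto simp: invertible_mat_def inverts_mat_def)
  have "dim_col (B * M) = r" "dim_col (M * B) = r" using M B(1) by auto
  hence "B \<in> carrier_mat r r" using B(2) by (intro carrier_matI) auto
  hence "det M * det B = 1" using det_mult[OF M(1)] B(1) by (metis det_one)
  thus "M \<in> carrier_mat r r \<and> det M dvd 1" using M by (metis dvd_triv_left)
next
  assume M: "M \<in> carrier_mat r r \<and> det M dvd 1"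
  then obtain u where u: "1 = det M * u" by blast
  define B where "B = u \<cdot>\<^sub>m adj_mat M"
  have adj: "adj_mat M \<in> carrier_mat r r" "M * adj_mat M = det M \<cdot>\<^sub>m 1\<^sub>m r" "adj_mat M * M = det M \<cdot>\<^sub>m 1\<^sub>m r"
    using adj_mat[of M r] M by auto
  have "M * B = u \<cdot>\<^sub>m (det M \<cdot>\<^sub>m 1\<^sub>m r)" "B * M = u \<cdot>\<^sub>m (det M \<cdot>\<^sub>m 1\<^sub>m r)"
    using M adj mult_smult_distrib[of M r r "adj_mat M" r u]
      mult_smult_assoc_mat[of "adj_mat M" r r M r u] by (simp_all add: B_def)
  moreover have "u \<cdot>\<^sub>m (det M \<cdot>\<^sub>m 1\<^sub>m r) = 1\<^sub>m r"
    using u by (intro eq_matI) (auto simp: mult.commute)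
  ultimately have "M * B = 1\<^sub>m r" "B * M = 1\<^sub>m r" by simp_all
  moreover have "B \<in> carrier_mat r r" using adj by (simp add: B_def)
  ultimately show "M \<in> GL r"
    using M unfolding GL_def invertible_mat_def inverts_mat_def square_mat.simps by auto
qed

lemma GL_inverse:
  assumes "M \<in> GL r"
  obtains B where "B \<in> GL r" "M * B = 1\<^sub>m r" "B * M = 1\<^sub>m r"
proof -
  have M: "M \<in> carrier_mat r r" "invertible_mat M" using assms by (auto simp: GL_def)
  then obtain B where B: "M * B = 1\<^sub>m r" "B * M = 1\<^sub>m (dim_row B)"
    by (auto simp: invertible_mat_def inverts_mat_def)
  have "dim_col (B * M) = r" "dim_col (M * B) = r" using M B(1) by auto
  hence dB: "B \<in> carrier_mat r r" using B(2) by (intro carrier_matI) auto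
  moreover have "invertible_mat B"
    using B M dB by (auto simp: invertible_mat_def inverts_mat_def intro!: exI[of _ M])
  ultimately show ?thesis using that B by (auto simp: GL_def)
qed

lemma GL_mult: "A \<in> GL r \<Longrightarrow> B \<in> GL r \<Longrightarrow> A * B \<in> GL r"
  unfolding GL_iff_det by (auto simp: det_mult)

section \<open>Generation of the special linear group over a power series ring\<close>

context
  fixes S :: "'f :: field fps mat set" and r :: nat
  assumes one: "1\<^sub>m r \<in> S"
    and mult: "\<And>A B. A \<in> S \<Longrightarrow> B \<in> S \<Longrightarrow> A * B \<in> S"
    and elem: "\<And>a k l. k < r \<Longrightarrow> l < r \<Longrightarrow> k \<noteq> l \<Longrightarrow> addrow_mat r a k l \<in> S"
begin

lemma addrow_in_S_imp:
  assumes "M \<in> carrier_mat r r" "k < r" "l < r" "k \<noteq> l" "addrow a k l M \<in> S"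
  shows "M \<in> S"
proof -
  have "addrow (- a) k l (addrow a k l M) = M"
    using assms(1-4) by (intro eq_matI) (auto simp: algebra_simps)
  moreover have "addrow (- a) k l (addrow a k l M) = addrow_mat r (- a) k l * addrow a k l M"
    by (rule addrow_mat[of _ r r]) (use assms in auto)
  ultimately show ?thesis using mult[OF elem assms(5)] assms(2-4) by metis
qed

definition cleared :: "nat \<Rightarrow> 'f fps mat \<Rightarrow> bool" where
  "cleared k M \<longleftrightarrow> M \<in> carrier_mat r r \<and> det M = 1 \<and>
     (\<forall>i<r. \<forall>j<k. M $$ (i, j) = (if i = j then 1 else 0))"

lemma cleared_addrow:
  assumes "cleared k M" "i < r" "l < r" "i \<noteq> l" "k \<le> l"
  shows "cleared k (addrow a i l M)"
  using assms by (auto simp: cleared_def det_addrow)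

text \<open>Rows from \<open>n\<close> on are already clear in column \<open>k\<close>. Each step
  clears row \<open>n\<close> with the pivot 1, passing over the pivot's own row.\<close>

lemma clear_column:
  assumes next_in: "\<And>M. cleared (Suc k) M \<Longrightarrow> M \<in> S" and "k < r"
    and "n \<le> r" "cleared k M" "M $$ (k, k) = 1" "\<And>i. n \<le> i \<Longrightarrow> i < r \<Longrightarrow> i \<noteq> k \<Longrightarrow> M $$ (i, k) = 0"
  shows "M \<in> S"
  using assms(3-)
proof (induction n arbitrary: M)
  case 0
  hence "cleared (Suc k) M" by (auto simp: cleared_def less_Suc_eq)
  thus ?case by (rule next_in)
next
  case (Suc n)
  show ?case
  proof (cases "n = k")
    case True
    have "M $$ (i, k) = 0" if "n \<le> i" "i < r" "i \<noteq> k" for i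
      using Suc.prems(4)[of i] that True by simp
    thus ?thesis using Suc.prems by (intro Suc.IH) auto
  next
    case False
    let ?M = "addrow (- (M $$ (n, k))) n k M"
    have M: "M \<in> carrier_mat r r" using Suc.prems by (simp add: cleared_def)
    have "?M \<in> S"
    proof (rule Suc.IH)
      show "cleared k ?M" using Suc.prems False \<open>k < r\<close> by (intro cleared_addrow) auto
      show "?M $$ (i, k) = 0" if "n \<le> i" "i < r" "i \<noteq> k" for i
        using that Suc.prems \<open>k < r\<close> M by (cases "i = n") auto
    qed (use Suc.prems False \<open>k < r\<close> M in auto)
    thus ?thesis using Suc.prems \<open>k < r\<close> False by (intro addrow_in_S_imp[OF M, of n k]) auto
  qed
qed

text \<open>Otherwise column \<open>k\<close>, reduced modulo X, would be a combination of the unit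
  vectors in the columns before it. The vector \<open>v\<close> records this dependence, and the
  reduced determinant would be 0 instead of 1.\<close>

lemma cleared_unit_entry:
  assumes "cleared k M" "k < r"
  shows "\<exists>i. k \<le> i \<and> i < r \<and> M $$ (i, k) $ 0 \<noteq> 0"
proof (rule ccontr)
  assume no: "\<not> ?thesis"
  have M: "M \<in> carrier_mat r r" using assms by (simp add: cleared_def)
  interpret red: comm_ring_hom "\<lambda>f :: 'f fps. f $ 0" by unfold_locales auto
  define M0 where "M0 = map_mat (\<lambda>f. f $ 0) M"
  define v where "v = vec r (\<lambda>i. if i = k then 1 else if i < k then - (M0 $$ (i, k)) else 0)"
  have M0: "M0 \<in> carrier_mat r r" using M by (simp add: M0_def)
  have entry: "M0 $$ (i, j) = (if i = j then 1 else 0)" if "i < r" "j < k" for i j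
    using that assms M by (auto simp: M0_def cleared_def)
  have zero: "M0 $$ (i, k) = 0" if "k \<le> i" "i < r" for i
    using that no M assms by (auto simp: M0_def)
  have "M0 *\<^sub>v v = 0\<^sub>v r"
  proof (rule eq_vecI)
    fix i assume i: "i < dim_vec (0\<^sub>v r :: 'f vec)"
    have "vec_index (M0 *\<^sub>v v) i = (\<Sum>j<r. M0 $$ (i, j) * vec_index v j)"
      using i M0 by (simp add: scalar_prod_def v_def atLeast0LessThan)
    also have "\<dots> = (\<Sum>j\<in>insert k {..<k}. M0 $$ (i, j) * vec_index v j)"
      using assms(2) by (intro sum.mono_neutral_right) (auto simp: v_def)
    also have "\<dots> = M0 $$ (i, k) - (\<Sum>j<k. M0 $$ (i, j) * M0 $$ (j, k))"
      using assms(2) by (simp add: v_def sum_negf)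
    also have "(\<Sum>j<k. M0 $$ (i, j) * M0 $$ (j, k)) = (\<Sum>j<k. if i = j then M0 $$ (j, k) else 0)"
      using i by (intro sum.cong) (auto simp: entry)
    also have "\<dots> = (if i < k then M0 $$ (i, k) else 0)" by simp
    finally show "vec_index (M0 *\<^sub>v v) i = vec_index (0\<^sub>v r) i" using i zero[of i] by simp
  qed (use M0 in auto)
  moreover have "v \<noteq> 0\<^sub>v r"
  proof
    assume "v = 0\<^sub>v r"
    hence "vec_index v k = 0" using assms(2) by simp
    thus False using assms(2) by (simp add: v_def)
  qed
  moreover have "v \<in> carrier_vec r" by (simp add: v_def)
  ultimately have "det M0 = 0"
    using det_0_iff_vec_prod_zero_field[OF M0] by blast
  moreover have "det M0 = 1" using assms by (simp add: M0_def cleared_def)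
  ultimately show False by simp
qed

text \<open>Elimination over a local ring without diagonal matrices. A pivot 1 is made by adding a
  multiple of another row that has a unit in this column; if the unit sits on the diagonal, the next
  row is first given the entry 1. In the last column the determinant forces the pivot to be
  1.\<close>

lemma cleared_in_S:
  assumes "cleared k M" "k \<le> r"
  shows "M \<in> S"
  using assms
proof (induction "r - k" arbitrary: k M)
  case 0
  hence "k = r" by simp
  hence "M = 1\<^sub>m r" using 0 unfolding cleared_def by (intro eq_matI) auto
  thus ?case using one by simp
next
  case (Suc d)
  hence k: "k < r" by simp
  have next_in: "M \<in> S" if "cleared (Suc k) M" for M
    using Suc that k by (intro Suc.hyps(1)[of "Suc k"]) auto
  have pivot1: "M \<in> S" if "cleared k M" "M $$ (k, k) = 1" for M
    by (rule clear_column[OF next_in k order.refl that]) auto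
  have pivot2: "M \<in> S" if M: "cleared k M" "k < i" "i < r" "M $$ (i, k) $ 0 \<noteq> 0" for M i
  proof -
    define a where "a = (1 - M $$ (k, k)) * inverse (M $$ (i, k))"
    have C: "M \<in> carrier_mat r r" using M by (simp add: cleared_def)
    have "a * M $$ (i, k) = 1 - M $$ (k, k)"
      using M(4) by (simp add: a_def mult.assoc inverse_mult_eq_1)
    hence "addrow a k i M \<in> S"
      using M k C by (intro pivot1 cleared_addrow) auto
    thus ?thesis using M k by (intro addrow_in_S_imp[OF C, of k i]) auto
  qed
  obtain i where i: "k \<le> i" "i < r" "M $$ (i, k) $ 0 \<noteq> 0"
    using cleared_unit_entry[OF Suc.prems(1) k] by blast
  have C: "M \<in> carrier_mat r r" using Suc.prems by (simp add: cleared_def)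
  show ?case
  proof (cases "i = k")
    case False
    hence "k < i" using i(1) by simp
    thus ?thesis by (rule pivot2[OF Suc.prems(1) _ i(2,3)])
  next
    case True
    show ?thesis
    proof (cases "Suc k = r")
      case False
      define a where "a = (1 - M $$ (Suc k, k)) * inverse (M $$ (k, k))"
      have "a * M $$ (k, k) = 1 - M $$ (Suc k, k)"
        using i True by (simp add: a_def mult.assoc inverse_mult_eq_1)
      hence "addrow a (Suc k) k M \<in> S"
        using False k C Suc.prems by (intro pivot2[of _ "Suc k"] cleared_addrow) auto
      thus ?thesis using False k by (intro addrow_in_S_imp[OF C, of "Suc k" k]) auto
    next
      case last: True
      have "upper_triangular M" using Suc.prems last C
        unfolding upper_triangular_def cleared_def by auto
      hence "det M = (\<Prod>i<r. M $$ (i, i))"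
        using det_upper_triangular[of M r] C by (simp add: prod_list_diag_prod atLeast0LessThan)
      also have "\<dots> = (\<Prod>i<k. M $$ (i, i)) * M $$ (k, k)" by (simp flip: last)
      also have "(\<Prod>i<k. M $$ (i, i)) = 1"
        using Suc.prems k unfolding cleared_def by (intro prod.neutral) auto
      finally show ?thesis using pivot1 Suc.prems by (auto simp: cleared_def)
    qed
  qed
qed

lemma SL_in_S: "M \<in> carrier_mat r r \<Longrightarrow> det M = 1 \<Longrightarrow> M \<in> S"
  using cleared_in_S[of 0 M] by (simp add: cleared_def)

end

text \<open>The identity plus the product of the column \<open>c\<close> and the row
  \<open>f\<close>. It is a genuine transvection only if \<open>f\<close> annihilates
  \<open>c\<close>, which is imposed where it is used.\<close>

definition transvection :: "nat \<Rightarrow> (nat \<Rightarrow> 'b) \<Rightarrow> (nat \<Rightarrow> 'b) \<Rightarrow> 'b :: comm_ring_1 mat" where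
  "transvection r c f = mat r r (\<lambda>(i, j). (if i = j then 1 else 0) + c i * f j)"

lemma transvection_carrier [simp]: "transvection r c f \<in> carrier_mat r r"
  by (simp add: transvection_def)

text \<open>The functionals all of whose transvections lie in \<open>G\<close> contain a basis, the
  rows of \<open>B\<close>. In the coordinates given by \<open>B\<close> these transvections include
  all elementary matrices.\<close>

theorem SL_subset_if_transvections:
  fixes G :: "'f :: field fps mat set"
  assumes car: "G \<subseteq> carrier_mat r r"
    and mult: "\<And>A B. A \<in> G \<Longrightarrow> B \<in> G \<Longrightarrow> A * B \<in> G"
    and tv: "\<And>v. \<exists>i<r. v i $ 0 \<noteq> 0 \<Longrightarrow> \<exists>f. (\<Sum>i<r. f i * v i) $ 0 \<noteq> 0 \<and>
               (\<forall>c. (\<Sum>i<r. f i * c i) = 0 \<longrightarrow> transvection r c f \<in> G)"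
    and M: "M \<in> carrier_mat r r" "det M = 1" and "r > 0"
  shows "M \<in> G"
proof -
  define \<Theta> where "\<Theta> = {f. \<forall>c. (\<Sum>i<r. f i * c i) = 0 \<longrightarrow> transvection r c f \<in> G}"
  have "\<exists>B. B \<in> carrier_mat r r \<and> det B $ 0 \<noteq> 0 \<and> (\<forall>i<k. (\<lambda>j. B $$ (i, j)) \<in> \<Theta>)" if "k \<le> r" for k
    using that
  proof (induction k)
    case 0
    show ?case by (intro exI[of _ "1\<^sub>m r"]) auto
  next
    case (Suc k)
    then obtain B where B: "B \<in> carrier_mat r r" "det B $ 0 \<noteq> 0" "\<And>i. i < k \<Longrightarrow> (\<lambda>j. B $$ (i, j)) \<in> \<Theta>"
      by auto
    have k: "k < r" using Suc by simp
    \<comment> \<open>The cofactors of row \<open>k\<close>: replacing that row by \<open>f\<close>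
      makes the determinant the value of \<open>f\<close> at \<open>v\<close>. The hypothesis
      supplies an \<open>f\<close> for which this is a unit.\<close>
    define v where "v i = cofactor B k i" for i
    have "\<exists>i<r. v i $ 0 \<noteq> 0"
    proof (rule ccontr)
      assume "\<not> ?thesis"
      hence "(\<Sum>i<r. B $$ (k, i) * v i) $ 0 = 0" by (simp add: fps_sum_nth)
      thus False using B(2) laplace_expansion_row[OF B(1) k] by (simp add: v_def)
    qed
    then obtain f where f: "(\<Sum>i<r. f i * v i) $ 0 \<noteq> 0" "f \<in> \<Theta>"
      using tv unfolding \<Theta>_def by blast
    define B1 where "B1 = mat r r (\<lambda>(i, j). if i = k then f j else B $$ (i, j))"
    have B1: "B1 \<in> carrier_mat r r" by (simp add: B1_def)
    have "mat_delete B1 k j = mat_delete B k j" if "j < r" for j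
      using B(1) k that by (intro eq_matI) (auto simp: mat_delete_def B1_def)
    hence cof: "cofactor B1 k j = v j" if "j < r" for j
      using that by (simp add: cofactor_def v_def)
    have "det B1 = (\<Sum>j<r. B1 $$ (k, j) * cofactor B1 k j)"
      by (rule laplace_expansion_row[OF B1 k])
    also have "\<dots> = (\<Sum>j<r. f j * v j)"
      using k by (intro sum.cong) (simp_all only: cof lessThan_iff, simp add: B1_def)
    finally have "det B1 $ 0 \<noteq> 0" using f by simp
    moreover have "(\<lambda>j. B1 $$ (i, j)) \<in> \<Theta>" if "i < Suc k" for i
    proof -
      have eq: "f1 \<in> \<Theta>" if "f2 \<in> \<Theta>" "\<And>j. j < r \<Longrightarrow> f1 j = f2 j" for f1 f2
      proof -
        have "transvection r c f1 = transvection r c f2" for c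
          using that by (intro eq_matI) (auto simp: transvection_def)
        moreover have "(\<Sum>i<r. f1 i * c i) = (\<Sum>i<r. f2 i * c i)" for c using that by simp
        ultimately show ?thesis using that(1) by (simp add: \<Theta>_def)
      qed
      show ?thesis
      proof (cases "i = k")
        case True
        show ?thesis by (rule eq[OF f(2)]) (use True k in \<open>simp add: B1_def\<close>)
      next
        case False
        hence "i < k" using that by simp
        show ?thesis by (rule eq[OF B(3)[OF \<open>i < k\<close>]]) (use False k that in \<open>simp add: B1_def\<close>)
      qed
    qed
    ultimately show ?case using B1 by blast
  qed
  from this[of r] obtain B where B: "B \<in> carrier_mat r r" "det B $ 0 \<noteq> 0"
    "\<And>i. i < r \<Longrightarrow> (\<lambda>j. B $$ (i, j)) \<in> \<Theta>" by auto
  hence "B \<in> GL r" by (simp add: GL_iff_det)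
  then obtain C where C: "C \<in> carrier_mat r r" "B * C = 1\<^sub>m r" "C * B = 1\<^sub>m r"
    using GL_inverse by (metis GL_iff_det)
  have BC: "(\<Sum>j<r. B $$ (i, j) * C $$ (j, k)) = (if i = k then 1 else 0)" if "i < r" "k < r" for i k
  proof -
    have "(B * C) $$ (i, k) = (\<Sum>j<r. B $$ (i, j) * C $$ (j, k))"
      using that B(1) C(1) by (simp add: scalar_prod_def atLeast0LessThan)
    thus ?thesis using that by (simp add: C(2))
  qed
  have CB: "(\<Sum>j<r. C $$ (i, j) * B $$ (j, k)) = (if i = k then 1 else 0)" if "i < r" "k < r" for i k
  proof -
    have "(C * B) $$ (i, k) = (\<Sum>j<r. C $$ (i, j) * B $$ (j, k))"
      using that B(1) C(1) by (simp add: scalar_prod_def atLeast0LessThan)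
    thus ?thesis using that by (simp add: C(3))
  qed
  define S where "S = {N \<in> carrier_mat r r. C * N * B \<in> G}"
  have "B * M * C \<in> S"
  proof (rule SL_in_S)
    fix N N' assume N: "N \<in> S" "N' \<in> S"
    hence NC: "N \<in> carrier_mat r r" "N' \<in> carrier_mat r r" by (auto simp: S_def)
    have "B * (C * (N' * B)) = B * C * (N' * B)"
      by (rule assoc_mult_mat[of B r r C r _ r, symmetric]) (use NC B C in auto)
    also have "\<dots> = N' * B" using NC B by (simp add: C(2))
    finally have "(C * N * B) * (C * N' * B) = C * (N * N') * B"
      using NC B C by (simp add: assoc_mult_mat[of _ r r _ r _ r])
    hence "C * (N * N') * B = (C * N * B) * (C * N' * B)" ..
    also have "\<dots> \<in> G" using N mult by (simp add: S_def)
    finally show "N * N' \<in> S" using NC by (simp add: S_def)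
  next
    fix a :: "'f fps" and k l assume kl: "k < r" "l < r" "k \<noteq> l"
    define c where "c i = C $$ (i, k) * a" for i
    have "C * addrow_mat r a k l * B = transvection r c (\<lambda>j. B $$ (l, j))"
    proof (rule eq_matI)
      fix i j assume "i < dim_row (transvection r c (\<lambda>j. B $$ (l, j)))"
        "j < dim_col (transvection r c (\<lambda>j. B $$ (l, j)))"
      hence ij: "i < r" "j < r" by (auto simp: transvection_def)
      have "C * addrow_mat r a k l * B = C * addrow a k l B"
        using B C kl by (simp add: addrow_mat[of _ r r] assoc_mult_mat[of _ r r _ r _ r])
      hence "(C * addrow_mat r a k l * B) $$ (i, j) = (\<Sum>s<r. C $$ (i, s) * addrow a k l B $$ (s, j))"
        using ij B C by (simp add: scalar_prod_def atLeast0LessThan)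
      also have "\<dots> = (\<Sum>s<r. C $$ (i, s) * B $$ (s, j) + (if s = k then C $$ (i, k) * (a * B $$ (l, j)) else 0))"
        using ij B kl by (intro sum.cong) (auto simp: algebra_simps)
      also have "\<dots> = (if i = j then 1 else 0) + c i * B $$ (l, j)"
        using kl ij by (simp add: sum.distrib CB c_def mult.assoc)
      finally show "(C * addrow_mat r a k l * B) $$ (i, j) = transvection r c (\<lambda>j. B $$ (l, j)) $$ (i, j)"
        using ij by (simp add: transvection_def)
    qed (use B C in \<open>auto simp: transvection_def\<close>)
    moreover have "(\<Sum>i<r. B $$ (l, i) * c i) = 0"
      using BC[of l k] kl by (simp add: c_def flip: mult.assoc sum_distrib_right)
    hence "transvection r c (\<lambda>j. B $$ (l, j)) \<in> G" using B(3)[OF kl(2)] by (simp add: \<Theta>_def)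
    ultimately show "addrow_mat r a k l \<in> S" by (simp add: S_def)
  next
    have "transvection r (\<lambda>_. 0) (\<lambda>j. B $$ (0, j)) \<in> G" using B(3)[OF \<open>r > 0\<close>] by (simp add: \<Theta>_def)
    moreover have "transvection r (\<lambda>_. 0) (\<lambda>j. B $$ (0, j)) = 1\<^sub>m r"
      by (intro eq_matI) (auto simp: transvection_def)
    ultimately show "1\<^sub>m r \<in> S" using B C by (simp add: S_def)
  next
    have "det B * det C = 1" using det_mult[OF B(1) C(1)] by (simp add: C(2))
    thus "det (B * M * C) = 1" using B C M by (simp add: det_mult[of _ r] mult.assoc)
  qed (use B C M in auto)
  hence "C * (B * M * C) * B \<in> G" by (simp add: S_def)
  also have "C * (B * M * C) * B = (C * B) * (M * (C * B))"
    using B(1) C(1) M(1) by (simp only: assoc_mult_mat[of _ r r _ r _ r] mult_carrier_mat[of _ r r _ r])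
  also have "\<dots> = M" using C M by simp
  finally show ?thesis .
qed

section \<open>The Tate module as a module of power series\<close>

definition fps_map :: "('b \<Rightarrow> 'c) \<Rightarrow> 'b fps \<Rightarrow> 'c fps" where
  "fps_map h f = Abs_fps (\<lambda>n. h (f $ n))"

lemma fps_map_nth [simp]: "fps_map h f $ n = h (f $ n)"
  by (simp add: fps_map_def)

lemma comm_ring_hom_fps_map:
  assumes "comm_ring_hom h"
  shows "comm_ring_hom (fps_map h)"
proof -
  interpret comm_ring_hom h by fact
  show ?thesis
    by unfold_locales (simp_all add: fps_eq_iff fps_mult_nth hom_add hom_mult hom_sum)
qed

lemma fps_map_X: "h 0 = 0 \<Longrightarrow> h 1 = 1 \<Longrightarrow> fps_map h fps_X = fps_X"
  by (simp add: fps_eq_iff)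

abbreviation emb :: "'a :: finite_field fps \<Rightarrow> 'a ratfun_ac fps" where
  "emb \<equiv> fps_map eps"

interpretation emb: comm_ring_hom emb
  by (rule comm_ring_hom_fps_map) unfold_locales

lemma emb_eq_0_iff [simp]: "emb c = 0 \<longleftrightarrow> c = 0"
  by (simp add: fps_eq_iff)

lemma emb_dvd_iff: "fps_X ^ n dvd emb c \<longleftrightarrow> fps_X ^ n dvd c"
  by (simp add: fps_X_power_dvd_iff)

lemma emb_X: "emb fps_X = fps_X"
  by (rule fps_map_X) simp_all

lemma emb_const: "emb (fps_const c) = fps_const (eps c)"
  by (simp add: fps_eq_iff)

lemma fps_map_emb: "ac_hom \<sigma> \<Longrightarrow> fps_map \<sigma> (emb c) = emb c"
  by (simp add: fps_eq_iff ac_hom_eps)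

lemma dvd_diff_mult:
  fixes a b c d :: "'b :: comm_ring_1"
  assumes "x dvd a - b" "x dvd c - d"
  shows "x dvd a * c - b * d"
proof -
  have "a * c - b * d = (a - b) * c + b * (c - d)" by (simp add: algebra_simps)
  thus ?thesis using assms by (simp add: dvd_add)
qed

text \<open>\<open>U\<close> plays the part of the points rational over the completion.
  Irreducibility enters as \<open>irr\<close>: the points of phi[T] with all conjugates in
  \<open>U\<close> form a submodule, which is proper because of \<open>\<xi> 1\<close>.\<close>

locale tate_local =
  fixes r :: nat and g :: "nat \<Rightarrow> 'a :: finite_field poly" and U :: "'a ratfun_ac set" and \<xi>
  assumes r: "r \<ge> 2" and g_r: "g r \<noteq> 0"
    and U: "eps.fq_subspace U"
    and U_surj: "\<And>y. y \<in> U \<Longrightarrow> \<exists>x\<in>U. phi r g x = y"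
    and U_finite: "finite {x \<in> U. phi r g x = 0}"
    and U_card: "card {x \<in> U. phi r g x = 0} = CARD('a) ^ (r - 1)"
    and xi_0: "\<xi> 0 = 0" and xi_Suc: "\<And>n. phi r g (\<xi> (Suc n)) = \<xi> n" and xi_1: "\<xi> 1 \<notin> U"
    and U_action: "\<And>n h c. h \<in> U \<Longrightarrow> (phi r g ^^ n) h = 0 \<Longrightarrow> c \<noteq> 0 \<Longrightarrow>
       \<exists>\<sigma>. ac_hom \<sigma> \<and> (\<forall>x\<in>U. \<sigma> x = x) \<and> \<sigma> (\<xi> n) = eps c * \<xi> n + h"
    and irr: "\<And>w. phi r g w = 0 \<Longrightarrow> w \<noteq> 0 \<Longrightarrow> \<exists>\<sigma>. ac_hom \<sigma> \<and> \<sigma> w \<notin> U"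
begin

lemma U_0: "0 \<in> U" and U_add: "x \<in> U \<Longrightarrow> y \<in> U \<Longrightarrow> x + y \<in> U" and U_scale: "x \<in> U \<Longrightarrow> eps c * x \<in> U"
  using U by (auto simp: eps.fq_subspace_def)

lemma U_sum: "(\<And>i. i \<in> A \<Longrightarrow> f i \<in> U) \<Longrightarrow> sum f A \<in> U"
  using eps.fq_subspace_sum[OF U] .

text \<open>A basis of phi[T] inside \<open>U\<close> has \<open>r - 1\<close> elements by the
  cardinality, and \<open>\<xi> 1\<close> completes it. The first \<open>r - 1\<close> vectors are
  then divided by T repeatedly without leaving \<open>U\<close>.\<close>

lemma basis_sequences:
  obtains b :: "nat \<Rightarrow> nat \<Rightarrow> 'a ratfun_ac" where
    "\<And>i n. i < r - 1 \<Longrightarrow> b i n \<in> U" "\<And>i n. phi r g (b i (Suc n)) = b i n" "\<And>i. i < r \<Longrightarrow> phi r g (b i 0) = 0"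
    "\<And>n. b (r - 1) n = \<xi> (Suc n)"
    "eps.fq_indep r (\<lambda>i. b i 0)" "eps.fq_span r (\<lambda>i. b i 0) = {x. phi r g x = 0}"
proof -
  define W where "W = {x \<in> U. phi r g x = 0}"
  have "eps.fq_subspace W"
    using U_0 U_add U_scale by (auto simp: eps.fq_subspace_def W_def phi_add phi_scale)
  then obtain s \<beta> where \<beta>: "eps.fq_indep s \<beta>" "eps.fq_span s \<beta> = W" "card W = CARD('a) ^ s"
    using eps.fq_basis_exists[of W] U_finite unfolding W_def by blast
  hence s: "s = r - 1" using U_card q_power_eq_iff[where 'a = 'a, of s "r - 1"] unfolding W_def by simp
  define \<gamma> where "\<gamma> = \<beta>(s := \<xi> 1)"
  have span: "eps.fq_span s \<gamma> = W"
    unfolding \<beta>(2)[symmetric] by (auto simp: eps.fq_span_def \<gamma>_def eps.fq_lincomb_def)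
  have "eps.fq_indep s \<gamma>" using \<beta>(1) by (simp add: eps.fq_indep_def \<gamma>_def eps.fq_lincomb_def)
  moreover have "\<gamma> s \<notin> eps.fq_span s \<gamma>"
    unfolding span using xi_1 by (simp add: W_def \<gamma>_def)
  ultimately have "eps.fq_indep (Suc s) \<gamma>" by (rule eps.fq_indep_SucI)
  hence ind: "eps.fq_indep r \<gamma>" using s r by simp
  have root: "phi r g (\<gamma> i) = 0" if "i < r" for i
  proof (cases "i = s")
    case True
    thus ?thesis using xi_Suc[of 0] xi_0 by (simp add: \<gamma>_def)
  next
    case False
    hence "\<gamma> i \<in> eps.fq_span s \<gamma>" using that s by (intro eps.fq_span_base) simp
    thus ?thesis by (simp add: span W_def)
  qed
  have mem: "\<gamma> i \<in> U" if "i < r - 1" for i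
    using eps.fq_span_base[of i s \<gamma>] that unfolding span s[symmetric] by (simp add: W_def)
  have V1: "finite {x. phi r g x = 0}" "card {x. phi r g x = 0} \<le> CARD('a) ^ r"
  proof -
    have "map_poly frac_ac (phi_poly r g) \<noteq> 0" using degree_phi_poly[of r g] g_r r by auto
    from poly_roots_finite[OF this] card_poly_roots_bound[OF this]
    show "finite {x. phi r g x = 0}" "card {x. phi r g x = 0} \<le> CARD('a) ^ r"
      using degree_phi_poly[of r g] g_r r by (simp_all add: phi_def)
  qed
  have "eps.fq_span r \<gamma> \<subseteq> {x. phi r g x = 0}"
    using root by (auto simp: eps.fq_span_def eps.fq_lincomb_def phi_sum phi_scale)
  moreover have "card (eps.fq_span r \<gamma>) = CARD('a) ^ r" by (rule eps.card_fq_span[OF ind])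
  ultimately have span_r: "eps.fq_span r \<gamma> = {x. phi r g x = 0}"
    using V1 by (intro card_seteq) auto
  have "\<exists>x. x 0 = \<gamma> i \<and> (\<forall>n. x n \<in> U \<and> phi r g (x (Suc n)) = x n)" if "i < r - 1" for i
  proof -
    have "\<exists>f. \<forall>n. (f n \<in> U \<and> (n = 0 \<longrightarrow> f n = \<gamma> i)) \<and> phi r g (f (Suc n)) = f n"
      by (rule dependent_nat_choice) (use mem[OF that] U_surj in blast)+
    thus ?thesis by metis
  qed
  then obtain B where B: "\<And>i. i < r - 1 \<Longrightarrow> B i 0 = \<gamma> i \<and> (\<forall>n. B i n \<in> U \<and> phi r g (B i (Suc n)) = B i n)"
    by metis
  define b where "b i = (if i < r - 1 then B i else (\<lambda>n. \<xi> (Suc n)))" for i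
  have b0: "b i 0 = \<gamma> i" if "i < r" for i
    using that B s by (auto simp: b_def \<gamma>_def)
  show ?thesis
  proof (rule that[of b])
    show "eps.fq_indep r (\<lambda>i. b i 0)"
      using ind b0 by (simp add: eps.fq_indep_def eps.fq_lincomb_def)
    have "eps.fq_span r (\<lambda>i. b i 0) = eps.fq_span r \<gamma>"
      using b0 by (auto simp: eps.fq_span_def eps.fq_lincomb_def)
    thus "eps.fq_span r (\<lambda>i. b i 0) = {x. phi r g x = 0}" using span_r by simp
  qed (use B b0 root xi_Suc in \<open>auto simp: b_def\<close>)
qed

end

text \<open>A compatible system is stored as a power series whose coefficient \<open>n\<close> is
  the T^(n+1)-torsion point, the shape of an Anderson generating function. Compatibility is one
  equation, and scalars act by multiplication with \<open>emb c\<close>.\<close>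

definition tate_fps :: "nat \<Rightarrow> (nat \<Rightarrow> 'a :: finite_field poly) \<Rightarrow> 'a ratfun_ac fps set" where
  "tate_fps r g = {f. fps_map (phi r g) f = fps_X * f}"

locale tate_local_basis = tate_local r g U \<xi>
  for r and g :: "nat \<Rightarrow> 'a :: finite_field poly" and U \<xi> +
  fixes b :: "nat \<Rightarrow> 'a ratfun_ac fps"
  assumes b_U: "\<And>i n. i < r - 1 \<Longrightarrow> b i $ n \<in> U" and b_tate: "\<And>i. i < r \<Longrightarrow> b i \<in> tate_fps r g"
    and b_last: "\<And>n. b (r - 1) $ n = \<xi> (Suc n)"
    and b_indep: "eps.fq_indep r (\<lambda>i. b i $ 0)"
    and b_span: "eps.fq_span r (\<lambda>i. b i $ 0) = {x. phi r g x = 0}"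

lemma (in tate_local) basis_exists: obtains b where "tate_local_basis r g U \<xi> b"
proof -
  obtain b where b: "\<And>i n. i < r - 1 \<Longrightarrow> b i n \<in> U" "\<And>i n. phi r g (b i (Suc n)) = b i n"
    "\<And>i. i < r \<Longrightarrow> phi r g (b i 0) = 0" "\<And>n. b (r - 1) n = \<xi> (Suc n)"
    "eps.fq_indep r (\<lambda>i. b i 0)" "eps.fq_span r (\<lambda>i. b i 0) = {x. phi r g x = 0}"
    by (rule basis_sequences) blast
  have "tate_local_basis r g U \<xi> (\<lambda>i. Abs_fps (b i))"
  proof unfold_locales
    show "Abs_fps (b i) \<in> tate_fps r g" if "i < r" for i
    proof -
      have "phi r g (b i n) = (fps_X * Abs_fps (b i)) $ n" for n
        using b(2)[of i "n - 1"] b(3)[OF that] by (cases n) auto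
      thus ?thesis by (simp add: tate_fps_def fps_eq_iff)
    qed
  qed (use b in auto)
  thus ?thesis by (rule that)
qed

lemma tate_fps_nth_0: "f \<in> tate_fps r g \<Longrightarrow> phi r g (f $ 0) = 0"
  unfolding tate_fps_def mem_Collect_eq by (metis fps_X_mult_nth fps_map_nth)

lemma tate_fps_nth_Suc: "f \<in> tate_fps r g \<Longrightarrow> phi r g (f $ Suc n) = f $ n"
  unfolding tate_fps_def mem_Collect_eq by (metis fps_X_mult_nth fps_map_nth diff_Suc_1 nat.distinct(1))

lemma tate_fps_iterate: "f \<in> tate_fps r g \<Longrightarrow> (phi r g ^^ k) (f $ (n + k)) = f $ n"
  by (induction k arbitrary: n) (simp_all add: funpow_swap1 tate_fps_nth_Suc del: funpow.simps(2), metis add_Suc_right funpow_swap1 o_apply funpow_Suc_right tate_fps_nth_Suc)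

lemma tate_fps_add: "f \<in> tate_fps r g \<Longrightarrow> h \<in> tate_fps r g \<Longrightarrow> f + h \<in> tate_fps r g"
  by (simp add: tate_fps_def fps_eq_iff phi_add del: fps_X_mult_nth) (simp add: fps_X_mult_nth)

lemma tate_fps_0: "0 \<in> tate_fps r g"
  by (simp add: tate_fps_def fps_eq_iff)

lemma tate_fps_mult_emb:
  assumes "f \<in> tate_fps r g"
  shows "emb c * f \<in> tate_fps r g"
proof -
  have "fps_map (phi r g) (emb c * f) = emb c * fps_map (phi r g) f"
    by (simp add: fps_eq_iff fps_mult_nth phi_sum phi_scale)
  thus ?thesis using assms by (simp add: tate_fps_def mult.left_commute)
qed

lemma tate_fps_diff: "f \<in> tate_fps r g \<Longrightarrow> h \<in> tate_fps r g \<Longrightarrow> f - h \<in> tate_fps r g"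
  using tate_fps_add[of f r g "emb (- 1) * h"] tate_fps_mult_emb[of h r g "- 1"] by (simp add: emb.hom_uminus)

lemma tate_fps_sum: "(\<And>i. i \<in> A \<Longrightarrow> f i \<in> tate_fps r g) \<Longrightarrow> sum f A \<in> tate_fps r g"
  by (induction A rule: infinite_finite_induct) (auto intro: tate_fps_0 tate_fps_add)

lemma tate_fps_X_cancel:
  assumes "fps_X * f \<in> tate_fps r g"
  shows "f \<in> tate_fps r g"
proof -
  have "fps_map (phi r g) (fps_X * f) = fps_X * fps_map (phi r g) f" by (simp add: fps_eq_iff)
  hence "fps_X * fps_map (phi r g) f = fps_X * (fps_X * f)" using assms by (simp add: tate_fps_def)
  thus ?thesis by (simp add: tate_fps_def)
qed

lemma tate_fps_ac_hom:
  assumes "ac_hom \<sigma>" "f \<in> tate_fps r g"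
  shows "fps_map \<sigma> f \<in> tate_fps r g"
proof -
  interpret comm_ring_hom "fps_map \<sigma>"
    using assms(1) by (intro comm_ring_hom_fps_map ac_hom_comm_ring_hom)
  interpret \<sigma>: comm_ring_hom \<sigma> using assms(1) by (rule ac_hom_comm_ring_hom)
  have "fps_map (phi r g) (fps_map \<sigma> f) = fps_map \<sigma> (fps_map (phi r g) f)"
    by (simp add: fps_eq_iff ac_hom_phi[OF assms(1)])
  also have "\<dots> = fps_X * fps_map \<sigma> f"
    using assms(2) by (simp add: tate_fps_def hom_mult fps_map_X)
  finally show ?thesis by (simp add: tate_fps_def)
qed

context tate_local_basis
begin

definition lin :: "(nat \<Rightarrow> 'a fps) \<Rightarrow> 'a ratfun_ac fps" where
  "lin c = (\<Sum>i<r. emb (c i) * b i)"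

lemma lin_tate: "lin c \<in> tate_fps r g"
  unfolding lin_def by (intro tate_fps_sum tate_fps_mult_emb b_tate) simp

lemma lin_diff: "lin c - lin d = lin (\<lambda>i. c i - d i)"
  by (simp add: lin_def emb.hom_minus left_diff_distrib sum_subtractf)

lemma lin_nth_0: "lin c $ 0 = eps.fq_lincomb r (\<lambda>i. b i $ 0) (\<lambda>i. c i $ 0)"
  by (simp add: lin_def fps_sum_nth eps.fq_lincomb_def)

lemma lin_X: "fps_X * lin c = lin (\<lambda>i. fps_X * c i)"
  by (simp add: lin_def emb.hom_mult emb_X sum_distrib_left mult.assoc)

lemma lin_cong: "(\<And>i. i < r \<Longrightarrow> c i = d i) \<Longrightarrow> lin c = lin d"
  by (simp add: lin_def)

lemma lin_dvd_imp:
  assumes "fps_X ^ n dvd lin c" "i < r"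
  shows "fps_X ^ n dvd c i"
  using assms
proof (induction n arbitrary: c i)
  case (Suc n)
  have "lin c $ 0 = 0" using Suc.prems(1) unfolding fps_X_power_dvd_iff by blast
  hence c0: "c i $ 0 = 0" if "i < r" for i
    using b_indep that unfolding lin_nth_0 eps.fq_indep_def by blast
  define d where "d i = fps_shift 1 (c i)" for i
  have cd: "c i = fps_X * d i" if "i < r" for i
    using c0[OF that] by (simp add: d_def fps_eq_iff)
  have "lin c = fps_X * lin d" unfolding lin_X by (rule lin_cong) (rule cd)
  hence "fps_X ^ n dvd lin d" using Suc.prems(1) by simp
  hence "fps_X ^ n dvd d i" using Suc.IH Suc.prems(2) by blast
  thus ?case using cd[OF Suc.prems(2)] by simp
qed simp

lemma lin_eq_imp:
  assumes "lin c = lin d" "i < r"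
  shows "c i = d i"
proof -
  have "fps_X ^ n dvd c i - d i" for n
    using lin_dvd_imp[of n "\<lambda>i. c i - d i" i] assms by (simp flip: lin_diff)
  hence "(c i - d i) $ n = 0" for n unfolding fps_X_power_dvd_iff by blast
  thus ?thesis by (simp add: fps_eq_iff)
qed

text \<open>Digit by digit: the constant term lies in phi[T] and is a combination of the basis
  there; subtracting it and dividing by X stays in the Tate module. The error \<delta> is then
  divisible by every power of X.\<close>

lemma lin_exists:
  assumes "f \<in> tate_fps r g"
  shows "\<exists>c. f = lin c"
proof -
  have "\<exists>d f'. f' \<in> tate_fps r g \<and> f = lin (\<lambda>i. fps_const (d i)) + fps_X * f'" if f: "f \<in> tate_fps r g" for f
  proof -
    have "f $ 0 \<in> eps.fq_span r (\<lambda>i. b i $ 0)" using tate_fps_nth_0[OF f] by (simp add: b_span)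
    then obtain d where d: "f $ 0 = eps.fq_lincomb r (\<lambda>i. b i $ 0) d" by (auto simp: eps.fq_span_def)
    define h where "h = f - lin (\<lambda>i. fps_const (d i))"
    have "h $ 0 = 0" by (simp add: h_def lin_nth_0 d)
    then obtain f' where f': "h = fps_X * f'" by (rule fps_X_dvdE)
    have "h \<in> tate_fps r g" unfolding h_def by (intro tate_fps_diff f lin_tate)
    hence "f' \<in> tate_fps r g" unfolding f' by (rule tate_fps_X_cancel)
    moreover have "f = lin (\<lambda>i. fps_const (d i)) + fps_X * f'" by (simp add: h_def flip: f')
    ultimately show ?thesis by blast
  qed
  then obtain D S where DS: "\<And>f. f \<in> tate_fps r g \<Longrightarrow> S f \<in> tate_fps r g \<and> f = lin (\<lambda>i. fps_const (D f i)) + fps_X * S f"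
    by metis
  define F where "F n = (S ^^ n) f" for n
  have F: "F n \<in> tate_fps r g" for n by (induction n) (auto simp: F_def assms DS)
  define c where "c n i = Abs_fps (\<lambda>k. D (F (n + k)) i)" for n i
  define \<delta> where "\<delta> n = F n - lin (c n)" for n
  have step: "\<delta> n = fps_X * \<delta> (Suc n)" for n
  proof -
    have *: "c n = (\<lambda>i. fps_const (D (F n) i) + fps_X * c (Suc n) i)"
      by (rule ext, rule fps_ext) (simp add: c_def)
    define L where "L = lin (\<lambda>i. fps_const (D (F n) i))"
    have A: "lin (c n) = L + fps_X * lin (c (Suc n))"
      unfolding lin_X unfolding L_def lin_def * emb.hom_add distrib_right sum.distrib ..
    have "F (Suc n) = S (F n)" by (simp add: F_def)
    hence B: "F n = L + fps_X * F (Suc n)" using DS[OF F[of n]] unfolding L_def by metis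
    have "F n - lin (c n) = (L + fps_X * F (Suc n)) - (L + fps_X * lin (c (Suc n)))"
      by (rule arg_cong2[OF B A])
    also have "\<dots> = fps_X * (F (Suc n) - lin (c (Suc n)))"
      by (simp only: right_diff_distrib add_diff_cancel_left)
    finally show ?thesis unfolding \<delta>_def .
  qed
  have "\<delta> 0 = fps_X ^ n * \<delta> n" for n
  proof (induction n)
    case (Suc n)
    have "fps_X ^ n * \<delta> n = fps_X ^ Suc n * \<delta> (Suc n)"
      unfolding power_Suc2 mult.assoc by (rule arg_cong[OF step])
    thus ?case using Suc by simp
  qed simp
  hence "fps_X ^ n dvd \<delta> 0" for n by (metis dvd_triv_left)
  hence "\<delta> 0 $ n = 0" for n unfolding fps_X_power_dvd_iff by blast
  hence "\<delta> 0 = 0" by (simp add: fps_eq_iff)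
  thus ?thesis by (auto simp: \<delta>_def F_def)
qed

definition coord :: "'a ratfun_ac fps \<Rightarrow> nat \<Rightarrow> 'a fps" where
  "coord f = (SOME c. f = lin c)"

lemma lin_coord: "f \<in> tate_fps r g \<Longrightarrow> lin (coord f) = f"
  unfolding coord_def using someI_ex[OF lin_exists] by metis

definition rho :: "('a ratfun_ac \<Rightarrow> 'a ratfun_ac) \<Rightarrow> 'a fps mat" where
  "rho \<sigma> = mat r r (\<lambda>(i, j). coord (fps_map \<sigma> (b j)) i)"

lemma rho_carrier [simp]: "rho \<sigma> \<in> carrier_mat r r"
  by (simp add: rho_def)

lemma rho_dim [simp]: "dim_row (rho \<sigma>) = r" "dim_col (rho \<sigma>) = r"
  by (simp_all add: rho_def)

lemma rho_action:
  assumes "ac_hom \<sigma>" "j < r"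
  shows "fps_map \<sigma> (b j) = lin (\<lambda>i. rho \<sigma> $$ (i, j))"
proof -
  have "lin (\<lambda>i. rho \<sigma> $$ (i, j)) = lin (coord (fps_map \<sigma> (b j)))"
    using assms(2) by (intro lin_cong) (simp add: rho_def)
  thus ?thesis using lin_coord[OF tate_fps_ac_hom[OF assms(1) b_tate[OF assms(2)]]] by simp
qed

lemma rho_congI:
  assumes "ac_hom \<sigma>" "i < r" "j < r" "fps_X ^ n dvd fps_map \<sigma> (b j) - lin (\<lambda>i. M $$ (i, j))"
  shows "fps_X ^ n dvd rho \<sigma> $$ (i, j) - M $$ (i, j)"
  using lin_dvd_imp[of n "\<lambda>i. rho \<sigma> $$ (i, j) - M $$ (i, j)"] assms rho_action[OF assms(1,3)]
  by (simp add: lin_diff)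

lemma rho_eqI:
  assumes "ac_hom \<sigma>" "M \<in> carrier_mat r r" "\<And>j. j < r \<Longrightarrow> fps_map \<sigma> (b j) = lin (\<lambda>i. M $$ (i, j))"
  shows "rho \<sigma> = M"
proof (rule eq_matI)
  fix i j assume "i < dim_row M" "j < dim_col M"
  hence ij: "i < r" "j < r" using assms(2) by auto
  have "lin (\<lambda>i. rho \<sigma> $$ (i, j)) = lin (\<lambda>i. M $$ (i, j))"
    using rho_action[OF assms(1) ij(2)] assms(3)[OF ij(2)] by simp
  thus "rho \<sigma> $$ (i, j) = M $$ (i, j)" using ij(1) by (rule lin_eq_imp)
qed (use assms(2) in \<open>auto simp: rho_def\<close>)

lemma lin_ac_hom:
  assumes "ac_hom \<sigma>"
  shows "fps_map \<sigma> (lin c) = (\<Sum>j<r. emb (c j) * fps_map \<sigma> (b j))"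
proof -
  interpret comm_ring_hom "fps_map \<sigma>"
    using assms(1) by (intro comm_ring_hom_fps_map ac_hom_comm_ring_hom)
  show ?thesis by (simp add: lin_def hom_sum hom_mult fps_map_emb[OF assms])
qed

lemma lin_ac_hom_rho:
  assumes "ac_hom \<sigma>"
  shows "fps_map \<sigma> (lin c) = lin (\<lambda>i. \<Sum>j<r. rho \<sigma> $$ (i, j) * c j)"
proof -
  have "fps_map \<sigma> (lin c) = (\<Sum>j<r. \<Sum>i<r. emb (c j) * (emb (rho \<sigma> $$ (i, j)) * b i))"
    unfolding lin_ac_hom[OF assms] by (intro sum.cong) (simp_all add: rho_action[OF assms] lin_def sum_distrib_left)
  also have "\<dots> = (\<Sum>i<r. \<Sum>j<r. emb (c j) * (emb (rho \<sigma> $$ (i, j)) * b i))" by (rule sum.swap)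
  also have "\<dots> = lin (\<lambda>i. \<Sum>j<r. rho \<sigma> $$ (i, j) * c j)"
    by (simp add: lin_def emb.hom_sum emb.hom_mult sum_distrib_left sum_distrib_right mult_ac)
  finally show ?thesis .
qed

lemma rho_comp:
  assumes "ac_hom \<sigma>" "ac_hom \<tau>"
  shows "rho (\<sigma> \<circ> \<tau>) = rho \<sigma> * rho \<tau>"
proof (rule rho_eqI)
  fix j assume j: "j < r"
  have "fps_map (\<sigma> \<circ> \<tau>) (b j) = fps_map \<sigma> (fps_map \<tau> (b j))" by (simp add: fps_eq_iff)
  also have "\<dots> = lin (\<lambda>i. \<Sum>k<r. rho \<sigma> $$ (i, k) * rho \<tau> $$ (k, j))"
    unfolding rho_action[OF assms(2) j] by (rule lin_ac_hom_rho[OF assms(1)])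
  also have "\<dots> = lin (\<lambda>i. (rho \<sigma> * rho \<tau>) $$ (i, j))"
    using j rho_carrier[of \<sigma>] rho_carrier[of \<tau>]
    by (intro lin_cong) (simp add: scalar_prod_def atLeast0LessThan)
  finally show "fps_map (\<sigma> \<circ> \<tau>) (b j) = lin (\<lambda>i. (rho \<sigma> * rho \<tau>) $$ (i, j))" .
qed (use assms ac_hom_comp mult_carrier_mat[OF rho_carrier rho_carrier] in auto)

lemma rho_id: "rho id = 1\<^sub>m r"
proof (rule rho_eqI[OF ac_hom_id])
  fix j assume j: "j < r"
  have "lin (\<lambda>i. 1\<^sub>m r $$ (i, j)) = (\<Sum>i<r. if i = j then b i else 0)"
    unfolding lin_def using j by (intro sum.cong) auto
  thus "fps_map id (b j) = lin (\<lambda>i. 1\<^sub>m r $$ (i, j))" using j by (simp add: fps_eq_iff)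
qed simp

lemma rho_GL:
  assumes "ac_hom \<sigma>"
  shows "rho \<sigma> \<in> GL r"
proof -
  let ?\<tau> = "inv_into UNIV \<sigma>"
  have \<tau>: "ac_hom ?\<tau>" by (rule ac_hom_inv[OF assms])
  have "\<sigma> \<circ> ?\<tau> = id" using ac_hom_bij[OF assms] by (auto simp: fun_eq_iff bij_def surj_f_inv_f)
  hence "rho \<sigma> * rho ?\<tau> = 1\<^sub>m r" using rho_comp[OF assms \<tau>] rho_id by simp
  hence "det (rho \<sigma>) * det (rho ?\<tau>) = 1"
    using det_mult[OF rho_carrier rho_carrier] by (metis det_one)
  thus ?thesis unfolding GL_iff_det using rho_carrier by (metis dvd_triv_left)
qed

text \<open>The image at level \<open>n\<close>, given by invertible matrices over the power series
  ring themselves instead of residues. Generation of SL over that ring thus applies without passing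
  to quotients.\<close>

definition img :: "nat \<Rightarrow> 'a fps mat set" where
  "img n = {M \<in> GL r. \<exists>\<sigma>. ac_hom \<sigma> \<and> (\<forall>i<r. \<forall>j<r. fps_X ^ n dvd M $$ (i, j) - rho \<sigma> $$ (i, j))}"

lemma img_carrier: "M \<in> img n \<Longrightarrow> M \<in> carrier_mat r r"
  by (auto simp: img_def GL_def)

lemma rho_img: "ac_hom \<sigma> \<Longrightarrow> rho \<sigma> \<in> img n"
  unfolding img_def using rho_GL by auto

lemma img_cong:
  assumes "M \<in> img n" "M' \<in> GL r" "\<And>i j. i < r \<Longrightarrow> j < r \<Longrightarrow> fps_X ^ n dvd M' $$ (i, j) - M $$ (i, j)"
  shows "M' \<in> img n"
proof -
  obtain \<sigma> where \<sigma>: "ac_hom \<sigma>" "\<forall>i<r. \<forall>j<r. fps_X ^ n dvd M $$ (i, j) - rho \<sigma> $$ (i, j)"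
    using assms(1) by (auto simp: img_def)
  have "fps_X ^ n dvd M' $$ (i, j) - rho \<sigma> $$ (i, j)" if "i < r" "j < r" for i j
    using dvd_add[OF assms(3)[OF that] \<sigma>(2)[rule_format, OF that]] by simp
  thus ?thesis using \<sigma>(1) assms(2) by (auto simp: img_def)
qed

lemma img_mult:
  assumes "A \<in> img n" "B \<in> img n"
  shows "A * B \<in> img n"
proof -
  obtain \<sigma> \<tau> where \<sigma>: "ac_hom \<sigma>" "\<forall>i<r. \<forall>j<r. fps_X ^ n dvd A $$ (i, j) - rho \<sigma> $$ (i, j)"
    and \<tau>: "ac_hom \<tau>" "\<forall>i<r. \<forall>j<r. fps_X ^ n dvd B $$ (i, j) - rho \<tau> $$ (i, j)"
    using assms by (auto simp: img_def)
  have AB: "A \<in> carrier_mat r r" "B \<in> carrier_mat r r" using assms img_carrier by auto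
  have "fps_X ^ n dvd (A * B) $$ (i, j) - rho (\<sigma> \<circ> \<tau>) $$ (i, j)" if "i < r" "j < r" for i j
  proof -
    have prod: "(M * N) $$ (i, j) = (\<Sum>k<r. M $$ (i, k) * N $$ (k, j))"
      if "M \<in> carrier_mat r r" "N \<in> carrier_mat r r" for M N :: "'a fps mat"
      using that \<open>i < r\<close> \<open>j < r\<close> by (simp add: scalar_prod_def atLeast0LessThan)
    have "(A * B) $$ (i, j) - rho (\<sigma> \<circ> \<tau>) $$ (i, j) =
        (\<Sum>k<r. A $$ (i, k) * B $$ (k, j) - rho \<sigma> $$ (i, k) * rho \<tau> $$ (k, j))"
      by (simp only: rho_comp[OF \<sigma>(1) \<tau>(1)] prod[OF AB] prod[OF rho_carrier rho_carrier] sum_subtractf)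
    also have "fps_X ^ n dvd \<dots>"
      using \<sigma>(2) \<tau>(2) that by (intro dvd_sum dvd_diff_mult) auto
    finally show ?thesis .
  qed
  moreover have "A * B \<in> GL r" using assms by (intro GL_mult) (auto simp: img_def)
  ultimately show ?thesis unfolding img_def using ac_hom_comp[OF \<sigma>(1) \<tau>(1)] by blast
qed

text \<open>The action of inertia: it fixes \<open>b 0, \<dots>, b (r - 2)\<close> and moves \<open>b (r - 1)\<close> freely.\<close>

lemma inertia_img:
  assumes M: "M \<in> GL r" and c: "c \<noteq> 0"
    and col: "\<And>i j. i < r \<Longrightarrow> j < r - 1 \<Longrightarrow> M $$ (i, j) = (if i = j then 1 else 0)"
    and corner: "M $$ (r - 1, r - 1) = fps_const c"
  shows "M \<in> img n"
proof -
  have "\<exists>\<sigma>. ac_hom \<sigma> \<and> (\<forall>i<r. \<forall>j<r. fps_X ^ n dvd rho \<sigma> $$ (i, j) - M $$ (i, j))"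
  proof (cases n)
    case 0
    thus ?thesis using ac_hom_id by auto
  next
    case (Suc k)
    define f where "f = (\<Sum>i<r - 1. emb (M $$ (i, r - 1)) * b i)"
    have f_tate: "f \<in> tate_fps r g" unfolding f_def
      by (intro tate_fps_sum tate_fps_mult_emb b_tate) auto
    have f_U: "f $ m \<in> U" for m
      unfolding f_def fps_sum_nth fps_mult_nth
      by (intro U_sum) (auto intro!: U_scale b_U)
    have split: "{..<r} = insert (r - 1) {..<r - 1}" using r by auto
    have lin_last: "lin (\<lambda>i. M $$ (i, r - 1)) = fps_const (eps c) * b (r - 1) + f"
      unfolding lin_def split by (simp add: f_def corner[unfolded One_nat_def] emb_const)
    have f_iter: "(phi r g ^^ (k - m)) (f $ k) = f $ m" if "m \<le> k" for m
      using tate_fps_iterate[OF f_tate, of "k - m" m] that by simp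
    have "(phi r g ^^ n) (f $ k) = phi r g ((phi r g ^^ (k - 0)) (f $ k))" by (simp add: Suc)
    also have "\<dots> = 0" using f_iter[of 0] tate_fps_nth_0[OF f_tate] by simp
    \<comment> \<open>The single point \<open>\<xi> n\<close>, which is coefficient \<open>k\<close>
      of the last basis series, is enough: the lower coefficients are its images under
      \<open>phi\<close> and follow.\<close>
    finally obtain \<sigma> where \<sigma>: "ac_hom \<sigma>" "\<forall>x\<in>U. \<sigma> x = x" "\<sigma> (\<xi> n) = eps c * \<xi> n + f $ k"
      using U_action[OF f_U _ c] by blast
    have iter: "\<sigma> ((phi r g ^^ m) x) = (phi r g ^^ m) (\<sigma> x)"
      "(phi r g ^^ m) (eps c * x + y) = eps c * (phi r g ^^ m) x + (phi r g ^^ m) y" for m x y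
      by (induction m) (simp_all add: ac_hom_phi[OF \<sigma>(1)] phi_add phi_scale)
    have xi_iter: "(phi r g ^^ (k - m)) (\<xi> n) = b (r - 1) $ m" if "m \<le> k" for m
      using tate_fps_iterate[OF b_tate, of "r - 1" "k - m" m] that r by (simp add: b_last[unfolded One_nat_def] Suc)
    have last: "\<sigma> (b (r - 1) $ m) = eps c * b (r - 1) $ m + f $ m" if "m < n" for m
    proof -
      have "m \<le> k" using that Suc by simp
      thus ?thesis
        using \<sigma>(3) iter xi_iter f_iter by metis
    qed
    have "fps_X ^ n dvd rho \<sigma> $$ (i, j) - M $$ (i, j)" if ij: "i < r" "j < r" for i j
    proof (rule rho_congI[OF \<sigma>(1) ij])
      show "fps_X ^ n dvd fps_map \<sigma> (b j) - lin (\<lambda>i. M $$ (i, j))"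
      proof (cases "j = r - 1")
        case True
        show ?thesis unfolding True lin_last fps_X_power_dvd_iff using last by simp
      next
        case False
        hence j: "j < r - 1" using ij by simp
        have "lin (\<lambda>i. M $$ (i, j)) = (\<Sum>i<r. if i = j then b i else 0)"
          unfolding lin_def using col[OF _ j] by (intro sum.cong) auto
        hence "lin (\<lambda>i. M $$ (i, j)) = b j" using ij by simp
        moreover have "fps_map \<sigma> (b j) = b j" using \<sigma>(2) b_U[OF j] by (simp add: fps_eq_iff)
        ultimately show ?thesis by simp
      qed
    qed
    thus ?thesis using \<sigma>(1) by blast
  qed
  then obtain \<sigma> where "ac_hom \<sigma>" "\<forall>i<r. \<forall>j<r. fps_X ^ n dvd rho \<sigma> $$ (i, j) - M $$ (i, j)" by blast
  thus ?thesis using M unfolding img_def by (subst (asm) dvd_diff_commute) blast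
qed

lemma img_diag:
  assumes "c \<noteq> 0"
  shows "multrow_mat r (r - 1) (fps_const c) \<in> img n"
proof (rule inertia_img[OF _ assms])
  show "multrow_mat r (r - 1) (fps_const c) \<in> GL r"
    using assms r by (simp add: GL_iff_det det_multrow_mat)
qed (use r in auto)

lemma transvection_img:
  assumes "d (r - 1) = 0"
  shows "transvection r d (\<lambda>j. if j = r - 1 then 1 else 0) \<in> img n" (is "?T \<in> _")
proof (rule inertia_img[of _ 1])
  have "upper_triangular ?T" by (auto simp: transvection_def upper_triangular_def)
  hence "det ?T = (\<Prod>i<r. ?T $$ (i, i))"
    using det_upper_triangular[of ?T r] by (simp add: prod_list_diag_prod atLeast0LessThan transvection_def)
  also have "\<dots> = 1" using assms by (intro prod.neutral) (auto simp: transvection_def)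
  finally show "?T \<in> GL r" by (simp add: GL_iff_det)
qed (use r assms in \<open>auto simp: transvection_def\<close>)

text \<open>Modulo X the vector \<open>v\<close> gives a nonzero point \<open>w\<close> of phi[T],
  and some \<sigma> moves it out of \<open>U\<close>, that is, makes its last coordinate nonzero.
  The last row of \<open>rho \<sigma>\<close> is the functional \<open>f\<close> sought, and
  conjugating the inertia transvections by \<sigma> gives those of \<open>f\<close>.\<close>

lemma SL_img:
  assumes "M \<in> carrier_mat r r" "det M = 1"
  shows "M \<in> img n"
proof (rule SL_subset_if_transvections[OF _ img_mult _ assms])
  fix v :: "nat \<Rightarrow> 'a fps" assume "\<exists>i<r. v i $ 0 \<noteq> 0"
  then obtain i where i: "i < r" "v i $ 0 \<noteq> 0" by blast
  define w where "w = lin v $ 0"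
  have "w \<noteq> 0" using i b_indep unfolding w_def lin_nth_0 eps.fq_indep_def by blast
  moreover have "phi r g w = 0" unfolding w_def by (rule tate_fps_nth_0[OF lin_tate])
  ultimately obtain \<sigma> where \<sigma>: "ac_hom \<sigma>" "\<sigma> w \<notin> U" using irr by blast
  define f where "f i = rho \<sigma> $$ (r - 1, i)" for i
  define v' where "v' i = (\<Sum>j<r. rho \<sigma> $$ (i, j) * v j)" for i
  have w': "\<sigma> w = lin v' $ 0"
    using arg_cong[OF lin_ac_hom_rho[OF \<sigma>(1), of v], of "\<lambda>f. f $ 0"] by (simp add: w_def v'_def[abs_def])
  have "v' (r - 1) $ 0 \<noteq> 0"
  proof
    assume v'0: "v' (r - 1) $ 0 = 0"
    have "{..<r} = insert (r - 1) {..<r - 1}" using r by auto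
    hence "\<sigma> w = (\<Sum>i<r - 1. eps (v' i $ 0) * b i $ 0)"
      unfolding w' lin_nth_0 eps.fq_lincomb_def by (simp add: v'0[unfolded One_nat_def])
    hence "\<sigma> w \<in> U" by (auto intro!: U_sum U_scale b_U)
    thus False using \<sigma>(2) by simp
  qed
  moreover have "transvection r c f \<in> img n" if c: "(\<Sum>i<r. f i * c i) = 0" for c
  proof -
    define \<tau> where "\<tau> = inv_into UNIV \<sigma>"
    have \<tau>: "ac_hom \<tau>" unfolding \<tau>_def by (rule ac_hom_inv[OF \<sigma>(1)])
    have "\<tau> \<circ> \<sigma> = id"
      using ac_hom_bij[OF \<sigma>(1)] by (auto simp: fun_eq_iff bij_def \<tau>_def)
    hence inv: "rho \<tau> * rho \<sigma> = 1\<^sub>m r" using rho_comp[OF \<tau> \<sigma>(1)] rho_id by simp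
    have entry: "(M * N) $$ (i, j) = (\<Sum>k<r. M $$ (i, k) * N $$ (k, j))"
      if "M \<in> carrier_mat r r" "N \<in> carrier_mat r r" "i < r" "j < r" for M N :: "'a fps mat" and i j
      using that by (simp add: scalar_prod_def atLeast0LessThan)
    have inv_entry: "(\<Sum>k<r. rho \<tau> $$ (i, k) * rho \<sigma> $$ (k, j)) = (if i = j then 1 else 0)"
      if "i < r" "j < r" for i j
      using entry[OF rho_carrier rho_carrier that, of \<tau> \<sigma>] that by (simp add: inv)
    define d where "d i = (\<Sum>j<r. rho \<sigma> $$ (i, j) * c j)" for i
    define e where "e = (\<lambda>j. if j = r - 1 then 1 else 0 :: 'a fps)"
    have inv_d: "(\<Sum>k<r. rho \<tau> $$ (i, k) * d k) = c i" if "i < r" for i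
    proof -
      have "(\<Sum>k<r. rho \<tau> $$ (i, k) * d k) = (\<Sum>j<r. \<Sum>k<r. rho \<tau> $$ (i, k) * rho \<sigma> $$ (k, j) * c j)"
        unfolding d_def sum_distrib_left by (subst sum.swap) (simp add: mult.assoc)
      also have "\<dots> = (\<Sum>j<r. if i = j then c j else 0)"
        using inv_entry[OF that] by (intro sum.cong) (simp_all flip: sum_distrib_right)
      finally show ?thesis using that by simp
    qed
    have "d (r - 1) = 0" using c by (simp add: d_def f_def)
    hence "transvection r d e \<in> img n" unfolding e_def by (rule transvection_img)
    hence "rho \<tau> * transvection r d e * rho \<sigma> \<in> img n"
      by (intro img_mult rho_img \<sigma> \<tau>)
    also have "rho \<tau> * transvection r d e * rho \<sigma> = transvection r c f"
    proof (rule eq_matI)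
      fix i j assume "i < dim_row (transvection r c f)" "j < dim_col (transvection r c f)"
      hence ij: "i < r" "j < r" by (simp_all add: transvection_def)
      have row: "(rho \<tau> * transvection r d e) $$ (i, k) = rho \<tau> $$ (i, k) + c i * e k" if "k < r" for k
      proof -
        have "(rho \<tau> * transvection r d e) $$ (i, k) =
            (\<Sum>l<r. (if l = k then rho \<tau> $$ (i, l) else 0) + rho \<tau> $$ (i, l) * d l * e k)"
          unfolding entry[OF rho_carrier transvection_carrier ij(1) that]
          using that by (intro sum.cong) (auto simp: transvection_def algebra_simps)
        thus ?thesis using that inv_d[OF ij(1)] by (simp add: sum.distrib flip: sum_distrib_right)
      qed
      have "(rho \<tau> * transvection r d e * rho \<sigma>) $$ (i, j) =
          (\<Sum>k<r. rho \<tau> $$ (i, k) * rho \<sigma> $$ (k, j) + (if k = r - 1 then c i * rho \<sigma> $$ (k, j) else 0))"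
        unfolding entry[OF mult_carrier_mat[OF rho_carrier transvection_carrier] rho_carrier ij]
        by (intro sum.cong refl, simp only: row lessThan_iff) (auto simp: e_def algebra_simps)
      also have "\<dots> = (if i = j then 1 else 0) + c i * f j"
        using inv_entry[OF ij] r by (simp add: sum.distrib f_def)
      finally show "(rho \<tau> * transvection r d e * rho \<sigma>) $$ (i, j) = transvection r c f $$ (i, j)"
        using ij by (simp add: transvection_def)
    qed (use rho_carrier[of \<sigma>] rho_carrier[of \<tau>] in \<open>simp_all add: transvection_def\<close>)
    finally show ?thesis .
  qed
  ultimately show "\<exists>f. (\<Sum>i<r. f i * v i) $ 0 \<noteq> 0 \<and> (\<forall>c. (\<Sum>i<r. f i * c i) = 0 \<longrightarrow> transvection r c f \<in> img n)"
    by (intro exI[of _ f]) (auto simp: v'_def f_def)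
qed (use r img_carrier in auto)

end

section \<open>The determinant\<close>

definition frob :: "nat \<Rightarrow> 'a :: finite_field ratfun_ac fps \<Rightarrow> 'a ratfun_ac fps" where
  "frob i = fps_map (\<lambda>x. x ^ (CARD('a) ^ i))"

lemma comm_ring_hom_frob: "comm_ring_hom (frob i)"
proof -
  have "comm_ring_hom (\<lambda>x :: 'a ratfun_ac. x ^ (CARD('a) ^ i))"
    by unfold_locales (simp_all add: eps.frob_add power_mult_distrib)
  thus ?thesis unfolding frob_def by (rule comm_ring_hom_fps_map)
qed

interpretation frob: comm_ring_hom "frob i" by (rule comm_ring_hom_frob)

lemma frob_nth [simp]: "frob i f $ n = (f $ n) ^ (CARD('a) ^ i)" for f :: "'a :: finite_field ratfun_ac fps"
  by (simp add: frob_def)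

lemma frob_emb: "frob i (emb c) = emb c"
  by (simp add: fps_eq_iff)

lemma frob_0 [simp]: "frob 0 f = f"
  by (simp add: fps_eq_iff)

lemma frob_frob: "frob i (frob j f) = frob (i + j) f" for f :: "'a :: finite_field ratfun_ac fps"
  by (simp add: fps_eq_iff add.commute[of i] power_add flip: power_mult)

lemma fps_map_frob: "ac_hom \<sigma> \<Longrightarrow> fps_map \<sigma> (frob i f) = frob i (fps_map \<sigma> f)"
proof -
  assume "ac_hom \<sigma>"
  then interpret comm_ring_hom \<sigma> by (rule ac_hom_comm_ring_hom)
  show ?thesis by (simp add: fps_eq_iff hom_power)
qed

lemma phi_eq:
  fixes g :: "nat \<Rightarrow> 'a :: finite_field poly"
  shows "phi r g x = frac_ac [:0, 1:] * x + (\<Sum>i=1..r. frac_ac (g i) * x ^ (CARD('a) ^ i))"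
  by (simp add: phi_def phi_poly_def frac_ac_poly.hom_add frac_ac_poly.hom_sum poly_sum poly_monom
      map_poly_monom)

subsection \<open>The Carlitz tower\<close>

text \<open>
  The torsion of the Carlitz module \<open>\<tau> + T\<close> is generated by an Eisenstein polynomial, whatever \<open>\<phi>\<close>
  is; the determinant of the Moore matrix of \<open>\<phi>\<close> is a twist of this module by a constant.
\<close>

definition carlitz :: "nat \<Rightarrow> 'a :: finite_field poly poly" where
  "carlitz n = ((\<lambda>p. p ^ CARD('a) + smult [:0, 1:] p) ^^ n) [:0, 1:]"

lemma carlitz_0: "carlitz 0 = [:0, 1:]"
  by (simp add: carlitz_def)

lemma carlitz_Suc: "(carlitz (Suc n) :: 'a :: finite_field poly poly) = carlitz n ^ CARD('a) + smult [:0, 1:] (carlitz n)"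
  by (simp add: carlitz_def)

lemma prime_elem_X_poly: "prime_elem ([:0, 1:] :: 'f :: field poly)"
proof (rule prime_elemI)
  have *: "[:0, 1:] dvd p \<longleftrightarrow> coeff p 0 = 0" for p :: "'f poly"
    using poly_eq_0_iff_dvd[of p 0] by (simp add: poly_0_coeff_0)
  fix a b :: "'f poly" assume "[:0, 1:] dvd a * b"
  thus "[:0, 1:] dvd a \<or> [:0, 1:] dvd b" by (simp add: * coeff_mult_0)
qed (simp_all add: is_unit_iff_degree)

lemma X_poly_multiplicity:
  fixes c :: "'f :: field poly"
  assumes "c \<noteq> 0"
  shows "\<exists>k c'. c = [:0, 1:] ^ k * c' \<and> \<not> [:0, 1:] dvd c'"
  using order_decomp[OF assms, of 0] by auto

lemma carlitz_form:
  "\<exists>Y. (carlitz n :: 'a :: finite_field poly poly) = monom 1 (CARD('a) ^ n) + smult [:0, 1:] Y"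
proof (induction n)
  case 0
  show ?case by (intro exI[of _ 0]) (simp add: carlitz_0 monom_altdef)
next
  case (Suc n)
  interpret A: fq_algebra "\<lambda>c :: 'a. [:[:c:]:]" "CARD('a)"
    by unfold_locales (simp_all add: one_pCons)
  obtain Y where Y: "(carlitz n :: 'a poly poly) = monom 1 (CARD('a) ^ n) + smult [:0, 1:] Y"
    using Suc by blast
  have "carlitz n ^ CARD('a) = monom 1 (CARD('a) ^ Suc n) + smult ([:0, 1:] ^ CARD('a)) (Y ^ CARD('a))"
    unfolding Y A.frob_add1 by (simp add: monom_power smult_power mult.commute)
  moreover have "[:0, 1:] ^ CARD('a) = [:0, 1:] * [:0, 1 :: 'a:] ^ (CARD('a) - 1)"
    by (metis power_eq_if zero_less_card_finite less_numeral_extra(3))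
  ultimately show ?case unfolding carlitz_Suc
    by (intro exI[of _ "smult ([:0, 1:] ^ (CARD('a) - 1)) (Y ^ CARD('a)) + carlitz n"])
       (simp add: smult_add_right del: mult_pCons_left)
qed

lemma carlitz_degree:
  "degree (carlitz n :: 'a :: finite_field poly poly) = CARD('a) ^ n \<and> lead_coeff (carlitz n :: 'a poly poly) = 1"
proof (induction n)
  case 0
  show ?case by (simp add: carlitz_0)
next
  case (Suc n)
  let ?C = "carlitz n :: 'a poly poly"
  have nz: "?C \<noteq> 0" using Suc by auto
  have "CARD('a) ^ n < CARD('a) ^ Suc n"
    using card_finite_field_ge_2[where 'a = 'a] by (intro power_strict_increasing) auto
  hence less: "degree (smult [:0, 1:] ?C) < degree (?C ^ CARD('a))"
    using Suc nz by (simp add: degree_power_eq)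
  have "degree (carlitz (Suc n) :: 'a poly poly) = degree (?C ^ CARD('a))"
    "lead_coeff (carlitz (Suc n) :: 'a poly poly) = lead_coeff (?C ^ CARD('a))"
    unfolding carlitz_Suc add.commute[of "?C ^ CARD('a)"]
    by (rule degree_add_eq_right[OF less], rule lead_coeff_add_le[OF less])
  moreover have "lead_coeff (?C ^ CARD('a)) = 1"
    using Suc lead_coeff_power[of ?C "CARD('a)"] by (metis power_one)
  ultimately show ?case using Suc nz by (simp add: degree_power_eq)
qed

lemma q_poly_carlitz: "q_poly CARD('a) (carlitz n :: 'a :: finite_field poly poly)"
proof -
  interpret A: fq_algebra "\<lambda>c :: 'a. [:c:]" "CARD('a)"
    by unfold_locales (simp_all add: one_pCons)
  show ?thesis
    by (induction n) (auto simp: carlitz_0 carlitz_Suc intro!: q_poly_X q_poly_add q_poly_smult A.q_poly_power1)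
qed

text \<open>Here \<open>z\<close> generates the Carlitz T-torsion, and both points are roots of
  C^(q-1) + T, where C is \<open>carlitz n\<close>. Modulo T this is a power of the variable, and
  its constant term is exactly T, so it is Eisenstein.\<close>

lemma carlitz_conjugate:
  fixes x y z :: "'a :: finite_field ratfun_ac"
  assumes "z ^ (CARD('a) - 1) = - frac_ac [:0, 1:]"
    and "poly (map_poly frac_ac (carlitz n)) x = z" "poly (map_poly frac_ac (carlitz n)) y = z"
  obtains \<sigma> where "ac_hom \<sigma>" "\<sigma> x = y"
proof -
  define k where "k = CARD('a) - 1"
  have k: "k > 0" using card_finite_field_ge_2[where 'a = 'a] by (simp add: k_def)
  define f :: "'a poly poly" where "f = carlitz n ^ k + [:[:0, 1:]:]"
  define d where "d = k * CARD('a) ^ n"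
  have "d > 0" using k by (simp add: d_def)
  have nz: "carlitz n \<noteq> (0 :: 'a poly poly)" using carlitz_degree[of n, where 'a = 'a] by auto
  have dC: "degree (carlitz n ^ k :: 'a poly poly) = d" using carlitz_degree[of n, where 'a = 'a] nz
    by (simp add: degree_power_eq d_def)
  hence deg: "degree f = d" unfolding f_def using \<open>d > 0\<close> by (subst degree_add_eq_left) simp_all
  have lead: "lead_coeff f = 1"
  proof -
    have "coeff f d = lead_coeff (carlitz n ^ k :: 'a poly poly)"
      using \<open>d > 0\<close> by (simp add: f_def dC coeff_pCons split: nat.split)
    also have "\<dots> = 1"
      using carlitz_degree[of n, where 'a = 'a] lead_coeff_power[of "carlitz n :: 'a poly poly" k]
      by (metis power_one)
    finally show ?thesis by (simp add: deg)
  qed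
  obtain Y where Y: "(carlitz n :: 'a poly poly) = monom 1 (CARD('a) ^ n) + smult [:0, 1:] Y"
    using carlitz_form by blast
  have "[:[:0, 1:]:] dvd (carlitz n ^ k - monom 1 (CARD('a) ^ n) ^ k :: 'a poly poly)"
  proof -
    have "carlitz n - monom 1 (CARD('a) ^ n) = [:[:0, 1:]:] * Y" by (simp add: Y)
    hence "[:[:0, 1:]:] dvd (carlitz n - monom 1 (CARD('a) ^ n) :: 'a poly poly)" by (simp only: dvd_triv_left)
    moreover have "(carlitz n - monom 1 (CARD('a) ^ n)) dvd (carlitz n ^ k - monom 1 (CARD('a) ^ n) ^ k :: 'a poly poly)"
      using poly_diff_dvd[of "carlitz n :: 'a poly poly" "monom 1 (CARD('a) ^ n)" "monom 1 k"] by (simp add: poly_monom)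
    ultimately show ?thesis by (rule dvd_trans)
  qed
  from dvd_add[OF this dvd_refl] have "[:[:0, 1:]:] dvd f - monom 1 d"
    by (simp add: f_def monom_power d_def mult.commute diff_add_eq del: const_poly_dvd_const_poly_iff)
  hence dvd: "[:0, 1:] dvd coeff f i" if "i \<noteq> d" for i
    using that unfolding const_poly_dvd_iff by (metis coeff_diff coeff_monom diff_zero)
  have "coeff (carlitz n ^ k :: 'a poly poly) 0 = 0"
    using k q_poly_coeff_0[OF card_finite_field_ge_2 q_poly_carlitz] by (simp add: coeff_0_power zero_power)
  hence const: "coeff f 0 = [:0, 1:]" by (simp add: f_def)
  have root: "poly (map_poly frac_ac f) w = 0" if "poly (map_poly frac_ac (carlitz n)) w = z" for w
    using assms(1) that by (simp add: f_def k_def frac_ac_poly.hom_add frac_ac_poly.hom_power map_poly_const)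
  obtain \<sigma> where "ac_hom \<sigma>" "\<sigma> x = y"
  proof (rule eisenstein_conjugate[OF prime_elem_X_poly X_poly_multiplicity])
    show "degree f > 0" by (simp add: deg \<open>d > 0\<close>)
    show "\<not> [:0, 1:] dvd lead_coeff f" by (simp add: lead is_unit_iff_degree)
    show "[:0, 1:] dvd coeff f i" if "i < degree f" for i using dvd that deg by simp
    show "\<not> [:0, 1:] ^ 2 dvd coeff f 0"
    proof
      assume "[:0, 1:] ^ 2 dvd coeff f 0"
      hence "degree ([:0, 1:] ^ 2 :: 'a poly) \<le> degree (coeff f 0)"
        unfolding const by (rule dvd_imp_degree_le) simp
      thus False by (simp add: const power2_eq_square degree_mult_eq)
    qed
    show "poly (map_poly frac_ac f) x = 0" "poly (map_poly frac_ac f) y = 0"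
      using assms root by blast+
  qed auto
  thus ?thesis by (rule that)
qed

context tate_local_basis
begin

abbreviation \<theta> :: "'a ratfun_ac" where "\<theta> \<equiv> frac_ac [:0, 1:]"

text \<open>The Moore matrix of the basis with Frobenius acting on coefficients. Frobenius twists
  commute with \<sigma> and fix \<open>emb\<close>, so \<sigma> acts on it through right
  multiplication by \<open>rho \<sigma>\<close>.\<close>

definition moore :: "'a ratfun_ac fps mat" where
  "moore = mat r r (\<lambda>(i, j). frob i (b j))"

lemma moore_carrier [simp]: "moore \<in> carrier_mat r r"
  by (simp add: moore_def)

lemma det_moore_ac_hom:
  assumes "ac_hom \<sigma>"
  shows "fps_map \<sigma> (det moore) = det moore * emb (det (rho \<sigma>))"
proof -
  interpret S: comm_ring_hom "fps_map \<sigma>"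
    using assms(1) by (intro comm_ring_hom_fps_map ac_hom_comm_ring_hom)
  have "map_mat (fps_map \<sigma>) moore = moore * map_mat emb (rho \<sigma>)"
  proof (rule eq_matI)
    fix i j assume "i < dim_row (moore * map_mat emb (rho \<sigma>))" "j < dim_col (moore * map_mat emb (rho \<sigma>))"
    hence ij: "i < r" "j < r" by (auto simp: moore_def)
    have "map_mat (fps_map \<sigma>) moore $$ (i, j) = frob i (lin (\<lambda>k. rho \<sigma> $$ (k, j)))"
      using ij by (simp add: moore_def fps_map_frob[OF assms] rho_action[OF assms])
    also have "\<dots> = (\<Sum>k<r. emb (rho \<sigma> $$ (k, j)) * frob i (b k))"
      by (simp add: lin_def frob.hom_sum frob.hom_mult frob_emb)
    also have "\<dots> = (moore * map_mat emb (rho \<sigma>)) $$ (i, j)"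
      using ij by (simp add: moore_def scalar_prod_def atLeast0LessThan mult.commute)
    finally show "map_mat (fps_map \<sigma>) moore $$ (i, j) = (moore * map_mat emb (rho \<sigma>)) $$ (i, j)" .
  qed (simp_all add: moore_def)
  hence "det (map_mat (fps_map \<sigma>) moore) = det moore * det (map_mat emb (rho \<sigma>))"
    by (simp add: det_mult[of _ r])
  thus ?thesis by simp
qed

text \<open>Moore's criterion: a relation among the rows at X = 0 is a nonzero additive polynomial
  of degree at most q^(r-1) that would vanish on all q^r points of phi[T].\<close>

lemma det_moore_nonzero: "det moore $ 0 \<noteq> 0"
proof
  assume "det moore $ 0 = 0"
  interpret red: comm_ring_hom "\<lambda>f :: 'a ratfun_ac fps. f $ 0" by unfold_locales auto
  define M where "M = map_mat (\<lambda>f. f $ 0) moore"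
  have M: "M \<in> carrier_mat r r" by (simp add: M_def)
  have "det M = 0" using \<open>det moore $ 0 = 0\<close> by (simp add: M_def)
  hence "det (transpose_mat M) = 0" by (simp add: det_transpose[OF M])
  then obtain v where v: "v \<in> carrier_vec r" "v \<noteq> 0\<^sub>v r" "transpose_mat M *\<^sub>v v = 0\<^sub>v r"
    using det_0_iff_vec_prod_zero_field[of "transpose_mat M" r] M by auto
  define p where "p = (\<Sum>i<r. monom (vec_index v i) (CARD('a) ^ i))"
  have q_poly: "q_poly CARD('a) p" unfolding p_def by (intro q_poly_sum q_poly_monom)
  have "poly p (b j $ 0) = 0" if j: "j < r" for j
  proof -
    have "vec_index (transpose_mat M *\<^sub>v v) j = (\<Sum>i<r. (b j $ 0) ^ (CARD('a) ^ i) * vec_index v i)"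
      using j M v(1) by (simp add: scalar_prod_def atLeast0LessThan M_def moore_def)
    thus ?thesis using v(3) j by (simp add: p_def poly_sum poly_monom mult.commute)
  qed
  hence "poly p x = 0" if "x \<in> eps.fq_span r (\<lambda>i. b i $ 0)" for x
    using that by (auto simp: eps.fq_span_def eps.fq_lincomb_def eps.q_poly_poly_sum[OF q_poly]
        eps.q_poly_poly_scale[OF q_poly])
  hence sub: "eps.fq_span r (\<lambda>i. b i $ 0) \<subseteq> {x. poly p x = 0}" by blast
  obtain i where i: "i < r" "vec_index v i \<noteq> 0" using v(1,2) by (metis carrier_vecD eq_vecI index_zero_vec)
  have "coeff p (CARD('a) ^ i) = vec_index v i" using i by (simp add: p_def coeff_sum)
  hence "p \<noteq> 0" using i by auto
  have "CARD('a) ^ r \<le> card {x. poly p x = 0}"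
    using card_mono[OF poly_roots_finite[OF \<open>p \<noteq> 0\<close>] sub] eps.card_fq_span[OF b_indep] by simp
  also have "\<dots> \<le> degree p" by (rule card_poly_roots_bound) fact
  also have "degree p \<le> CARD('a) ^ (r - 1)" unfolding p_def
    by (intro degree_sum_le order.trans[OF degree_monom_le] power_increasing) auto
  also have "\<dots> < CARD('a) ^ r"
    using card_finite_field_ge_2[where 'a = 'a] r by (intro power_strict_increasing) auto
  finally show False by simp
qed

text \<open>Frobenius shifts the rows of the Moore matrix, and the new last row is expressed by the
  equation of the Tate module. So it acts through the companion matrix \<Psi>, whose first column
  has a single nonzero entry.\<close>

lemma frob_det_moore:
  obtains \<kappa> where "frob 1 (det moore) = fps_const \<kappa> * (fps_X - fps_const \<theta>) * det moore"
proof -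
  define G where "G i = frac_ac (g i)" for i
  have Gr: "G r \<noteq> 0" using g_r by (simp add: G_def)
  define \<Psi> where "\<Psi> = mat r r (\<lambda>(i, j). if i < r - 1 then (if j = Suc i then 1 else 0)
    else if j = 0 then fps_const (1 / G r) * (fps_X - fps_const \<theta>) else fps_const (- (G j / G r)))"
  have \<Psi>: "\<Psi> \<in> carrier_mat r r" by (simp add: \<Psi>_def)
  have "map_mat (frob 1) moore = \<Psi> * moore"
  proof (rule eq_matI)
    fix i j assume "i < dim_row (\<Psi> * moore)" "j < dim_col (\<Psi> * moore)"
    hence ij: "i < r" "j < r" by (auto simp: moore_def \<Psi>_def)
    have lhs: "map_mat (frob 1) moore $$ (i, j) = frob (Suc i) (b j)"
      using ij by (simp add: moore_def frob_frob)
    have rhs: "(\<Psi> * moore) $$ (i, j) = (\<Sum>k<r. \<Psi> $$ (i, k) * frob k (b j))"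
      using ij by (simp add: moore_def \<Psi>_def scalar_prod_def atLeast0LessThan)
    show "map_mat (frob 1) moore $$ (i, j) = (\<Psi> * moore) $$ (i, j)"
    proof (cases "i < r - 1")
      case True
      have "(\<Sum>k<r. \<Psi> $$ (i, k) * frob k (b j)) = (\<Sum>k<r. if k = Suc i then frob k (b j) else 0)"
        using True ij by (intro sum.cong) (auto simp: \<Psi>_def)
      also have "\<dots> = frob (Suc i) (b j)" using True by auto
      finally show ?thesis using lhs rhs by simp
    next
      case False
      hence i: "Suc i = r" using ij by simp
      have split: "{..<r} = insert 0 {1..r - 1}" "{1..r} = insert r {1..r - 1}" using r by auto
      have "fps_X * b j = fps_map (phi r g) (b j)" using b_tate[OF ij(2)] by (simp add: tate_fps_def)
      also have "\<dots> = fps_const \<theta> * b j + (\<Sum>k=1..r. fps_const (G k) * frob k (b j))"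
        by (simp add: fps_eq_iff phi_eq fps_sum_nth G_def)
      also have "\<dots> = fps_const \<theta> * b j + (fps_const (G r) * frob r (b j) + (\<Sum>k=1..r - 1. fps_const (G k) * frob k (b j)))"
        unfolding split(2) using r by simp
      finally have "fps_const (G r) * frob r (b j) =
          (fps_X - fps_const \<theta>) * b j - (\<Sum>k=1..r - 1. fps_const (G k) * frob k (b j))"
        by (simp add: algebra_simps)
      hence "fps_const (1 / G r) * (fps_const (G r) * frob r (b j)) =
          fps_const (1 / G r) * (fps_X - fps_const \<theta>) * b j - (\<Sum>k=1..r - 1. fps_const (G k / G r) * frob k (b j))"
        by (simp add: right_diff_distrib sum_distrib_left flip: mult.assoc)
      moreover have "fps_const (1 / G r) * (fps_const (G r) * frob r (b j)) = frob r (b j)"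
        using Gr by (simp flip: mult.assoc)
      moreover have "(\<Sum>k<r. \<Psi> $$ (i, k) * frob k (b j)) = fps_const (1 / G r) * (fps_X - fps_const \<theta>) * b j -
          (\<Sum>k=1..r - 1. fps_const (G k / G r) * frob k (b j))"
      proof -
        have "(\<Sum>k=1..r - 1. \<Psi> $$ (i, k) * frob k (b j)) = (\<Sum>k=1..r - 1. - (fps_const (G k / G r) * frob k (b j)))"
          using False ij by (intro sum.cong) (auto simp: \<Psi>_def simp flip: fps_const_neg)
        moreover have "\<Psi> $$ (i, 0) = fps_const (1 / G r) * (fps_X - fps_const \<theta>)"
          using False ij r by (simp add: \<Psi>_def)
        ultimately show ?thesis unfolding split(1) by (simp add: sum_negf)
      qed
      ultimately show ?thesis using lhs rhs i by simp
    qed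
  qed (simp_all add: moore_def \<Psi>_def)
  hence eq: "frob 1 (det moore) = det \<Psi> * det moore"
    using det_mult[OF \<Psi> moore_carrier] by (metis frob.hom_det)
  have "det \<Psi> = (\<Sum>i<r. \<Psi> $$ (i, 0) * cofactor \<Psi> i 0)"
    using r by (intro laplace_expansion_column[OF \<Psi>]) simp
  also have "\<dots> = (\<Sum>i<r. if i = r - 1 then fps_const (1 / G r) * (fps_X - fps_const \<theta>) * cofactor \<Psi> (r - 1) 0 else 0)"
    using r by (intro sum.cong) (auto simp: \<Psi>_def)
  also have "\<dots> = fps_const (1 / G r) * (fps_X - fps_const \<theta>) * cofactor \<Psi> (r - 1) 0"
    using r by simp
  also have "mat_delete \<Psi> (r - 1) 0 = 1\<^sub>m (r - 1)"
    using r by (intro eq_matI) (auto simp: mat_delete_def \<Psi>_def)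
  hence "cofactor \<Psi> (r - 1) 0 = (-1) ^ (r - 1)" by (simp add: cofactor_def)
  also have "(-1) ^ (r - 1) = fps_const ((-1) ^ (r - 1) :: 'a ratfun_ac)"
    by (metis fps_const_1_eq_1 fps_const_neg fps_const_power)
  finally have "det \<Psi> = fps_const ((-1) ^ (r - 1) * (1 / G r)) * (fps_X - fps_const \<theta>)"
    by (simp only: mult_ac flip: fps_const_mult)
  thus ?thesis using that eq by metis
qed

text \<open>After scaling by \<mu> the coefficients of the Moore determinant form a Carlitz division
  tower, on which some \<sigma> acts as \<open>u\<close> up to level \<open>n\<close>. The scaling
  factor need not be fixed by \<sigma>, which costs the constant \<open>c\<close>.\<close>

lemma det_rho_units:
  assumes "u $ 0 = 1"
  obtains \<sigma> c where "ac_hom \<sigma>" "c \<noteq> 0" "fps_X ^ n dvd det (rho \<sigma>) - fps_const c * u"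
proof -
  define D where "D = det moore"
  have D0: "D $ 0 \<noteq> 0" unfolding D_def by (rule det_moore_nonzero)
  obtain \<kappa> where \<kappa>: "frob 1 D = fps_const \<kappa> * (fps_X - fps_const \<theta>) * D"
    unfolding D_def by (rule frob_det_moore)
  have "\<theta> \<noteq> 0" by simp
  have D_0: "(D $ 0) ^ CARD('a) = - \<kappa> * \<theta> * D $ 0"
    using arg_cong[OF \<kappa>, of "\<lambda>f. f $ 0"] by simp
  have D_Suc: "(D $ Suc k) ^ CARD('a) = \<kappa> * (D $ k - \<theta> * D $ Suc k)" for k
  proof -
    have "frob 1 D $ Suc k = (fps_const \<kappa> * (fps_X * D - fps_const \<theta> * D)) $ Suc k"
      unfolding \<kappa> by (simp only: mult.assoc left_diff_distrib)
    thus ?thesis by simp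
  qed
  obtain z0 where z0: "z0 ^ (CARD('a) - 1) = - \<theta>"
    using nth_root_exists[of "CARD('a) - 1"] card_finite_field_ge_2[where 'a = 'a] by auto
  have "z0 \<noteq> 0"
    using z0 \<open>\<theta> \<noteq> 0\<close> card_finite_field_ge_2[where 'a = 'a] by (auto simp: power_0_left split: if_splits)
  have z0q: "z0 ^ CARD('a) = - \<theta> * z0"
    using z0 power_minus_mult[of "CARD('a)" z0] by simp
  \<comment> \<open>This scaling makes \<mu>^q \<kappa> = \<mu>, which turns the recursion for the
    coefficients of \<open>D\<close> into x^q + T x. It also makes the bottom coefficient equal to
    \<open>z0\<close>.\<close>
  define \<mu> where "\<mu> = z0 / D $ 0"
  have \<mu>: "\<mu> \<noteq> 0" using \<open>z0 \<noteq> 0\<close> D0 by (simp add: \<mu>_def)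
  have \<kappa>_nz: "\<kappa> \<noteq> 0" using D_0 D0 by auto
  have \<mu>q: "\<mu> ^ CARD('a) * \<kappa> = \<mu>"
    using D_0 z0q D0 \<open>\<theta> \<noteq> 0\<close> \<kappa>_nz by (simp add: \<mu>_def power_divide field_simps)
  define \<delta> where "\<delta> k = \<mu> * D $ k" for k
  have C_0: "\<delta> 0 ^ CARD('a) + \<theta> * \<delta> 0 = 0" and \<delta>0: "\<delta> 0 = z0"
    using z0q D0 by (simp_all add: \<delta>_def \<mu>_def)
  have C_Suc: "\<delta> (Suc k) ^ CARD('a) + \<theta> * \<delta> (Suc k) = \<delta> k" for k
  proof -
    have "\<delta> (Suc k) ^ CARD('a) = (\<mu> ^ CARD('a) * \<kappa>) * (D $ k - \<theta> * D $ Suc k)"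
      by (simp add: \<delta>_def power_mult_distrib D_Suc)
    thus ?thesis unfolding \<mu>q by (simp add: \<delta>_def algebra_simps)
  qed
  define C :: "'a ratfun_ac \<Rightarrow> 'a ratfun_ac" where "C x = x ^ CARD('a) + \<theta> * x" for x
  have carlitz: "poly (map_poly frac_ac (carlitz k)) x = (C ^^ k) x" for k x
    by (induction k) (simp_all add: carlitz_0 carlitz_Suc C_def map_poly_pCons frac_ac_poly.hom_add
        frac_ac_poly.hom_power frac_ac.map_poly_hom_smult)
  have C_add: "C (x + y) = C x + C y" and C_scale: "C (eps a * x) = eps a * C x" for x y a
    by (simp_all add: C_def eps.frob_add1 power_mult_distrib algebra_simps)
  have "C 0 = 0" by (simp add: C_def)
  hence C_sum: "C (sum f A) = (\<Sum>i\<in>A. C (f i))" for f :: "nat \<Rightarrow> _" and A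
    by (induction A rule: infinite_finite_induct) (simp_all add: C_add)
  \<comment> \<open>Coefficient \<open>k\<close> of the tower multiplied by \<open>u\<close>: a
    second tower with the same bottom point because \<open>u $ 0 = 1\<close>. One conjugation at the
    top level carries one tower to the other.\<close>
  define \<eta> where "\<eta> k = (\<Sum>i\<le>k. eps (u $ (k - i)) * \<delta> i)" for k
  have C_\<delta>: "C (\<delta> (Suc k)) = \<delta> k" "C (\<delta> 0) = 0" for k using C_0 C_Suc by (simp_all add: C_def)
  have C_\<eta>: "C (\<eta> (Suc k)) = \<eta> k" for k
    by (simp add: \<eta>_def C_add C_sum C_scale sum.atMost_Suc_shift C_\<delta> del: sum.atMost_Suc)
  have iter: "(C ^^ j) (\<delta> (k + j)) = \<delta> k \<and> (C ^^ j) (\<eta> (k + j)) = \<eta> k" for j k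
    by (induction j arbitrary: k) (simp_all add: funpow_Suc_right C_\<delta> C_\<eta> del: funpow.simps(2))
  have \<eta>0: "\<eta> 0 = z0" using assms by (simp add: \<eta>_def \<delta>0)
  obtain \<sigma> where \<sigma>: "ac_hom \<sigma>" "\<sigma> (\<delta> n) = \<eta> n"
    by (rule carlitz_conjugate[OF z0, of n "\<delta> n" "\<eta> n"])
       (use iter[of n 0] in \<open>simp_all add: carlitz \<delta>0 \<eta>0\<close>)
  interpret \<sigma>: comm_ring_hom \<sigma> using \<sigma>(1) by (rule ac_hom_comm_ring_hom)
  have C_\<sigma>: "\<sigma> (C x) = C (\<sigma> x)" for x
    by (simp add: C_def \<sigma>.hom_add \<sigma>.hom_mult \<sigma>.hom_power ac_hom_frac_ac[OF \<sigma>(1)])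
  have \<sigma>_iter: "\<sigma> ((C ^^ j) x) = (C ^^ j) (\<sigma> x)" for j x by (induction j) (simp_all add: C_\<sigma>)
  have \<sigma>\<delta>: "\<sigma> (\<delta> k) = \<eta> k" if "k \<le> n" for k
    using iter[of "n - k" k] that \<sigma>(2) \<sigma>_iter[of "n - k" "\<delta> n"] by simp
  define \<Delta> where "\<Delta> = fps_const \<mu> * D"
  have \<Delta>: "\<Delta> $ k = \<delta> k" for k by (simp add: \<Delta>_def \<delta>_def)
  have 1: "fps_X ^ n dvd fps_map \<sigma> \<Delta> - emb u * \<Delta>"
    unfolding fps_X_power_dvd_iff
  proof (intro allI impI)
    fix k assume "k < n"
    have "(emb u * \<Delta>) $ k = (\<Sum>i=0..k. \<Delta> $ i * emb u $ (k - i))"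
      by (subst mult.commute) (simp add: fps_mult_nth)
    hence "(emb u * \<Delta>) $ k = \<eta> k" by (simp add: \<Delta> \<eta>_def atLeast0AtMost mult.commute)
    thus "(fps_map \<sigma> \<Delta> - emb u * \<Delta>) $ k = 0" using \<sigma>\<delta>[of k] \<open>k < n\<close> by (simp add: \<Delta>)
  qed
  interpret S: comm_ring_hom "fps_map \<sigma>"
    using \<sigma>(1) by (intro comm_ring_hom_fps_map ac_hom_comm_ring_hom)
  define d where "d = det (rho \<sigma>)"
  define c where "c = \<sigma> \<mu> / \<mu>"
  have "fps_map \<sigma> (fps_const \<mu>) = fps_const (\<sigma> \<mu>)" by (simp add: fps_eq_iff)
  hence "fps_map \<sigma> \<Delta> = fps_const (\<sigma> \<mu>) * (D * emb d)"
    by (simp add: \<Delta>_def S.hom_mult D_def d_def det_moore_ac_hom[OF \<sigma>(1)])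
  also have "fps_const (\<sigma> \<mu>) = fps_const c * fps_const \<mu>" using \<mu> by (simp add: c_def)
  also have "\<dots> * (D * emb d) = fps_const c * emb d * \<Delta>" by (simp only: \<Delta>_def mult_ac)
  finally have "fps_X ^ n dvd (fps_const c * emb d - emb u) * \<Delta>"
    using 1 by (simp add: left_diff_distrib)
  moreover have "\<Delta> dvd 1" using \<mu> D0 by (simp add: \<Delta>_def)
  ultimately have 2: "fps_X ^ n dvd fps_const c * emb d - emb u"
    by (metis dvd_mult_unit_iff)
  have d0: "d $ 0 \<noteq> 0" using rho_GL[OF \<sigma>(1)] by (simp add: d_def GL_iff_det)
  \<comment> \<open>The twist \<open>c\<close> is identified at the bottom of the tower: \<sigma>
    fixes \<open>z0 = \<mu> * D $ 0\<close>, so \<open>c\<close> is inverse to the constant term of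
    the determinant and lies in F_q.\<close>
  have "\<sigma> z0 = z0" using \<sigma>\<delta>[of 0] by (simp add: \<delta>0 \<eta>0)
  have "fps_map \<sigma> D $ 0 = (D * emb d) $ 0" by (simp add: D_def d_def det_moore_ac_hom[OF \<sigma>(1)])
  hence "\<sigma> (D $ 0) = D $ 0 * eps (d $ 0)" by simp
  moreover have "\<mu> * D $ 0 = z0" using D0 by (simp add: \<mu>_def)
  hence "\<sigma> \<mu> * \<sigma> (D $ 0) = \<mu> * D $ 0" using \<open>\<sigma> z0 = z0\<close> by (metis \<sigma>.hom_mult)
  ultimately have "c * eps (d $ 0) = 1" using D0 \<mu> by (simp add: c_def field_simps)
  have "fps_const (eps (d $ 0)) * (fps_const c * emb d - emb u) = emb (d - fps_const (d $ 0) * u)"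
  proof -
    have "fps_const (eps (d $ 0)) * (fps_const c * emb d) = emb d"
      using \<open>c * eps (d $ 0) = 1\<close> by (simp add: mult.commute flip: mult.assoc)
    thus ?thesis by (simp add: right_diff_distrib emb.hom_minus emb.hom_mult emb_const)
  qed
  hence "fps_X ^ n dvd d - fps_const (d $ 0) * u"
    using 2 by (metis dvd_mult emb_dvd_iff)
  thus ?thesis using that[of \<sigma> "d $ 0"] \<sigma>(1) d0 by (simp add: d_def)
qed

text \<open>The determinant of M is first matched modulo X^n: a Galois element gives it up to a
  constant, which an inertia matrix repairs. A matrix congruent to 1 makes it exact, and what
  remains lies in SL.\<close>

lemma GL_img:
  assumes M: "M \<in> GL r"
  shows "M \<in> img n"
proof -
  have M': "M \<in> carrier_mat r r" "det M $ 0 \<noteq> 0" using M by (auto simp: GL_iff_det)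
  define u where "u = det M * fps_const (inverse (det M $ 0))"
  obtain \<sigma> c where \<sigma>: "ac_hom \<sigma>" "c \<noteq> 0" "fps_X ^ n dvd det (rho \<sigma>) - fps_const c * u"
    using det_rho_units[of u n] M' by (auto simp: u_def)
  define a where "a = det M $ 0 / c"
  define A where "A = rho \<sigma> * multrow_mat r (r - 1) (fps_const a)"
  have "a \<noteq> 0" using M' \<sigma> by (simp add: a_def)
  have A: "A \<in> img n" unfolding A_def by (intro img_mult rho_img img_diag \<sigma>) fact
  hence A_GL: "A \<in> GL r" by (simp add: img_def)
  have detA: "det A = det (rho \<sigma>) * fps_const a"
    unfolding A_def using r by (subst det_mult[of _ r]) (auto simp: det_multrow_mat)
  have "fps_const c * u * fps_const a = det M"
    using M' \<sigma>(2) by (simp add: u_def a_def mult_ac)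
  hence "det A - det M = (det (rho \<sigma>) - fps_const c * u) * fps_const a"
    by (simp add: detA left_diff_distrib)
  hence dvd: "fps_X ^ n dvd det M - det A" using \<sigma>(3) by (metis dvd_mult2 dvd_diff_commute)
  have unit: "det A dvd 1" using A_GL by (simp only: GL_iff_det)
  then obtain e where e: "det M = det A * e" by (metis dvd_trans one_dvd dvdE)
  \<comment> \<open>The remaining factor \<open>e\<close> is 1 modulo X^n, so this matrix is
    congruent to the identity and belongs to \<open>img n\<close> for free.\<close>
  define E where "E = multrow_mat r (r - 1) e"
  have E: "E \<in> carrier_mat r r" "det E = e" using r by (simp_all add: E_def det_multrow_mat)
  have "fps_X ^ n dvd det A * (e - 1)" using dvd by (simp add: e right_diff_distrib)
  obtain v where v: "1 = det A * v" using unit by (rule dvdE)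
  have "v * (det A * (e - 1)) = det A * v * (e - 1)" by (simp only: mult_ac)
  hence "v * (det A * (e - 1)) = e - 1" by (simp flip: v)
  with \<open>fps_X ^ n dvd det A * (e - 1)\<close> have e1: "fps_X ^ n dvd e - 1" by (metis dvd_mult)
  have "det M dvd 1" using M by (simp only: GL_iff_det)
  hence "E \<in> GL r" using E e by (metis GL_iff_det dvd_mult_right)
  moreover have "1\<^sub>m r \<in> img n" using rho_img[OF ac_hom_id] by (simp add: rho_id)
  moreover have "fps_X ^ n dvd E $$ (i, j) - 1\<^sub>m r $$ (i, j)" if "i < r" "j < r" for i j
  proof -
    have "E $$ (i, j) - 1\<^sub>m r $$ (i, j) = (if i = j \<and> i = r - 1 then e - 1 else 0)"
      using that by (simp add: E_def multrow_mat_def)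
    thus ?thesis using e1 by simp
  qed
  ultimately have "E \<in> img n" using img_cong by blast
  define B where "B = A * E"
  have B: "B \<in> img n" unfolding B_def by (intro img_mult) fact+
  hence B_GL: "B \<in> GL r" by (simp add: img_def)
  have "det B = det M" unfolding B_def using A_GL E by (simp add: det_mult[of _ r] e GL_def)
  obtain B' where B': "B' \<in> GL r" "B * B' = 1\<^sub>m r" "B' * B = 1\<^sub>m r" using GL_inverse[OF B_GL] .
  have car: "B \<in> carrier_mat r r" "B' \<in> carrier_mat r r" using B_GL B' by (auto simp: GL_def)
  have "det M * det B' = 1" using det_mult[OF car] B'(2) \<open>det B = det M\<close> by simp
  hence "M * B' \<in> img n" using M' car by (intro SL_img) (auto simp: det_mult[of _ r])
  hence "M * B' * B \<in> img n" using B by (rule img_mult)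
  also have "M * B' * B = M" using M' car B' by (simp add: assoc_mult_mat[of _ r r _ r _ r])
  finally show ?thesis .
qed

text \<open>
  Compactness of the Galois group is replaced by extending the partial homomorphism given by the
  values that are eventually constant along a sequence of approximations.
\<close>

theorem rho_surj:
  assumes "M \<in> GL r"
  obtains \<sigma> where "ac_hom \<sigma>" "rho \<sigma> = M"
proof -
  have "\<exists>\<sigma>. ac_hom \<sigma> \<and> (\<forall>i<r. \<forall>j<r. fps_X ^ n dvd M $$ (i, j) - rho \<sigma> $$ (i, j))" for n
    using GL_img[OF assms, of n] by (simp add: img_def)
  then obtain s where s: "\<And>n. ac_hom (s n)"
    "\<And>n i j. i < r \<Longrightarrow> j < r \<Longrightarrow> fps_X ^ n dvd M $$ (i, j) - rho (s n) $$ (i, j)" by metis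
  define R where "R = {(x, y). \<forall>\<^sub>F n in sequentially. s n x = y}"
  have hom: "comm_ring_hom (s n)" for n using s(1) by (rule ac_hom_comm_ring_hom)
  note [simp] = comm_ring_hom_zero_iff[OF hom]
  interpret s: comm_ring_hom "s n" for n by (rule hom)
  have "ring_graph R"
  proof (rule ring_graphI)
    fix x y x' y' assume "(x, y) \<in> R" "(x', y') \<in> R"
    hence "\<forall>\<^sub>F n in sequentially. s n x = y \<and> s n x' = y'" by (simp add: R_def eventually_conj)
    thus "(x - x', y - y') \<in> R" "(x * x', y * y') \<in> R"
      unfolding R_def mem_Collect_eq prod.case
      by (auto elim!: eventually_mono simp: s.hom_minus s.hom_mult)
  next
    fix x y assume "(x, y) \<in> R"
    then obtain n where "s n x = y" by (auto simp: R_def dest: eventually_happens)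
    thus "x = 0 \<longleftrightarrow> y = 0" by auto
  qed (simp add: R_def)
  moreover have "(to_ac c, to_ac c) \<in> R" for c by (simp add: R_def ac_hom_to_ac[OF s(1)])
  ultimately obtain \<sigma> where \<sigma>: "ac_hom \<sigma>" "\<And>x y. (x, y) \<in> R \<Longrightarrow> \<sigma> x = y"
    using ac_hom_extend by blast
  have "rho \<sigma> = M"
  proof (rule rho_eqI[OF \<sigma>(1)])
    show "M \<in> carrier_mat r r" using assms by (simp add: GL_def)
    fix j assume j: "j < r"
    show "fps_map \<sigma> (b j) = lin (\<lambda>i. M $$ (i, j))"
    proof (rule fps_ext)
      fix k
      have "s n (b j $ k) = lin (\<lambda>i. M $$ (i, j)) $ k" if "n > k" for n
      proof -
        have "fps_X ^ n dvd emb (M $$ (i, j) - rho (s n) $$ (i, j)) * b i" if "i < r" for i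
          using s(2)[OF that j] by (simp add: emb_dvd_iff dvd_mult2)
        hence "fps_X ^ n dvd lin (\<lambda>i. M $$ (i, j)) - lin (\<lambda>i. rho (s n) $$ (i, j))"
          unfolding lin_diff by (auto simp: lin_def intro: dvd_sum)
        hence "lin (\<lambda>i. M $$ (i, j)) $ k = lin (\<lambda>i. rho (s n) $$ (i, j)) $ k"
          using that unfolding fps_X_power_dvd_iff by simp
        also have "\<dots> = fps_map (s n) (b j) $ k" by (simp only: rho_action[OF s(1) j])
        finally show ?thesis by simp
      qed
      hence "\<forall>\<^sub>F n in sequentially. s n (b j $ k) = lin (\<lambda>i. M $$ (i, j)) $ k"
        by (intro eventually_sequentiallyI[of "Suc k"]) simp
      thus "fps_map \<sigma> (b j) $ k = lin (\<lambda>i. M $$ (i, j)) $ k" using \<sigma>(2) by (simp add: R_def)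
    qed
  qed
  thus ?thesis using that \<sigma>(1) by blast
qed

end

section \<open>The Galois representation on the Tate module\<close>

lemma of_nat_card_ratfun: "of_nat (CARD('a :: finite_field)) = (0 :: 'a ratfun)"
proof -
  have "(of_nat (CARD('a)) :: 'a) = 0"
    using of_nat_card_choose_eq_0[where 'a = 'a, of 1] card_finite_field_ge_2[where 'a = 'a] by simp
  hence "(of_nat (CARD('a)) :: 'a poly) = 0" by (simp add: of_nat_poly)
  thus ?thesis by (metis to_fract_of_nat to_fract_0)
qed

lemma prime_CHAR_ratfun: "prime CHAR('a :: finite_field ratfun)"
proof (rule prime_CHAR_semidom)
  show "CHAR('a ratfun) > 0" unfolding CHAR_pos_iff
    using of_nat_card_ratfun by (intro exI[of _ "CARD('a)"]) simp
qed

section \<open>Evaluation of twisted polynomials and the action of power series on torsion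
  points\<close>

definition twisted_action :: "'a :: finite_field twisted_poly \<Rightarrow> 'a ratfun_ac \<Rightarrow> 'a ratfun_ac" where
  "twisted_action f x = poly (map_poly to_ac (additive_poly f)) x"

lemma twisted_action_eq:
  fixes f :: "'a :: finite_field twisted_poly"
  assumes "\<And>i. i > N \<Longrightarrow> tcoeff f i = 0"
  shows "twisted_action f x = (\<Sum>i\<le>N. to_ac (tcoeff f i) * x ^ (CARD('a) ^ i))"
proof -
  have "twisted_action f x = (\<Sum>i | tcoeff f i \<noteq> 0. to_ac (tcoeff f i) * x ^ (CARD('a) ^ i))"
    by (simp add: twisted_action_def additive_poly_def to_ac_poly.hom_sum map_poly_monom poly_sum poly_monom)
  also have "\<dots> = (\<Sum>i\<le>N. to_ac (tcoeff f i) * x ^ (CARD('a) ^ i))"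
  proof (rule sum.mono_neutral_left)
    show "{i. tcoeff f i \<noteq> 0} \<subseteq> {..N}" using assms by (metis (mono_tags, lifting) atMost_iff mem_Collect_eq not_less subsetI)
  qed auto
  finally show ?thesis .
qed

lemma tcoeff_bound:
  fixes f :: "'a :: finite_field twisted_poly"
  obtains N where "\<And>i. i > N \<Longrightarrow> tcoeff f i = 0"
proof -
  have "\<forall>i\<in>{i. tcoeff f i \<noteq> 0}. i \<le> Max {i. tcoeff f i \<noteq> 0}"
    using finite_tcoeff[of f] by simp
  thus ?thesis by (intro that[of "Max {i. tcoeff f i \<noteq> 0}"]) (metis (mono_tags, lifting) mem_Collect_eq not_less)
qed

lemma twisted_action_add:
  fixes f h :: "'a :: finite_field twisted_poly"
  shows "twisted_action (f + h) x = twisted_action f x + twisted_action h x"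
proof -
  obtain N M where "\<And>i. i > N \<Longrightarrow> tcoeff f i = 0" "\<And>i. i > M \<Longrightarrow> tcoeff h i = 0"
    using tcoeff_bound by metis
  thus ?thesis
    using twisted_action_eq[of "max N M" f] twisted_action_eq[of "max N M" h]
      twisted_action_eq[of "max N M" "f + h"]
    by (simp add: plus_twisted_poly.rep_eq distrib_right sum.distrib)
qed

lemma twisted_action_mult:
  fixes f h :: "'a :: finite_field twisted_poly"
  shows "twisted_action (f * h) x = twisted_action f (twisted_action h x)"
proof -
  let ?q = "CARD('a)"
  obtain N0 M0 where NM: "\<And>i. i > N0 \<Longrightarrow> tcoeff f i = 0" "\<And>i. i > M0 \<Longrightarrow> tcoeff h i = 0"
    using tcoeff_bound by metis
  define N where "N = max N0 M0"
  have N: "tcoeff f i = 0" "tcoeff h i = 0" if "i > N" for i using NM that by (simp_all add: N_def)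
  define F where "F i j = to_ac (tcoeff f i) * (to_ac (tcoeff h j) * x ^ (?q ^ j)) ^ (?q ^ i)" for i j
  have "tcoeff (f * h) n = 0" if "n > 2 * N" for n
  proof -
    have "tcoeff f i * tcoeff h (n - i) ^ (?q ^ i) = 0" if "i \<le> n" for i
      using N[of i] N[of "n - i"] \<open>n > 2 * N\<close> that by (cases "i > N") (auto simp: power_0_left)
    thus ?thesis by (auto simp: times_twisted_poly.rep_eq intro!: sum.neutral)
  qed
  hence "twisted_action (f * h) x = (\<Sum>n\<le>2 * N. to_ac (tcoeff (f * h) n) * x ^ (?q ^ n))"
    by (rule twisted_action_eq)
  also have "\<dots> = (\<Sum>n\<le>2 * N. \<Sum>i\<le>n. F i (n - i))"
  proof (rule sum.cong[OF refl])
    fix n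
    have "(x ^ (?q ^ (n - i))) ^ (?q ^ i) = x ^ (?q ^ n)" if "i \<le> n" for i
      using that by (metis le_add_diff_inverse2 power_add power_mult)
    thus "to_ac (tcoeff (f * h) n) * x ^ (?q ^ n) = (\<Sum>i\<le>n. F i (n - i))"
      by (simp add: times_twisted_poly.rep_eq to_ac_sum sum_distrib_right F_def power_mult_distrib
          atLeast0AtMost mult.assoc)
  qed
  also have "\<dots> = (\<Sum>(i, j)\<in>{(i, j). i + j \<le> 2 * N}. F i j)"
    by (rule sum.triangle_reindex_eq[symmetric])
  also have "\<dots> = (\<Sum>(i, j)\<in>{..N} \<times> {..N}. F i j)"
  proof (rule sum.mono_neutral_right)
    show "finite {(i, j). i + j \<le> 2 * N}"
      by (rule finite_subset[of _ "{..2 * N} \<times> {..2 * N}"]) auto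
    show "\<forall>p\<in>{(i, j). i + j \<le> 2 * N} - {..N} \<times> {..N}. (case p of (i, j) \<Rightarrow> F i j) = 0"
    proof
      fix p assume p: "p \<in> {(i, j). i + j \<le> 2 * N} - {..N} \<times> {..N}"
      obtain i j where ij: "p = (i, j)" by (cases p)
      hence "i > N \<or> j > N" using p by auto
      thus "(case p of (i, j) \<Rightarrow> F i j) = 0" using N[of i] N[of j] by (auto simp: F_def ij power_0_left)
    qed
  qed auto
  also have "\<dots> = (\<Sum>i\<le>N. to_ac (tcoeff f i) * (\<Sum>j\<le>N. to_ac (tcoeff h j) * x ^ (?q ^ j)) ^ (?q ^ i))"
    by (simp add: sum.cartesian_product[symmetric] F_def eps.frob_sum sum_distrib_left)
  also have "\<dots> = twisted_action f (twisted_action h x)"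
    using N by (simp add: twisted_action_eq[of N])
  finally show ?thesis .
qed

lemma twisted_action_tconst: "twisted_action (tconst c) x = to_ac c * x"
  using twisted_action_eq[of 0 "tconst c" x] by (simp add: tcoeff_tconst)

lemma twisted_action_drinfeld_T: "twisted_action (drinfeld_T r g) x = phi r g x"
proof -
  have "{..r} = insert 0 {1..r}" by auto
  thus ?thesis
    using twisted_action_eq[of r "drinfeld_T r g" x]
    by (simp add: tcoeff_drinfeld_T phi_eq frac_ac_def)
qed

lemma drinfeld_action_eq: "drinfeld_action \<phi> a x = twisted_action (\<phi> a) x"
  by (simp add: drinfeld_action_def twisted_action_def)

lemma drinfeld_action_sum:
  assumes "\<And>i. i \<ge> n \<Longrightarrow> coeff a i = 0"
  shows "drinfeld_action (drinfeld r g) a x = (\<Sum>i<n. eps (coeff a i) * (phi r g ^^ i) x)"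
  using assms
proof (induction a arbitrary: n x)
  case 0
  show ?case by (simp add: drinfeld_action_eq drinfeld_0 twisted_action_tconst flip: tconst_0)
next
  case (pCons c a)
  have "n \<noteq> 0"
  proof
    assume "n = 0"
    hence "pCons c a = 0" by (intro poly_eqI) (simp add: pCons.prems)
    thus False using pCons.hyps by simp
  qed
  then obtain m where n: "n = Suc m" by (cases n) auto
  have "drinfeld_action (drinfeld r g) (pCons c a) x =
      eps c * x + drinfeld_action (drinfeld r g) a (phi r g x)"
    by (simp add: drinfeld_action_eq drinfeld_pCons twisted_action_add twisted_action_mult
        twisted_action_tconst twisted_action_drinfeld_T eps_def frac_ac_def)
  also have "drinfeld_action (drinfeld r g) a (phi r g x) = (\<Sum>i<m. eps (coeff a i) * (phi r g ^^ i) (phi r g x))"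
    using pCons.prems[of "Suc _"] by (intro pCons.IH) (simp add: n)
  finally show ?case
    by (simp add: n sum.lessThan_Suc_shift funpow_swap1 del: sum.lessThan_Suc)
qed

lemma drinfeld_action_X_power: "drinfeld_action (drinfeld r g) (monom 1 n) x = (phi r g ^^ n) x"
  using drinfeld_action_sum[of "Suc n" "monom 1 n" r g x] by (simp add: if_distrib[of eps] if_distribR sum.delta cong: if_cong)

lemma drinfeld_action_X: "drinfeld_action (drinfeld r g) [:0, 1:] x = phi r g x"
  using drinfeld_action_X_power[of r g 1 x] by (simp add: monom_altdef)

lemma pderiv_phi_poly: "pderiv (phi_poly r g) = [:[:0, 1:]:]"
proof (rule poly_eqI)
  fix n
  show "coeff (pderiv (phi_poly r g)) n = coeff [:[:0, 1:]:] n"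
  proof (cases "coeff (phi_poly r g) (Suc n) = 0 \<or> n = 0")
    case True
    thus ?thesis
      using coeff_phi_poly_1[of r g] by (auto simp: coeff_pderiv coeff_pCons split: nat.split)
  next
    case False
    then obtain j where j: "Suc n = CARD('a) ^ j"
      using q_poly_phi_poly[of r g] by (auto simp: q_poly_def)
    hence "j > 0" using False by (cases j) auto
    have "(of_nat (CARD('a)) :: 'a poly) = 0"
      using of_nat_card_choose_eq_0[where 'a = 'a, of 1] card_finite_field_ge_2[where 'a = 'a]
      by (simp add: of_nat_poly)
    hence "(of_nat (Suc n) :: 'a poly) = 0" using \<open>j > 0\<close> unfolding j by simp
    thus ?thesis using False by (simp add: coeff_pderiv coeff_pCons split: nat.split del: of_nat_Suc)
  qed
qed

text \<open>The polynomial of T^n has constant derivative T^n, hence only simple roots.\<close>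

lemma torsion_separable:
  assumes "(phi r g ^^ n) x = 0"
  shows "x \<in> sep_closure"
proof -
  define P where "P n = (pcompose (phi_poly r g) ^^ n) [:0, 1:]" for n
  have P: "poly (map_poly frac_ac (P n)) x = (phi r g ^^ n) x" for n
    by (induction n) (simp_all add: P_def frac_ac.map_poly_pcompose poly_pcompose phi_def map_poly_pCons)
  have dP: "pderiv (P n) = [:[:0, 1:] ^ n:]" for n
  proof (induction n)
    case (Suc n)
    have "pderiv (P (Suc n)) = pcompose [:[:0, 1:]:] (P n) * pderiv (P n)"
      by (simp add: P_def pderiv_pcompose pderiv_phi_poly)
    thus ?case using Suc by simp
  qed (simp add: P_def pderiv_pCons one_pCons)
  have "poly (map_poly to_ac (pderiv (fract_poly (P n)))) x = poly (map_poly frac_ac (pderiv (P n))) x"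
    by (simp add: map_poly_frac_ac to_ac.map_poly_pderiv) (simp add: frac_ac.map_poly_pderiv flip: map_poly_frac_ac)
  also have "\<dots> \<noteq> 0" by (simp add: dP map_poly_const frac_ac.hom_power)
  finally show ?thesis unfolding sep_closure_iff
    using P[of n] assms by (intro exI[of _ "fract_poly (P n)"]) (simp add: map_poly_frac_ac)
qed

lemma T_torsion_drinfeld: "T_torsion (drinfeld r g) n = {x. (phi r g ^^ n) x = 0}"
  unfolding T_torsion_def drinfeld_action_X_power using torsion_separable by blast

text \<open>A point of the Tate module is a power series whose coefficients are shifted by one.\<close>

definition tate_seq :: "'b :: zero fps \<Rightarrow> nat \<Rightarrow> 'b" where
  "tate_seq f n = (case n of 0 \<Rightarrow> 0 | Suc k \<Rightarrow> f $ k)"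

lemma tate_seq_0 [simp]: "tate_seq f 0 = 0" and tate_seq_Suc [simp]: "tate_seq f (Suc n) = f $ n"
  by (simp_all add: tate_seq_def)

lemma tate_seq_eq_iff: "tate_seq f = tate_seq h \<longleftrightarrow> f = h"
proof
  assume "tate_seq f = tate_seq h"
  hence "tate_seq f (Suc n) = tate_seq h (Suc n)" for n by simp
  thus "f = h" by (simp add: fps_eq_iff)
qed simp

lemma tate_module_drinfeld: "tate_module (drinfeld r g) = tate_seq ` tate_fps r g"
proof (intro equalityI subsetI)
  fix x assume "x \<in> tate_module (drinfeld r g)"
  hence x: "(phi r g ^^ n) (x n) = 0" "phi r g (x (Suc n)) = x n" for n
    by (simp_all add: tate_module_def T_torsion_drinfeld drinfeld_action_X)
  have x0: "x 0 = 0" using x(1)[of 0] by simp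
  have "phi r g (x (Suc n)) = (fps_X * Abs_fps (\<lambda>n. x (Suc n))) $ n" for n
    using x(2) x0 by (cases n) auto
  hence "Abs_fps (\<lambda>n. x (Suc n)) \<in> tate_fps r g" by (simp add: tate_fps_def fps_eq_iff)
  moreover have "x = tate_seq (Abs_fps (\<lambda>n. x (Suc n)))"
    using x0 by (auto simp: fun_eq_iff tate_seq_def split: nat.split)
  ultimately show "x \<in> tate_seq ` tate_fps r g" by blast
next
  fix x assume "x \<in> tate_seq ` tate_fps r g"
  then obtain f where f: "f \<in> tate_fps r g" "x = tate_seq f" by blast
  have step: "phi r g (tate_seq f (Suc n)) = tate_seq f n" for n
    using tate_fps_nth_0[OF f(1)] tate_fps_nth_Suc[OF f(1)] by (cases n) simp_all
  have "(phi r g ^^ n) (tate_seq f n) = 0" for n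
    by (induction n) (simp_all add: funpow_Suc_right step del: funpow.simps(2) tate_seq_Suc)
  thus "x \<in> tate_module (drinfeld r g)"
    using step by (simp add: f(2) tate_module_def T_torsion_drinfeld drinfeld_action_X)
qed

lemma tate_smult_drinfeld:
  assumes "f \<in> tate_fps r g"
  shows "tate_smult (drinfeld r g) c (tate_seq f) = tate_seq (emb c * f)"
proof
  fix n
  have "tate_smult (drinfeld r g) c (tate_seq f) n =
      (\<Sum>i<n. eps (coeff (truncate_fps n c) i) * (phi r g ^^ i) (tate_seq f n))"
    unfolding tate_smult_def by (rule drinfeld_action_sum) simp
  also have "\<dots> = tate_seq (emb c * f) n"
  proof (cases n)
    case (Suc k)
    have "(phi r g ^^ i) (f $ k) = f $ (k - i)" if "i \<le> k" for i
      using tate_fps_iterate[OF assms, of i "k - i"] that by simp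
    thus ?thesis by (simp add: Suc fps_mult_nth lessThan_Suc_atMost atLeast0AtMost)
  qed simp
  finally show "tate_smult (drinfeld r g) c (tate_seq f) n = tate_seq (emb c * f) n" .
qed

context tate_local_basis
begin

lemma tate_lincomb_drinfeld:
  "tate_lincomb (drinfeld r g) r (\<lambda>i. tate_seq (b i)) c = tate_seq (lin (vec_index c))"
proof
  fix n
  have "tate_lincomb (drinfeld r g) r (\<lambda>i. tate_seq (b i)) c n = (\<Sum>i<r. tate_seq (emb (vec_index c i) * b i) n)"
    unfolding tate_lincomb_def using tate_smult_drinfeld[OF b_tate] by simp
  thus "tate_lincomb (drinfeld r g) r (\<lambda>i. tate_seq (b i)) c n = tate_seq (lin (vec_index c)) n"
    by (cases n) (simp_all add: lin_def fps_sum_nth)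
qed

lemma tate_coords_unique:
  assumes "c \<in> carrier_vec r" "c' \<in> carrier_vec r" "lin (vec_index c) = lin (vec_index c')"
  shows "c = c'"
  using assms lin_eq_imp by (intro eq_vecI) auto

lemma tate_basis_drinfeld: "tate_basis (drinfeld r g) r (\<lambda>i. tate_seq (b i))"
  unfolding tate_basis_def tate_module_drinfeld
proof (intro conjI allI impI ballI)
  fix x assume "x \<in> tate_seq ` tate_fps r g"
  then obtain f where f: "f \<in> tate_fps r g" "x = tate_seq f" by blast
  obtain c where "f = lin c" using lin_exists[OF f(1)] by blast
  hence "f = lin (vec_index (vec r c))" by (simp add: lin_def)
  thus "\<exists>!c. c \<in> carrier_vec r \<and> x = tate_lincomb (drinfeld r g) r (\<lambda>i. tate_seq (b i)) c"
    unfolding tate_lincomb_drinfeld f(2) tate_seq_eq_iff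
    using tate_coords_unique by (intro ex1I[of _ "vec r c"]) auto
qed (use b_tate in auto)

lemma tate_rep_drinfeld:
  assumes "ac_hom \<tau>" "\<And>x. x \<in> sep_closure \<Longrightarrow> \<sigma> x = \<tau> x"
  shows "tate_rep (drinfeld r g) r (\<lambda>i. tate_seq (b i)) \<sigma> = rho \<tau>"
proof (rule eq_matI)
  fix i j assume "i < dim_row (rho \<tau>)" "j < dim_col (rho \<tau>)"
  hence ij: "i < r" "j < r" by simp_all
  interpret \<tau>: comm_ring_hom \<tau> using assms(1) by (rule ac_hom_comm_ring_hom)
  have "tate_seq (b j) \<in> tate_module (drinfeld r g)"
    unfolding tate_module_drinfeld using b_tate[OF ij(2)] by blast
  hence "tate_seq (b j) n \<in> sep_closure" for n by (simp add: tate_module_def T_torsion_def)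
  hence "\<sigma> \<circ> tate_seq (b j) = tate_seq (fps_map \<tau> (b j))"
    using assms(2) by (auto simp: fun_eq_iff tate_seq_def split: nat.split)
  also have "\<dots> = tate_seq (lin (vec_index (vec r (\<lambda>i. rho \<tau> $$ (i, j)))))"
    unfolding rho_action[OF assms(1) ij(2)] by (simp add: lin_def)
  finally have eq: "\<sigma> \<circ> tate_seq (b j) = tate_seq (lin (vec_index (vec r (\<lambda>i. rho \<tau> $$ (i, j)))))" .
  have "tate_coords (drinfeld r g) r (\<lambda>i. tate_seq (b i)) (\<sigma> \<circ> tate_seq (b j)) = vec r (\<lambda>i. rho \<tau> $$ (i, j))"
    unfolding tate_coords_def tate_lincomb_drinfeld eq tate_seq_eq_iff
    by (rule the_equality) (auto intro: tate_coords_unique)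
  thus "tate_rep (drinfeld r g) r (\<lambda>i. tate_seq (b i)) \<sigma> $$ (i, j) = rho \<tau> $$ (i, j)"
    using ij by (simp add: tate_rep_def)
qed (simp_all add: tate_rep_def)

lemma tate_rep_surjective_drinfeld: "tate_rep_surjective (drinfeld r g) r"
  unfolding tate_rep_surjective_def
proof (intro exI conjI)
  show "tate_basis (drinfeld r g) r (\<lambda>i. tate_seq (b i))" by (rule tate_basis_drinfeld)
  show "tate_rep (drinfeld r g) r (\<lambda>i. tate_seq (b i)) ` galois_group = GL r"
  proof (intro equalityI subsetI)
    fix M assume "M \<in> tate_rep (drinfeld r g) r (\<lambda>i. tate_seq (b i)) ` galois_group"
    then obtain \<sigma> where \<sigma>: "\<sigma> \<in> galois_group" "M = tate_rep (drinfeld r g) r (\<lambda>i. tate_seq (b i)) \<sigma>" by blast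
    obtain \<tau> where \<tau>: "ac_hom \<tau>" "\<And>x. x \<in> sep_closure \<Longrightarrow> \<tau> x = \<sigma> x"
      using galois_group_extend[OF prime_CHAR_ratfun \<sigma>(1)] by blast
    hence "M = rho \<tau>" unfolding \<sigma>(2) by (intro tate_rep_drinfeld) auto
    thus "M \<in> GL r" using rho_GL[OF \<tau>(1)] by simp
  next
    fix M :: "'a fps mat" assume "M \<in> GL r"
    then obtain \<tau> where \<tau>: "ac_hom \<tau>" "rho \<tau> = M" by (rule rho_surj)
    have "restrict \<tau> sep_closure \<in> galois_group"
      by (rule galois_group_restrict[OF prime_CHAR_ratfun \<tau>(1)])
    moreover have "tate_rep (drinfeld r g) r (\<lambda>i. tate_seq (b i)) (restrict \<tau> sep_closure) = M"
      unfolding \<tau>(2)[symmetric] by (rule tate_rep_drinfeld[OF \<tau>(1)]) simp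
    ultimately show "M \<in> tate_rep (drinfeld r g) r (\<lambda>i. tate_seq (b i)) ` galois_group" by blast
  qed
qed

end

theorem tate_rep_surjectiveI:
  fixes g :: "nat \<Rightarrow> 'a :: finite_field poly" and \<alpha> :: "'a alg_closure"
  assumes "r \<ge> 2" "g r \<noteq> 0" "\<alpha> \<noteq> 0"
    and "poly (map_poly to_ac (g r)) \<alpha> = 0" "poly (map_poly to_ac (pderiv (g r))) \<alpha> \<noteq> 0"
      "poly (map_poly to_ac (g (r - 1))) \<alpha> \<noteq> 0"
    and irr: "\<And>W. eps.fq_subspace W \<Longrightarrow> W \<subset> {x. phi r g x = 0} \<Longrightarrow>
      (\<And>\<sigma> w. ac_hom \<sigma> \<Longrightarrow> w \<in> W \<Longrightarrow> \<sigma> w \<in> W) \<Longrightarrow> W = {0}"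
  shows "tate_rep_surjective (drinfeld r g) r"
proof -
  obtain U \<xi> where U: "eps.fq_subspace U"
    "\<And>y. y \<in> U \<Longrightarrow> \<exists>x\<in>U. phi r g x = y"
    "finite {x \<in> U. phi r g x = 0}" "card {x \<in> U. phi r g x = 0} = CARD('a) ^ (r - 1)"
    "\<xi> 0 = 0" "\<And>n. phi r g (\<xi> (Suc n)) = \<xi> n" "\<xi> 1 \<notin> U"
    "\<And>n h c. h \<in> U \<Longrightarrow> (phi r g ^^ n) h = 0 \<Longrightarrow> c \<noteq> 0 \<Longrightarrow>
       \<exists>\<sigma>. ac_hom \<sigma> \<and> (\<forall>x\<in>U. \<sigma> x = x) \<and> \<sigma> (\<xi> n) = eps c * \<xi> n + h"
    by (rule drinfeld_local_structure[OF assms(1,3-6)]) blast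
  interpret tate_local r g U \<xi>
  proof unfold_locales
    fix w assume w: "phi r g w = 0" "w \<noteq> 0"
    show "\<exists>\<sigma>. ac_hom \<sigma> \<and> \<sigma> w \<notin> U"
    proof (rule ccontr)
      assume no: "\<not> ?thesis"
      \<comment> \<open>The largest Galois stable subset of phi[T] inside \<open>U\<close>. It
        misses \<open>\<xi> 1\<close>, so it is a proper submodule and irreducibility makes it
        zero.\<close>
      define W where "W = {x. phi r g x = 0 \<and> (\<forall>\<sigma>. ac_hom \<sigma> \<longrightarrow> \<sigma> x \<in> U)}"
      have hom: "\<sigma> (x + y) = \<sigma> x + \<sigma> y" "\<sigma> (eps c * x) = eps c * \<sigma> x" "\<sigma> 0 = 0" if "ac_hom \<sigma>" for \<sigma> x y c
      proof -
        interpret comm_ring_hom \<sigma> using that by (rule ac_hom_comm_ring_hom)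
        show "\<sigma> (x + y) = \<sigma> x + \<sigma> y" "\<sigma> (eps c * x) = eps c * \<sigma> x" "\<sigma> 0 = 0"
          by (simp_all add: hom_add hom_mult ac_hom_eps[OF that])
      qed
      have "W = {0}"
      proof (rule irr)
        show "eps.fq_subspace W"
          using U(1) by (auto simp: eps.fq_subspace_def W_def phi_add phi_scale hom)
        have "\<xi> 1 \<notin> W" using U(7) ac_hom_id by (auto simp: W_def)
        moreover have "phi r g (\<xi> 1) = 0" using U(5) U(6)[of 0] by simp
        ultimately show "W \<subset> {x. phi r g x = 0}" by (auto simp: W_def)
        fix \<sigma> :: "'a ratfun_ac \<Rightarrow> 'a ratfun_ac" and w assume "ac_hom \<sigma>" "w \<in> W"
        thus "\<sigma> w \<in> W"
          using ac_hom_comp[of _ \<sigma>] hom(3)[of \<sigma>] by (auto simp: W_def simp flip: ac_hom_phi) (metis comp_apply)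
      qed
      moreover have "w \<in> W" using no w by (auto simp: W_def)
      ultimately show False using w by simp
    qed
  qed (use assms U in auto)
  obtain b where "tate_local_basis r g U \<xi> b" by (rule basis_exists)
  then interpret tate_local_basis r g U \<xi> b .
  show ?thesis by (rule tate_rep_surjective_drinfeld)
qed

section \<open>Reducible torsion modules\<close>

text \<open>Gauss's lemma over a polynomial ring: denominators are cleared and then removed one
  irreducible factor at a time. \<open>R\<close> is kept proportional to \<open>P\<close>, so that
  it has the same exponents.\<close>

lemma poly_factor_over_base:
  fixes f :: "'f :: field poly poly"
  assumes "fract_poly f = P * Q" "f \<noteq> 0"
  obtains R S c where "f = R * S" "c \<noteq> 0" "fract_poly R = smult c P"
proof -
  have descent: "\<exists>R S c. f = R * S \<and> c \<noteq> 0 \<and> fract_poly R = smult c P"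
    if "smult e f = R0 * S0" "e \<noteq> 0" "a \<noteq> 0" "fract_poly R0 = smult a P" for e R0 S0 a
    using that
  proof (induction "degree e" arbitrary: e R0 S0 a rule: less_induct)
    case less
    show ?case
    proof (cases "degree e = 0")
      case True
      then obtain k where k: "e = [:k:]" "k \<noteq> 0" using less.prems(2) by (auto elim: degree_eq_zeroE)
      have "f = smult [:1 / k:] (smult e f)" using k by (simp add: smult_smult one_pCons[symmetric])
      also have "\<dots> = R0 * smult [:1 / k:] S0"
        unfolding less.prems(1) by (rule mult_smult_right[symmetric])
      finally show ?thesis using less.prems by blast
    next
      case False
      hence "degree (map_poly to_ac e) > 0" by simp
      then obtain \<alpha> where \<alpha>: "poly (map_poly to_ac e) \<alpha> = 0" using alg_closed_imp_poly_has_root by blast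
      obtain \<pi> :: "'f poly" where \<pi>: "irreducible \<pi>" "poly (map_poly to_ac \<pi>) \<alpha> = 0"
        by (rule irreducible_root_exists)
      then obtain e' where e': "e = \<pi> * e'" using irreducible_root_dvd_iff \<alpha> by blast
      have "\<pi> \<noteq> 0" "e' \<noteq> 0" using e' less.prems by auto
      have "degree \<pi> > 0" using \<pi>(1) by (auto simp: irreducible_def is_unit_iff_degree)
      hence deg: "degree e' < degree e" using \<open>\<pi> \<noteq> 0\<close> \<open>e' \<noteq> 0\<close> by (simp add: e' degree_mult_eq)
      have prime: "prime_elem [:\<pi>:]"
        using field_poly_irreducible_imp_prime[OF \<pi>(1)] by (simp add: prime_elem_const_poly_iff)
      have "R0 * S0 = [:\<pi>:] * smult e' f" by (simp add: e' mult.commute flip: less.prems(1))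
      hence "[:\<pi>:] dvd R0 * S0" by (metis dvd_triv_left)
      then consider "[:\<pi>:] dvd R0" | "[:\<pi>:] dvd S0" using prime_elem_dvd_multD[OF prime] by blast
      thus ?thesis
      proof cases
        case 1
        then obtain R1 where R1: "R0 = smult \<pi> R1" by (auto elim!: dvdE)
        have "smult \<pi> (smult e' f) = smult \<pi> (R1 * S0)" using less.prems(1) by (simp add: e' R1)
        hence "smult e' f = R1 * S0" using \<open>\<pi> \<noteq> 0\<close> by (metis smult_cancel)
        moreover have "fract_poly R1 = smult (a / to_fract \<pi>) P"
        proof -
          have "smult (to_fract \<pi>) (fract_poly R1) = smult a P" using less.prems(4) by (simp add: R1)
          hence "smult (inverse (to_fract \<pi>)) (smult (to_fract \<pi>) (fract_poly R1)) =
              smult (inverse (to_fract \<pi>)) (smult a P)" by simp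
          thus ?thesis using \<open>\<pi> \<noteq> 0\<close> by (simp add: field_simps)
        qed
        ultimately show ?thesis
          using less.hyps[OF deg, of R1 S0 "a / to_fract \<pi>"] \<open>e' \<noteq> 0\<close> \<open>\<pi> \<noteq> 0\<close> less.prems(3) by simp
      next
        case 2
        then obtain S1 where S1: "S0 = smult \<pi> S1" by (auto elim!: dvdE)
        have "smult \<pi> (smult e' f) = smult \<pi> (R0 * S1)" using less.prems(1) by (simp add: e' S1)
        hence "smult e' f = R0 * S1" using \<open>\<pi> \<noteq> 0\<close> by (metis smult_cancel)
        thus ?thesis using less.hyps[OF deg, of R0 S1 a] \<open>e' \<noteq> 0\<close> less.prems by simp
      qed
    qed
  qed
  obtain a R0 where R0: "a \<noteq> 0" "smult (to_fract a) P = fract_poly R0"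
    by (rule fract_poly_clear_denominators)
  obtain b S0 where S0: "b \<noteq> 0" "smult (to_fract b) Q = fract_poly S0"
    by (rule fract_poly_clear_denominators)
  have "fract_poly (smult (a * b) f) = smult (to_fract a) P * smult (to_fract b) Q"
    by (simp add: assms mult.commute)
  also have "\<dots> = fract_poly (R0 * S0)" by (simp add: R0 S0)
  finally have "smult (a * b) f = R0 * S0" by (simp only: fract_poly_eq_iff)
  thus ?thesis using descent[of "a * b" R0 S0 "to_fract a"] that R0 S0 by auto
qed

lemma vanishing_poly_dvd:
  fixes p :: "'b :: idom poly"
  assumes "finite W" "\<And>w. w \<in> W \<Longrightarrow> poly p w = 0"
  shows "(\<Prod>w\<in>W. [:- w, 1:]) dvd p"
  using assms
proof (induction W arbitrary: p rule: finite_induct)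
  case (insert w W)
  obtain s where s: "p = [:- w, 1:] * s" using insert.prems[of w] poly_eq_0_iff_dvd by blast
  have "poly s v = 0" if "v \<in> W" for v
    using insert.prems[of v] insert.hyps(2) that by (auto simp: s)
  hence "(\<Prod>w\<in>W. [:- w, 1:]) dvd s" by (rule insert.IH)
  thus ?case unfolding s prod.insert[OF insert.hyps] by (rule mult_dvd_mono[OF dvd_refl])
qed simp

text \<open>A factor of \<open>\<phi>\<^sub>T(x)\<close> over \<open>A\<close> which is the polynomial of a submodule of dimension \<open>s\<close>.\<close>

definition phi_factor :: "nat \<Rightarrow> nat \<Rightarrow> (nat \<Rightarrow> 'a :: finite_field poly) \<Rightarrow> 'a poly poly \<Rightarrow> 'a poly poly \<Rightarrow> bool" where
  "phi_factor r s g R S \<longleftrightarrow> phi_poly r g = R * S \<and> degree R = CARD('a) ^ s \<and> q_poly CARD('a) R"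

text \<open>The vanishing polynomial of \<open>W\<close> has separable coefficients, and every
  \<sigma> fixes them because it permutes \<open>W\<close>. So it is defined over F and divides the
  polynomial of phi_T; Gauss's lemma brings the factorisation down to A.\<close>

theorem reducible_phi_factor:
  fixes g :: "nat \<Rightarrow> 'a :: finite_field poly"
  assumes "r \<ge> 1" "g r \<noteq> 0" "eps.fq_subspace W" "W \<subset> {x. phi r g x = 0}" "W \<noteq> {0}"
    and stable: "\<And>\<sigma> w. ac_hom \<sigma> \<Longrightarrow> w \<in> W \<Longrightarrow> \<sigma> w \<in> W"
  obtains s R S where "1 \<le> s" "s < r" "phi_factor r s g R S"
proof -
  let ?\<Phi> = "map_poly frac_ac (phi_poly r g)"
  have deg: "degree ?\<Phi> = CARD('a) ^ r" using degree_phi_poly[of r g] assms by simp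
  have "?\<Phi> \<noteq> 0" using deg by auto
  hence V: "finite {x. phi r g x = 0}" "card {x. phi r g x = 0} \<le> CARD('a) ^ r"
    using poly_roots_finite card_poly_roots_bound deg unfolding phi_def by metis+
  have fin: "finite W" using V assms(4) finite_subset by blast
  obtain s \<beta> where s: "eps.fq_indep s \<beta>" "eps.fq_span s \<beta> = W" "card W = CARD('a) ^ s"
    using eps.fq_basis_exists[OF fin assms(3)] .
  have "s \<noteq> 0"
  proof
    assume "s = 0"
    thus False using s(2) assms(5) by (simp add: eps.fq_span_def eps.fq_lincomb_def)
  qed
  have "CARD('a) ^ s < CARD('a) ^ r"
    using psubset_card_mono[OF V(1) assms(4)] V(2) s(3) by simp
  hence "s < r" using card_finite_field_ge_2[where 'a = 'a] by (metis power_less_imp_less_exp power_strict_increasing_iff less_le_trans one_less_numeral_iff semiring_norm(76))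
  define PW where "PW = eps.vanishing_poly W"
  have PW: "degree PW = CARD('a) ^ s" "q_poly CARD('a) PW"
    unfolding PW_def using s fin assms(3) by (auto simp: eps.degree_vanishing_poly eps.q_poly_vanishing_poly)
  note prime = prime_CHAR_ratfun[where 'a = 'a]
  have coeff_sep: "coeff (\<Prod>w\<in>V. [:- w, 1:]) i \<in> sep_closure" if "finite V" "V \<subseteq> W" for V i
    using that
  proof (induction V arbitrary: i rule: finite_induct)
    case empty
    show ?case by (simp add: sep_closure_0[OF prime] sep_closure_1[OF prime])
  next
    case (insert v V)
    have "phi r g v = 0" using insert.prems assms(4) by blast
    hence "v \<in> sep_closure" using torsion_separable[of 1 r g v] by simp
    moreover have "coeff (\<Prod>w\<in>V. [:- w, 1:]) j \<in> sep_closure" for j using insert by simp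
    ultimately show ?case using insert.hyps
      by (auto simp: coeff_pCons intro!: sep_closure_diff[OF prime] sep_closure_mult[OF prime]
          sep_closure_uminus[OF prime] split: nat.split)
  qed
  have "\<sigma> (coeff PW i) = coeff PW i" if \<sigma>: "ac_hom \<sigma>" for \<sigma> i
  proof -
    interpret \<sigma>: idom_hom \<sigma> using ac_hom_comm_ring_hom[OF \<sigma>] by (simp add: idom_hom_def)
    interpret \<sigma>p: map_poly_comm_ring_hom \<sigma> ..
    have inj: "inj_on \<sigma> W"
      using comm_ring_hom_inj[OF ac_hom_comm_ring_hom[OF \<sigma>]] by (simp add: inj_on_def inj_def)
    have "\<sigma> ` W = W" using stable[OF \<sigma>] inj fin by (intro endo_inj_surj) auto
    have "map_poly \<sigma> PW = (\<Prod>w\<in>W. [:- \<sigma> w, 1:])"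
      by (simp add: PW_def eps.vanishing_poly_def \<sigma>p.hom_prod map_poly_pCons \<sigma>.hom_uminus)
    also have "\<dots> = (\<Prod>w\<in>\<sigma> ` W. [:- w, 1:])" using inj by (simp add: prod.reindex)
    also have "\<dots> = PW" by (simp add: \<open>\<sigma> ` W = W\<close> PW_def eps.vanishing_poly_def)
    finally show ?thesis by (metis \<sigma>.hom_zero coeff_map_poly)
  qed
  moreover have "coeff PW i \<in> sep_closure" for i
    using coeff_sep[OF fin order.refl] by (simp add: PW_def eps.vanishing_poly_def)
  ultimately have "coeff PW i \<in> range to_ac" for i using sep_closure_fixed by blast
  hence "\<forall>i. \<exists>c. coeff PW i = to_ac c" by blast
  then obtain c where c: "\<And>i. coeff PW i = to_ac (c i)" by metis
  define P where "P = map_poly of_ac PW"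
  have P: "map_poly to_ac P = PW"
    by (rule poly_eqI) (simp add: P_def coeff_map_poly c)
  hence degP: "degree P = CARD('a) ^ s" using PW(1) degree_map_poly[of to_ac P] by simp
  hence "P \<noteq> 0" by auto
  have "PW dvd ?\<Phi>" unfolding PW_def eps.vanishing_poly_def
    using fin assms(4) by (intro vanishing_poly_dvd) (auto simp: phi_def)
  define Q M where "Q = fract_poly (phi_poly r g) div P" and "M = fract_poly (phi_poly r g) mod P"
  have eq: "fract_poly (phi_poly r g) = P * Q + M" by (simp add: Q_def M_def)
  have "?\<Phi> = PW * map_poly to_ac Q + map_poly to_ac M"
    unfolding map_poly_frac_ac eq to_ac_poly.hom_add to_ac_poly.hom_mult P ..
  hence "PW dvd map_poly to_ac M" using \<open>PW dvd ?\<Phi>\<close> by (metis dvd_add_right_iff dvd_triv_left)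
  moreover have "M = 0 \<or> degree M < degree P"
    unfolding M_def using degree_mod_less'[OF \<open>P \<noteq> 0\<close>] by blast
  ultimately have "M = 0" using degP PW(1) divides_degree[of PW "map_poly to_ac M"] by auto
  hence "fract_poly (phi_poly r g) = P * Q" using eq by simp
  moreover have "phi_poly r g \<noteq> 0" using \<open>?\<Phi> \<noteq> 0\<close> by auto
  ultimately obtain R S e where RS: "phi_poly r g = R * S" "e \<noteq> 0" "fract_poly R = smult e P"
    by (rule poly_factor_over_base) blast
  have "degree R = CARD('a) ^ s"
  proof -
    have "degree R = degree (fract_poly R)" by (simp add: degree_map_poly)
    thus ?thesis using RS degP by simp
  qed
  moreover have "q_poly CARD('a) R"
    unfolding q_poly_def
  proof (intro allI impI)
    fix i assume "coeff R i \<noteq> 0"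
    hence "coeff (fract_poly R) i \<noteq> 0" by (simp add: coeff_map_poly)
    hence "coeff P i \<noteq> 0" by (simp add: RS)
    hence "coeff PW i \<noteq> 0" by (simp add: coeff_map_poly flip: P)
    thus "\<exists>j. i = CARD('a) ^ j" using PW(2) by (simp add: q_poly_def)
  qed
  ultimately show ?thesis using that[of s R S] RS \<open>s \<noteq> 0\<close> \<open>s < r\<close> by (simp add: phi_factor_def)
qed

context
  fixes r s :: nat and g :: "nat \<Rightarrow> 'a :: finite_field poly" and R S
  assumes RS: "phi_factor r s g R S"
begin

text \<open>\<open>R\<close> has no constant term, so its linear coefficient divides T. This leaves
  boundedly many values for it, independently of the degree bound on the tuple.\<close>

lemma phi_factor_linear: "coeff R 1 * coeff S 0 = [:0, 1:]"
proof -
  have "coeff R 0 = 0"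
    using RS q_poly_coeff_0[OF card_finite_field_ge_2[where 'a = 'a], of R] by (simp add: phi_factor_def)
  moreover have "coeff (R * S) 1 = coeff R 0 * coeff S 1 + coeff R 1 * coeff S 0"
    by (simp add: coeff_mult)
  moreover have "coeff (R * S) 1 = [:0, 1:]"
    using coeff_phi_poly_1[of r g] RS by (simp add: phi_factor_def)
  ultimately show ?thesis by simp
qed

lemma phi_factor_linear_nz: "coeff R 1 \<noteq> 0"
  using phi_factor_linear by auto

lemma phi_factor_linear_deg: "deg_less (coeff R 1) 2"
proof -
  have "coeff R 1 \<noteq> 0" "coeff S 0 \<noteq> 0" using phi_factor_linear by auto
  hence "degree (coeff R 1) + degree (coeff S 0) = 1"
    using arg_cong[OF phi_factor_linear, of degree] by (simp add: degree_mult_eq)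
  thus ?thesis by (simp add: deg_less_def)
qed

lemma phi_factor_lead:
  assumes "r \<ge> 1" "g r \<noteq> 0"
  shows "lead_coeff R * lead_coeff S = g r"
  using lead_coeff_phi_poly[of r g] assms RS by (simp add: phi_factor_def lead_coeff_mult)

end

text \<open>Multiplicativity of the Gauss norm at the infinite place.\<close>

lemma deg_less_factor:
  fixes R S :: "'f :: field poly poly"
  assumes "\<And>i. deg_less (coeff (R * S) i) d" "S \<noteq> 0"
  shows "deg_less (coeff R i) d"
proof (cases "R = 0")
  case False
  \<comment> \<open>Takes the last coefficient among those of largest T-degree \<open>m\<close>. In
    a product the two coefficients so chosen contribute a top term that nothing else can
    cancel.\<close>
  have top: "\<exists>m i. (\<forall>a. degree (coeff p a) \<le> m) \<and> coeff (coeff p i) m \<noteq> 0 \<and> (\<forall>a>i. coeff (coeff p a) m = 0)"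
    if "p \<noteq> 0" for p :: "'f poly poly"
  proof -
    define m where "m = Max ((\<lambda>a. degree (coeff p a)) ` {..degree p})"
    have m: "degree (coeff p a) \<le> m" for a
      by (cases "a \<le> degree p") (auto simp: m_def coeff_eq_0 intro: Max_ge)
    have "m \<in> (\<lambda>a. degree (coeff p a)) ` {..degree p}" unfolding m_def by (rule Max_in) auto
    then obtain a where a: "m = degree (coeff p a)" by blast
    define A where "A = {a. coeff (coeff p a) m \<noteq> 0}"
    have "A \<subseteq> {..degree p}" by (auto simp: A_def intro: le_degree)
    hence "finite A" using finite_subset by blast
    have "A \<noteq> {}"
    proof (cases "m = 0")
      case True
      have "coeff (lead_coeff p) 0 \<noteq> 0"
        using m[of "degree p"] that True by (metis degree_0_id le_zero_eq leading_coeff_0_iff)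
      thus ?thesis using True by (auto simp: A_def)
    next
      case False
      hence "coeff p a \<noteq> 0" using a by auto
      hence "coeff (coeff p a) m \<noteq> 0" unfolding a by (simp only: leading_coeff_0_iff not_False_eq_True)
      thus ?thesis by (auto simp: A_def)
    qed
    have "coeff (coeff p (Max A)) m \<noteq> 0" using Max_in[OF \<open>finite A\<close> \<open>A \<noteq> {}\<close>] by (simp add: A_def)
    moreover have "coeff (coeff p b) m = 0" if "b > Max A" for b
      using Max_ge[OF \<open>finite A\<close>, of b] that by (auto simp: A_def)
    ultimately show ?thesis using m by blast
  qed
  obtain m i where i: "\<And>a. degree (coeff R a) \<le> m" "coeff (coeff R i) m \<noteq> 0" "\<And>a. a > i \<Longrightarrow> coeff (coeff R a) m = 0"
    using top[OF False] by blast
  obtain k j where j: "\<And>a. degree (coeff S a) \<le> k" "coeff (coeff S j) k \<noteq> 0" "\<And>a. a > j \<Longrightarrow> coeff (coeff S a) k = 0"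
    using top[OF assms(2)] by blast
  have prod: "coeff (f * h) (m + k) = coeff f m * coeff h k" if "degree f \<le> m" "degree h \<le> k" for f h :: "'f poly"
  proof -
    have "coeff (f * h) (m + k) = (\<Sum>l\<le>m + k. coeff f l * coeff h (m + k - l))" by (simp add: coeff_mult)
    also have "\<dots> = (\<Sum>l\<in>{m}. coeff f l * coeff h (m + k - l))"
    proof (rule sum.mono_neutral_right)
      show "\<forall>l\<in>{..m + k} - {m}. coeff f l * coeff h (m + k - l) = 0"
      proof
        fix l assume "l \<in> {..m + k} - {m}"
        hence "l > m \<or> m + k - l > k" by auto
        thus "coeff f l * coeff h (m + k - l) = 0" using that by (auto simp: coeff_eq_0)
      qed
    qed auto
    finally show ?thesis by simp
  qed
  have "coeff (coeff (R * S) (i + j)) (m + k) = (\<Sum>a\<le>i + j. coeff (coeff R a) m * coeff (coeff S (i + j - a)) k)"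
    unfolding coeff_mult[of R S] coeff_sum using prod[OF i(1) j(1)] by simp
  also have "\<dots> = (\<Sum>a\<in>{i}. coeff (coeff R a) m * coeff (coeff S (i + j - a)) k)"
  proof (rule sum.mono_neutral_right)
    show "\<forall>a\<in>{..i + j} - {i}. coeff (coeff R a) m * coeff (coeff S (i + j - a)) k = 0"
    proof
      fix a assume "a \<in> {..i + j} - {i}"
      hence "a > i \<or> i + j - a > j" by auto
      thus "coeff (coeff R a) m * coeff (coeff S (i + j - a)) k = 0" using i(3) j(3) by auto
    qed
  qed auto
  finally have nz: "coeff (coeff (R * S) (i + j)) (m + k) \<noteq> 0" using i(2) j(2) by simp
  hence "m + k \<le> degree (coeff (R * S) (i + j))" by (rule le_degree)
  moreover have "coeff (R * S) (i + j) \<noteq> 0" using nz by auto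
  ultimately have "m < d" using assms(1)[of "i + j"] by (simp add: deg_less_def)
  thus ?thesis using i(1)[of i] i(1) by (simp add: deg_less_def) (metis le_less_trans)
qed (simp add: deg_less_def)

text \<open>
  The difference of the two polynomials has degree at most \<open>q\<^sup>s\<close> and is divisible by \<open>R\<close>, so it is a
  multiple of \<open>R\<close> by a constant; the linear coefficients show that the constant vanishes.
\<close>

lemma phi_factor_unique:
  fixes g g' :: "nat \<Rightarrow> 'a :: finite_field poly"
  assumes "phi_factor r s g R S" "phi_factor r s g' R S'" "s \<le> r"
    and eq: "\<And>i. s < i \<Longrightarrow> i \<le> r \<Longrightarrow> g i = g' i" and i: "1 \<le> i" "i \<le> r"
  shows "g i = g' i"
proof -
  define D where "D = phi_poly r g - phi_poly r g'"
  have D: "D = R * (S - S')" using assms by (simp add: D_def phi_factor_def right_diff_distrib)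
  have coeff_D: "coeff D (CARD('a) ^ j) = g j - g' j" if "1 \<le> j" "j \<le> r" for j
    using that by (simp add: D_def coeff_phi_poly_power)
  have "R \<noteq> 0" using assms(1) by (auto simp: phi_factor_def)
  have "S - S' = 0"
  proof (rule ccontr)
    assume nz: "S - S' \<noteq> 0"
    hence "D \<noteq> 0" using D \<open>R \<noteq> 0\<close> by simp
    have "degree D \<le> CARD('a) ^ s"
    proof (rule degree_le, intro allI impI)
      fix k assume k: "CARD('a) ^ s < k"
      show "coeff D k = 0"
      proof (rule ccontr)
        assume nz: "coeff D k \<noteq> 0"
        have "q_poly CARD('a) D" unfolding D_def by (intro q_poly_diff q_poly_phi_poly)
        then obtain j where j: "k = CARD('a) ^ j" using nz by (auto simp: q_poly_def)
        hence "s < j" using k card_finite_field_ge_2[where 'a = 'a]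
          by (metis less_le_trans one_less_numeral_iff power_less_imp_less_exp power_strict_increasing_iff semiring_norm(76))
        moreover have "j \<le> r"
        proof (rule ccontr)
          assume "\<not> j \<le> r"
          hence "coeff D k = 0" using \<open>s < j\<close> by (simp add: D_def j coeff_phi_poly_power)
          thus False using nz by simp
        qed
        ultimately have "coeff D k = 0" using coeff_D[of j] eq[of j] by (simp add: j)
        thus False using nz by simp
      qed
    qed
    moreover have "degree D = CARD('a) ^ s + degree (S - S')"
      using nz \<open>R \<noteq> 0\<close> assms(1) by (simp add: D degree_mult_eq phi_factor_def)
    ultimately have "degree (S - S') = 0" by simp
    then obtain e where e: "S - S' = [:e:]" by (auto elim: degree_eq_zeroE)
    have "coeff D 1 = 0" by (simp only: D_def coeff_diff coeff_phi_poly_1) simp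
    hence "coeff R 1 * e = 0" by (simp add: D e mult.commute)
    thus False using e nz phi_factor_linear_nz[OF assms(1)] by simp
  qed
  hence "D = 0" by (simp add: D)
  thus ?thesis using coeff_D[OF i] by simp
qed

section \<open>Simple roots\<close>

interpretation to_ac_fq: fq_algebra "to_ac :: 'a :: finite_field \<Rightarrow> 'a alg_closure" "CARD('a)"
  by unfold_locales (rule refl)

lemma deg_less_iff_coeff: "deg_less f d \<longleftrightarrow> (\<forall>i\<ge>d. coeff f i = 0)"
proof
  assume "\<forall>i\<ge>d. coeff f i = 0"
  thus "deg_less f d" unfolding deg_less_def by (metis leading_coeff_0_iff not_le)
qed (auto simp: deg_less_def coeff_eq_0)

lemma deg_less_bij:
  "bij_betw (\<lambda>f. restrict (coeff f) {..<d}) {f :: 'b :: comm_monoid_add poly. deg_less f d} ({..<d} \<rightarrow>\<^sub>E UNIV)"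
  unfolding bij_betw_def
proof
  show "inj_on (\<lambda>f. restrict (coeff f) {..<d}) {f :: 'b poly. deg_less f d}"
  proof (rule inj_onI, rule poly_eqI)
    fix f h :: "'b poly" and n
    assume "f \<in> {f. deg_less f d}" "h \<in> {f. deg_less f d}" and eq: "restrict (coeff f) {..<d} = restrict (coeff h) {..<d}"
    moreover have "coeff f n = coeff h n" if "n < d" using fun_cong[OF eq, of n] that by simp
    ultimately show "coeff f n = coeff h n" by (cases "n < d") (simp_all add: deg_less_iff_coeff)
  qed
  show "(\<lambda>f. restrict (coeff f) {..<d}) ` {f :: 'b poly. deg_less f d} = {..<d} \<rightarrow>\<^sub>E UNIV"
  proof (intro equalityI subsetI)
    fix c :: "nat \<Rightarrow> 'b" assume c: "c \<in> {..<d} \<rightarrow>\<^sub>E UNIV"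
    define f where "f = poly_of_list (map c [0..<d])"
    have f: "coeff f i = (if i < d then c i else 0)" for i
      by (simp add: f_def nth_default_def)
    hence "deg_less f d" by (simp add: deg_less_iff_coeff)
    moreover have "restrict (coeff f) {..<d} = c"
      using c by (auto simp: f fun_eq_iff PiE_def extensional_def)
    ultimately show "c \<in> (\<lambda>f. restrict (coeff f) {..<d}) ` {f. deg_less f d}" by blast
  qed (auto split: if_splits)
qed

lemma finite_deg_less: "finite {f :: 'b :: {finite, comm_monoid_add} poly. deg_less f d}"
  using bij_betw_finite[OF deg_less_bij[of d, where 'b = 'b]] by (simp add: finite_PiE)

lemma card_deg_less: "card {f :: 'b :: {finite, comm_monoid_add} poly. deg_less f d} = CARD('b) ^ d"
  using bij_betw_same_card[OF deg_less_bij[of d, where 'b = 'b]] by (simp add: card_PiE)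

text \<open>The powers of \<alpha> take finitely many values, so two Frobenius powers of \<alpha>
  agree. Cancelling the common Frobenius makes \<alpha> a root of some X^(q^k) - X, whose derivative
  is -1.\<close>

lemma finite_field_alg_closure_separable:
  fixes \<alpha> :: "'a :: finite_field alg_closure"
  shows "\<alpha> \<in> sep_closure"
proof -
  obtain \<pi> :: "'a poly" where \<pi>: "irreducible \<pi>" "poly (map_poly to_ac \<pi>) \<alpha> = 0"
    by (rule irreducible_root_exists)
  have "\<pi> \<noteq> 0" using \<pi>(1) by auto
  let ?F = "(\<lambda>p. poly (map_poly to_ac p) \<alpha>) ` {p. deg_less p (degree \<pi>)}"
  have "\<alpha> ^ k \<in> ?F" for k
  proof -
    have "poly (map_poly to_ac (\<pi> * (monom 1 k div \<pi>) + monom 1 k mod \<pi>)) \<alpha> = \<alpha> ^ k"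
      by (simp add: map_poly_monom poly_monom)
    hence "\<alpha> ^ k = poly (map_poly to_ac (monom 1 k mod \<pi>)) \<alpha>"
      using \<pi>(2) unfolding to_ac_poly.hom_add to_ac_poly.hom_mult by simp
    moreover have "deg_less (monom 1 k mod \<pi>) (degree \<pi>)"
      using degree_mod_less'[OF \<open>\<pi> \<noteq> 0\<close>] by (auto simp: deg_less_def)
    ultimately show ?thesis by blast
  qed
  hence "range (\<lambda>i. \<alpha> ^ (CARD('a) ^ i)) \<subseteq> ?F" by blast
  hence "finite (range (\<lambda>i. \<alpha> ^ (CARD('a) ^ i)))"
    by (rule finite_subset) (rule finite_imageI[OF finite_deg_less])
  hence "\<not> inj (\<lambda>i. \<alpha> ^ (CARD('a) ^ i))" using finite_imageD infinite_UNIV_nat by blast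
  then obtain i j where ij: "i < j" "\<alpha> ^ (CARD('a) ^ i) = \<alpha> ^ (CARD('a) ^ j)"
    unfolding inj_def by (metis linorder_neqE_nat)
  have "(\<alpha> ^ (CARD('a) ^ (j - i))) ^ (CARD('a) ^ i) = \<alpha> ^ (CARD('a) ^ i)"
    using ij by (simp flip: power_mult power_add)
  hence N: "\<alpha> ^ (CARD('a) ^ (j - i)) = \<alpha>" by (simp only: to_ac_fq.frob_inj)
  define G :: "'a poly" where "G = monom 1 (CARD('a) ^ (j - i)) - monom 1 1"
  have "(of_nat (CARD('a)) :: 'a) = 0"
    using of_nat_card_choose_eq_0[where 'a = 'a, of 1] card_finite_field_ge_2[where 'a = 'a] by simp
  hence "(of_nat (CARD('a) ^ (j - i)) :: 'a) = 0" using ij(1) by simp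
  hence "pderiv G = - 1" using ij(1) by (simp add: zero_power G_def pderiv_diff pderiv_monom monom_0 one_pCons)
  moreover have "poly (map_poly to_ac G) \<alpha> = 0"
    using N by (simp add: G_def to_ac_poly.hom_minus map_poly_monom poly_monom)
  ultimately show ?thesis unfolding sep_closure_iff
    by (intro exI[of _ G]) (simp add: to_ac_poly.hom_uminus)
qed

lemma irreducible_root_simple:
  fixes \<pi> :: "'a :: finite_field poly"
  assumes "irreducible \<pi>" "poly (map_poly to_ac \<pi>) \<alpha> = 0"
  shows "poly (map_poly to_ac (pderiv \<pi>)) \<alpha> \<noteq> 0"
proof
  assume 0: "poly (map_poly to_ac (pderiv \<pi>)) \<alpha> = 0"
  obtain G :: "'a poly" where G: "poly (map_poly to_ac G) \<alpha> = 0" "poly (map_poly to_ac (pderiv G)) \<alpha> \<noteq> 0"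
    using finite_field_alg_closure_separable[of \<alpha>] unfolding sep_closure_iff by blast
  obtain v where "G = \<pi> * v" using irreducible_root_dvd_iff[OF assms] G(1) by blast
  hence "poly (map_poly to_ac (pderiv G)) \<alpha> = 0"
    using 0 assms(2) by (simp add: pderiv_mult to_ac_poly.hom_add to_ac_poly.hom_mult)
  thus False using G(2) by simp
qed

text \<open>
  Let \<open>a\<^sup>2\<close> be the largest square dividing \<open>f\<close>; what remains after removing the common divisor with
  \<open>h\<close> is separable with all its roots among those of \<open>T a\<close>.
\<close>

lemma no_simple_root_decomposition:
  fixes f h :: "'a :: finite_field poly"
  assumes "f \<noteq> 0" "h \<noteq> 0"
    and no: "\<And>\<alpha> :: 'a alg_closure. \<alpha> \<noteq> 0 \<Longrightarrow> poly (map_poly to_ac f) \<alpha> = 0 \<Longrightarrow>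
      poly (map_poly to_ac (pderiv f)) \<alpha> \<noteq> 0 \<Longrightarrow> poly (map_poly to_ac h) \<alpha> = 0"
  obtains a b s c where "f = a\<^sup>2 * b * s" "h = s * c" "degree b \<le> Suc (degree a)"
proof -
  let ?ev = "\<lambda>p. poly (map_poly to_ac p)"
  have ev: "?ev (p * p') x = ?ev p x * ?ev p' x" "?ev (p + p') x = ?ev p x + ?ev p' x" for p p' :: "'a poly" and x
    by (simp_all add: to_ac_poly.hom_mult to_ac_poly.hom_add)
  have "degree a < Suc (degree f)" if "a\<^sup>2 dvd f" for a
  proof -
    have "degree (a\<^sup>2) \<le> degree f" using that assms(1) by (rule dvd_imp_degree_le)
    moreover have "degree a \<le> degree (a\<^sup>2)"
      by (cases "a = 0") (simp_all add: power2_eq_square degree_mult_eq)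
    ultimately show ?thesis by simp
  qed
  then obtain a where a: "a\<^sup>2 dvd f" and a_max: "\<And>y. y\<^sup>2 dvd f \<Longrightarrow> degree y \<le> degree a"
    using ex_has_greatest_nat[of "\<lambda>a. a\<^sup>2 dvd f" 1 degree "Suc (degree f)"] by auto
  then obtain t where t: "f = a\<^sup>2 * t" by blast
  have "a \<noteq> 0" "t \<noteq> 0" using t assms(1) by auto
  have "degree y < Suc (degree h)" if "y dvd t \<and> y dvd h" for y
    using that dvd_imp_degree_le[of y h] assms(2) by (simp add: le_imp_less_Suc)
  \<comment> \<open>A common divisor of largest degree serves as greatest common divisor: a further
    common irreducible factor would enlarge it. Only the degrees are compared.\<close>
  then obtain s where "s dvd t" "s dvd h" and s_max: "\<And>y. y dvd t \<Longrightarrow> y dvd h \<Longrightarrow> degree y \<le> degree s"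
    using ex_has_greatest_nat[of "\<lambda>y. y dvd t \<and> y dvd h" 1 degree "Suc (degree h)"] by auto
  then obtain b c where b: "t = s * b" and c: "h = s * c" by blast
  have "s \<noteq> 0" "b \<noteq> 0" using b \<open>t \<noteq> 0\<close> by auto
  have deg_irr: "degree \<pi> > 0" if "irreducible \<pi>" for \<pi> :: "'a poly"
    using that by (auto simp: irreducible_def is_unit_iff_degree)
  have no_square: False if "irreducible \<pi>" "\<pi> * \<pi> dvd t" for \<pi>
  proof -
    have "(a * \<pi>)\<^sup>2 dvd f" unfolding t power_mult_distrib using that(2)
      by (intro mult_dvd_mono) (simp_all add: power2_eq_square)
    hence "degree (a * \<pi>) \<le> degree a" by (rule a_max)
    moreover have "\<pi> \<noteq> 0" using that(1) by auto
    ultimately show False using deg_irr[OF that(1)] \<open>a \<noteq> 0\<close> by (simp add: degree_mult_eq)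
  qed
  have t_sep: "?ev (pderiv t) \<alpha> \<noteq> 0" if root: "?ev t \<alpha> = 0" for \<alpha>
  proof -
    obtain \<pi> :: "'a poly" where \<pi>: "irreducible \<pi>" "?ev \<pi> \<alpha> = 0" by (rule irreducible_root_exists)
    then obtain u where u: "t = \<pi> * u" using irreducible_root_dvd_iff root by blast
    have "?ev u \<alpha> \<noteq> 0"
    proof
      assume "?ev u \<alpha> = 0"
      hence "\<pi> dvd u" using irreducible_root_dvd_iff[OF \<pi>] by blast
      hence "\<pi> * \<pi> dvd t" unfolding u by (rule mult_dvd_mono[OF dvd_refl])
      thus False using no_square \<pi>(1) by blast
    qed
    thus ?thesis using irreducible_root_simple[OF \<pi>] \<pi>(2) by (simp add: u pderiv_mult ev)
  qed
  have roots: "\<alpha> = 0 \<or> ?ev a \<alpha> = 0" if root: "?ev b \<alpha> = 0" for \<alpha>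
  proof (rule ccontr)
    assume "\<not> ?thesis"
    hence nz: "\<alpha> \<noteq> 0" "?ev a \<alpha> \<noteq> 0" by auto
    obtain \<pi> :: "'a poly" where \<pi>: "irreducible \<pi>" "?ev \<pi> \<alpha> = 0" by (rule irreducible_root_exists)
    note dvd = irreducible_root_dvd_iff[OF \<pi>]
    have "?ev t \<alpha> = 0" using root by (simp add: b ev)
    have "?ev f \<alpha> = 0" by (simp add: t ev \<open>?ev t \<alpha> = 0\<close>)
    moreover have "pderiv f = pderiv (a\<^sup>2) * t + a\<^sup>2 * pderiv t" by (simp add: t pderiv_mult)
    hence "?ev (pderiv f) \<alpha> \<noteq> 0"
      using t_sep[OF \<open>?ev t \<alpha> = 0\<close>] nz(2) \<open>?ev t \<alpha> = 0\<close> by (simp add: ev power2_eq_square)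
    ultimately have "?ev h \<alpha> = 0" using no[OF nz(1)] by blast
    hence "?ev s \<alpha> = 0 \<or> ?ev c \<alpha> = 0" by (simp add: c ev)
    thus False
    proof
      assume "?ev s \<alpha> = 0"
      hence "\<pi> dvd s" "\<pi> dvd b" using dvd root by blast+
      hence "\<pi> * \<pi> dvd t" unfolding b by (rule mult_dvd_mono)
      thus False using no_square \<pi>(1) by blast
    next
      assume "?ev c \<alpha> = 0"
      hence "\<pi> dvd c" "\<pi> dvd b" using dvd root by blast+
      hence "s * \<pi> dvd t" "s * \<pi> dvd h" by (simp_all add: b c)
      hence "degree (s * \<pi>) \<le> degree s" by (rule s_max)
      moreover have "\<pi> \<noteq> 0" using \<pi>(1) by auto
      ultimately show False using deg_irr[OF \<pi>(1)] \<open>s \<noteq> 0\<close> by (simp add: degree_mult_eq)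
    qed
  qed
  have b_sep: "poly (pderiv (map_poly to_ac b)) \<alpha> \<noteq> 0" if "?ev b \<alpha> = 0" for \<alpha>
  proof
    assume "poly (pderiv (map_poly to_ac b)) \<alpha> = 0"
    hence "?ev (pderiv b) \<alpha> = 0" by (simp add: to_ac.map_poly_pderiv)
    hence "?ev (pderiv t) \<alpha> = 0" using that by (simp add: b pderiv_mult ev)
    moreover have "?ev t \<alpha> = 0" using that by (simp add: b ev)
    ultimately show False using t_sep by blast
  qed
  have "degree b = card {x. ?ev b x = 0}"
    using card_roots_eq_degree[of "map_poly to_ac b", OF _ b_sep] \<open>b \<noteq> 0\<close> by simp
  also have "\<dots> \<le> card (insert 0 {x. ?ev a x = 0})"
    using roots \<open>a \<noteq> 0\<close> by (intro card_mono) (auto simp: poly_roots_finite)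
  also have "\<dots> \<le> Suc (card {x. ?ev a x = 0})" by (rule card_insert_le_m1) simp_all
  also have "card {x. ?ev a x = 0} \<le> degree a"
    using card_poly_roots_bound[of "map_poly to_ac a"] \<open>a \<noteq> 0\<close> by simp
  finally have "degree b \<le> Suc (degree a)" by simp
  moreover have "f = a\<^sup>2 * b * s" by (simp add: t b mult.commute mult.left_commute)
  ultimately show ?thesis using that c by blast
qed

section \<open>Counting exceptional tuples\<close>

definition tuples_below :: "nat \<Rightarrow> nat \<Rightarrow> (nat \<Rightarrow> 'a :: finite_field poly) set" where
  "tuples_below r d = {g \<in> drinfeld_tuples r. \<forall>i\<in>{1..r}. deg_less (g i) d}"

lemma tuples_belowD:
  assumes "g \<in> tuples_below r d"
  shows "g \<in> extensional {1..r}" "g r \<noteq> 0" "\<And>i. 1 \<le> i \<Longrightarrow> i \<le> r \<Longrightarrow> deg_less (g i) d"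
  using assms by (auto simp: tuples_below_def drinfeld_tuples_def PiE_def)

lemma tuples_below_eq_PiE:
  assumes "r \<ge> 1"
  shows "tuples_below r d =
    (\<Pi>\<^sub>E i\<in>{1..r}. if i = r then {f :: 'a :: finite_field poly. deg_less f d} - {0} else {f. deg_less f d})"
proof (intro equalityI subsetI)
  fix g :: "nat \<Rightarrow> 'a poly"
  assume g: "g \<in> (\<Pi>\<^sub>E i\<in>{1..r}. if i = r then {f. deg_less f d} - {0} else {f. deg_less f d})"
  have "deg_less (g i) d" "i = r \<Longrightarrow> g i \<noteq> 0" if "i \<in> {1..r}" for i
    using PiE_mem[OF g that] by (auto split: if_splits)
  thus "g \<in> tuples_below r d"
    using g assms by (auto simp: tuples_below_def drinfeld_tuples_def PiE_def)
qed (auto simp: tuples_below_def drinfeld_tuples_def PiE_def)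

lemma finite_tuples_below: "r \<ge> 1 \<Longrightarrow> finite (tuples_below r d)"
  by (simp add: tuples_below_eq_PiE finite_PiE finite_deg_less)

lemma card_tuples_below:
  assumes "r \<ge> 1"
  shows "card (tuples_below r d :: (nat \<Rightarrow> 'a :: finite_field poly) set) =
    (CARD('a) ^ d) ^ (r - 1) * (CARD('a) ^ d - 1)"
proof -
  let ?D = "{f :: 'a poly. deg_less f d}"
  have "{1..r} = insert r {1..<r}" using assms by auto
  hence "card (tuples_below r d :: (nat \<Rightarrow> 'a poly) set) =
      (\<Prod>i\<in>insert r {1..<r}. card (if i = r then ?D - {0} else ?D))"
    using assms by (simp add: tuples_below_eq_PiE card_PiE del: atLeastLessThan_iff)
  also have "\<dots> = card (?D - {0}) * (\<Prod>i\<in>{1..<r}. card ?D)"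
    by (subst prod.insert) (auto intro!: prod.cong)
  also have "card (?D - {0}) = CARD('a) ^ d - 1"
    by (subst card_Diff_singleton) (simp_all add: deg_less_def card_deg_less[unfolded deg_less_def])
  finally show ?thesis by (simp add: card_deg_less)
qed

text \<open>Pairs of factors of a nonzero polynomial of degree below \<open>N\<close>. There are at
  most N q^(N+1) of them, compared with about q^(2N) unrestricted pairs; all counting below rests on
  this saving.\<close>

definition poly_pairs :: "nat \<Rightarrow> ('a :: finite_field poly \<times> 'a poly) set" where
  "poly_pairs N = {(a, b). a \<noteq> 0 \<and> b \<noteq> 0 \<and> degree a + degree b < N}"

lemma poly_pairs:
  shows finite_poly_pairs: "finite (poly_pairs N :: ('a :: finite_field poly \<times> 'a poly) set)"
    and card_poly_pairs: "card (poly_pairs N :: ('a poly \<times> 'a poly) set) \<le> N * CARD('a) ^ (N + 1)"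
proof -
  let ?U = "\<lambda>i. {f :: 'a poly. deg_less f (Suc i)} \<times> {f :: 'a poly. deg_less f (N - i)}"
  have fin: "finite (\<Union>i<N. ?U i)" by (simp add: finite_deg_less)
  have sub: "(poly_pairs N :: ('a poly \<times> 'a poly) set) \<subseteq> (\<Union>i<N. ?U i)"
  proof (rule subrelI)
    fix a b :: "'a poly" assume "(a, b) \<in> poly_pairs N"
    hence "degree a < N" "(a, b) \<in> ?U (degree a)" by (auto simp: poly_pairs_def deg_less_def)
    thus "(a, b) \<in> (\<Union>i<N. ?U i)" by blast
  qed
  show "finite (poly_pairs N :: ('a poly \<times> 'a poly) set)" using sub fin by (rule finite_subset)
  have "card (poly_pairs N :: ('a poly \<times> 'a poly) set) \<le> card (\<Union>i<N. ?U i)"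
    using fin sub by (rule card_mono)
  also have "\<dots> \<le> (\<Sum>i<N. card (?U i))" by (rule card_UN_le) simp
  also have "\<dots> = (\<Sum>i<N. CARD('a) ^ (N + 1))"
    by (intro sum.cong) (simp_all add: card_cartesian_product card_deg_less flip: power_add power_Suc)
  finally show "card (poly_pairs N :: ('a poly \<times> 'a poly) set) \<le> N * CARD('a) ^ (N + 1)" by simp
qed

text \<open>
  \<open>R\<close> and the coefficients \<open>g\<^sub>i\<close> with \<open>s < i\<close> determine the tuple; what makes the count small is that
  \<open>g\<^sub>r\<close> and the leading coefficient of \<open>R\<close> together amount to a factorisation of \<open>g\<^sub>r\<close>.
\<close>

lemma card_phi_factor:
  assumes "1 \<le> s" "s < r" "d \<ge> 2"
  shows "card {g \<in> tuples_below r d :: (nat \<Rightarrow> 'a :: finite_field poly) set. \<exists>R S. phi_factor r s g R S} \<le>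
    CARD('a) ^ 2 * (d * CARD('a) ^ (d + 1)) * (CARD('a) ^ d) ^ (r - 2)"
    (is "card ?B \<le> _")
proof -
  have q: "CARD('a) \<ge> 2" by (rule card_finite_field_ge_2)
  define R where "R g = fst (SOME P. phi_factor r s g (fst P) (snd P))" for g :: "nat \<Rightarrow> 'a poly"
  define S where "S g = snd (SOME P. phi_factor r s g (fst P) (snd P))" for g :: "nat \<Rightarrow> 'a poly"
  have RS: "phi_factor r s g (R g) (S g)" if "g \<in> ?B" for g
  proof -
    have "\<exists>P. phi_factor r s g (fst P) (snd P)" using that by auto
    thus ?thesis unfolding R_def S_def by (rule someI_ex)
  qed
  have RS': "phi_poly r g = R g * S g" "degree (R g) = CARD('a) ^ s" "q_poly CARD('a) (R g)" if "g \<in> ?B" for g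
    using RS[OF that] by (simp_all add: phi_factor_def)
  \<comment> \<open>The linear coefficient of \<open>R\<close> has q^2 choices and the two leading
    coefficients form a pair with product \<open>g r\<close>. The other \<open>r - 2\<close> slots
    hold coefficients of \<open>R\<close> below \<open>s\<close> and of the tuple above
    \<open>s\<close>. Slot \<open>s\<close> is left out: there \<open>R\<close> has its leading
    coefficient, and \<open>phi_factor_unique\<close> recovers the tuple.\<close>
  define code where "code g = (coeff (R g) 1, (lead_coeff (R g), lead_coeff (S g)),
    restrict (\<lambda>i. if i < s then coeff (R g) (CARD('a) ^ i) else g i) ({1..<r} - {s}))" for g
  let ?D = "\<lambda>d. {f :: 'a poly. deg_less f d}"
  let ?C = "?D 2 \<times> (poly_pairs d :: ('a poly \<times> 'a poly) set) \<times> (({1..<r} - {s}) \<rightarrow>\<^sub>E ?D d)"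
  have sub: "code ` ?B \<subseteq> ?C"
  proof (rule image_subsetI)
    fix g :: "nat \<Rightarrow> 'a poly" assume g: "g \<in> ?B"
    hence below: "g \<in> tuples_below r d" by blast
    have lead: "lead_coeff (R g) * lead_coeff (S g) = g r"
      using phi_factor_lead[OF RS[OF g]] tuples_belowD(2)[OF below] assms by simp
    hence nz: "lead_coeff (R g) \<noteq> 0" "lead_coeff (S g) \<noteq> 0" using tuples_belowD(2)[OF below] by auto
    have "degree (g r) < d" using tuples_belowD[OF below] tuples_belowD(3)[OF below, of r] assms
      by (auto simp: deg_less_def)
    hence "(lead_coeff (R g), lead_coeff (S g)) \<in> poly_pairs d"
      using nz by (simp add: poly_pairs_def degree_mult_eq flip: lead)
    moreover have "deg_less (coeff (R g) i) d" for i
    proof (rule deg_less_factor)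
      show "deg_less (coeff (R g * S g) n) d" for n
      proof (cases "coeff (phi_poly r g) n = 0")
        case False
        then obtain j where j: "n = CARD('a) ^ j" using q_poly_phi_poly[of r g] by (auto simp: q_poly_def)
        show ?thesis
        proof (cases "j = 0")
          case True
          hence "coeff (R g * S g) n = [:0, 1:]"
            using coeff_phi_poly_1[of r g] RS'[OF g] by (simp add: j)
          thus ?thesis using assms(3) by (simp add: deg_less_def)
        next
          case False
          hence "coeff (R g * S g) n = (if j \<le> r then g j else 0)"
            using coeff_phi_poly_power[of j r g] RS'[OF g] by (simp add: j)
          thus ?thesis using tuples_belowD(3)[OF below, of j] False by (auto simp: deg_less_def)
        qed
      qed (use RS'[OF g] in \<open>auto simp: deg_less_def\<close>)
      show "S g \<noteq> 0" using nz by auto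
    qed
    moreover have "deg_less (g i) d" if "i \<in> {1..<r}" for i using that tuples_belowD(3)[OF below] by simp
    ultimately show "code g \<in> ?C"
      using phi_factor_linear_deg[OF RS[OF g]] by (auto simp: code_def)
  qed
  have inj: "inj_on code ?B"
  proof (rule inj_onI)
    fix g g' :: "nat \<Rightarrow> 'a poly" assume g: "g \<in> ?B" and g': "g' \<in> ?B" and eq: "code g = code g'"
    hence below: "g \<in> tuples_below r d" "g' \<in> tuples_below r d" by blast+
    have low: "coeff (R g) 1 = coeff (R g') 1" and lead: "lead_coeff (R g) = lead_coeff (R g')"
        "lead_coeff (S g) = lead_coeff (S g')"
      using eq by (simp_all add: code_def)
    have mid: "(if i < s then coeff (R g) (CARD('a) ^ i) else g i) =
        (if i < s then coeff (R g') (CARD('a) ^ i) else g' i)" if "i \<in> {1..<r} - {s}" for i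
    proof -
      have "snd (snd (code g)) i = snd (snd (code g')) i" using eq by simp
      thus ?thesis using that by (simp add: code_def)
    qed
    have "R g = R g'"
    proof (rule poly_eqI)
      fix n
      show "coeff (R g) n = coeff (R g') n"
      proof (cases "\<exists>i\<le>s. n = CARD('a) ^ i")
        case True
        then obtain i where i: "i \<le> s" "n = CARD('a) ^ i" by blast
        consider "i = 0" | "i = s" | "1 \<le> i" "i < s" using i by linarith
        thus ?thesis
        proof cases
          case 2
          thus ?thesis using lead(1) RS'[OF g] RS'[OF g'] i by simp
        next
          case 3
          thus ?thesis using mid[of i] assms i by simp
        qed (use low i in simp)
      next
        case False
        have "coeff (R x) n = 0" if x: "x \<in> ?B" for x
        proof (rule ccontr)
          assume nz: "coeff (R x) n \<noteq> 0"
          then obtain i where i: "n = CARD('a) ^ i" using RS'[OF x] by (auto simp: q_poly_def)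
          have "CARD('a) ^ i \<le> CARD('a) ^ s" using le_degree[OF nz] RS'[OF x] i by simp
          hence "i \<le> s" using q by (simp add: power_increasing_iff)
          thus False using False i by blast
        qed
        thus ?thesis using g g' by simp
      qed
    qed
    have "g r = g' r"
      using phi_factor_lead[OF RS[OF g]] phi_factor_lead[OF RS[OF g']] lead assms
        tuples_belowD(2)[OF below(1)] tuples_belowD(2)[OF below(2)] by simp
    hence high: "g i = g' i" if "s < i" "i \<le> r" for i
      using mid[of i] that assms by (cases "i = r") auto
    have "g i = g' i" if "i \<in> {1..r}" for i
    proof (rule phi_factor_unique)
      show "phi_factor r s g (R g) (S g)" by (rule RS[OF g])
      show "phi_factor r s g' (R g) (S g')" unfolding \<open>R g = R g'\<close> by (rule RS[OF g'])
      show "g j = g' j" if "s < j" "j \<le> r" for j using that by (rule high)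
    qed (use assms that in simp_all)
    thus "g = g'" using tuples_belowD(1)[OF below(1)] tuples_belowD(1)[OF below(2)] by (rule extensionalityI[rotated 2])
  qed
  have "finite ?C" by (simp add: finite_deg_less finite_poly_pairs finite_PiE)
  with inj sub have "card ?B \<le> card ?C" by (rule card_inj_on_le)
  also have "card ?C = CARD('a) ^ 2 * (card (poly_pairs d :: ('a poly \<times> 'a poly) set) * (CARD('a) ^ d) ^ card ({1..<r} - {s}))"
    by (simp add: card_cartesian_product card_deg_less card_PiE)
  also have "card ({1..<r} - {s}) = r - 2" using assms by (simp add: card_Diff_subset)
  also have "CARD('a) ^ 2 * (card (poly_pairs d :: ('a poly \<times> 'a poly) set) * (CARD('a) ^ d) ^ (r - 2)) \<le>
      CARD('a) ^ 2 * ((d * CARD('a) ^ (d + 1)) * (CARD('a) ^ d) ^ (r - 2))"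
    by (intro mult_le_mono order.refl card_poly_pairs)
  finally show ?thesis by (simp only: mult.assoc)
qed

lemma card_penultimate_zero:
  assumes "r \<ge> 2"
  shows "card {g \<in> tuples_below r d :: (nat \<Rightarrow> 'a :: finite_field poly) set. g (r - 1) = 0} \<le> (CARD('a) ^ d) ^ (r - 1)"
    (is "card ?B \<le> _")
proof -
  let ?C = "({1..r} - {r - 1}) \<rightarrow>\<^sub>E {f :: 'a poly. deg_less f d}"
  have sub: "(\<lambda>g. restrict g ({1..r} - {r - 1})) ` ?B \<subseteq> ?C"
    by (auto simp: tuples_below_def split: if_splits)
  have inj: "inj_on (\<lambda>g. restrict g ({1..r} - {r - 1})) ?B"
  proof (rule inj_onI)
    fix g g' :: "nat \<Rightarrow> 'a poly"
    assume g: "g \<in> ?B" "g' \<in> ?B" and eq: "restrict g ({1..r} - {r - 1}) = restrict g' ({1..r} - {r - 1})"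
    have "g i = g' i" if "i \<in> {1..r}" for i
    proof (cases "i = r - 1")
      case False
      thus ?thesis using fun_cong[OF eq, of i] that by simp
    qed (use g in simp)
    moreover have "g \<in> extensional {1..r}" "g' \<in> extensional {1..r}" using g tuples_belowD(1) by blast+
    ultimately show "g = g'" by (intro extensionalityI[of g "{1..r}"])
  qed
  have "finite ?C" by (simp add: finite_deg_less finite_PiE)
  with inj sub have "card ?B \<le> card ?C" by (rule card_inj_on_le)
  also have "\<dots> = (CARD('a) ^ d) ^ card ({1..r} - {r - 1})" by (simp add: card_PiE card_deg_less)
  also have "card ({1..r} - {r - 1}) = r - 1" using assms by (simp add: card_Diff_subset)
  finally show ?thesis .
qed

text \<open>The last two entries become a^2 b s and s c. The pair \<open>(s, c)\<close> costs hardly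
  more than the penultimate entry alone, while \<open>(a, b)\<close> replaces the last entry and is
  short because the square counts twice.\<close>

lemma card_no_simple_root:
  assumes "r \<ge> 2"
  shows "card {g \<in> tuples_below r d :: (nat \<Rightarrow> 'a :: finite_field poly) set. g (r - 1) \<noteq> 0 \<and>
      (\<forall>\<alpha> :: 'a alg_closure. \<alpha> \<noteq> 0 \<longrightarrow> poly (map_poly to_ac (g r)) \<alpha> = 0 \<longrightarrow>
        poly (map_poly to_ac (pderiv (g r))) \<alpha> \<noteq> 0 \<longrightarrow> poly (map_poly to_ac (g (r - 1))) \<alpha> = 0)} \<le>
    (CARD('a) ^ d) ^ (r - 2) * (d * CARD('a) ^ (d + 1)) *
      ((2 * d div 3 + 1) * CARD('a) ^ (2 * d div 3 + 2))"
    (is "card ?B \<le> _")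
proof -
  define m where "m = 2 * d div 3 + 1"
  let ?C = "({1..<r - 1} \<rightarrow>\<^sub>E {f :: 'a poly. deg_less f d}) \<times>
    (poly_pairs d :: ('a poly \<times> 'a poly) set) \<times> (poly_pairs m :: ('a poly \<times> 'a poly) set)"
  define F :: "(nat \<Rightarrow> 'a poly) \<times> ('a poly \<times> 'a poly) \<times> ('a poly \<times> 'a poly) \<Rightarrow> nat \<Rightarrow> 'a poly" where
    "F = (\<lambda>(h, (s, c), (a, b)) i. if i = r then a\<^sup>2 * b * s else if i = r - 1 then s * c else h i)"
  have "?B \<subseteq> F ` ?C"
  proof
    fix g assume g: "g \<in> ?B"
    hence below: "g \<in> tuples_below r d" by blast
    have nz: "g r \<noteq> 0" "g (r - 1) \<noteq> 0" using tuples_belowD(2)[OF below] g by blast+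
    obtain a b s c where abs: "g r = a\<^sup>2 * b * s" "g (r - 1) = s * c" "degree b \<le> Suc (degree a)"
      by (rule no_simple_root_decomposition[OF nz]) (use g in blast)+
    have nz': "a \<noteq> 0" "b \<noteq> 0" "s \<noteq> 0" "c \<noteq> 0" using abs nz by auto
    have deg: "degree (g r) < d" "degree (g (r - 1)) < d"
      using tuples_belowD(3)[OF below, of r] tuples_belowD(3)[OF below, of "r - 1"] nz assms
      by (auto simp: deg_less_def)
    have "degree s + degree c < d" using deg(2) nz' unfolding abs by (simp add: degree_mult_eq)
    moreover have "2 * degree a + degree b + degree s < d"
      using deg(1) nz' unfolding abs by (simp add: degree_mult_eq power2_eq_square)
    \<comment> \<open>With A and B the degrees of a and b, 2A + B < d and B <= A + 1 give 3(A + B)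
      <= 2(2A + B) + 1 < 2d. This is the origin of 2d/3.\<close>
    hence "degree a + degree b < m" using abs(3) unfolding m_def by linarith
    moreover have "restrict g {1..<r - 1} \<in> {1..<r - 1} \<rightarrow>\<^sub>E {f. deg_less f d}"
      using tuples_belowD(3)[OF below] by auto
    ultimately have "(restrict g {1..<r - 1}, (s, c), (a, b)) \<in> ?C"
      using nz' by (simp add: poly_pairs_def)
    moreover have "g = F (restrict g {1..<r - 1}, (s, c), (a, b))"
    proof
      fix i
      consider "i = r" | "i = r - 1" | "i \<in> {1..<r - 1}" | "i \<notin> {1..r}" "i \<notin> {1..<r - 1}" "i \<noteq> r" "i \<noteq> r - 1"
        using assms by fastforce
      thus "g i = F (restrict g {1..<r - 1}, (s, c), (a, b)) i"
      proof cases
        case 2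
        have "r - 1 \<noteq> r" using assms by simp
        thus ?thesis using 2 abs(2) by (simp add: F_def)
      next
        case 4
        thus ?thesis using extensional_arb[OF tuples_belowD(1)[OF below], of i] by (simp add: F_def)
      qed (auto simp: F_def abs)
    qed
    ultimately show "g \<in> F ` ?C" by (rule rev_image_eqI)
  qed
  moreover have fin: "finite ?C" by (simp add: finite_deg_less finite_poly_pairs finite_PiE)
  ultimately have "card ?B \<le> card (F ` ?C)" by (intro card_mono finite_imageI)
  also have "\<dots> \<le> card ?C" by (rule card_image_le[OF fin])
  also have "\<dots> = (CARD('a) ^ d) ^ (r - 2) * (card (poly_pairs d :: ('a poly \<times> 'a poly) set) *
      card (poly_pairs m :: ('a poly \<times> 'a poly) set))"
    by (simp add: card_cartesian_product card_deg_less card_PiE numeral_2_eq_2)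
  also have "\<dots> \<le> (CARD('a) ^ d) ^ (r - 2) * ((d * CARD('a) ^ (d + 1)) * (m * CARD('a) ^ (m + 1)))"
    by (intro mult_le_mono order.refl card_poly_pairs)
  finally show ?thesis by (simp add: m_def mult.assoc)
qed

text \<open>Against about (q^d)^r tuples, the factor (q^d)^(r-1) leaves one q^d to spare. The
  reducible tuples use up a multiple of \<open>d\<close> of it, where q^3 comes from q^2 linear
  coefficients and one q of \<open>card_poly_pairs\<close>; those without a suitable root use about
  q^(2d/3).\<close>

lemma card_non_surjective:
  assumes "r \<ge> 2" "d \<ge> 2"
  defines "q \<equiv> CARD('a)"
  shows "card (tuples_below r d - (surjective_tuples r :: (nat \<Rightarrow> 'a :: finite_field poly) set)) \<le>
    (q ^ d) ^ (r - 1) * (r * q ^ 3 * d + 1 + d * (2 * d div 3 + 1) * q ^ (2 * d div 3 + 3))"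
proof -
  let ?B = "tuples_below r d :: (nat \<Rightarrow> 'a poly) set"
  define B1 where "B1 s = {g \<in> ?B. \<exists>R S. phi_factor r s g R S}" for s
  define B2 where "B2 = {g \<in> ?B. g (r - 1) = 0}"
  define B3 where "B3 = {g \<in> ?B. g (r - 1) \<noteq> 0 \<and>
      (\<forall>\<alpha> :: 'a alg_closure. \<alpha> \<noteq> 0 \<longrightarrow> poly (map_poly to_ac (g r)) \<alpha> = 0 \<longrightarrow>
        poly (map_poly to_ac (pderiv (g r))) \<alpha> \<noteq> 0 \<longrightarrow> poly (map_poly to_ac (g (r - 1))) \<alpha> = 0)}"
  have fin: "finite ?B" using assms by (intro finite_tuples_below) simp
  have "?B - surjective_tuples r \<subseteq> (\<Union>s\<in>{1..<r}. B1 s) \<union> B2 \<union> B3"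
  proof
    fix g assume g: "g \<in> ?B - surjective_tuples r"
    show "g \<in> (\<Union>s\<in>{1..<r}. B1 s) \<union> B2 \<union> B3"
    proof (rule ccontr)
      assume not: "g \<notin> (\<Union>s\<in>{1..<r}. B1 s) \<union> B2 \<union> B3"
      have nz: "g r \<noteq> 0" using g tuples_belowD(2) by blast
      obtain \<alpha> :: "'a alg_closure" where \<alpha>: "\<alpha> \<noteq> 0" "poly (map_poly to_ac (g r)) \<alpha> = 0"
        "poly (map_poly to_ac (pderiv (g r))) \<alpha> \<noteq> 0" "poly (map_poly to_ac (g (r - 1))) \<alpha> \<noteq> 0"
        using not g unfolding B2_def B3_def by blast
      have "tate_rep_surjective (drinfeld r g) r"
      proof (rule tate_rep_surjectiveI[OF assms(1) nz \<alpha>])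
        fix W assume W: "eps.fq_subspace W" "W \<subset> {x. phi r g x = 0}"
          "\<And>\<sigma> w. ac_hom \<sigma> \<Longrightarrow> w \<in> W \<Longrightarrow> \<sigma> w \<in> W"
        show "W = {0}"
        proof (rule ccontr)
          assume "W \<noteq> {0}"
          have "r \<ge> 1" using assms(1) by simp
          obtain s R S where "1 \<le> s" "s < r" "phi_factor r s g R S"
            by (rule reducible_phi_factor[OF \<open>r \<ge> 1\<close> nz W(1,2) \<open>W \<noteq> {0}\<close>])
              (erule (1) W(3), rule that)
          hence "g \<in> (\<Union>s\<in>{1..<r}. B1 s)" using g unfolding B1_def
            by (intro UN_I[of s]) auto
          thus False using not by blast
        qed
      qed
      thus False using g by (auto simp: surjective_tuples_def tuples_below_def)
    qed
  qed
  hence "card (?B - surjective_tuples r) \<le> card ((\<Union>s\<in>{1..<r}. B1 s) \<union> B2 \<union> B3)"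
    using fin by (intro card_mono) (auto simp: B1_def B2_def B3_def)
  also have "\<dots> \<le> card (\<Union>s\<in>{1..<r}. B1 s) + card B2 + card B3"
    by (intro order.trans[OF card_Un_le] add_right_mono card_Un_le)
  also have "card (\<Union>s\<in>{1..<r}. B1 s) \<le> (\<Sum>s\<in>{1..<r}. card (B1 s))" by (rule card_UN_le) simp
  also have "\<dots> \<le> (\<Sum>s\<in>{1..<r}. q ^ 2 * (d * q ^ (d + 1)) * (q ^ d) ^ (r - 2))"
    unfolding B1_def q_def using assms(2) by (intro sum_mono card_phi_factor) auto
  also have "\<dots> \<le> r * (q ^ 2 * (d * q ^ (d + 1)) * (q ^ d) ^ (r - 2))" by simp
  also have "card B2 \<le> (q ^ d) ^ (r - 1)"
    unfolding B2_def q_def by (rule card_penultimate_zero[OF assms(1)])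
  also have "card B3 \<le> (q ^ d) ^ (r - 2) * (d * q ^ (d + 1)) * ((2 * d div 3 + 1) * q ^ (2 * d div 3 + 2))"
    unfolding B3_def q_def by (rule card_no_simple_root[OF assms(1)])
  also have "r * (q ^ 2 * (d * q ^ (d + 1)) * (q ^ d) ^ (r - 2)) + (q ^ d) ^ (r - 1) +
      (q ^ d) ^ (r - 2) * (d * q ^ (d + 1)) * ((2 * d div 3 + 1) * q ^ (2 * d div 3 + 2)) =
    (q ^ d) ^ (r - 1) * (r * q ^ 3 * d + 1 + d * (2 * d div 3 + 1) * q ^ (2 * d div 3 + 3))"
  proof -
    obtain k where "r = Suc (Suc k)" using assms(1) by (metis add_2_eq_Suc le_Suc_ex)
    hence "r - 1 = Suc k" "r - 2 = k" by simp_all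
    thus ?thesis
      by (simp add: power_add algebra_simps power2_eq_square power3_eq_cube)
  qed
  finally show ?thesis by simp
qed

lemma exceptional_ratio_tendsto_0:
  fixes q c :: real
  assumes "q > 1" "c \<ge> 0"
  shows "(\<lambda>d. (c * real d + 1 + real d * real (2 * d div 3 + 1) * q ^ (2 * d div 3 + 3)) / (q ^ d - 1)) \<longlonglongrightarrow> 0"
proof (rule tendsto_sandwich[OF _ _ tendsto_const])
  define l where "l = ln q"
  have l: "l > 0" and q: "q = exp l" using assms by (simp_all add: l_def)
  have pow: "q ^ k = exp (l * real k)" for k
    unfolding q by (simp add: mult.commute flip: exp_of_nat_mult)
  \<comment> \<open>The same quotient with the integer division replaced by its real upper bound,
    which leaves an elementary expression whose limit is immediate.\<close>
  let ?b = "\<lambda>d. (c * real d + 1 + real d * (real d + 1) * exp (l * (2 * real d / 3 + 3))) / (exp (l * real d) - 1)"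
  show "?b \<longlonglongrightarrow> 0" using l by real_asymp
  show "\<forall>\<^sub>F d in sequentially. (c * real d + 1 + real d * real (2 * d div 3 + 1) * q ^ (2 * d div 3 + 3)) / (q ^ d - 1) \<le> ?b d"
  proof (rule always_eventually, rule allI)
    fix d
    have "real (3 * (2 * d div 3)) \<le> real (2 * d)" by (subst of_nat_le_iff) simp
    hence "real (2 * d div 3) \<le> 2 * real d / 3" by simp
    moreover have "2 * d div 3 \<le> d" by linarith
    hence "real (2 * d div 3 + 1) \<le> real d + 1" by simp
    ultimately show "(c * real d + 1 + real d * real (2 * d div 3 + 1) * q ^ (2 * d div 3 + 3)) / (q ^ d - 1) \<le> ?b d"
      unfolding pow using l by (intro divide_right_mono add_left_mono mult_mono) auto
  qed
  show "\<forall>\<^sub>F d in sequentially. 0 \<le> (c * real d + 1 + real d * real (2 * d div 3 + 1) * q ^ (2 * d div 3 + 3)) / (q ^ d - 1)"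
    using assms by (intro always_eventually allI divide_nonneg_nonneg add_nonneg_nonneg mult_nonneg_nonneg) auto
qed

theorem theorem6p3:
  fixes p n r :: nat
  assumes "prime p" and "odd p"
    and "CARD('a :: finite_field) = p ^ n" and "CARD('a) \<ge> 5"
    and "r \<ge> 2"
  shows "(\<lambda>d. real (card {g \<in> surjective_tuples r :: (nat \<Rightarrow> 'a poly) set. \<forall>i\<in>{1..r}. deg_less (g i) d}) /
              real (card {g \<in> drinfeld_tuples r :: (nat \<Rightarrow> 'a poly) set. \<forall>i\<in>{1..r}. deg_less (g i) d}))
         \<longlonglongrightarrow> 1"
proof -
  let ?q = "CARD('a)"
  let ?B = "\<lambda>d. tuples_below r d :: (nat \<Rightarrow> 'a poly) set"
  let ?S = "surjective_tuples r :: (nat \<Rightarrow> 'a poly) set"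
  let ?e = "\<lambda>d. real (card (?B d - ?S)) / real (card (?B d))"
  let ?b = "\<lambda>d. (real (r * ?q ^ 3) * real d + 1 + real d * real (2 * d div 3 + 1) * real ?q ^ (2 * d div 3 + 3)) /
      (real ?q ^ d - 1)"
  have r: "r \<ge> 1" using assms by simp
  have q: "real ?q > 1" using card_finite_field_ge_2[where 'a = 'a] by simp
  have "?e \<longlonglongrightarrow> 0"
  proof (rule tendsto_sandwich[OF _ _ tendsto_const])
    show "?b \<longlonglongrightarrow> 0" using q by (rule exceptional_ratio_tendsto_0) simp
    show "\<forall>\<^sub>F d in sequentially. ?e d \<le> ?b d"
      using eventually_ge_at_top[of 2]
    proof eventually_elim
      case (elim d)
      have "?q ^ d \<ge> 1" by simp
      hence card: "real (card (?B d)) = (real ?q ^ d) ^ (r - 1) * (real ?q ^ d - 1)"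
        by (simp add: card_tuples_below[OF r] of_nat_diff)
      have "real (card (?B d - ?S)) \<le> real ((?q ^ d) ^ (r - 1) *
          (r * ?q ^ 3 * d + 1 + d * (2 * d div 3 + 1) * ?q ^ (2 * d div 3 + 3)))"
        using card_non_surjective[OF assms(5) elim] by (simp only: of_nat_le_iff)
      also have "\<dots> = (real ?q ^ d) ^ (r - 1) * (real (r * ?q ^ 3) * real d + 1 +
          real d * real (2 * d div 3 + 1) * real ?q ^ (2 * d div 3 + 3))"
        by (simp only: of_nat_mult of_nat_add of_nat_power of_nat_1)
      finally have "?e d \<le> ((real ?q ^ d) ^ (r - 1) * (real (r * ?q ^ 3) * real d + 1 +
          real d * real (2 * d div 3 + 1) * real ?q ^ (2 * d div 3 + 3))) /
          ((real ?q ^ d) ^ (r - 1) * (real ?q ^ d - 1))"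
        unfolding card using q by (intro divide_right_mono) auto
      also have "\<dots> = ?b d" by (rule mult_divide_mult_cancel_left) (use q in simp)
      finally show ?case .
    qed
  qed simp
  hence lim: "(\<lambda>d. 1 - ?e d) \<longlonglongrightarrow> 1" using tendsto_diff[OF tendsto_const, of ?e 0 sequentially 1] by simp
  have "\<forall>\<^sub>F d in sequentially. 1 - ?e d = real (card (?B d \<inter> ?S)) / real (card (?B d))"
    using eventually_ge_at_top[of 1]
  proof eventually_elim
    case (elim d)
    have "card (?B d) = card (?B d \<inter> ?S) + card (?B d - ?S)"
      using card_Int_Diff[OF finite_tuples_below[OF r]] .
    hence split: "real (card (?B d \<inter> ?S)) = real (card (?B d)) - real (card (?B d - ?S))" by simp
    have "card (?B d) \<noteq> 0"
      using q elim power_gt1_lemma one_less_power[of ?q d] by (simp add: card_tuples_below[OF r])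
    thus ?case unfolding split diff_divide_distrib by simp
  qed
  with lim have "(\<lambda>d. real (card (?B d \<inter> ?S)) / real (card (?B d))) \<longlonglongrightarrow> 1"
    by (rule Lim_transform_eventually)
  moreover have "{g \<in> ?S. \<forall>i\<in>{1..r}. deg_less (g i) d} = ?B d \<inter> ?S" for d
    by (auto simp: tuples_below_def surjective_tuples_def)
  ultimately show ?thesis by (simp only: tuples_below_def)
qed


end
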